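(* Assume the setting and Standing Assumption (A) described in the context, and let $\varepsilon_0>0$ be such that $Y_\varepsilon^0>0$ on $[-1,1]$ for every $\varepsilon\in(0,\varepsilon_0)$. Then for every $\varepsilon\in(0,\varepsilon_0)$, \[\sigma_{ess}(-\Delta_\varepsilon)=[\lambda_{\varepsilon,1}(0),\infty).\]
   Context: Let $n\ge 1$ and let $\Gamma:\mathbb R\to\mathbb R^{n+1}$ be a $C^{1,1}$ curve parametrized by arc length, $T=\Gamma'$. It carries a relatively parallel adapted frame: almost-everywhere differentiable unit normal fields $N_1,\dots,N_n$ with $(T,N_1,\dots,N_n)$ orthonormal, $T'=\sum_j k_jN_j$, $N_j'=-k_jT$, where $k_j$ are locally bounded; write $k=(k_1,\dots,k_n)$. Let $\Theta=(\Theta_1,\dots,\Theta_n):\mathbb R\to\mathbb R^n$ with $\Theta_1^2+\dots+\Theta_n^2=1$, $N_\Theta=\sum_j\Theta_jN_j$, $\Lambda=\mathbb R\times(-1,1)$, $\mathcal L_\varepsilon(s,t)=\Gamma(s)+\varepsilon t N_\Theta(s)$ (assumed injective) and $\Omega_\varepsilon=\mathcal L_\varepsilon(\Lambda)$. Standing Assumption (A): $\Theta\in C^{1,1}(\mathbb R;\mathbb R^n)$, $k\cdot\Theta=\sum_j k_j\Theta_j\equiv0$, and $|\Theta'(s)|=\gamma-\beta(s)$ for all $s$, where $\gamma>0$ and $\beta:\mathbb R\to\mathbb R$ is continuous, almost everywhere differentiable, with compact support contained in $[-s_0,s_0]$ for some $s_0>0$, and $\beta'\in L^\infty(\mathbb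 R)$. Under (A) the metric induced by $\mathcal L_\varepsilon$ on $\Lambda$ is $\mathrm{diag}(f_\varepsilon^2,\varepsilon^2)$ with $f_\varepsilon(s,t)=\sqrt{1+|\Theta'(s)|^2\varepsilon^2t^2}$. The Dirichlet Laplacian $-\Delta_\varepsilon$ of $\Omega_\varepsilon$ is the self-adjoint operator in $L^2(\Lambda,\varepsilon f_\varepsilon\,ds\,dt)$ associated with the closed form $\psi\mapsto\int_\Lambda\big(|\partial_s\psi|^2/f_\varepsilon^2+|\partial_t\psi|^2/\varepsilon^2\big)\varepsilon f_\varepsilon\,ds\,dt$ on $H^1_0(\Lambda)$. Let $h_\varepsilon(t)=\sqrt{1+\gamma^2\varepsilon^2t^2}$, $Y_\varepsilon^0(t)=-\frac{3\gamma^4\varepsilon^2t^2}{4h_\varepsilon^4(t)}+\frac{\gamma^2}{2h_\varepsilon^2(t)}$, and $D_\varepsilon(0)=-\varepsilon^{-2}\partial_t^2+Y_\varepsilon^0$ on $L^2(-1,1)$ with domain $H^1_0(-1,1)\cap H^2(-1,1)$; $\lambda_{\varepsilon,1}(0)$ denotes its lowest eigenvalue. *)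

theory Defs
  imports "HOL-Analysis.Analysis"
begin

definition L2w :: "'x::euclidean_space set \<Rightarrow> ('x \<Rightarrow> real) \<Rightarrow> ('x \<Rightarrow> complex) \<Rightarrow> bool" where
  "L2w S w u \<longleftrightarrow> u \<in> borel_measurable lborel \<and>
     set_integrable lborel S (\<lambda>x. w x * (cmod (u x))\<^sup>2)"

definition nrmw :: "'x::euclidean_space set \<Rightarrow> ('x \<Rightarrow> real) \<Rightarrow> ('x \<Rightarrow> complex) \<Rightarrow> real" where
  "nrmw S w u = sqrt (LINT x:S|lborel. w x * (cmod (u x))\<^sup>2)"

definition ipw :: "'x::euclidean_space set \<Rightarrow> ('x \<Rightarrow> real) \<Rightarrow> ('x \<Rightarrow> complex) \<Rightarrow> ('x \<Rightarrow> complex) \<Rightarrow> complex" where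
  "ipw S w u v = (LINT x:S|lborel. complex_of_real (w x) * u x * cnj (v x))"

definition aeq :: "'x::euclidean_space set \<Rightarrow> ('x \<Rightarrow> complex) \<Rightarrow> ('x \<Rightarrow> complex) \<Rightarrow> bool" where
  "aeq S u v \<longleftrightarrow> (AE x in lborel. x \<in> S \<longrightarrow> u x = v x)"

section \<open>Spectrum, discrete and essential spectrum of an operator given by its graph A
  in the Hilbert space L2(S, w dx)\<close>

definition in_resolvent :: "'x::euclidean_space set \<Rightarrow> ('x \<Rightarrow> real)
   \<Rightarrow> (('x \<Rightarrow> complex) \<times> ('x \<Rightarrow> complex)) set \<Rightarrow> complex \<Rightarrow> bool" where
  "in_resolvent S w A z \<longleftrightarrow>
     (\<forall>g. L2w S w g \<longrightarrow> (\<exists>\<psi> f. (\<psi>, f) \<in> A \<and> aeq S (\<lambda>x. f x - z * \<psi> x) g)) \<and>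
     (\<exists>C. \<forall>\<psi> f. (\<psi>, f) \<in> A \<longrightarrow> nrmw S w \<psi> \<le> C * nrmw S w (\<lambda>x. f x - z * \<psi> x))"

definition op_spectrum :: "'x::euclidean_space set \<Rightarrow> ('x \<Rightarrow> real)
   \<Rightarrow> (('x \<Rightarrow> complex) \<times> ('x \<Rightarrow> complex)) set \<Rightarrow> complex set" where
  "op_spectrum S w A = {z. \<not> in_resolvent S w A z}"

definition is_eigfun :: "'x::euclidean_space set
   \<Rightarrow> (('x \<Rightarrow> complex) \<times> ('x \<Rightarrow> complex)) set \<Rightarrow> complex \<Rightarrow> ('x \<Rightarrow> complex) \<Rightarrow> bool" where
  "is_eigfun S A z \<psi> \<longleftrightarrow> (\<exists>f. (\<psi>, f) \<in> A \<and> aeq S f (\<lambda>x. z * \<psi> x))"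

definition is_eigenvalue :: "'x::euclidean_space set
   \<Rightarrow> (('x \<Rightarrow> complex) \<times> ('x \<Rightarrow> complex)) set \<Rightarrow> complex \<Rightarrow> bool" where
  "is_eigenvalue S A z \<longleftrightarrow> (\<exists>\<psi>. is_eigfun S A z \<psi> \<and> \<not> aeq S \<psi> (\<lambda>_. 0))"

definition finite_multiplicity :: "'x::euclidean_space set
   \<Rightarrow> (('x \<Rightarrow> complex) \<times> ('x \<Rightarrow> complex)) set \<Rightarrow> complex \<Rightarrow> bool" where
  "finite_multiplicity S A z \<longleftrightarrow>
     (\<exists>es :: ('x \<Rightarrow> complex) list. \<forall>\<psi>. is_eigfun S A z \<psi> \<longrightarrow>
        (\<exists>c :: nat \<Rightarrow> complex. aeq S \<psi> (\<lambda>x. \<Sum>i<length es. c i * (es ! i) x)))"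

definition discrete_spectrum :: "'x::euclidean_space set \<Rightarrow> ('x \<Rightarrow> real)
   \<Rightarrow> (('x \<Rightarrow> complex) \<times> ('x \<Rightarrow> complex)) set \<Rightarrow> complex set" where
  "discrete_spectrum S w A = {z \<in> op_spectrum S w A.
      (\<exists>e>0. \<forall>z' \<in> op_spectrum S w A. dist z' z < e \<longrightarrow> z' = z) \<and>
      is_eigenvalue S A z \<and> finite_multiplicity S A z}"

definition ess_spectrum :: "'x::euclidean_space set \<Rightarrow> ('x \<Rightarrow> real)
   \<Rightarrow> (('x \<Rightarrow> complex) \<times> ('x \<Rightarrow> complex)) set \<Rightarrow> complex set" where
  "ess_spectrum S w A = op_spectrum S w A - discrete_spectrum S w A"

definition C1c_R2 :: "(real \<times> real) set \<Rightarrow> (real \<times> real \<Rightarrow> complex)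
   \<Rightarrow> (real \<times> real \<Rightarrow> complex) \<Rightarrow> (real \<times> real \<Rightarrow> complex) \<Rightarrow> bool" where
  "C1c_R2 U \<phi> ps pt \<longleftrightarrow> continuous_on UNIV ps \<and> continuous_on UNIV pt \<and>
     (\<forall>x. (\<phi> has_derivative (\<lambda>h. fst h *\<^sub>R ps x + snd h *\<^sub>R pt x)) (at x)) \<and>
     compact (closure {x. \<phi> x \<noteq> 0}) \<and> closure {x. \<phi> x \<noteq> 0} \<subseteq> U"

definition H10_R2 :: "(real \<times> real) set \<Rightarrow> (real \<times> real \<Rightarrow> complex)
   \<Rightarrow> (real \<times> real \<Rightarrow> complex) \<Rightarrow> (real \<times> real \<Rightarrow> complex) \<Rightarrow> bool" where
  "H10_R2 U \<psi> \<psi>s \<psi>t \<longleftrightarrow> L2w U (\<lambda>_. 1) \<psi> \<and> L2w U (\<lambda>_. 1) \<psi>s \<and> L2w U (\<lambda>_. 1) \<psi>t \<and>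
     (\<exists>\<phi> ps pt. (\<forall>n. C1c_R2 U (\<phi> n) (ps n) (pt n)) \<and>
        (\<lambda>n. LINT x:U|lborel. (cmod (\<phi> n x - \<psi> x))\<^sup>2) \<longlonglongrightarrow> 0 \<and>
        (\<lambda>n. LINT x:U|lborel. (cmod (ps n x - \<psi>s x))\<^sup>2) \<longlonglongrightarrow> 0 \<and>
        (\<lambda>n. LINT x:U|lborel. (cmod (pt n x - \<psi>t x))\<^sup>2) \<longlonglongrightarrow> 0)"

definition Lam :: "(real \<times> real) set" where
  "Lam = UNIV \<times> {-1<..<1}"

text \<open>Graph of the self-adjoint operator in L2(Lam, eps F ds dt) associated with the closed form
  psi |-> int (|d_s psi|^2/F^2 + |d_t psi|^2/eps^2) eps F on H^1_0(Lam)
  (representation theorem: psi in the domain and A psi = g iff q(psi,phi) = <g,phi> for all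
  phi in the form domain).\<close>
definition dirichlet_graph :: "real \<Rightarrow> (real \<times> real \<Rightarrow> real)
   \<Rightarrow> ((real \<times> real \<Rightarrow> complex) \<times> (real \<times> real \<Rightarrow> complex)) set" where
  "dirichlet_graph \<epsilon> F = {(\<psi>, g). L2w Lam (\<lambda>x. \<epsilon> * F x) g \<and>
     (\<exists>\<psi>s \<psi>t. H10_R2 Lam \<psi> \<psi>s \<psi>t \<and>
       (\<forall>\<phi> \<phi>s \<phi>t. H10_R2 Lam \<phi> \<phi>s \<phi>t \<longrightarrow>
          (LINT x:Lam|lborel. complex_of_real (\<epsilon> * F x) *
              (\<psi>s x * cnj (\<phi>s x) / complex_of_real ((F x)\<^sup>2)
               + \<psi>t x * cnj (\<phi>t x) / complex_of_real (\<epsilon>\<^sup>2)))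
          = ipw Lam (\<lambda>x. \<epsilon> * F x) g \<phi>))}"

text \<open>f_eps(s,t) = sqrt(1 + |Theta'(s)|^2 eps^2 t^2), with a the function s |-> |Theta'(s)|.\<close>
definition f_eps :: "(real \<Rightarrow> real) \<Rightarrow> real \<Rightarrow> real \<times> real \<Rightarrow> real" where
  "f_eps a \<epsilon> x = sqrt (1 + (a (fst x))\<^sup>2 * \<epsilon>\<^sup>2 * (snd x)\<^sup>2)"

definition h_eps :: "real \<Rightarrow> real \<Rightarrow> real \<Rightarrow> real" where
  "h_eps \<gamma> \<epsilon> t = sqrt (1 + \<gamma>\<^sup>2 * \<epsilon>\<^sup>2 * t\<^sup>2)"

definition Y0 :: "real \<Rightarrow> real \<Rightarrow> real \<Rightarrow> real" where
  "Y0 \<gamma> \<epsilon> t = - (3 * \<gamma>^4 * \<epsilon>\<^sup>2 * t\<^sup>2) / (4 * (h_eps \<gamma> \<epsilon> t)^4)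
                + \<gamma>\<^sup>2 / (2 * (h_eps \<gamma> \<epsilon> t)\<^sup>2)"

definition C1c_R :: "real set \<Rightarrow> (real \<Rightarrow> complex) \<Rightarrow> (real \<Rightarrow> complex) \<Rightarrow> bool" where
  "C1c_R U \<phi> \<phi>' \<longleftrightarrow> continuous_on UNIV \<phi>' \<and>
     (\<forall>x. (\<phi> has_vector_derivative \<phi>' x) (at x)) \<and>
     compact (closure {x. \<phi> x \<noteq> 0}) \<and> closure {x. \<phi> x \<noteq> 0} \<subseteq> U"

definition H10_R :: "real set \<Rightarrow> (real \<Rightarrow> complex) \<Rightarrow> (real \<Rightarrow> complex) \<Rightarrow> bool" where
  "H10_R U u u' \<longleftrightarrow> L2w U (\<lambda>_. 1) u \<and> L2w U (\<lambda>_. 1) u' \<and>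
     (\<exists>\<phi> \<phi>'. (\<forall>n. C1c_R U (\<phi> n) (\<phi>' n)) \<and>
        (\<lambda>n. LINT x:U|lborel. (cmod (\<phi> n x - u x))\<^sup>2) \<longlonglongrightarrow> 0 \<and>
        (\<lambda>n. LINT x:U|lborel. (cmod (\<phi>' n x - u' x))\<^sup>2) \<longlonglongrightarrow> 0)"

definition weak_deriv_R :: "real set \<Rightarrow> (real \<Rightarrow> complex) \<Rightarrow> (real \<Rightarrow> complex) \<Rightarrow> bool" where
  "weak_deriv_R U v v' \<longleftrightarrow> (\<forall>\<phi> \<phi>'. C1c_R U \<phi> \<phi>' \<longrightarrow>
     (LINT x:U|lborel. v x * \<phi>' x) = - (LINT x:U|lborel. v' x * \<phi> x))"

definition D0_eigenvalue :: "real \<Rightarrow> real \<Rightarrow> complex \<Rightarrow> bool" where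
  "D0_eigenvalue \<gamma> \<epsilon> z \<longleftrightarrow> (\<exists>u u' u''. H10_R {-1<..<1} u u' \<and> L2w {-1<..<1} (\<lambda>_. 1) u'' \<and>
     weak_deriv_R {-1<..<1} u' u'' \<and> \<not> aeq {-1<..<1} u (\<lambda>_. 0) \<and>
     aeq {-1<..<1} (\<lambda>t. - u'' t / complex_of_real (\<epsilon>\<^sup>2) + complex_of_real (Y0 \<gamma> \<epsilon> t) * u t)
                    (\<lambda>t. z * u t))"

definition lambda1 :: "real \<Rightarrow> real \<Rightarrow> real" where
  "lambda1 \<gamma> \<epsilon> = (LEAST l::real. D0_eigenvalue \<gamma> \<epsilon> (complex_of_real l))"

end

theory Submission
  imports Defs
begin

text \<open>Substituting \<open>u = v / sqrt h\<close> turns the transverse operator \<open>D(0)\<close> into the Sturm-Liouville problem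
  \<open>-(h u')' = \<epsilon>\<^sup>2 \<lambda> h u\<close>, and \<open>\<mu> = lambda1\<close> is the parameter at which it has a positive solution \<open>u\<close> that
  vanishes at both ends. Where \<open>\<bar>s\<bar> \<ge> s0\<close> the function \<open>F\<close> equals \<open>h\<close>, and Picone's identity on each fibre
  bounds the form below by \<open>\<mu>\<close>. The bounded piece \<open>\<bar>s\<bar> \<le> s0\<close> is cut into small cells, on which the
  Poincare inequality gives the same bound up to finitely many mean values. Hence the form lies above \<open>\<mu>\<close> after a
  finite rank perturbation, and below \<open>\<mu>\<close> there are only finitely many spectral points, all of them eigenvalues of
  finite multiplicity. Conversely, for \<open>l \<ge> \<mu>\<close> the positive solution of the transverse problem with an additional
  term \<open>\<kappa> / h\<^sup>2\<close>, multiplied by a plane wave of frequency \<open>sqrt \<kappa>\<close> that is cut off far out, is a Weyl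
  sequence for \<open>l\<close>.\<close>

section \<open>The Hilbert space of square integrable functions\<close>

text \<open>The essential spectrum is what the discrete part leaves over, so below \<mu> a bound on
  the form is not enough: resolvent equations have to be solved there. No compact embedding is
  invoked. The form with the finite rank term added is coercive below \<mu> and is inverted by
  Lax-Milgram; taking the added term back is linear algebra on the finite dimensional span of the
  solutions that belong to the perturbing vectors. The number of these vectors also bounds the
  number of eigenvalues below \<mu>, which therefore cannot accumulate. Non-real points get a
  coercivity argument of their own. Positivity of \<open>Y0\<close> is used twice: it makes \<mu>
  nonnegative, so that on the middle piece the weight may be replaced by its maximum, and it lets
  the search for positive solutions start from a nonnegative potential, for which no further zero
  occurs. The term \<kappa> / h^2 comes from separating variables: a longitudinal factor Z with Z''
  = - \<kappa> Z adds \<kappa> / h^2 to the transverse potential.\<close>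

definition sq_int :: "('a::euclidean_space \<Rightarrow> complex) \<Rightarrow> bool" where
  "sq_int f \<longleftrightarrow> f \<in> borel_measurable lborel \<and> integrable lborel (\<lambda>x. (cmod (f x))\<^sup>2)"

lemma sq_int_measurable: "sq_int f \<Longrightarrow> f \<in> borel_measurable lborel"
  by (simp add: sq_int_def)

lemma sq_int_integrable: "sq_int f \<Longrightarrow> integrable lborel (\<lambda>x. (cmod (f x))\<^sup>2)"
  by (simp add: sq_int_def)

lemma sq_int_bound:
  assumes f: "f \<in> borel_measurable lborel" and g: "integrable lborel g"
    and "AE x in lborel. (cmod (f x))\<^sup>2 \<le> g x"
  shows "sq_int f"
proof -
  have "integrable lborel (\<lambda>x. (cmod (f x))\<^sup>2)"
  proof (rule Bochner_Integration.integrable_bound[OF g])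
    show "(\<lambda>x. (cmod (f x))\<^sup>2) \<in> borel_measurable lborel" using f by measurable
    show "AE x in lborel. norm ((cmod (f x))\<^sup>2) \<le> norm (g x)"
      using assms(3) by eventually_elim auto
  qed
  with f show ?thesis by (simp add: sq_int_def)
qed

lemma sq_int_zero [simp]: "sq_int (\<lambda>x. 0)"
  by (simp add: sq_int_def)

lemma sq_int_mult_bounded:
  assumes f: "sq_int f" and m: "m \<in> borel_measurable lborel"
    and b: "\<And>x. cmod (m x) \<le> C"
  shows "sq_int (\<lambda>x. m x * f x)"
proof (rule sq_int_bound)
  show "(\<lambda>x. m x * f x) \<in> borel_measurable lborel"
    using sq_int_measurable[OF f] m by measurable
  show "integrable lborel (\<lambda>x. C\<^sup>2 * (cmod (f x))\<^sup>2)"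
    using sq_int_integrable[OF f] by simp
  have "(cmod (m x * f x))\<^sup>2 \<le> C\<^sup>2 * (cmod (f x))\<^sup>2" for x
    by (simp add: norm_mult power_mult_distrib) (intro mult_right_mono power_mono b; simp)
  then show "AE x in lborel. (cmod (m x * f x))\<^sup>2 \<le> C\<^sup>2 * (cmod (f x))\<^sup>2" by simp
qed

lemma sq_int_cmult: "sq_int f \<Longrightarrow> sq_int (\<lambda>x. c * f x)"
  by (rule sq_int_mult_bounded[where C="cmod c"]) auto

lemma sq_int_scaleR: "sq_int f \<Longrightarrow> sq_int (\<lambda>x. r *\<^sub>R f x)"
  using sq_int_cmult[of f "of_real r"] by (simp add: scaleR_conv_of_real)

lemma sq_int_add:
  assumes f: "sq_int f" and g: "sq_int g"
  shows "sq_int (\<lambda>x. f x + g x)"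
proof (rule sq_int_bound)
  show "(\<lambda>x. f x + g x) \<in> borel_measurable lborel"
    using sq_int_measurable[OF f] sq_int_measurable[OF g] by measurable
  show "integrable lborel (\<lambda>x. 2 * (cmod (f x))\<^sup>2 + 2 * (cmod (g x))\<^sup>2)"
    using sq_int_integrable[OF f] sq_int_integrable[OF g] by simp
  have "(cmod (f x + g x))\<^sup>2 \<le> 2 * (cmod (f x))\<^sup>2 + 2 * (cmod (g x))\<^sup>2" for x
  proof -
    have "(cmod (f x + g x))\<^sup>2 \<le> (cmod (f x) + cmod (g x))\<^sup>2"
      by (intro power_mono norm_triangle_ineq) simp
    also have "\<dots> \<le> 2 * (cmod (f x))\<^sup>2 + 2 * (cmod (g x))\<^sup>2"
      using sum_squares_bound[of "cmod (f x)" "cmod (g x)"] by (simp add: power2_sum)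
    finally show ?thesis .
  qed
  then show "AE x in lborel. (cmod (f x + g x))\<^sup>2 \<le> 2 * (cmod (f x))\<^sup>2 + 2 * (cmod (g x))\<^sup>2"
    by simp
qed

lemma sq_int_uminus: "sq_int f \<Longrightarrow> sq_int (\<lambda>x. - f x)"
  using sq_int_cmult[of f "-1"] by simp

lemma sq_int_diff: "sq_int f \<Longrightarrow> sq_int g \<Longrightarrow> sq_int (\<lambda>x. f x - g x)"
  using sq_int_add[of f "\<lambda>x. - g x"] sq_int_uminus[of g] by simp

lemma borel_measurable_cnj [measurable]: "cnj \<in> borel_measurable borel"
  by (intro borel_measurable_continuous_onI continuous_intros)

lemma Re_mult_cnj_self: "Re (z * cnj z) = (cmod z)\<^sup>2"
  by (simp add: complex_mult_cnj cmod_power2)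

lemma sq_int_integrable_mult:
  assumes f: "sq_int f" and g: "sq_int g"
  shows "integrable lborel (\<lambda>x. f x * cnj (g x))"
proof (rule Bochner_Integration.integrable_bound)
  show "integrable lborel (\<lambda>x. (cmod (f x))\<^sup>2 + (cmod (g x))\<^sup>2)"
    using sq_int_integrable[OF f] sq_int_integrable[OF g] by simp
  show "(\<lambda>x. f x * cnj (g x)) \<in> borel_measurable lborel"
    using sq_int_measurable[OF f] sq_int_measurable[OF g] by measurable
  show "AE x in lborel. norm (f x * cnj (g x)) \<le> norm ((cmod (f x))\<^sup>2 + (cmod (g x))\<^sup>2)"
  proof (rule AE_I2)
    fix x
    have "cmod (f x) * cmod (g x) \<le> (cmod (f x))\<^sup>2 + (cmod (g x))\<^sup>2"
      using sum_squares_bound[of "cmod (f x)" "cmod (g x)"]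
        mult_nonneg_nonneg[OF norm_ge_zero[of "f x"] norm_ge_zero[of "g x"]] by linarith
    then show "norm (f x * cnj (g x)) \<le> norm ((cmod (f x))\<^sup>2 + (cmod (g x))\<^sup>2)"
      by (simp add: norm_mult)
  qed
qed

lemma sq_int_integrable_Re:
  "sq_int f \<Longrightarrow> sq_int g \<Longrightarrow> integrable lborel (\<lambda>x. Re (f x * cnj (g x)))"
  by (intro integrable_Re sq_int_integrable_mult)

\<comment> \<open>The quotient is partial: only square integrable functions are related to
  themselves, so \<open>cls f\<close> is meaningful only under \<open>sq_int f\<close>. Having a
  type makes the abstract Hilbert space results available through the classes
  \<open>real_inner\<close> and \<open>complete_space\<close>.\<close>
quotient_type (overloaded) 'a L2 = "'a::euclidean_space \<Rightarrow> complex" /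
  partial: "\<lambda>f g. sq_int f \<and> sq_int g \<and> (AE x in lborel. f x = g x)"
  morphisms rep_L2 cls
proof (rule part_equivpI)
  show "\<exists>f::'a \<Rightarrow> complex. sq_int f \<and> sq_int f \<and> (AE x in lborel. f x = f x)"
    by (rule exI[of _ "\<lambda>x. 0"]) simp
  show "symp (\<lambda>f g::'a \<Rightarrow> complex. sq_int f \<and> sq_int g \<and> (AE x in lborel. f x = g x))"
    by (rule sympI) (auto elim: eventually_mono)
  show "transp (\<lambda>f g::'a \<Rightarrow> complex. sq_int f \<and> sq_int g \<and> (AE x in lborel. f x = g x))"
  proof (rule transpI)
    fix f g h :: "'a \<Rightarrow> complex"
    assume a: "sq_int f \<and> sq_int g \<and> (AE x in lborel. f x = g x)"
      "sq_int g \<and> sq_int h \<and> (AE x in lborel. g x = h x)"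
    then have "AE x in lborel. f x = g x" "AE x in lborel. g x = h x" by auto
    then have "AE x in lborel. f x = h x" by eventually_elim simp
    with a show "sq_int f \<and> sq_int h \<and> (AE x in lborel. f x = h x)" by simp
  qed
qed

lemma L2_cases: obtains f where "sq_int f" "x = cls f"
proof -
  have "\<exists>f. sq_int f \<and> x = cls f"
    using Quotient3_rep_reflp[OF Quotient3_L2, of x] Quotient3_abs_rep[OF Quotient3_L2, of x] by metis
  then show ?thesis using that by blast
qed

lemma cls_eq_iff:
  assumes "sq_int f" "sq_int g"
  shows "cls f = cls g \<longleftrightarrow> (AE x in lborel. f x = g x)"
  using Quotient3_rel[OF Quotient3_L2, of f g] assms by auto

instantiation L2 :: (euclidean_space) "{zero, plus, minus, uminus, scaleR}"
begin

lift_definition zero_L2 :: "'a L2" is "\<lambda>x. 0" by simp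

lift_definition plus_L2 :: "'a L2 \<Rightarrow> 'a L2 \<Rightarrow> 'a L2" is "\<lambda>f g x. f x + g x"
proof -
  fix f f' g g' :: "'a \<Rightarrow> complex"
  assume a: "sq_int f \<and> sq_int f' \<and> (AE x in lborel. f x = f' x)"
    "sq_int g \<and> sq_int g' \<and> (AE x in lborel. g x = g' x)"
  then have "AE x in lborel. f x = f' x" "AE x in lborel. g x = g' x" by auto
  then have "AE x in lborel. f x + g x = f' x + g' x" by eventually_elim simp
  with a show "sq_int (\<lambda>x. f x + g x) \<and> sq_int (\<lambda>x. f' x + g' x) \<and>
    (AE x in lborel. f x + g x = f' x + g' x)"
    by (simp add: sq_int_add)
qed

lift_definition minus_L2 :: "'a L2 \<Rightarrow> 'a L2 \<Rightarrow> 'a L2" is "\<lambda>f g x. f x - g x"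
proof -
  fix f f' g g' :: "'a \<Rightarrow> complex"
  assume a: "sq_int f \<and> sq_int f' \<and> (AE x in lborel. f x = f' x)"
    "sq_int g \<and> sq_int g' \<and> (AE x in lborel. g x = g' x)"
  then have "AE x in lborel. f x = f' x" "AE x in lborel. g x = g' x" by auto
  then have "AE x in lborel. f x - g x = f' x - g' x" by eventually_elim simp
  with a show "sq_int (\<lambda>x. f x - g x) \<and> sq_int (\<lambda>x. f' x - g' x) \<and>
    (AE x in lborel. f x - g x = f' x - g' x)"
    by (simp add: sq_int_diff)
qed

lift_definition uminus_L2 :: "'a L2 \<Rightarrow> 'a L2" is "\<lambda>f x. - f x"
proof -
  fix f f' :: "'a \<Rightarrow> complex"
  assume a: "sq_int f \<and> sq_int f' \<and> (AE x in lborel. f x = f' x)"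
  then have "AE x in lborel. f x = f' x" by auto
  then have "AE x in lborel. - f x = - f' x" by eventually_elim simp
  with a show "sq_int (\<lambda>x. - f x) \<and> sq_int (\<lambda>x. - f' x) \<and> (AE x in lborel. - f x = - f' x)"
    by (simp add: sq_int_uminus)
qed

lift_definition scaleR_L2 :: "real \<Rightarrow> 'a L2 \<Rightarrow> 'a L2" is "\<lambda>r f x. r *\<^sub>R f x"
proof -
  fix r :: real and f f' :: "'a \<Rightarrow> complex"
  assume a: "sq_int f \<and> sq_int f' \<and> (AE x in lborel. f x = f' x)"
  then have "AE x in lborel. f x = f' x" by auto
  then have "AE x in lborel. r *\<^sub>R f x = r *\<^sub>R f' x" by eventually_elim simp
  with a show "sq_int (\<lambda>x. r *\<^sub>R f x) \<and> sq_int (\<lambda>x. r *\<^sub>R f' x) \<and> (AE x in lborel. r *\<^sub>R f x = r *\<^sub>R f' x)"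
    by (simp add: sq_int_scaleR)
qed

instance ..

end

instantiation L2 :: (euclidean_space) real_inner
begin

lift_definition inner_L2 :: "'a L2 \<Rightarrow> 'a L2 \<Rightarrow> real" is
  "\<lambda>f g. LINT x|lborel. Re (f x * cnj (g x))"
proof -
  fix f f' g g' :: "'a \<Rightarrow> complex"
  assume a: "sq_int f \<and> sq_int f' \<and> (AE x in lborel. f x = f' x)"
    "sq_int g \<and> sq_int g' \<and> (AE x in lborel. g x = g' x)"
  show "(LINT x|lborel. Re (f x * cnj (g x))) = (LINT x|lborel. Re (f' x * cnj (g' x)))"
  proof (rule integral_cong_AE)
    show "(\<lambda>x. Re (f x * cnj (g x))) \<in> borel_measurable lborel"
      "(\<lambda>x. Re (f' x * cnj (g' x))) \<in> borel_measurable lborel"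
      using a sq_int_integrable_Re borel_measurable_integrable by blast+
    have "AE x in lborel. f x = f' x" "AE x in lborel. g x = g' x" using a by auto
    then show "AE x in lborel. Re (f x * cnj (g x)) = Re (f' x * cnj (g' x))"
      by eventually_elim simp
  qed
qed

definition norm_L2 :: "'a L2 \<Rightarrow> real" where "norm_L2 x = sqrt (inner x x)"
definition dist_L2 :: "'a L2 \<Rightarrow> 'a L2 \<Rightarrow> real" where "dist_L2 x y = norm (x - y)"
definition sgn_L2 :: "'a L2 \<Rightarrow> 'a L2" where "sgn_L2 x = inverse (norm x) *\<^sub>R x"
definition uniformity_L2 :: "('a L2 \<times> 'a L2) filter" where
  "uniformity_L2 = (INF e\<in>{0<..}. principal {(x, y). dist x y < e})"
definition open_L2 :: "'a L2 set \<Rightarrow> bool" where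
  "open_L2 U \<longleftrightarrow> (\<forall>x\<in>U. eventually (\<lambda>(x', y). x' = x \<longrightarrow> y \<in> U) uniformity)"

instance
proof
  fix x y z :: "'a L2" and r s :: real and U :: "'a L2 set"
  show "x + y + z = x + (y + z)"
    by transfer (simp add: sq_int_add add.assoc)
  show "x + y = y + x"
    by transfer (simp add: sq_int_add add.commute)
  show "0 + x = x" by transfer simp
  show "- x + x = 0" by transfer simp
  show "x - y = x + - y" by transfer (simp add: sq_int_diff)
  show "r *\<^sub>R (x + y) = r *\<^sub>R x + r *\<^sub>R y"
    by transfer (auto simp: scaleR_add_right intro!: sq_int_add sq_int_scaleR)
  show "(r + s) *\<^sub>R x = r *\<^sub>R x + s *\<^sub>R x"
    by transfer (auto simp: scaleR_add_left intro!: sq_int_add sq_int_scaleR)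
  show "r *\<^sub>R s *\<^sub>R x = (r * s) *\<^sub>R x"
    by transfer (auto intro!: sq_int_scaleR)
  show "1 *\<^sub>R x = x" by transfer simp
  show "dist x y = norm (x - y)" by (rule dist_L2_def)
  show "sgn x = x /\<^sub>R norm x" by (rule sgn_L2_def)
  show "uniformity = (INF e\<in>{0<..}. principal {(x::'a L2, y). dist x y < e})"
    by (rule uniformity_L2_def)
  show "open U = (\<forall>x\<in>U. \<forall>\<^sub>F (x', y) in uniformity. x' = x \<longrightarrow> y \<in> U)"
    by (rule open_L2_def)
  show "norm x = sqrt (inner x x)" by (rule norm_L2_def)
  show "inner x y = inner y x"
    by transfer (simp add: mult.commute)
  show "inner (x + y) z = inner x z + inner y z"
  proof transfer
    fix f g h :: "'a \<Rightarrow> complex"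
    assume "sq_int f \<and> sq_int f \<and> (AE x in lborel. f x = f x)"
      "sq_int g \<and> sq_int g \<and> (AE x in lborel. g x = g x)"
      "sq_int h \<and> sq_int h \<and> (AE x in lborel. h x = h x)"
    then have "integrable lborel (\<lambda>x. Re (f x * cnj (h x)))" "integrable lborel (\<lambda>x. Re (g x * cnj (h x)))"
      using sq_int_integrable_Re by blast+
    from Bochner_Integration.integral_add[OF this]
    show "(LINT x|lborel. Re ((f x + g x) * cnj (h x))) =
       (LINT x|lborel. Re (f x * cnj (h x))) + (LINT x|lborel. Re (g x * cnj (h x)))"
      by (simp add: algebra_simps)
  qed
  show "inner (r *\<^sub>R x) y = r * inner x y"
  proof transfer
    fix r and f g :: "'a \<Rightarrow> complex"
    have "(LINT x|lborel. r * Re (f x * cnj (g x))) = r * (LINT x|lborel. Re (f x * cnj (g x)))"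
      by (rule integral_mult_right_zero)
    then show "(LINT x|lborel. Re (r *\<^sub>R f x * cnj (g x))) = r * (LINT x|lborel. Re (f x * cnj (g x)))"
      by (simp add: algebra_simps)
  qed
  show "0 \<le> inner x x"
    by transfer (simp add: Re_mult_cnj_self)
  show "inner x x = 0 \<longleftrightarrow> x = 0"
  proof transfer
    fix f :: "'a \<Rightarrow> complex"
    assume a: "sq_int f \<and> sq_int f \<and> (AE x in lborel. f x = f x)"
    have "(LINT x|lborel. (cmod (f x))\<^sup>2) = 0 \<longleftrightarrow> (AE x in lborel. (cmod (f x))\<^sup>2 = 0)"
      using a by (intro integral_nonneg_eq_0_iff_AE) (auto simp: sq_int_def)
    also have "\<dots> \<longleftrightarrow> (AE x in lborel. f x = 0)" by simp
    finally show "((LINT x|lborel. Re (f x * cnj (f x))) = 0) =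
      (sq_int f \<and> sq_int (\<lambda>x::'a. 0) \<and> (AE x in lborel. f x = 0))"
      unfolding Re_mult_cnj_self using a by simp
  qed
qed

end

lemma cls_zero: "cls (\<lambda>x. 0) = 0"
  by (simp add: zero_L2.abs_eq)

lemma cls_add: "sq_int f \<Longrightarrow> sq_int g \<Longrightarrow> cls f + cls g = cls (\<lambda>x. f x + g x)"
  by (rule plus_L2.abs_eq) auto

lemma cls_diff: "sq_int f \<Longrightarrow> sq_int g \<Longrightarrow> cls f - cls g = cls (\<lambda>x. f x - g x)"
  by (rule minus_L2.abs_eq) auto

lemma cls_scaleR: "sq_int f \<Longrightarrow> r *\<^sub>R cls f = cls (\<lambda>x. r *\<^sub>R f x)"
  by (rule scaleR_L2.abs_eq) auto

lemma inner_cls: "sq_int f \<Longrightarrow> sq_int g \<Longrightarrow> inner (cls f) (cls g) = (LINT x|lborel. Re (f x * cnj (g x)))"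
  by (rule inner_L2.abs_eq) auto

lemma norm_cls_sq: "sq_int f \<Longrightarrow> (norm (cls f))\<^sup>2 = (LINT x|lborel. (cmod (f x))\<^sup>2)"
  unfolding power2_norm_eq_inner[of "cls f"] by (simp only: inner_cls Re_mult_cnj_self)

lemma norm_cls_diff_sq:
  "sq_int f \<Longrightarrow> sq_int g \<Longrightarrow> (norm (cls f - cls g))\<^sup>2 = (LINT x|lborel. (cmod (f x - g x))\<^sup>2)"
  by (simp add: cls_diff norm_cls_sq sq_int_diff)

text \<open>Fatou's lemma as a norm bound. It is applied to the tails g m - g n with n fixed, where
  it gives both membership of the limit in the space and the rate of convergence.\<close>

lemma sq_int_Fatou:
  fixes g :: "nat \<Rightarrow> 'a::euclidean_space \<Rightarrow> complex"
  assumes g: "\<And>m. sq_int (g m)" and F: "F \<in> borel_measurable lborel"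
    and lim: "AE x in lborel. (\<lambda>m. g m x) \<longlonglongrightarrow> F x"
    and b: "\<And>m. m \<ge> n \<Longrightarrow> norm (cls (g m)) \<le> B" and "B \<ge> 0"
  shows "sq_int F \<and> norm (cls F) \<le> B"
proof -
  have meas: "\<And>m. g m \<in> borel_measurable lborel" using g by (simp add: sq_int_def)
  note [measurable] = meas F
  have nn: "(\<integral>\<^sup>+x. ennreal ((cmod (g m x))\<^sup>2) \<partial>lborel) = ennreal ((norm (cls (g m)))\<^sup>2)" for m
    by (simp add: norm_cls_sq[OF g] nn_integral_eq_integral sq_int_integrable[OF g])
  have "(\<integral>\<^sup>+x. ennreal ((cmod (F x))\<^sup>2) \<partial>lborel) = (\<integral>\<^sup>+x. liminf (\<lambda>m. ennreal ((cmod (g m x))\<^sup>2)) \<partial>lborel)"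
  proof (rule nn_integral_cong_AE)
    show "AE x in lborel. ennreal ((cmod (F x))\<^sup>2) = liminf (\<lambda>m. ennreal ((cmod (g m x))\<^sup>2))"
      using lim
    proof eventually_elim
      case (elim x)
      have "(\<lambda>m. ennreal ((cmod (g m x))\<^sup>2)) \<longlonglongrightarrow> ennreal ((cmod (F x))\<^sup>2)"
        by (intro tendsto_intros elim tendsto_ennrealI)
      then show ?case by (metis lim_imp_Liminf trivial_limit_sequentially)
    qed
  qed
  also have "\<dots> \<le> liminf (\<lambda>m. \<integral>\<^sup>+x. ennreal ((cmod (g m x))\<^sup>2) \<partial>lborel)"
    by (rule nn_integral_liminf) measurable
  also have "\<dots> \<le> ennreal (B\<^sup>2)"
  proof -
    have "eventually (\<lambda>m. (\<integral>\<^sup>+x. ennreal ((cmod (g m x))\<^sup>2) \<partial>lborel) \<le> ennreal (B\<^sup>2)) sequentially"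
      unfolding eventually_sequentially nn
      by (intro exI[of _ n] allI impI ennreal_leI power_mono b) auto
    from Liminf_mono[OF this] show ?thesis by (simp add: Liminf_const)
  qed
  finally have le: "(\<integral>\<^sup>+x. ennreal ((cmod (F x))\<^sup>2) \<partial>lborel) \<le> ennreal (B\<^sup>2)" .
  then have int: "integrable lborel (\<lambda>x. (cmod (F x))\<^sup>2)"
    by (intro integrableI_nonneg) (auto simp: top.not_eq_extremum le_less_trans)
  then have sq: "sq_int F" using F by (simp add: sq_int_def)
  have "ennreal ((norm (cls F))\<^sup>2) \<le> ennreal (B\<^sup>2)"
    using le by (simp add: norm_cls_sq[OF sq] nn_integral_eq_integral int)
  then have "(norm (cls F))\<^sup>2 \<le> B\<^sup>2" by simp
  then have "norm (cls F) \<le> B" using \<open>B \<ge> 0\<close> by (rule power2_le_imp_le)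
  with sq show ?thesis by simp
qed

lemma cls_sum:
  "finite I \<Longrightarrow> (\<And>i. i \<in> I \<Longrightarrow> sq_int (f i)) \<Longrightarrow>
    sq_int (\<lambda>x. \<Sum>i\<in>I. f i x) \<and> (\<Sum>i\<in>I. cls (f i)) = cls (\<lambda>x. \<Sum>i\<in>I. f i x)"
proof (induction I rule: finite_induct)
  case (insert i I)
  then show ?case by (auto simp: sq_int_add cls_add)
qed (auto simp: cls_zero)

text \<open>Riesz-Fischer. The partial sums of |g (k + 1) - g k| have norm at most 2, so by monotone
  convergence their supremum is finite almost everywhere. There the telescoping series converges
  absolutely and g n has a pointwise limit; Fatou turns this into convergence in norm.\<close>

lemma L2_rapid_Cauchy_converges:
  fixes g :: "nat \<Rightarrow> 'a::euclidean_space \<Rightarrow> complex"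
  assumes g: "\<And>n. sq_int (g n)"
    and d: "\<And>n. norm (cls (g (Suc n)) - cls (g n)) \<le> (1/2)^n"
  shows "convergent (\<lambda>n. cls (g n))"
proof -
  define D where "D k x = complex_of_real (cmod (g (Suc k) x - g k x))" for k x
  have gm [measurable]: "g n \<in> borel_measurable lborel" for n using g by (simp add: sq_int_def)
  have sD: "sq_int (D k)" for k
  proof (rule sq_int_bound)
    show "D k \<in> borel_measurable lborel" unfolding D_def by measurable
    show "integrable lborel (\<lambda>x. (cmod (g (Suc k) x - g k x))\<^sup>2)"
      by (rule sq_int_integrable) (intro sq_int_diff g)
  qed (simp add: D_def)
  have nD: "norm (cls (D k)) \<le> (1/2)^k" for k
  proof -
    have "(norm (cls (D k)))\<^sup>2 = (norm (cls (g (Suc k)) - cls (g k)))\<^sup>2"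
      by (simp add: norm_cls_sq[OF sD] norm_cls_diff_sq[OF g g] D_def)
    then have "norm (cls (D k)) = norm (cls (g (Suc k)) - cls (g k))" by simp
    then show ?thesis using d[of k] by simp
  qed
  define S where "S n x = (\<Sum>k<n. cmod (g (Suc k) x - g k x))" for n x
  have S: "sq_int (\<lambda>x. of_real (S n x))" "norm (cls (\<lambda>x. of_real (S n x))) \<le> 2" for n
  proof -
    have *: "(\<lambda>x. of_real (S n x)) = (\<lambda>x. \<Sum>k<n. D k x)"
      by (simp add: S_def D_def)
    from cls_sum[of "{..<n}" D, OF _ sD]
    have **: "sq_int (\<lambda>x. of_real (S n x))" "(\<Sum>k<n. cls (D k)) = cls (\<lambda>x. of_real (S n x))"
      unfolding * by auto
    show "sq_int (\<lambda>x. of_real (S n x))" by fact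
    have "norm (cls (\<lambda>x. of_real (S n x))) \<le> (\<Sum>k<n. (1/2)^k)"
      unfolding **(2)[symmetric] by (rule sum_norm_le) (rule nD)
    also have "\<dots> \<le> 2" by (simp add: geometric_sum)
    finally show "norm (cls (\<lambda>x. of_real (S n x))) \<le> 2" .
  qed
  have Sm [measurable]: "S n \<in> borel_measurable lborel" for n unfolding S_def by measurable
  have "(\<integral>\<^sup>+x. (SUP n. ennreal ((S n x)\<^sup>2)) \<partial>lborel) = (SUP n. \<integral>\<^sup>+x. ennreal ((S n x)\<^sup>2) \<partial>lborel)"
  proof (rule nn_integral_monotone_convergence_SUP)
    show "incseq (\<lambda>n x. ennreal ((S n x)\<^sup>2))"
      unfolding incseq_def le_fun_def S_def
      by (intro allI impI ennreal_leI power_mono sum_mono2) (auto intro: sum_nonneg)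
  qed measurable
  also have "\<dots> \<le> ennreal 4"
  proof (rule SUP_least)
    fix n
    have "(\<integral>\<^sup>+x. ennreal ((S n x)\<^sup>2) \<partial>lborel) = ennreal ((norm (cls (\<lambda>x. of_real (S n x))))\<^sup>2)"
      using sq_int_integrable[OF S(1)[of n]]
      by (simp add: norm_cls_sq[OF S(1)] nn_integral_eq_integral)
    also have "\<dots> \<le> ennreal (2\<^sup>2)" by (intro ennreal_leI power_mono S) auto
    finally show "(\<integral>\<^sup>+x. ennreal ((S n x)\<^sup>2) \<partial>lborel) \<le> ennreal 4" by simp
  qed
  finally have "(\<integral>\<^sup>+x. (SUP n. ennreal ((S n x)\<^sup>2)) \<partial>lborel) \<noteq> \<infinity>" by (auto simp: top_unique)
  then have "AE x in lborel. (SUP n. ennreal ((S n x)\<^sup>2)) \<noteq> \<infinity>"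
    by (intro nn_integral_noteq_infinite) measurable
  then have conv: "AE x in lborel. convergent (\<lambda>n. g n x)"
  proof eventually_elim
    case (elim x)
    define B where "B = enn2real (SUP n. ennreal ((S n x)\<^sup>2))"
    have "(S n x)\<^sup>2 \<le> B" for n
    proof -
      have "ennreal ((S n x)\<^sup>2) \<le> (SUP n. ennreal ((S n x)\<^sup>2))" by (rule SUP_upper) simp
      also have "\<dots> = ennreal B" unfolding B_def using elim by (metis ennreal_enn2real infinity_ennreal_def top.not_eq_extremum)
      finally show ?thesis by (simp add: B_def ennreal_le_iff)
    qed
    then have "S n x \<le> sqrt B" for n by (rule real_le_rsqrt)
    then have "summable (\<lambda>k. cmod (g (Suc k) x - g k x))"
      by (intro summableI_nonneg_bounded[where x="sqrt B"]) (auto simp: S_def)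
    then have "summable (\<lambda>k. g (Suc k) x - g k x)" by (rule summable_norm_cancel)
    then have "convergent (\<lambda>n. \<Sum>k<n. g (Suc k) x - g k x)"
      by (simp only: summable_iff_convergent)
    then have "convergent (\<lambda>n. g n x - g 0 x)" by (simp only: sum_lessThan_telescope[of "\<lambda>n. g n x"])
    then obtain l where "(\<lambda>n. g n x - g 0 x) \<longlonglongrightarrow> l" by (auto simp: convergent_def)
    from tendsto_add[OF this tendsto_const[of "g 0 x"]] show ?case by (auto simp: convergent_def)
  qed
  define F where "F x = lim (\<lambda>n. g n x)" for x
  have Fm: "F \<in> borel_measurable lborel" unfolding F_def by measurable
  have lim: "AE x in lborel. (\<lambda>n. g n x) \<longlonglongrightarrow> F x"
    using conv by eventually_elim (simp add: F_def convergent_LIMSEQ_iff)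
  \<comment> \<open>The subtracted term 2 * (1/2)^m lets the induction close: one further step costs
    (1/2)^m, exactly the change of that term from m to m + 1.\<close>
  have tail: "norm (cls (g m) - cls (g n)) \<le> 2 * (1/2)^n - 2 * (1/2)^m" if "m \<ge> n" for m n
    using that
  proof (induction m rule: dec_induct)
    case (step m)
    have "norm (cls (g (Suc m)) - cls (g n)) \<le> norm (cls (g (Suc m)) - cls (g m)) + norm (cls (g m) - cls (g n))"
      using norm_triangle_ineq[of "cls (g (Suc m)) - cls (g m)" "cls (g m) - cls (g n)"] by simp
    then show ?case using step d[of m] by simp
  qed simp
  have *: "sq_int (\<lambda>x. F x - g n x) \<and> norm (cls (\<lambda>x. F x - g n x)) \<le> 2 * (1/2)^n" for n
  proof (rule sq_int_Fatou[where g="\<lambda>m x. g m x - g n x" and n=n])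
    show "sq_int (\<lambda>x. g m x - g n x)" for m by (intro sq_int_diff g)
    show "(\<lambda>x. F x - g n x) \<in> borel_measurable lborel" using Fm by measurable
    show "AE x in lborel. (\<lambda>m. g m x - g n x) \<longlonglongrightarrow> F x - g n x"
      using lim by eventually_elim (intro tendsto_intros)
    fix m assume "n \<le> m"
    have "0 \<le> 2 * (1/2::real)^m" by simp
    with tail[OF \<open>n \<le> m\<close>] show "norm (cls (\<lambda>x. g m x - g n x)) \<le> 2 * (1 / 2) ^ n"
      unfolding cls_diff[OF g g] by linarith
  qed simp
  have "sq_int (\<lambda>x. (F x - g 0 x) + g 0 x)" by (intro sq_int_add g conjunct1[OF *])
  then have sF: "sq_int F" by simp
  have "(\<lambda>n. cls (g n) - cls F) \<longlonglongrightarrow> 0"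
  proof (rule Lim_null_comparison)
    show "\<forall>\<^sub>F n in sequentially. norm (cls (g n) - cls F) \<le> 2 * (1/2)^n"
      using * by (auto simp: norm_minus_commute[of "cls (g _)"] cls_diff[OF sF g])
    have "(\<lambda>n. 2 * (1/2::real)^n) \<longlonglongrightarrow> 2 * 0"
      by (intro tendsto_intros LIMSEQ_power_zero) simp
    then show "(\<lambda>n. 2 * (1/2::real)^n) \<longlonglongrightarrow> 0" by simp
  qed
  then show ?thesis by (metis Lim_null convergent_def)
qed

instance L2 :: (euclidean_space) complete_space
proof
  fix X :: "nat \<Rightarrow> 'a L2"
  assume X: "Cauchy X"
  have "\<exists>N. \<forall>m\<ge>N. \<forall>n\<ge>N. norm (X m - X n) < (1/2)^k" for k
    using X by (auto simp: Cauchy_def dist_norm)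
  then obtain N where N: "\<And>k m n. m \<ge> N k \<Longrightarrow> n \<ge> N k \<Longrightarrow> norm (X m - X n) < (1/2)^k" by metis
  \<comment> \<open>Each index lies beyond the previous one and beyond the Cauchy threshold of its
    stage, so the subsequence is rapidly Cauchy.\<close>
  define r where "r = rec_nat (N 0) (\<lambda>k rk. Suc (rk + N (Suc k)))"
  have rS: "r (Suc k) = Suc (r k + N (Suc k))" for k by (simp add: r_def)
  have r: "strict_mono r" by (rule strict_monoI_Suc) (simp add: rS)
  have rN: "r k \<ge> N k" for k by (cases k) (simp_all add: rS, simp add: r_def)
  have "\<exists>g. sq_int g \<and> X n = cls g" for n using L2_cases by blast
  then obtain g where g: "\<And>n. sq_int (g n)" "\<And>n. X n = cls (g n)" by metis
  have "convergent (\<lambda>n. cls (g (r n)))"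
  proof (rule L2_rapid_Cauchy_converges)
    show "sq_int (g (r n))" for n by (rule g)
    show "norm (cls (g (r (Suc n))) - cls (g (r n))) \<le> (1/2)^n" for n
      using N[of n "r (Suc n)" "r n"] rN[of n] by (simp add: g(2)[symmetric] rS)
  qed
  then obtain l where "(X \<circ> r) \<longlonglongrightarrow> l" by (auto simp: convergent_def g(2) o_def)
  with Cauchy_converges_subseq[OF X r] show "convergent X" by (auto simp: convergent_def)
qed

section \<open>Closed forms on a Hilbert space\<close>

text \<open>The representing vector minimises |u|^2 - 2 l u over the subspace. The parallelogram
  identity makes a minimising sequence Cauchy, and vanishing of the first variation at its limit is
  the claim. Arguing on a closed subspace avoids making it a type of its own.\<close>

lemma riesz_closed_subspace:
  fixes X :: "'h::{real_inner,complete_space} set"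
  assumes X: "subspace X" "closed X" and l: "bounded_linear l"
  shows "\<exists>f\<in>X. \<forall>\<phi>\<in>X. inner f \<phi> = l \<phi>"
proof -
  interpret l: bounded_linear l by (rule l)
  obtain K where K: "K > 0" "\<And>x. \<bar>l x\<bar> \<le> norm x * K"
    using l.pos_bounded by (auto simp: real_norm_def)
  define J where "J u = inner u u - 2 * l u" for u
  \<comment> \<open>Complete the square in norm u.\<close>
  have Jlow: "J u \<ge> - (K\<^sup>2)" for u
  proof -
    have "J u \<ge> (norm u)\<^sup>2 - 2 * (norm u * K)"
      using K(2)[of u] by (simp add: J_def power2_norm_eq_inner abs_le_iff)
    moreover have "0 \<le> (norm u - K)\<^sup>2" by simp
    ultimately show ?thesis by (simp add: power2_diff)
  qed
  define d where "d = Inf (J ` X)"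
  have bdd: "bdd_below (J ` X)" using Jlow by (auto intro!: bdd_belowI)
  have X0: "0 \<in> X" using X(1) by (rule subspace_0)
  have dle: "d \<le> J u" if "u \<in> X" for u
    unfolding d_def by (rule cInf_lower) (use that bdd in auto)
  have "\<exists>u\<in>X. J u < d + 1 / Suc n" for n
    using cInf_lessD[of "J ` X" "d + 1 / Suc n"] X0 unfolding d_def by fastforce
  then obtain u where u: "\<And>n. u n \<in> X" "\<And>n. J (u n) < d + 1 / Suc n" by metis
  have par: "(norm (u n - u m))\<^sup>2 \<le> 2 * (1 / Suc n + 1 / Suc m)" for n m
  proof -
    have mid: "(1/2) *\<^sub>R (u n + u m) \<in> X"
      using X(1) u(1) by (simp add: subspace_add subspace_scale)
    have "J (u n) + J (u m) - 2 * J ((1/2) *\<^sub>R (u n + u m)) = (norm (u n - u m))\<^sup>2 / 2"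
      unfolding J_def power2_norm_eq_inner
      by (simp add: l.scaleR l.add inner_simps inner_commute field_simps)
    then have "(norm (u n - u m))\<^sup>2 = 2 * (J (u n) + J (u m) - 2 * J ((1/2) *\<^sub>R (u n + u m)))" by simp
    also have "\<dots> \<le> 2 * (1 / Suc n + 1 / Suc m)"
      using dle[OF mid] u(2)[of n] u(2)[of m] by (simp del: of_nat_Suc)
    finally show ?thesis .
  qed
  have "Cauchy u"
  proof (rule metric_CauchyI)
    fix e :: real assume "e > 0"
    have aux: "a \<le> c \<Longrightarrow> b \<le> c \<Longrightarrow> x \<le> 2 * (a + b) \<Longrightarrow> c < wext / 4 \<Longrightarrow> x < wext" for a b c x wext :: real
      by (simp add: field_simps)
    obtain M where M: "1 / Suc M < e\<^sup>2 / 4" using nat_approx_posE[of "e\<^sup>2 / 4"] \<open>e > 0\<close> by auto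
    have "dist (u m) (u n) < e" if "m \<ge> M" "n \<ge> M" for m n
    proof -
      have "1 / real (Suc m) \<le> 1 / Suc M" "1 / real (Suc n) \<le> 1 / Suc M"
        using that by (auto intro!: divide_left_mono)
      then have "(norm (u m - u n))\<^sup>2 < e\<^sup>2" using par[of m n] M
        by (metis (no_types, lifting) aux)
      then show ?thesis unfolding dist_norm by (rule power2_less_imp_less) (use \<open>e > 0\<close> in simp)
    qed
    then show "\<exists>M. \<forall>m\<ge>M. \<forall>n\<ge>M. dist (u m) (u n) < e" by blast
  qed
  then obtain f where f: "u \<longlonglongrightarrow> f" using Cauchy_convergent convergent_def by blast
  have fX: "f \<in> X" using closed_sequentially[OF X(2)] u(1) f by blast
  have "(\<lambda>n. J (u n)) \<longlonglongrightarrow> J f"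
    unfolding J_def by (intro tendsto_intros f l.tendsto)
  moreover have "(\<lambda>n. d + 1 / Suc n) \<longlonglongrightarrow> d + 0"
    by (intro tendsto_intros) (rule LIMSEQ_inverse_real_of_nat[unfolded inverse_eq_divide])
  ultimately have "J f \<le> d + 0"
    by (rule LIMSEQ_le) (use u(2) in \<open>auto intro: less_imp_le\<close>)
  then have min: "J f \<le> J w" if "w \<in> X" for w using dle[OF that] by simp
  have "inner f \<phi> = l \<phi>" if "\<phi> \<in> X" for \<phi>
  proof (cases "\<phi> = 0")
    case False
    define c where "c = inner f \<phi> - l \<phi>"
    \<comment> \<open>The minimiser of J (f + t \<phi>) - J f = 2 t c + t^2 |\<phi>|^2.\<close>
    define t where "t = - c / inner \<phi> \<phi>"
    have pos: "inner \<phi> \<phi> > 0" using False by simp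
    have "f + t *\<^sub>R \<phi> \<in> X" using X(1) fX that by (simp add: subspace_add subspace_scale)
    from min[OF this] have "0 \<le> 2 * t * c + t * t * inner \<phi> \<phi>"
      by (simp add: J_def c_def l.add l.scaleR inner_simps inner_commute algebra_simps)
    also have "2 * t * c + t * t * inner \<phi> \<phi> = - (c\<^sup>2 / inner \<phi> \<phi>)"
      using pos by (simp add: t_def field_simps power2_eq_square)
    finally have "c\<^sup>2 / inner \<phi> \<phi> \<le> 0" by simp
    then have "c\<^sup>2 \<le> 0" using pos by (simp add: divide_le_0_iff not_less)
    then show ?thesis by (simp add: c_def)
  qed (simp add: l.zero)
  with fX show ?thesis by blast
qed

text \<open>No symmetry is assumed, because for non-real points the form is composed with a rotation
  of the test function. T represents the form and f the functional; u - \<rho> (T u - f) is a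
  contraction of X in u, and its fixed point satisfies T u = f.\<close>

lemma lax_milgram:
  fixes X :: "'h::{real_inner,complete_space} set"
  assumes X: "subspace X" "closed X" and l: "bounded_linear l"
    and B: "\<And>u. bounded_linear (B u)" "\<And>u v \<phi>. B (u - v) \<phi> = B u \<phi> - B v \<phi>"
    and Bb: "\<And>u \<phi>. \<bar>B u \<phi>\<bar> \<le> K * norm u * norm \<phi>"
    and c: "c > 0" "\<And>u. u \<in> X \<Longrightarrow> c * (norm u)\<^sup>2 \<le> B u u"
  shows "\<exists>u\<in>X. \<forall>\<phi>\<in>X. B u \<phi> = l \<phi>"
proof -
  obtain f where f: "f \<in> X" "\<And>\<phi>. \<phi> \<in> X \<Longrightarrow> inner f \<phi> = l \<phi>"
    using riesz_closed_subspace[OF X l] by blast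
  have "\<exists>T. \<forall>u. T u \<in> X \<and> (\<forall>\<phi>\<in>X. inner (T u) \<phi> = B u \<phi>)"
    using riesz_closed_subspace[OF X B(1)] by (intro choice) blast
  then obtain T where T: "\<And>u. T u \<in> X" "\<And>u \<phi>. \<phi> \<in> X \<Longrightarrow> inner (T u) \<phi> = B u \<phi>" by blast
  \<comment> \<open>Enlarging the bound beyond c keeps the contraction factor strictly between 0 and
    1.\<close>
  define K' where "K' = max K (c + 1)"
  have K': "K' > c" "K' > 0" using c(1) by (auto simp: K'_def)
  have Bb': "\<bar>B u \<phi>\<bar> \<le> K' * norm u * norm \<phi>" for u \<phi>
  proof -
    have "K * (norm u * norm \<phi>) \<le> K' * (norm u * norm \<phi>)"
      by (intro mult_right_mono) (auto simp: K'_def)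
    with Bb[of u \<phi>] show ?thesis by (simp add: mult.assoc)
  qed
  \<comment> \<open>This value minimises 1 - 2 \<rho> c + \<rho>^2 K'^2, the square of the
    contraction factor, and yields 1 - c^2 / K'^2.\<close>
  define \<rho> where "\<rho> = c / K'\<^sup>2"
  define G where "G u = u - \<rho> *\<^sub>R (T u - f)" for u
  define k where "k = sqrt (1 - c\<^sup>2 / K'\<^sup>2)"
  have "c\<^sup>2 < K'\<^sup>2" using K' c(1) by (intro power_strict_mono) auto
  then have k2: "0 < 1 - c\<^sup>2 / K'\<^sup>2" "1 - c\<^sup>2 / K'\<^sup>2 < 1" using c(1) K' by auto
  then have k: "0 \<le> k" "k < 1" "k\<^sup>2 = 1 - c\<^sup>2 / K'\<^sup>2" by (auto simp: k_def)
  have contr: "dist (G u) (G v) \<le> k * dist u v" if "u \<in> X" "v \<in> X" for u v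
  proof -
    define e where "e = u - v"
    define t where "t = T u - T v"
    have eX: "e \<in> X" "t \<in> X" using that T(1) X(1) by (auto simp: e_def t_def subspace_diff)
    have t: "inner t \<phi> = B e \<phi>" if "\<phi> \<in> X" for \<phi>
      using that by (simp add: t_def e_def inner_diff_left T(2) B(2))
    have "(norm t)\<^sup>2 \<le> K' * norm e * norm t"
      using t[OF eX(2)] Bb'[of e t] by (simp add: power2_norm_eq_inner)
    then have tb: "norm t \<le> K' * norm e"
      by (cases "norm t = 0") (use K'(2) in \<open>auto simp: power2_eq_square\<close>)
    have "inner e t \<ge> c * (norm e)\<^sup>2" using t[OF eX(1)] c(2)[OF eX(1)] by (simp add: inner_commute)
    then have et: "2 * \<rho> * inner e t \<ge> 2 * \<rho> * (c * (norm e)\<^sup>2)"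
      using c(1) by (intro mult_left_mono) (auto simp: \<rho>_def)
    have "(norm t)\<^sup>2 \<le> (K' * norm e)\<^sup>2" using tb by (intro power_mono) auto
    then have tt: "\<rho>\<^sup>2 * (norm t)\<^sup>2 \<le> \<rho>\<^sup>2 * (K' * norm e)\<^sup>2" by (intro mult_left_mono) auto
    have w: "G u - G v = e - \<rho> *\<^sub>R t" by (simp add: G_def e_def t_def algebra_simps)
    have "(norm (G u - G v))\<^sup>2 = (norm e)\<^sup>2 - 2 * \<rho> * inner e t + \<rho>\<^sup>2 * (norm t)\<^sup>2"
      unfolding w power2_norm_eq_inner
      by (simp add: inner_simps inner_commute power2_eq_square algebra_simps)
    also have "\<dots> \<le> (norm e)\<^sup>2 - 2 * \<rho> * (c * (norm e)\<^sup>2) + \<rho>\<^sup>2 * (K' * norm e)\<^sup>2"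
      using et tt by linarith
    also have "\<dots> = k\<^sup>2 * (norm e)\<^sup>2"
      using K'(2) unfolding k(3) by (simp add: \<rho>_def field_simps power2_eq_square)
    also have "\<dots> = (k * norm e)\<^sup>2" by (simp add: power_mult_distrib)
    finally have "norm (G u - G v) \<le> k * norm e"
      by (rule power2_le_imp_le) (use k(1) in simp)
    then show ?thesis by (simp add: dist_norm e_def)
  qed
  have "\<exists>!x\<in>X. G x = x"
  proof (rule Banach_fix)
    show "complete X" using X(2) by (simp add: complete_eq_closed)
    show "X \<noteq> {}" using f(1) by blast
    show "G ` X \<subseteq> X" using X(1) f(1) T(1) by (auto simp: G_def intro!: subspace_diff subspace_scale)
  qed (use k contr in auto)
  then obtain u where u: "u \<in> X" "G u = u" by blast
  have "\<rho> \<noteq> 0" using c(1) K'(2) by (simp add: \<rho>_def)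
  with u(2) have "T u = f" by (simp add: G_def)
  with u(1) T(2) f(2) show ?thesis by metis
qed

text \<open>A pair \<open>u\<close> in \<open>X\<close> stands for a function together with its weighted gradient, so that
  \<open>inner (snd u) (snd \<phi>)\<close> is the form of the operator.\<close>

locale form_perturbation =
  fixes X :: "('h::{real_inner,complete_space} \<times> 'k::{real_inner,complete_space}) set"
    and e :: "nat \<Rightarrow> 'h" and N :: nat and L :: real
  assumes subspace_X: "subspace X" and closed_X: "closed X"
    and lower: "\<And>u. u \<in> X \<Longrightarrow>
      L * inner (fst u) (fst u) \<le> inner (snd u) (snd u) + (\<Sum>i<N. (inner (e i) (fst u))\<^sup>2)"
begin

definition sol :: "real \<Rightarrow> 'h \<Rightarrow> 'h \<times> 'k \<Rightarrow> bool" where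
  "sol z g u \<longleftrightarrow> u \<in> X \<and> (\<forall>\<phi>\<in>X. inner (snd u) (snd \<phi>) - z * inner (fst u) (fst \<phi>) = inner g (fst \<phi>))"

text \<open>The form minus z together with the finite rank term of \<open>lower\<close>. It is
  coercive for z < L, which the form in \<open>sol\<close> need not be.\<close>

definition B :: "real \<Rightarrow> 'h \<times> 'k \<Rightarrow> 'h \<times> 'k \<Rightarrow> real" where
  "B z u \<phi> = inner (snd u) (snd \<phi>) - z * inner (fst u) (fst \<phi>)
     + (\<Sum>i<N. inner (e i) (fst u) * inner (e i) (fst \<phi>))"

lemma norm_sq_split: "(norm u)\<^sup>2 = inner (fst u) (fst u) + inner (snd u) (snd u)"
  for u :: "'h \<times> 'k"
  by (simp add: power2_norm_eq_inner inner_prod_def)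

lemma B_bounded_linear: "bounded_linear (B z u)"
  unfolding B_def
  by (intro bounded_linear_add bounded_linear_sub bounded_linear_sum bounded_linear_compose[OF bounded_linear_inner_right]
      bounded_linear_fst bounded_linear_snd bounded_linear_compose[OF bounded_linear_mult_right])

lemma B_add: "B z (u + v) \<phi> = B z u \<phi> + B z v \<phi>"
  by (simp add: B_def inner_simps algebra_simps sum.distrib)

lemma B_diff: "B z (u - v) \<phi> = B z u \<phi> - B z v \<phi>"
  by (simp add: B_def inner_simps algebra_simps sum.distrib sum_subtractf)

lemma B_scale: "B z (c *\<^sub>R u) \<phi> = c * B z u \<phi>"
  by (simp add: B_def inner_simps algebra_simps sum_distrib_left)

lemma B_bound: "\<bar>B z u \<phi>\<bar> \<le> (1 + \<bar>z\<bar> + (\<Sum>i<N. (norm (e i))\<^sup>2)) * norm u * norm \<phi>"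
proof -
  have n: "norm (fst u) \<le> norm u" "norm (snd u) \<le> norm u" for u :: "'h \<times> 'k"
    by (metis norm_fst_le prod.collapse, metis norm_snd_le prod.collapse)
  have 1: "\<bar>inner (snd u) (snd \<phi>)\<bar> \<le> norm u * norm \<phi>"
    by (rule order_trans[OF Cauchy_Schwarz_ineq2]) (intro mult_mono n; simp)
  have "\<bar>inner (fst u) (fst \<phi>)\<bar> \<le> norm u * norm \<phi>"
    by (rule order_trans[OF Cauchy_Schwarz_ineq2]) (intro mult_mono n; simp)
  then have 2: "\<bar>z * inner (fst u) (fst \<phi>)\<bar> \<le> \<bar>z\<bar> * (norm u * norm \<phi>)"
    by (simp add: abs_mult mult_left_mono)
  have 3: "\<bar>\<Sum>i<N. inner (e i) (fst u) * inner (e i) (fst \<phi>)\<bar> \<le> (\<Sum>i<N. (norm (e i))\<^sup>2 * (norm u * norm \<phi>))"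
  proof (rule order_trans[OF sum_abs sum_mono])
    fix i
    have i: "\<bar>inner (e i) (fst u)\<bar> \<le> norm (e i) * norm u" for u :: "'h \<times> 'k"
      by (rule order_trans[OF Cauchy_Schwarz_ineq2]) (intro mult_mono n; simp)
    have "\<bar>inner (e i) (fst u) * inner (e i) (fst \<phi>)\<bar> \<le> (norm (e i) * norm u) * (norm (e i) * norm \<phi>)"
      unfolding abs_mult by (intro mult_mono i) auto
    then show "\<bar>inner (e i) (fst u) * inner (e i) (fst \<phi>)\<bar> \<le> (norm (e i))\<^sup>2 * (norm u * norm \<phi>)"
      by (simp add: power2_eq_square algebra_simps)
  qed
  have "\<bar>B z u \<phi>\<bar> \<le> norm u * norm \<phi> + \<bar>z\<bar> * (norm u * norm \<phi>) + (\<Sum>i<N. (norm (e i))\<^sup>2 * (norm u * norm \<phi>))"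
    unfolding B_def using 1 2 3 by linarith
  then show ?thesis by (simp add: algebra_simps sum_distrib_right sum_distrib_left)
qed

text \<open>A share \<theta> of the energy q is set aside and the rest is estimated by
  \<open>lower\<close>, so that both components of the norm are controlled.\<close>

lemma B_coercive:
  assumes "z < L"
  obtains c where "c > 0" "\<And>u. u \<in> X \<Longrightarrow> c * (norm u)\<^sup>2 \<le> B z u u"
proof -
  \<comment> \<open>Small enough that giving up the share \<theta> of L costs at most half of the
    gap L - z.\<close>
  define \<theta> where "\<theta> = min (1/2) ((L - z) / (2 * (\<bar>L\<bar> + 1)))"
  have \<theta>: "0 < \<theta>" "\<theta> \<le> 1/2" "\<theta> * L \<le> (L - z) / 2"
  proof -
    show "0 < \<theta>" using assms by (simp add: \<theta>_def)
    show "\<theta> \<le> 1/2" unfolding \<theta>_def by (rule min.cobounded1)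
    have "\<theta> * L \<le> \<theta> * (\<bar>L\<bar> + 1)" using \<open>0 < \<theta>\<close> by (intro mult_left_mono) auto
    also have "\<dots> \<le> (L - z) / (2 * (\<bar>L\<bar> + 1)) * (\<bar>L\<bar> + 1)"
      by (intro mult_right_mono) (auto simp: \<theta>_def)
    also have "\<dots> = (L - z) / 2" by (simp add: field_simps)
    finally show "\<theta> * L \<le> (L - z) / 2" .
  qed
  show ?thesis
  proof (rule that[of "min \<theta> ((L - z) / 2)"])
    show "0 < min \<theta> ((L - z) / 2)" using \<theta> assms by simp
    fix u assume u: "u \<in> X"
    define q m S where "q = inner (snd u) (snd u)" and "m = inner (fst u) (fst u)"
      and "S = (\<Sum>i<N. (inner (e i) (fst u))\<^sup>2)"
    have pos: "q \<ge> 0" "m \<ge> 0" "S \<ge> 0" by (auto simp: q_def m_def S_def sum_nonneg)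
    have low: "L * m \<le> q + S" using lower[OF u] by (simp add: q_def m_def S_def)
    have "(1 - \<theta>) * (L * m) \<le> (1 - \<theta>) * (q + S)" using low \<theta> by (intro mult_left_mono) auto
    moreover have "\<theta> * S \<ge> 0" using \<theta> pos by simp
    moreover have "\<theta> * L * m \<le> (L - z) / 2 * m" using \<theta>(3) pos by (intro mult_right_mono) auto
    ultimately have "\<theta> * q + (L - z) / 2 * m \<le> q + S - z * m" by (simp add: field_simps)
    moreover have "min \<theta> ((L - z) / 2) * q \<le> \<theta> * q" "min \<theta> ((L - z) / 2) * m \<le> (L - z) / 2 * m"
      using mult_right_mono[OF min.cobounded1[of \<theta> "(L - z) / 2"] pos(1)]
        mult_right_mono[OF min.cobounded2[of \<theta> "(L - z) / 2"] pos(2)] by simp_all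
    ultimately have "min \<theta> ((L - z) / 2) * (m + q) \<le> q + S - z * m" by (simp add: distrib_left)
    moreover have "B z u u = q + S - z * m"
      by (simp add: B_def q_def m_def S_def power2_eq_square)
    ultimately show "min \<theta> ((L - z) / 2) * (norm u)\<^sup>2 \<le> B z u u"
      by (simp add: norm_sq_split q_def m_def)
  qed
qed

lemma B_solve:
  assumes "z < L"
  obtains R C where "\<And>g. R g \<in> X" "\<And>g \<phi>. \<phi> \<in> X \<Longrightarrow> B z (R g) \<phi> = inner g (fst \<phi>)"
    "C \<ge> 0" "\<And>g. norm (R g) \<le> C * norm g"
    "\<And>u. u \<in> X \<Longrightarrow> (\<And>\<phi>. \<phi> \<in> X \<Longrightarrow> B z u \<phi> = 0) \<Longrightarrow> u = 0"
proof -
  obtain c where c: "c > 0" "\<And>u. u \<in> X \<Longrightarrow> c * (norm u)\<^sup>2 \<le> B z u u"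
    using B_coercive[OF assms] by blast
  have "\<exists>u\<in>X. \<forall>\<phi>\<in>X. B z u \<phi> = inner g (fst \<phi>)" for g
    by (rule lax_milgram[OF subspace_X closed_X _ B_bounded_linear B_diff B_bound c])
      (intro bounded_linear_compose[OF bounded_linear_inner_right bounded_linear_fst])
  then obtain R where R: "\<And>g. R g \<in> X" "\<And>g \<phi>. \<phi> \<in> X \<Longrightarrow> B z (R g) \<phi> = inner g (fst \<phi>)" by metis
  have "norm (R g) \<le> 1 / c * norm g" for g
  proof -
    have "c * (norm (R g))\<^sup>2 \<le> inner g (fst (R g))" using c(2)[OF R(1)[of g]] R by simp
    also have "\<dots> \<le> norm g * norm (fst (R g))" by (rule norm_cauchy_schwarz)
    also have "\<dots> \<le> norm g * norm (R g)" by (intro mult_left_mono) (metis norm_fst_le prod.collapse, simp)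
    finally have "c * norm (R g) * norm (R g) \<le> norm g * norm (R g)" by (simp add: power2_eq_square)
    then have "norm (R g) = 0 \<or> c * norm (R g) \<le> norm g"
      by (metis mult_right_le_imp_le norm_ge_zero order_le_less)
    then show ?thesis using c(1) by (auto simp: field_simps)
  qed
  moreover have "u = 0" if "u \<in> X" "\<And>\<phi>. \<phi> \<in> X \<Longrightarrow> B z u \<phi> = 0" for u
  proof -
    have "c * (norm u)\<^sup>2 \<le> 0" using c(2)[OF that(1)] that by simp
    then show "u = 0" using c(1) by (simp add: mult_le_0_iff)
  qed
  ultimately show ?thesis using that[of R "1 / c"] R c(1) by simp
qed

text \<open>Test with u itself. An eigenvector is thus detected by its first component, the
  function.\<close>

lemma sol_zero_snd: "sol z 0 u \<Longrightarrow> fst u = 0 \<Longrightarrow> u = 0"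
  unfolding sol_def by (metis fst_conv inner_eq_zero_iff inner_zero_left mult_zero_right diff_zero
      prod_eqI snd_conv zero_prod_def)

text \<open>A homogeneous solution u satisfies the perturbed equation whose right side is the sum of
  the vectors inner (e i) (fst u) times e i. That equation is uniquely solvable, so the solutions
  belonging to the e i span the eigenspace.\<close>

lemma eigenspace_finite:
  assumes "z < L"
  shows "\<exists>r. \<forall>u. sol z 0 u \<longrightarrow> u = (\<Sum>i<N. inner (e i) (fst u) *\<^sub>R r i)"
proof -
  obtain R C where R: "\<And>g. R g \<in> X" "\<And>g \<phi>. \<phi> \<in> X \<Longrightarrow> B z (R g) \<phi> = inner g (fst \<phi>)"
    "\<And>u. u \<in> X \<Longrightarrow> (\<And>\<phi>. \<phi> \<in> X \<Longrightarrow> B z u \<phi> = 0) \<Longrightarrow> u = 0"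
    using B_solve[OF assms] by metis
  have B_sum: "B z (\<Sum>i<n. c i *\<^sub>R v i) \<phi> = (\<Sum>i<n. c i * B z (v i) \<phi>)" for n :: nat and c v \<phi>
    by (induction n) (simp_all add: B_add B_scale, simp add: B_def)
  have "u = (\<Sum>i<N. inner (e i) (fst u) *\<^sub>R R (e i))" if u: "sol z 0 u" for u
  proof -
    have uX: "u \<in> X" using u by (simp add: sol_def)
    have "u - (\<Sum>i<N. inner (e i) (fst u) *\<^sub>R R (e i)) = 0"
    proof (rule R(3))
      show "u - (\<Sum>i<N. inner (e i) (fst u) *\<^sub>R R (e i)) \<in> X"
        by (intro subspace_diff[OF subspace_X] uX subspace_sum[OF subspace_X] subspace_scale[OF subspace_X] R(1))
      fix \<phi> assume p: "\<phi> \<in> X"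
      have "inner (snd u) (snd \<phi>) - z * inner (fst u) (fst \<phi>) = 0" using u p by (simp add: sol_def)
      then show "B z (u - (\<Sum>i<N. inner (e i) (fst u) *\<^sub>R R (e i))) \<phi> = 0"
        unfolding B_diff B_sum using p by (simp add: R(2)) (simp add: B_def)
    qed
    then show ?thesis by simp
  qed
  then show ?thesis by (intro exI[of _ "\<lambda>i. R (e i)"] allI impI)
qed

text \<open>Let r i solve the perturbed equation for e i, and let S u be u minus the sum of inner (e
  i) (fst u) times r i. The unperturbed equation then reads S u = R g. S maps the finite dimensional
  span V of the r i into itself and is injective there, hence onto; preimages of the r i give the
  solution explicitly, together with its bound.\<close>

theorem fredholm_alternative:
  assumes "z < L" and inj: "\<And>u. sol z 0 u \<Longrightarrow> fst u = 0"
  shows "(\<forall>g. \<exists>u. sol z g u) \<and> (\<exists>C. \<forall>g u. sol z g u \<longrightarrow> norm (fst u) \<le> C * norm g)"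
proof -
  obtain R C where R: "\<And>g. R g \<in> X" "\<And>g \<phi>. \<phi> \<in> X \<Longrightarrow> B z (R g) \<phi> = inner g (fst \<phi>)"
    "C \<ge> 0" "\<And>g. norm (R g) \<le> C * norm g"
    "\<And>u. u \<in> X \<Longrightarrow> (\<And>\<phi>. \<phi> \<in> X \<Longrightarrow> B z u \<phi> = 0) \<Longrightarrow> u = 0"
    using B_solve[OF assms(1)] by metis
  have B_sum: "B z (\<Sum>i<n. c i *\<^sub>R v i) \<phi> = (\<Sum>i<n. c i * B z (v i) \<phi>)" for n :: nat and c v \<phi>
    by (induction n) (simp_all add: B_add B_scale, simp add: B_def)
  define r where "r i = R (e i)" for i
  define S where "S u = u - (\<Sum>i<N. inner (e i) (fst u) *\<^sub>R r i)" for u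
  have linS: "linear S"
    by (rule linearI)
      (simp_all add: S_def inner_simps scaleR_add_left sum.distrib scaleR_sum_right algebra_simps)
  have SX: "S u \<in> X" if "u \<in> X" for u
    unfolding S_def r_def
    by (intro subspace_diff[OF subspace_X] that subspace_sum[OF subspace_X] subspace_scale[OF subspace_X] R(1))
  have BS: "B z (S u) \<phi> = inner (snd u) (snd \<phi>) - z * inner (fst u) (fst \<phi>)" if "\<phi> \<in> X" for u \<phi>
    unfolding S_def B_diff B_sum using that by (simp add: R(2) r_def) (simp add: B_def)
  have sol_iff: "sol z g u \<longleftrightarrow> u \<in> X \<and> S u = R g" for g u
  proof
    assume u: "sol z g u"
    then have uX: "u \<in> X" by (simp add: sol_def)
    have "S u - R g = 0"
      by (rule R(5)) (use u uX in \<open>auto simp: B_diff BS R(2) sol_def intro!: subspace_diff[OF subspace_X] SX R(1)\<close>)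
    with uX show "u \<in> X \<and> S u = R g" by simp
  next
    assume "u \<in> X \<and> S u = R g"
    then show "sol z g u" unfolding sol_def using BS R(2) by metis
  qed
  have R0: "R 0 = 0" by (rule R(5)[OF R(1)]) (simp add: R(2))
  have injS: "u = 0" if "u \<in> X" "S u = 0" for u
    using that sol_iff[of 0 u] inj[of u] sol_zero_snd[of z u] R0 by auto
  define V where "V = span (r ` {..<N})"
  have VX: "V \<subseteq> X" unfolding V_def
    by (rule span_minimal) (auto simp: r_def R(1) subspace_X)
  have SV: "S u \<in> V" if "u \<in> V" for u
    unfolding S_def using that unfolding V_def
    by (intro span_diff span_sum span_scale) (auto intro: span_base)
  \<comment> \<open>Surjectivity of S on V by counting: S carries a basis of V to an independent set
    of the same size, and V contains no larger one.\<close>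
  obtain b where b: "b \<subseteq> V" "independent b" "V \<subseteq> span b"
    using maximal_independent_subset[of V] by blast
  have bV: "span b = V" using b by (metis V_def span_mono span_span subset_antisym)
  have bfin: "finite b"
    using independent_span_bound[of "r ` {..<N}" b] b unfolding V_def by auto
  have injb: "inj_on S (span b)"
    unfolding bV
  proof (rule inj_onI)
    fix x y assume xy: "x \<in> V" "y \<in> V" "S x = S y"
    have "x - y \<in> X" using xy VX subspace_X by (auto intro: subspace_diff)
    moreover have "S (x - y) = 0" using xy by (simp add: linear_diff[OF linS])
    ultimately show "x = y" using injS[of "x - y"] by simp
  qed
  have indSb: "independent (S ` b)"
    by (rule linear_independent_injective_image[OF linS b(2) injb])
  have cardSb: "card (S ` b) = card b"
    by (rule card_image) (rule inj_on_subset[OF injb], rule span_superset)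
  have surj: "\<exists>s\<in>V. S s = w" if w: "w \<in> V" for w
  proof -
    have "w \<in> span (S ` b)"
    proof (rule ccontr)
      assume n: "w \<notin> span (S ` b)"
      then have "independent (insert w (S ` b))" using indSb by (simp add: independent_insert)
      moreover have "insert w (S ` b) \<subseteq> span b" using w SV b(1) unfolding bV by auto
      ultimately have "card (insert w (S ` b)) \<le> card b"
        using independent_span_bound[OF bfin] by blast
      moreover have "w \<notin> S ` b" using n span_base[of w "S ` b"] by blast
      ultimately show False using bfin cardSb by simp
    qed
    also have "span (S ` b) = S ` V" using linear_span_image[OF linS, of b] bV by simp
    finally show ?thesis by auto
  qed
  have "\<exists>s. \<forall>i<N. s i \<in> V \<and> S (s i) = r i"
  proof -
    have "\<forall>i. \<exists>s. i < N \<longrightarrow> s \<in> V \<and> S s = r i" using surj unfolding V_def by (meson imageI lessThan_iff span_base)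
    then show ?thesis by metis
  qed
  then obtain s where s: "\<And>i. i < N \<Longrightarrow> s i \<in> V" "\<And>i. i < N \<Longrightarrow> S (s i) = r i" by blast
  \<comment> \<open>S (R g) falls short of R g by a combination of the r i, which the s i
    restore.\<close>
  define U where "U g = R g + (\<Sum>i<N. inner (e i) (fst (R g)) *\<^sub>R s i)" for g
  have UX: "U g \<in> X" for g
    unfolding U_def using s(1) VX
    by (intro subspace_add[OF subspace_X] R(1) subspace_sum[OF subspace_X] subspace_scale[OF subspace_X]) auto
  have SU: "S (U g) = R g" for g
  proof -
    have "S (U g) = S (R g) + (\<Sum>i<N. inner (e i) (fst (R g)) *\<^sub>R r i)"
      using s(2) by (simp add: U_def linear_add[OF linS] linear_sum[OF linS] linear_scale[OF linS])
    then show ?thesis by (simp add: S_def)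
  qed
  have bound: "norm (fst u) \<le> (C + (\<Sum>i<N. norm (e i) * C * norm (s i))) * norm g" if "sol z g u" for g u
  proof -
    have u: "u \<in> X" "S u = R g" using that sol_iff by auto
    have "u - U g = 0"
      by (rule injS) (use u UX SU subspace_X in \<open>auto simp: linear_diff[OF linS] intro: subspace_diff\<close>)
    then have uU: "u = U g" by simp
    have nf: "norm (fst (R g)) \<le> C * norm g"
      by (rule order_trans[OF _ R(4)]) (metis norm_fst_le prod.collapse)
    have "norm (fst u) \<le> norm u" by (metis norm_fst_le prod.collapse)
    also have "\<dots> \<le> norm (R g) + (\<Sum>i<N. norm (inner (e i) (fst (R g)) *\<^sub>R s i))"
      unfolding uU U_def by (rule order_trans[OF norm_triangle_ineq]) (intro add_left_mono norm_sum)
    also have "\<dots> \<le> C * norm g + (\<Sum>i<N. norm (e i) * (C * norm g) * norm (s i))"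
    proof (intro add_mono R(4) sum_mono)
      fix i
      have "\<bar>inner (e i) (fst (R g))\<bar> \<le> norm (e i) * (C * norm g)"
        by (rule order_trans[OF Cauchy_Schwarz_ineq2]) (intro mult_left_mono nf; simp)
      then show "norm (inner (e i) (fst (R g)) *\<^sub>R s i) \<le> norm (e i) * (C * norm g) * norm (s i)"
        by (simp add: mult_right_mono)
    qed
    also have "\<dots> = (C + (\<Sum>i<N. norm (e i) * C * norm (s i))) * norm g"
      by (simp add: algebra_simps sum_distrib_left)
    finally show ?thesis .
  qed
  have "sol z g (U g)" for g using sol_iff UX SU by blast
  with bound show ?thesis by (metis (no_types, lifting))
qed

text \<open>Eigenvectors of distinct eigenvalues are orthogonal in the space and in the form, so on
  their span, away from 0, the form is strictly below L times the squared norm. On the kernel of P,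
  whose range has dimension at most N, \<open>lower\<close> gives the opposite inequality. Hence P
  is injective on the span.\<close>

theorem card_eigenvalues_le:
  assumes Z: "finite Z" and eig: "\<And>z. z \<in> Z \<Longrightarrow> z < L \<and> (\<exists>u. sol z 0 u \<and> fst u \<noteq> 0)"
  shows "card Z \<le> N"
proof -
  obtain \<psi> where \<psi>: "\<And>z. z \<in> Z \<Longrightarrow> sol z 0 (\<psi> z)" "\<And>z. z \<in> Z \<Longrightarrow> fst (\<psi> z) \<noteq> 0"
    using eig by metis
  have X\<psi>: "\<psi> z \<in> X" if "z \<in> Z" for z using \<psi>(1)[OF that] by (simp add: sol_def)
  have q: "inner (snd (\<psi> z)) (snd (\<psi> y)) = z * inner (fst (\<psi> z)) (fst (\<psi> y))" if "z \<in> Z" "y \<in> Z" for z y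
    using \<psi>(1)[OF that(1)] X\<psi>[OF that(2)] by (simp add: sol_def)
  have orth: "inner (fst (\<psi> z)) (fst (\<psi> y)) = 0" if "z \<in> Z" "y \<in> Z" "z \<noteq> y" for z y
    using q[OF that(1,2)] q[OF that(2,1)] that(3) by (simp add: inner_commute)
  define u where "u a = (\<Sum>z\<in>Z. a z *\<^sub>R \<psi> z)" for a
  have uX: "u a \<in> X" for a
    unfolding u_def by (intro subspace_sum[OF subspace_X] subspace_scale[OF subspace_X] X\<psi>)
  have m: "inner (fst (u a)) (fst (u a)) = (\<Sum>z\<in>Z. (a z)\<^sup>2 * inner (fst (\<psi> z)) (fst (\<psi> z)))" for a
  proof -
    have "inner (fst (u a)) (fst (u a)) = (\<Sum>z\<in>Z. \<Sum>y\<in>Z. a z * a y * inner (fst (\<psi> z)) (fst (\<psi> y)))"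
      by (simp add: u_def fst_sum inner_sum_left inner_sum_right sum_distrib_left mult.assoc mult.left_commute inner_commute)
    also have "\<dots> = (\<Sum>z\<in>Z. \<Sum>y\<in>Z. if y = z then (a z)\<^sup>2 * inner (fst (\<psi> z)) (fst (\<psi> z)) else 0)"
      by (intro sum.cong refl) (auto simp: orth power2_eq_square)
    finally show ?thesis using Z by simp
  qed
  have qq: "inner (snd (u a)) (snd (u a)) = (\<Sum>z\<in>Z. (a z)\<^sup>2 * (z * inner (fst (\<psi> z)) (fst (\<psi> z))))" for a
  proof -
    have "inner (snd (u a)) (snd (u a)) = (\<Sum>z\<in>Z. \<Sum>y\<in>Z. a z * a y * inner (snd (\<psi> z)) (snd (\<psi> y)))"
      by (simp add: u_def snd_sum inner_sum_left inner_sum_right sum_distrib_left mult.assoc mult.left_commute inner_commute)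
    also have "\<dots> = (\<Sum>z\<in>Z. \<Sum>y\<in>Z. if y = z then (a z)\<^sup>2 * (z * inner (fst (\<psi> z)) (fst (\<psi> z))) else 0)"
      by (intro sum.cong refl) (auto simp: orth q power2_eq_square)
    finally show ?thesis using Z by simp
  qed
  define P where "P u = (\<Sum>i<N. inner (e i) (fst u) *\<^sub>R e i)" for u :: "'h \<times> 'k"
  have linP: "linear P"
    by (rule linearI) (simp_all add: P_def inner_simps scaleR_add_left sum.distrib scaleR_sum_right)
  have a0: "a z = 0" if P0: "P (u a) = 0" and z: "z \<in> Z" for a z
  proof -
    have "(\<Sum>i<N. (inner (e i) (fst (u a)))\<^sup>2) = inner (P (u a)) (fst (u a))"
      by (simp add: P_def inner_sum_left power2_eq_square)
    then have "L * inner (fst (u a)) (fst (u a)) \<le> inner (snd (u a)) (snd (u a))"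
      using lower[OF uX[of a]] P0 by simp
    then have "(\<Sum>z\<in>Z. (a z)\<^sup>2 * ((L - z) * inner (fst (\<psi> z)) (fst (\<psi> z)))) \<le> 0"
      unfolding m qq by (simp add: algebra_simps sum_distrib_left sum_subtractf)
    moreover have nn: "(a z)\<^sup>2 * ((L - z) * inner (fst (\<psi> z)) (fst (\<psi> z))) \<ge> 0" if "z \<in> Z" for z
      using eig[OF that] by simp
    ultimately have "(\<Sum>z\<in>Z. (a z)\<^sup>2 * ((L - z) * inner (fst (\<psi> z)) (fst (\<psi> z)))) = 0"
      by (meson antisym sum_nonneg)
    then have "(a z)\<^sup>2 * ((L - z) * inner (fst (\<psi> z)) (fst (\<psi> z))) = 0"
      using nn z Z by (simp add: sum_nonneg_eq_0_iff)
    then show "a z = 0" using eig[OF z] \<psi>(2)[OF z] by auto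
  qed
  have inj\<psi>: "inj_on \<psi> Z"
    by (rule inj_onI) (metis \<psi>(2) inner_eq_zero_iff orth)
  have span: "\<exists>a. v = u a" if "v \<in> span (\<psi> ` Z)" for v
  proof -
    have "v \<in> range (\<lambda>c. \<Sum>w\<in>\<psi> ` Z. c w *\<^sub>R w)"
      using that span_finite[of "\<psi> ` Z"] Z by simp
    then obtain c where "v = (\<Sum>w\<in>\<psi> ` Z. c w *\<^sub>R w)" by blast
    then have "v = u (\<lambda>z. c (\<psi> z))" by (simp add: u_def sum.reindex[OF inj\<psi>])
    then show ?thesis by blast
  qed
  have ind: "independent (\<psi> ` Z)"
  proof (rule independent_if_scalars_zero)
    fix c x assume *: "(\<Sum>w\<in>\<psi> ` Z. c w *\<^sub>R w) = 0" and x: "x \<in> \<psi> ` Z"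
    have "u (\<lambda>z. c (\<psi> z)) = 0" using * by (simp add: u_def sum.reindex[OF inj\<psi>])
    then have "P (u (\<lambda>z. c (\<psi> z))) = 0" by (simp add: P_def)
    then show "c x = 0" using a0[of "\<lambda>z. c (\<psi> z)"] x by auto
  qed (use Z in simp)
  have injP: "inj_on P (span (\<psi> ` Z))"
  proof (rule inj_onI)
    fix x y assume xy: "x \<in> span (\<psi> ` Z)" "y \<in> span (\<psi> ` Z)" "P x = P y"
    then obtain a where a: "x - y = u a" using span span_diff by blast
    have "P (u a) = 0" using xy(3) unfolding a[symmetric] by (simp add: linear_diff[OF linP])
    from a0[OF this] have "u a = 0" unfolding u_def by (intro sum.neutral) auto
    with a show "x = y" by simp
  qed
  have "card Z = card (P ` \<psi> ` Z)"
    using card_image[OF inj\<psi>] card_image[OF inj_on_subset[OF injP span_superset]] by simp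
  also have "\<dots> \<le> card (e ` {..<N})"
  proof -
    have "P ` \<psi> ` Z \<subseteq> span (e ` {..<N})"
      unfolding P_def by (intro image_subsetI span_sum span_scale span_base) auto
    then show ?thesis
      using independent_span_bound[OF _ linear_independent_injective_image[OF linP ind injP]] by simp
  qed
  also have "\<dots> \<le> N" using card_image_le[of "{..<N}" e] by simp
  finally show ?thesis .
qed

end

text \<open>J1 and J2 stand for multiplication by the imaginary unit. Testing with \<eta> u +
  \<sigma> J u adds \<eta> (q - x m), from the part along u, and |y| m, from the part along J u,
  where q and m are the squared norms of the two components. For small \<eta> the sum is
  coercive.\<close>

theorem nonreal_resolvent:
  fixes X :: "('h::{real_inner,complete_space} \<times> 'k::{real_inner,complete_space}) set"
    and x y :: real
  assumes X: "subspace X" "closed X"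
    and J1: "bounded_linear J1" "\<And>x y. inner (J1 x) (J1 y) = inner x y" "\<And>x. inner (J1 x) x = 0"
      "\<And>x. J1 (J1 x) = - x"
    and J2: "bounded_linear J2" "\<And>x y. inner (J2 x) (J2 y) = inner x y" "\<And>x. inner (J2 x) x = 0"
      "\<And>x. J2 (J2 x) = - x"
    and JX: "\<And>u. u \<in> X \<Longrightarrow> (J1 (fst u), J2 (snd u)) \<in> X"
    and y: "y \<noteq> 0"
  defines "sol \<equiv> (\<lambda>g u. u \<in> X \<and> (\<forall>\<phi>\<in>X. inner (snd u) (snd \<phi>) - x * inner (fst u) (fst \<phi>)
      - y * inner (J1 (fst u)) (fst \<phi>) = inner g (fst \<phi>)))"
  shows "(\<forall>g. \<exists>u. sol g u) \<and> (\<exists>C. \<forall>g u. sol g u \<longrightarrow> norm (fst u) \<le> C * norm g)"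
proof -
  \<comment> \<open>So small that \<eta> x is at most |y| / 2; the sign \<sigma> below turns -
    \<sigma> y into |y|.\<close>
  define \<eta> where "\<eta> = \<bar>y\<bar> / (2 * (\<bar>x\<bar> + 1))"
  define \<sigma> where "\<sigma> = - sgn y"
  interpret J1: bounded_linear J1 by (rule J1)
  interpret J2: bounded_linear J2 by (rule J2)
  define J where "J u = (J1 (fst u), J2 (snd u))" for u :: "'h \<times> 'k"
  define b where "b u \<phi> = inner (snd u) (snd \<phi>) - x * inner (fst u) (fst \<phi>) - y * inner (J1 (fst u)) (fst \<phi>)" for u \<phi> :: "'h \<times> 'k"
  define W where "W \<phi> = \<eta> *\<^sub>R \<phi> + \<sigma> *\<^sub>R J \<phi>" for \<phi>
  have sol: "sol g u \<longleftrightarrow> u \<in> X \<and> (\<forall>\<phi>\<in>X. b u \<phi> = inner g (fst \<phi>))" for g u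
    by (simp add: sol_def b_def)
  have n: "norm (fst u) \<le> norm u" "norm (snd u) \<le> norm u" for u :: "'h \<times> 'k"
    by (metis norm_fst_le prod.collapse, metis norm_snd_le prod.collapse)
  have J1n: "norm (J1 v) = norm v" for v by (simp add: norm_eq_sqrt_inner J1(2))
  have J2n: "norm (J2 v) = norm v" for v by (simp add: norm_eq_sqrt_inner J2(2))
  have Jn: "norm (J u) = norm u" for u by (simp add: J_def norm_prod_def J1n J2n)
  have \<eta>: "\<eta> > 0" "\<eta> * x \<le> \<bar>y\<bar> / 2"
  proof -
    show "\<eta> > 0" using y by (simp add: \<eta>_def)
    have "\<eta> * x \<le> \<eta> * (\<bar>x\<bar> + 1)" using \<open>\<eta> > 0\<close> by (intro mult_left_mono) auto
    also have "\<dots> = \<bar>y\<bar> / 2" by (simp add: \<eta>_def field_simps)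
    finally show "\<eta> * x \<le> \<bar>y\<bar> / 2" .
  qed
  have \<sigma>: "\<bar>\<sigma>\<bar> = 1" "\<sigma>\<^sup>2 = 1" "\<sigma> * y = - \<bar>y\<bar>" using y by (auto simp: \<sigma>_def sgn_if)
  have JblJ: "bounded_linear J"
    unfolding J_def by (intro bounded_linear_Pair bounded_linear_compose[OF J1(1)]
        bounded_linear_compose[OF J2(1)] bounded_linear_fst bounded_linear_snd)
  have Wbl: "bounded_linear W"
    unfolding W_def by (intro bounded_linear_add bounded_linear_scaleR_right bounded_linear_ident
        bounded_linear_compose[OF bounded_linear_scaleR_right JblJ])
  have WX: "W \<phi> \<in> X" if "\<phi> \<in> X" for \<phi>
    unfolding W_def J_def by (intro subspace_add[OF X(1)] subspace_scale[OF X(1)] that JX)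
  have Wn: "norm (W \<phi>) \<le> (\<eta> + 1) * norm \<phi>" for \<phi>
    unfolding W_def by (rule order_trans[OF norm_triangle_ineq]) (use \<eta>(1) \<sigma>(1) in \<open>simp add: Jn distrib_right\<close>)
  have bbl: "bounded_linear (b u)" for u
    unfolding b_def
    by (intro bounded_linear_sub bounded_linear_compose[OF bounded_linear_inner_right]
      bounded_linear_fst bounded_linear_snd bounded_linear_compose[OF bounded_linear_mult_right])
  have bb: "\<bar>b u \<phi>\<bar> \<le> (1 + \<bar>x\<bar> + \<bar>y\<bar>) * norm u * norm \<phi>" for u \<phi>
  proof -
    have 1: "\<bar>inner (snd u) (snd \<phi>)\<bar> \<le> norm u * norm \<phi>"
      by (rule order_trans[OF Cauchy_Schwarz_ineq2]) (intro mult_mono n; simp)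
    have 2: "\<bar>x * inner (fst u) (fst \<phi>)\<bar> \<le> \<bar>x\<bar> * (norm u * norm \<phi>)" unfolding abs_mult
      by (rule mult_left_mono, rule order_trans[OF Cauchy_Schwarz_ineq2], intro mult_mono n) auto
    have 3: "\<bar>y * inner (J1 (fst u)) (fst \<phi>)\<bar> \<le> \<bar>y\<bar> * (norm u * norm \<phi>)" unfolding abs_mult
      by (rule mult_left_mono, rule order_trans[OF Cauchy_Schwarz_ineq2], unfold J1n, intro mult_mono n) auto
    have "\<bar>b u \<phi>\<bar> \<le> norm u * norm \<phi> + \<bar>x\<bar> * (norm u * norm \<phi>) + \<bar>y\<bar> * (norm u * norm \<phi>)"
      unfolding b_def using 1 2 3 by linarith
    then show ?thesis by (simp add: algebra_simps)
  qed
  define K where "K = (1 + \<bar>x\<bar> + \<bar>y\<bar>) * (\<eta> + 1)"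
  have Bb: "\<bar>b u (W \<phi>)\<bar> \<le> K * norm u * norm \<phi>" for u \<phi>
  proof -
    have "\<bar>b u (W \<phi>)\<bar> \<le> (1 + \<bar>x\<bar> + \<bar>y\<bar>) * norm u * norm (W \<phi>)" by (rule bb)
    also have "\<dots> \<le> (1 + \<bar>x\<bar> + \<bar>y\<bar>) * norm u * ((\<eta> + 1) * norm \<phi>)" by (intro mult_left_mono Wn) auto
    finally show ?thesis by (simp add: K_def algebra_simps)
  qed
  define c where "c = min \<eta> (\<bar>y\<bar> / 2)"
  have c: "c > 0" using \<eta> y by (simp add: c_def)
  have coer: "c * (norm u)\<^sup>2 \<le> b u (W u)" for u
  proof -
    define q m where "q = inner (snd u) (snd u)" and "m = inner (fst u) (fst u)"
    have pos: "q \<ge> 0" "m \<ge> 0" by (auto simp: q_def m_def)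
    have "b u (W u) = \<eta> * (q - x * m) - \<sigma> * y * m"
      using J1(3)[of "fst u"] J2(3)[of "snd u"] J1(2)[of "fst u" "fst u"]
      by (simp add: b_def W_def J_def q_def m_def inner_simps inner_commute algebra_simps)
    also have "\<dots> = \<eta> * q - \<eta> * x * m + \<bar>y\<bar> * m" unfolding \<sigma>(3) by (simp add: algebra_simps)
    also have "\<dots> \<ge> \<eta> * q + \<bar>y\<bar> / 2 * m"
      using mult_right_mono[OF \<eta>(2) pos(2)] by (simp add: algebra_simps)
    finally have "b u (W u) \<ge> \<eta> * q + \<bar>y\<bar> / 2 * m" .
    moreover have "c * q \<le> \<eta> * q" "c * m \<le> \<bar>y\<bar> / 2 * m"
      using mult_right_mono[OF min.cobounded1[of \<eta> "\<bar>y\<bar> / 2"] pos(1)]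
        mult_right_mono[OF min.cobounded2[of \<eta> "\<bar>y\<bar> / 2"] pos(2)] by (simp_all add: c_def)
    ultimately have "c * (m + q) \<le> b u (W u)" by (simp add: distrib_left)
    then show ?thesis by (simp add: power2_norm_eq_inner inner_prod_def q_def m_def)
  qed
  have bdiff: "b (u - v) \<phi> = b u \<phi> - b v \<phi>" for u v \<phi>
    by (simp add: b_def J1.diff inner_simps algebra_simps)
  have ex: "\<exists>u. sol g u" for g
  proof -
    have "\<exists>u\<in>X. \<forall>\<phi>\<in>X. b u (W \<phi>) = inner g (fst (W \<phi>))"
    proof (rule lax_milgram[OF X _ _ _ Bb c coer])
      show "bounded_linear (\<lambda>\<phi>. inner g (fst (W \<phi>)))"
        by (intro bounded_linear_compose[OF bounded_linear_inner_right] bounded_linear_compose[OF bounded_linear_fst Wbl])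
      show "bounded_linear (\<lambda>\<phi>. b u (W \<phi>))" for u by (rule bounded_linear_compose[OF bbl Wbl])
      show "b (u - v) (W \<phi>) = b u (W \<phi>) - b v (W \<phi>)" for u v \<phi> by (rule bdiff)
    qed
    then obtain u where u: "u \<in> X" "\<And>\<phi>. \<phi> \<in> X \<Longrightarrow> b u (W \<phi>) = inner g (fst (W \<phi>))" by blast
    have "b u \<phi> = inner g (fst \<phi>)" if p: "\<phi> \<in> X" for \<phi>
    proof -
      \<comment> \<open>The preimage of \<phi> under W: since J J = -1, the product of \<eta> +
        \<sigma> J and \<eta> - \<sigma> J is \<eta>^2 + 1. Hence testing with all W \<phi> is the
        same as testing with all \<phi>.\<close>
      define p where "p = (1 / (\<eta>\<^sup>2 + 1)) *\<^sub>R (\<eta> *\<^sub>R \<phi> - \<sigma> *\<^sub>R J \<phi>)"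
      have "p \<in> X" unfolding p_def J_def by (intro subspace_diff[OF X(1)] subspace_scale[OF X(1)] p JX)
      moreover have "W p = \<phi>"
      proof -
        interpret W: bounded_linear W by (rule Wbl)
        interpret J: bounded_linear J by (rule JblJ)
        have JJ: "J (J \<phi>) = - \<phi>" by (simp add: J_def J1(4) J2(4) prod_eq_iff)
        have "W (\<eta> *\<^sub>R \<phi> - \<sigma> *\<^sub>R J \<phi>) = (\<eta> * \<eta>) *\<^sub>R \<phi> + (\<sigma> * \<sigma>) *\<^sub>R \<phi>"
          by (simp add: W_def J.diff J.scaleR JJ algebra_simps)
        also have "\<dots> = (\<eta>\<^sup>2 + 1) *\<^sub>R \<phi>" using \<sigma>(2) by (simp add: power2_eq_square scaleR_add_left)
        finally have "W p = (1 / (\<eta>\<^sup>2 + 1)) *\<^sub>R ((\<eta>\<^sup>2 + 1) *\<^sub>R \<phi>)" by (simp only: p_def W.scaleR)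
        moreover have "\<eta>\<^sup>2 + 1 \<noteq> 0" using zero_le_power2[of \<eta>] by linarith
        ultimately show ?thesis by simp
      qed
      ultimately show ?thesis using u(2)[of p] by simp
    qed
    with u(1) show ?thesis using sol by blast
  qed
  have "norm (fst u) \<le> (\<eta> + 1) / c * norm g" if "sol g u" for g u
  proof -
    have u: "u \<in> X" "\<And>\<phi>. \<phi> \<in> X \<Longrightarrow> b u \<phi> = inner g (fst \<phi>)" using that sol by auto
    have "c * (norm u)\<^sup>2 \<le> inner g (fst (W u))" using coer[of u] u(2)[OF WX[OF u(1)]] by simp
    also have "\<dots> \<le> norm g * norm (fst (W u))" by (rule norm_cauchy_schwarz)
    also have "\<dots> \<le> norm g * ((\<eta> + 1) * norm u)"
      by (intro mult_left_mono order_trans[OF n(1) Wn]) simp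
    finally have "(c * norm u) * norm u \<le> ((\<eta> + 1) * norm g) * norm u"
      by (simp add: power2_eq_square algebra_simps)
    then have "norm u = 0 \<or> c * norm u \<le> (\<eta> + 1) * norm g"
      by (metis mult_right_le_imp_le norm_ge_zero order_le_less)
    then have "norm u \<le> (\<eta> + 1) / c * norm g" using c \<eta>(1) by (auto simp: field_simps)
    with n(1)[of u] show ?thesis by linarith
  qed
  with ex show ?thesis by blast
qed

section \<open>Principal solutions of second order equations\<close>

text \<open>A shooting problem for v'' = Q v: the data at the left end fix the solution, and v 1 = 0
  is the condition for an eigenfunction. Derivatives at the end points are one-sided.\<close>

definition ode_sol :: "(real \<Rightarrow> real) \<Rightarrow> (real \<Rightarrow> real) \<Rightarrow> (real \<Rightarrow> real) \<Rightarrow> bool" where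
  "ode_sol Q v v' \<longleftrightarrow> (\<forall>t\<in>{-1..1}. (v has_real_derivative v' t) (at t within {-1..1}) \<and>
      (v' has_real_derivative Q t * v t) (at t within {-1..1})) \<and> v (-1) = 0 \<and> v' (-1) = 1"

lemma ode_solD:
  assumes "ode_sol Q v v'"
  shows "t \<in> {-1..1} \<Longrightarrow> (v has_real_derivative v' t) (at t within {-1..1})"
    "t \<in> {-1..1} \<Longrightarrow> (v' has_real_derivative Q t * v t) (at t within {-1..1})"
    "v (-1) = 0" "v' (-1) = 1" "continuous_on {-1..1} v" "continuous_on {-1..1} v'"
  using assms unfolding ode_sol_def by (auto intro!: DERIV_continuous_on)

text \<open>Not the iterates but their increments: the solution is the sum of all first components,
  its derivative the sum of all second components.\<close>

fun picard :: "(real \<Rightarrow> real) \<Rightarrow> nat \<Rightarrow> (real \<Rightarrow> real) \<times> (real \<Rightarrow> real)" where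
  "picard Q 0 = ((\<lambda>t. t + 1), (\<lambda>t. 1))"
| "picard Q (Suc n) =
    ((\<lambda>t. integral {-1..t} (\<lambda>x. integral {-1..x} (\<lambda>y. Q y * fst (picard Q n) y))),
     (\<lambda>t. integral {-1..t} (\<lambda>y. Q y * fst (picard Q n) y)))"

lemma picard_deriv:
  assumes Q: "continuous_on {-1..1} Q"
  shows "continuous_on {-1..1} (fst (picard Q n)) \<and> continuous_on {-1..1} (snd (picard Q n)) \<and>
    (\<forall>t\<in>{-1..1}. (fst (picard Q n) has_real_derivative snd (picard Q n) t) (at t within {-1..1})) \<and>
    (\<forall>t\<in>{-1..1}. (snd (picard Q (Suc n)) has_real_derivative Q t * fst (picard Q n) t) (at t within {-1..1}))"
proof (induction n)
  case 0
  have "continuous_on {-1..1} (\<lambda>y. Q y * (y + 1))" by (intro continuous_intros Q)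
  from integral_has_real_derivative[OF this] show ?case
    by (auto intro!: continuous_intros derivative_eq_intros)
next
  case (Suc n)
  then have 1: "continuous_on {-1..1} (\<lambda>y. Q y * fst (picard Q n) y)"
    by (intro continuous_intros Q) auto
  note d1 = integral_has_real_derivative[OF this]
  then have 2: "continuous_on {-1..1} (\<lambda>t. integral {-1..t} (\<lambda>y. Q y * fst (picard Q n) y))"
    by (intro DERIV_continuous_on)
  note d2 = integral_has_real_derivative[OF this]
  then have 3: "continuous_on {-1..1} (fst (picard Q (Suc n)))"
    using DERIV_continuous_on[OF d2] by simp
  then have 4: "continuous_on {-1..1} (\<lambda>y. Q y * fst (picard Q (Suc n)) y)"
    by (intro continuous_intros Q)
  show ?case using 2 3 d2 integral_has_real_derivative[OF 4] by simp
qed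

text \<open>One bound serves both components. A step gains L from Q and (t + 1) / (n + 1) from the
  inner integral; of the outer integral only the length 2 of the interval is kept, whence the factor
  2 * L.\<close>

lemma picard_bound:
  assumes Q: "continuous_on {-1..1} Q" and L: "\<And>t. t \<in> {-1..1} \<Longrightarrow> \<bar>Q t\<bar> \<le> L"
    and t: "t \<in> {-1..1}"
  shows "\<bar>fst (picard Q n) t\<bar> \<le> 2 * (2 * L)^n * (t + 1)^n / fact n \<and>
    \<bar>snd (picard Q n) t\<bar> \<le> 2 * (2 * L)^n * (t + 1)^n / fact n"
  using t
proof (induction n arbitrary: t)
  case (Suc n)
  have L0: "L \<ge> 0" using L[of 0] by simp
  note p = picard_deriv[OF Q]
  define c where "c x = 2 * (2 * L)^Suc n * (x + 1)^Suc n / fact (Suc n)" for x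
  have b: "\<bar>snd (picard Q (Suc n)) s\<bar> \<le> c s / 2" if s: "s \<in> {-1..1}" for s
  proof -
    have "((\<lambda>x. L * (2 * (2 * L)^n * (x + 1)^n / fact n)) has_integral (c s / 2 - c (-1) / 2)) {-1..s}"
    proof (rule fundamental_theorem_of_calculus)
      fix x assume "x \<in> {-1..s}"
      define k where "k = (2 * L)^Suc n / fact (Suc n)"
      have k: "k * real (Suc n) = L * 2 * (2 * L)^n / fact n"
        by (simp add: k_def fact_Suc[of n] del: of_nat_Suc)
      have "((\<lambda>x. k * (x + 1)^Suc n) has_real_derivative k * (real (Suc n) * (x + 1)^n)) (at x within {-1..s})"
        by (rule derivative_eq_intros refl)+ simp
      moreover have "(\<lambda>x. c x / 2) = (\<lambda>x. k * (x + 1)^Suc n)" 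
        by (simp add: c_def k_def field_simps del: power_Suc fact_Suc)
      moreover have "k * (real (Suc n) * (x + 1)^n) = L * (2 * (2 * L)^n * (x + 1)^n / fact n)"
        unfolding mult.assoc[symmetric] k by simp
      ultimately have "((\<lambda>x. c x / 2) has_real_derivative L * (2 * (2 * L)^n * (x + 1)^n / fact n)) (at x within {-1..s})"
        by simp
      then show "((\<lambda>x. c x / 2) has_vector_derivative L * (2 * (2 * L)^n * (x + 1)^n / fact n)) (at x within {-1..s})"
        by (simp add: has_real_derivative_iff_has_vector_derivative)
    qed (use s in simp)
    then have int: "((\<lambda>x. L * (2 * (2 * L)^n * (x + 1)^n / fact n)) has_integral c s / 2) {-1..s}"
      by (simp add: c_def)
    have "continuous_on {-1..s} (\<lambda>y. Q y * fst (picard Q n) y)"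
      by (rule continuous_on_subset[of "{-1..1}"]) (use p s Q in \<open>auto intro!: continuous_intros\<close>)
    then have i: "(\<lambda>y. Q y * fst (picard Q n) y) integrable_on {-1..s}"
      by (rule integrable_continuous_real)
    have "norm (integral {-1..s} (\<lambda>y. Q y * fst (picard Q n) y))
        \<le> integral {-1..s} (\<lambda>x. L * (2 * (2 * L)^n * (x + 1)^n / fact n))"
    proof (rule integral_norm_bound_integral[OF i])
      fix x assume "x \<in> {-1..s}"
      then have x: "x \<in> {-1..1}" using s by auto
      show "norm (Q x * fst (picard Q n) x) \<le> L * (2 * (2 * L)^n * (x + 1)^n / fact n)"
        unfolding real_norm_def abs_mult using Suc.IH[OF x] L[OF x] L0 by (intro mult_mono) auto
    qed (use int in blast)
    then show ?thesis using integral_unique[OF int] by simp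
  qed
  have cmono: "c x \<le> c s" if "-1 \<le> x" "x \<le> s" for x s
    unfolding c_def using that L0 by (intro divide_right_mono mult_left_mono power_mono) auto
  have cpos: "c s \<ge> 0" if "s \<ge> -1" for s unfolding c_def using that L0 by simp
  have cont: "continuous_on {-1..t} (snd (picard Q (Suc n)))"
    by (rule continuous_on_subset[of "{-1..1}"]) (use p[of "Suc n"] Suc.prems in auto)
  have "norm (integral {-1..t} (snd (picard Q (Suc n)))) \<le> c t / 2 * (t - (-1))"
  proof (rule integral_bound[OF _ cont])
    fix x assume x: "x \<in> {-1..t}"
    then show "norm (snd (picard Q (Suc n)) x) \<le> c t / 2"
      using b[of x] cmono[of x t] Suc.prems by auto
  qed (use Suc.prems in simp)
  also have "\<dots> \<le> c t / 2 * 2"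
    using Suc.prems cpos[of t] by (intro mult_left_mono) auto
  finally have "\<bar>fst (picard Q (Suc n)) t\<bar> \<le> c t" by simp
  moreover have "\<bar>snd (picard Q (Suc n)) t\<bar> \<le> c t"
    using b[OF Suc.prems] cpos[of t] Suc.prems by auto
  ultimately show ?case by (simp only: c_def)
qed auto

lemma ode_sol_exists:
  assumes Q: "continuous_on {-1..1} Q"
  shows "\<exists>v v'. ode_sol Q v v'"
proof -
  obtain L where L: "\<And>t. t \<in> {-1..1} \<Longrightarrow> \<bar>Q t\<bar> \<le> L" "L \<ge> 0"
    using compact_imp_bounded[OF compact_continuous_image[OF Q compact_Icc]]
    by (auto simp: bounded_pos image_iff) (metis abs_ge_zero atLeastAtMost_iff less_imp_le order_trans zero_le_one)
  define a where "a n = fst (picard Q n)" for n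
  define b where "b n = snd (picard Q n)" for n
  note p = picard_deriv[OF Q]
  define M where "M n = 2 * ((4 * L)^n / fact n)" for n :: nat
  have bnd: "\<bar>a n t\<bar> \<le> M n" "\<bar>b n t\<bar> \<le> M n" if t: "t \<in> {-1..1}" for n t
  proof -
    have "2 * (2 * L)^n * (t + 1)^n / fact n \<le> 2 * (2 * L)^n * 2^n / fact n"
      using t L(2) by (intro divide_right_mono mult_left_mono power_mono) auto
    also have "(2 * L)^n * 2^n = (4 * L)^n"
      by (subst power_mult_distrib[symmetric]) (simp add: mult.commute)
    then have "2 * (2 * L)^n * 2^n / fact n = M n" by (simp add: M_def mult.assoc)
    finally have "2 * (2 * L)^n * (t + 1)^n / fact n \<le> M n" .
    then show "\<bar>a n t\<bar> \<le> M n" "\<bar>b n t\<bar> \<le> M n"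
      using picard_bound[OF Q L(1) t, of n] by (auto simp: a_def b_def)
  qed
  have sM: "summable M"
    unfolding M_def using summable_exp[of "4 * L"] by (intro summable_mult) (simp add: field_simps)
  \<comment> \<open>The termwise derivative of b: differentiation lowers the index by one and kills
    the constant term at 0, so these functions sum to Q times the sum of the a n.\<close>
  define b' where "b' n t = (if n = 0 then 0 else Q t * a (n - 1) t)" for n t
  have bnd': "norm (b' n t) \<le> (if n = 0 then 0 else L * M (n - 1))" if t: "t \<in> {-1..1}" for n t
    using bnd(1)[OF t, of "n - 1"] L(1)[OF t] L(2) by (auto simp: b'_def abs_mult intro: mult_mono)
  have "summable (\<lambda>n. (if Suc n = 0 then 0 else L * M (Suc n - 1)))" using sM by (simp add: summable_mult)
  then have sM': "summable (\<lambda>n. (if n = 0 then 0 else L * M (n - 1)))" by (subst (asm) summable_Suc_iff)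
  have ub: "uniform_limit {-1..1} (\<lambda>n t. \<Sum>i<n. b i t) (\<lambda>t. \<Sum>i. b i t) sequentially"
    by (rule Weierstrass_m_test[OF _ sM]) (use bnd in auto)
  have ub': "uniform_limit {-1..1} (\<lambda>n t. \<Sum>i<n. b' i t) (\<lambda>t. \<Sum>i. b' i t) sequentially"
    by (rule Weierstrass_m_test[OF bnd' sM'])
  have da: "(a n has_real_derivative b n t) (at t within {-1..1})" if "t \<in> {-1..1}" for n t
    using p[of n] that by (simp add: a_def b_def)
  have db: "(b n has_real_derivative b' n t) (at t within {-1..1})" if t: "t \<in> {-1..1}" for n t
  proof (cases n)
    case 0
    then show ?thesis by (simp add: b_def b'_def)
  next
    case (Suc m)
    then show ?thesis using p[of m] t unfolding b_def b'_def a_def by simp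
  qed
  have sa: "summable (\<lambda>n. a n t)" if "t \<in> {-1..1}" for t
    by (rule summable_comparison_test'[OF sM, of 0]) (use bnd that in auto)
  have sb: "summable (\<lambda>n. b n t)" if "t \<in> {-1..1}" for t
    by (rule summable_comparison_test'[OF sM, of 0]) (use bnd that in auto)
  have "\<exists>v. \<forall>t\<in>{-1..1}. (\<lambda>n. a n t) sums v t \<and> (v has_real_derivative (\<Sum>i. b i t)) (at t within {-1..1})"
    by (rule has_field_derivative_series[OF _ da ub _ sa[of "-1"]]) auto
  then obtain v where v0: "\<forall>t\<in>{-1..1}. (\<lambda>n. a n t) sums v t \<and>
      (v has_real_derivative (\<Sum>i. b i t)) (at t within {-1..1})" by blast
  note v = v0[rule_format]
  have "\<exists>w. \<forall>t\<in>{-1..1}. (\<lambda>n. b n t) sums w t \<and> (w has_real_derivative (\<Sum>i. b' i t)) (at t within {-1..1})"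
    by (rule has_field_derivative_series[OF _ db ub' _ sb[of "-1"]]) auto
  then obtain w where w0: "\<forall>t\<in>{-1..1}. (\<lambda>n. b n t) sums w t \<and>
      (w has_real_derivative (\<Sum>i. b' i t)) (at t within {-1..1})" by blast
  note w = w0[rule_format]
  have wb: "(\<Sum>i. b i t) = w t" if "t \<in> {-1..1}" for t using w[OF that] by (simp add: sums_iff)
  have wv: "(\<Sum>i. b' i t) = Q t * v t" if t: "t \<in> {-1..1}" for t
  proof -
    have "(\<lambda>n. Q t * a n t) sums (Q t * v t)" using v[OF t] by (intro sums_mult) auto
    then have "(\<lambda>n. b' (Suc n) t) sums (Q t * v t)" by (simp add: b'_def)
    then have "(\<lambda>n. b' n t) sums (Q t * v t)" by (subst (asm) sums_Suc_iff) (simp add: b'_def)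
    then show ?thesis by (simp add: sums_iff)
  qed
  have a0: "a n (-1) = 0" for n by (cases n) (simp_all add: a_def)
  have b0: "b n (-1) = (if n = 0 then 1 else 0)" for n by (cases n) (simp_all add: b_def)
  have "ode_sol Q v w"
    unfolding ode_sol_def
  proof (intro conjI ballI)
    fix t :: real assume t: "t \<in> {-1..1}"
    show "(v has_real_derivative w t) (at t within {-1..1})" using v[OF t] wb[OF t] by simp
    show "(w has_real_derivative Q t * v t) (at t within {-1..1})" using w[OF t] wv[OF t] by simp
  next
    show "v (-1) = 0" using v[of "-1"] by (simp add: a0 sums_iff)
    have "(\<lambda>n. b n (-1)) sums 1" unfolding b0 using sums_single[of 0 "\<lambda>_. 1::real"] by simp
    then show "w (-1) = 1" using w[of "-1"] sums_unique2 by fastforce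
  qed
  then show ?thesis by blast
qed

section \<open>Growth, positivity and comparison of solutions\<close>

lemma deriv_nonneg_mono:
  fixes f :: "real \<Rightarrow> real"
  assumes d: "\<And>t. t \<in> {a..b} \<Longrightarrow> (f has_real_derivative f' t) (at t within {a..b})"
    and nn: "\<And>t. t \<in> {a<..<b} \<Longrightarrow> f' t \<ge> 0" and xy: "a \<le> x" "x \<le> y" "y \<le> b"
  shows "f x \<le> f y"
proof (rule DERIV_nonneg_imp_increasing_open[OF xy(2)])
  fix t assume t: "x < t" "t < y"
  then have "(f has_real_derivative f' t) (at t)"
    using d[of t] xy at_within_Icc_at[of a t b] by auto
  moreover have "f' t \<ge> 0" using nn[of t] t xy by simp
  ultimately show "\<exists>y. (f has_real_derivative y) (at t) \<and> 0 \<le> y" by blast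
next
  have "continuous_on {a..b} f" using d by (intro DERIV_continuous_on)
  then show "continuous_on {x..y} f" by (rule continuous_on_subset) (use xy in auto)
qed

text \<open>The function R (t + 1) - wext t * exp (- K (t + 1)) is nondecreasing. Here
  \<open>wext\<close> is a variable; the constant of that name comes later.\<close>

lemma gronwall:
  fixes wext :: "real \<Rightarrow> real"
  assumes d: "\<And>t. t \<in> {-1..1} \<Longrightarrow> (wext has_real_derivative E' t) (at t within {-1..1})"
    and le: "\<And>t. t \<in> {-1..1} \<Longrightarrow> E' t \<le> K * wext t + R" and "K \<ge> 0" "R \<ge> 0" and E0: "wext (-1) \<ge> 0"
    and t: "t \<in> {-1..1}"
  shows "wext t \<le> (wext (-1) + 2 * R) * exp (2 * K)"
proof -
  define F where "F t = R * (t + 1) - wext t * exp (- K * (t + 1))" for t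
  define F' where "F' t = R - (E' t * exp (- K * (t + 1)) - K * wext t * exp (- K * (t + 1)))" for t
  have "F (-1) \<le> F t"
  proof (rule deriv_nonneg_mono[of "-1" 1 F F'])
    fix x :: real assume x: "x \<in> {-1..1}"
    show "(F has_real_derivative F' x) (at x within {-1..1})"
      unfolding F_def F'_def by (rule derivative_eq_intros d[OF x] refl | simp)+
  next
    fix x :: real assume x: "x \<in> {-1<..<1}"
    have "(E' x - K * wext x) * exp (- K * (x + 1)) \<le> R * exp (- K * (x + 1))"
      using le[of x] x by (intro mult_right_mono) auto
    also have "\<dots> \<le> R * 1" using x assms(3,4) by (intro mult_left_mono) auto
    finally show "F' x \<ge> 0" by (simp add: F'_def algebra_simps)
  qed (use t in auto)
  then have "wext t * exp (- K * (t + 1)) \<le> wext (-1) + R * (t + 1)" by (simp add: F_def)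
  also have "\<dots> \<le> wext (-1) + R * 2" using t assms(4) by (intro add_left_mono mult_left_mono) auto
  finally have "wext t * exp (- K * (t + 1)) * exp (K * (t + 1)) \<le> (wext (-1) + R * 2) * exp (K * (t + 1))"
    by (rule mult_right_mono) simp
  then have "wext t \<le> (wext (-1) + R * 2) * exp (K * (t + 1))" by (simp add: mult.assoc exp_add[symmetric])
  also have "\<dots> \<le> (wext (-1) + R * 2) * exp (K * 2)"
    using t assms(3,4) E0 by (intro mult_left_mono) (auto intro: mult_left_mono)
  finally show ?thesis by (simp add: mult.commute)
qed

text \<open>The energy v^2 + v'^2 equals 1 at the left end and decays at most at the exponential
  rate 1 + L.\<close>

lemma ode_sol_nontrivial:
  assumes s: "ode_sol Q v v'" and L: "\<And>t. t \<in> {-1..1} \<Longrightarrow> \<bar>Q t\<bar> \<le> L" and t: "t \<in> {-1..1}"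
  shows "\<not> (v t = 0 \<and> v' t = 0)"
proof
  assume z: "v t = 0 \<and> v' t = 0"
  define wext where "wext x = ((v x)\<^sup>2 + (v' x)\<^sup>2) * exp ((1 + L) * x)" for x
  define E' where "E' x = (2 * v x * v' x + 2 * v' x * (Q x * v x)) * exp ((1 + L) * x)
      + ((v x)\<^sup>2 + (v' x)\<^sup>2) * ((1 + L) * exp ((1 + L) * x))" for x
  have "wext (-1) \<le> wext t"
  proof (rule deriv_nonneg_mono[of "-1" 1 wext E'])
    fix x :: real assume x: "x \<in> {-1..1}"
    show "(wext has_real_derivative E' x) (at x within {-1..1})"
      unfolding wext_def E'_def
      by (rule derivative_eq_intros ode_solD[OF s] x refl | simp add: algebra_simps)+
  next
    fix x :: real assume x: "x \<in> {-1<..<1}"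
    have "\<bar>1 + Q x\<bar> \<le> 1 + L" using L[of x] x by auto
    then have "\<bar>2 * v x * v' x\<bar> * \<bar>1 + Q x\<bar> \<le> ((v x)\<^sup>2 + (v' x)\<^sup>2) * (1 + L)"
      using sum_squares_bound[of "\<bar>v x\<bar>" "\<bar>v' x\<bar>"] by (intro mult_mono) (auto simp: abs_mult)
    moreover have "- (2 * v x * v' x * (1 + Q x)) \<le> \<bar>2 * v x * v' x\<bar> * \<bar>1 + Q x\<bar>"
      by (metis abs_ge_minus_self abs_mult)
    ultimately have "2 * v x * v' x * (1 + Q x) + ((v x)\<^sup>2 + (v' x)\<^sup>2) * (1 + L) \<ge> 0"
      by linarith
    then have "(2 * v x * v' x * (1 + Q x) + ((v x)\<^sup>2 + (v' x)\<^sup>2) * (1 + L)) * exp ((1 + L) * x) \<ge> 0"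
      by simp
    then show "E' x \<ge> 0" by (simp add: E'_def algebra_simps)
  qed (use t in auto)
  then show False using z ode_solD(3,4)[OF s] by (simp add: wext_def)
qed

lemma bounded_on_Icc:
  fixes f :: "real \<Rightarrow> real"
  assumes "continuous_on {-1..1} f"
  obtains L where "\<And>t. t \<in> {-1..1} \<Longrightarrow> \<bar>f t\<bar> \<le> L" "L \<ge> 0"
proof -
  obtain B where B: "B > 0" "\<And>y. y \<in> f ` {-1..1} \<Longrightarrow> norm y \<le> B"
    using compact_imp_bounded[OF compact_continuous_image[OF assms compact_Icc]] by (auto simp: bounded_pos)
  then show ?thesis using that[of B] B(2)[OF imageI] by simp
qed

text \<open>Dividing out the zero at the left end, with the limit v' (-1) = 1 as value there, turns
  positivity on a half open interval into positivity of a continuous function on a compact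
  one.\<close>

definition quot :: "(real \<Rightarrow> real) \<Rightarrow> real \<Rightarrow> real" where
  "quot v t = (if t = -1 then 1 else v t / (t + 1))"

lemma quot_continuous:
  assumes s: "ode_sol Q v v'"
  shows "continuous_on {-1..1} (quot v)"
  unfolding continuous_on_def
proof
  fix t :: real assume t: "t \<in> {-1..1}"
  show "(quot v \<longlongrightarrow> quot v t) (at t within {-1..1})"
  proof (cases "t = -1")
    case True
    have "((\<lambda>y. (v y - v (-1)) / (y - (-1))) \<longlongrightarrow> v' (-1)) (at (-1) within {-1..1})"
      using ode_solD(1)[OF s, of "-1"] by (simp add: has_field_derivative_iff)
    then have "((\<lambda>y. v y / (y + 1)) \<longlongrightarrow> 1) (at (-1) within {-1..1})"
      using ode_solD(3,4)[OF s] by simp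
    then have "(quot v \<longlongrightarrow> 1) (at (-1) within {-1..1})"
      by (rule Lim_transform_eventually) (auto simp: eventually_at_filter quot_def)
    then show ?thesis using True by (simp add: quot_def)
  next
    case False
    have "(v \<longlongrightarrow> v t) (at t within {-1..1})"
      using ode_solD(5)[OF s] t by (simp add: continuous_on_def)
    then have "((\<lambda>y. v y / (y + 1)) \<longlongrightarrow> v t / (t + 1)) (at t within {-1..1})"
      using False t by (intro tendsto_intros) auto
    moreover have "eventually (\<lambda>y. v y / (y + 1) = quot v y) (at t within {-1..1})"
      using False t by (auto simp: eventually_at quot_def intro!: exI[of _ "t + 1"] simp: dist_real_def)
    ultimately have "(quot v \<longlongrightarrow> v t / (t + 1)) (at t within {-1..1})"
      by (rule Lim_transform_eventually)
    then show ?thesis using False by (simp add: quot_def)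
  qed
qed

lemma quot_pos_iff: "t \<in> {-1<..1} \<Longrightarrow> quot v t > 0 \<longleftrightarrow> v t > 0"
  by (auto simp: quot_def zero_less_divide_iff)

text \<open>For Q \<ge> 0 the product v v' is nondecreasing and starts at 0, so v^2 is
  nondecreasing. A zero at x would make v vanish on [-1, x], against v' (-1) = 1.\<close>

lemma ode_sol_pos:
  assumes s: "ode_sol Q v v'" and Q: "\<And>t. t \<in> {-1..1} \<Longrightarrow> Q t \<ge> 0" and t: "t \<in> {-1<..1}"
  shows "v t > 0"
proof (rule ccontr)
  assume "\<not> v t > 0"
  \<comment> \<open>The argument needs an exact zero; the intermediate value theorem for
    \<open>quot\<close> supplies one away from the left end.\<close>
  then have "quot v t \<le> 0" using quot_pos_iff[OF t, of v] by simp
  moreover have "quot v (-1) = 1" by (simp add: quot_def)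
  moreover have "continuous_on {-1..t} (quot v)"
    by (rule continuous_on_subset[OF quot_continuous[OF s]]) (use t in auto)
  ultimately obtain x where x: "-1 \<le> x" "x \<le> t" "quot v x = 0"
    using IVT2'[of "quot v" t 0 "-1"] t by auto
  then have x1: "x \<noteq> -1" by (auto simp: quot_def)
  with x have vx: "v x = 0" by (simp add: quot_def)
  have vv: "v y * v' y \<ge> 0" if y: "y \<in> {-1..1}" for y
  proof -
    have "v (-1) * v' (-1) \<le> v y * v' y"
    proof (rule deriv_nonneg_mono[of "-1" 1 "\<lambda>y. v y * v' y" "\<lambda>y. v' y * v' y + (Q y * v y) * v y"])
      fix z :: real assume z: "z \<in> {-1..1}"
      show "((\<lambda>y. v y * v' y) has_real_derivative v' z * v' z + Q z * v z * v z) (at z within {-1..1})"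
        by (rule DERIV_mult ode_solD[OF s] z)+
    next
      fix z :: real assume z: "z \<in> {-1<..<1}"
      show "0 \<le> v' z * v' z + Q z * v z * v z"
        using Q[of z] z by (simp add: mult.assoc)
    qed (use y in auto)
    then show ?thesis using ode_solD(3)[OF s] by simp
  qed
  have v0: "v y = 0" if y: "-1 \<le> y" "y \<le> x" for y
  proof -
    have "v y * v y \<le> v x * v x"
    proof (rule deriv_nonneg_mono[of "-1" 1 "\<lambda>y. v y * v y" "\<lambda>y. v' y * v y + v' y * v y"])
      fix z :: real assume z: "z \<in> {-1..1}"
      show "((\<lambda>y. v y * v y) has_real_derivative v' z * v z + v' z * v z) (at z within {-1..1})"
        by (rule DERIV_mult ode_solD[OF s] z)+
    next
      fix z :: real assume z: "z \<in> {-1<..<1}"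
      show "0 \<le> v' z * v z + v' z * v z" using vv[of z] z by (simp add: mult.commute)
    qed (use x y t in auto)
    then show ?thesis using vx by (simp add: mult_le_0_iff) (metis linorder_neq_iff mult_le_0_iff not_le)
  qed
  have "v' (-1) > 0" using ode_solD(4)[OF s] by simp
  then obtain d where d: "d > 0" "\<And>h. h > 0 \<Longrightarrow> -1 + h \<in> {-1..1} \<Longrightarrow> h < d \<Longrightarrow> v (-1) < v (-1 + h)"
    using has_real_derivative_pos_inc_right[OF ode_solD(1)[OF s, of "-1"]] by auto
  define h where "h = min (d / 2) (x + 1)"
  have "h > 0" "h < d" "h \<le> x + 1" using d(1) x x1 by (auto simp: h_def)
  then show False using d(2)[of h] v0[of "-1 + h"] ode_solD(3)[OF s] x t by auto
qed

text \<open>The Wronskian of the two solutions is monotone.\<close>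

lemma sturm_comparison:
  assumes v: "ode_sol Q v v'" and s: "ode_sol P s s'"
    and P: "\<And>t. t \<in> {-1..1} \<Longrightarrow> \<bar>P t\<bar> \<le> L"
    and pos: "\<And>t. t \<in> {-1<..<1} \<Longrightarrow> s t > 0" and s1: "s 1 = 0"
    and QP: "\<And>t. t \<in> {-1..1} \<Longrightarrow> Q t \<le> P t"
  shows "\<exists>t\<in>{-1<..1}. v t \<le> 0"
proof (rule ccontr)
  assume "\<not> ?thesis"
  then have vpos: "v t > 0" if "t \<in> {-1<..1}" for t using that by force
  define W where "W t = v t * s' t - v' t * s t" for t
  have "W (-1) \<le> W 1"
  proof (rule deriv_nonneg_mono[of "-1" 1 W "\<lambda>t. v t * s t * (P t - Q t)"])
    fix t :: real assume t: "t \<in> {-1..1}"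
    show "(W has_real_derivative v t * s t * (P t - Q t)) (at t within {-1..1})"
      unfolding W_def
      by (rule derivative_eq_intros ode_solD[OF v] ode_solD[OF s] t refl)+ (simp add: algebra_simps)
  next
    fix t :: real assume t: "t \<in> {-1<..<1}"
    then show "0 \<le> v t * s t * (P t - Q t)" using pos[OF t] vpos[of t] QP[of t] by simp
  qed auto
  \<comment> \<open>This leads to s' 1 > 0; but then s, which vanishes at 1, would be negative just
    before it.\<close>
  then have "0 \<le> v 1 * s' 1" using ode_solD(3)[OF v] ode_solD(3)[OF s] s1 by (simp add: W_def)
  then have s'1: "s' 1 \<ge> 0" using vpos[of 1] by (simp add: zero_le_mult_iff)
  have "s' 1 \<noteq> 0" using ode_sol_nontrivial[OF s P, of 1] s1 by simp
  with s'1 have s'1: "s' 1 > 0" by simp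
  obtain d where d: "d > 0" "\<And>h. h > 0 \<Longrightarrow> 1 - h \<in> {-1..1} \<Longrightarrow> h < d \<Longrightarrow> s (1 - h) < s 1"
    using has_real_derivative_pos_inc_left[OF ode_solD(1)[OF s] s'1] by auto
  define h where "h = min (d / 2) 1"
  have "s (1 - h) < 0" using d(2)[of h] d(1) s1 by (auto simp: h_def)
  moreover have "s (1 - h) > 0" using d(1) by (intro pos) (auto simp: h_def)
  ultimately show False by simp
qed

text \<open>Gronwall for the energy of the difference, whose equation has the forcing (\<tau> -
  \<sigma>) q1 w. Only the derivatives are compared: both solutions vanish at -1, so the same
  constant then bounds the difference of their quotients \<open>quot\<close>.\<close>

lemma ode_sol_param_lipschitz:
  assumes q: "continuous_on {-1..1} q0" "continuous_on {-1..1} q1"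
  shows "\<exists>C. \<forall>\<tau>\<in>{0..T}. \<forall>\<sigma>\<in>{0..T}. \<forall>v v' w w'.
    ode_sol (\<lambda>t. q0 t + \<tau> * q1 t) v v' \<longrightarrow> ode_sol (\<lambda>t. q0 t + \<sigma> * q1 t) w w' \<longrightarrow>
    (\<forall>t\<in>{-1..1}. \<bar>v' t - w' t\<bar> \<le> C * \<bar>\<tau> - \<sigma>\<bar>)"
proof -
  obtain L0 where L0: "\<And>t. t \<in> {-1..1} \<Longrightarrow> \<bar>q0 t\<bar> \<le> L0" "L0 \<ge> 0" by (rule bounded_on_Icc[OF q(1)]) blast
  obtain L1 where L1: "\<And>t. t \<in> {-1..1} \<Longrightarrow> \<bar>q1 t\<bar> \<le> L1" "L1 \<ge> 0" by (rule bounded_on_Icc[OF q(2)]) blast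
  define L where "L = L0 + \<bar>T\<bar> * L1"
  have Lnn: "L \<ge> 0" using L0 L1 by (simp add: L_def)
  have QL: "\<bar>q0 t + \<tau> * q1 t\<bar> \<le> L" if "t \<in> {-1..1}" "\<tau> \<in> {0..T}" for t \<tau>
  proof -
    have "\<bar>\<tau> * q1 t\<bar> \<le> \<bar>T\<bar> * L1" using that L1 unfolding abs_mult by (intro mult_mono) auto
    then show ?thesis using L0(1)[OF that(1)] by (simp add: L_def)
  qed
  define C0 where "C0 = exp (2 * (1 + L))"
  have en: "2 * x * y + 2 * y * (Q * x) \<le> (1 + L) * (x\<^sup>2 + y\<^sup>2)" if "\<bar>Q\<bar> \<le> L" for x y Q :: real
  proof -
    have "\<bar>2 * x * y\<bar> * \<bar>1 + Q\<bar> \<le> (x\<^sup>2 + y\<^sup>2) * (1 + L)"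
      using sum_squares_bound[of "\<bar>x\<bar>" "\<bar>y\<bar>"] that by (intro mult_mono) (auto simp: abs_mult)
    moreover have "2 * x * y + 2 * y * (Q * x) = 2 * x * y * (1 + Q)" by (simp add: algebra_simps)
    moreover have "2 * x * y * (1 + Q) \<le> \<bar>2 * x * y\<bar> * \<bar>1 + Q\<bar>"
      by (metis abs_ge_self abs_mult)
    ultimately show ?thesis by (simp add: mult.commute)
  qed
  have wb: "(w t)\<^sup>2 + (w' t)\<^sup>2 \<le> C0"
    if s: "ode_sol (\<lambda>t. q0 t + \<sigma> * q1 t) w w'" and "\<sigma> \<in> {0..T}" "t \<in> {-1..1}" for \<sigma> w w' t
  proof -
    have "(w t)\<^sup>2 + (w' t)\<^sup>2 \<le> ((w (-1))\<^sup>2 + (w' (-1))\<^sup>2 + 2 * 0) * exp (2 * (1 + L))"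
    proof (rule gronwall[where wext="\<lambda>t. (w t)\<^sup>2 + (w' t)\<^sup>2"
          and E'="\<lambda>t. 2 * w t * w' t + 2 * w' t * ((q0 t + \<sigma> * q1 t) * w t)"])
      fix x :: real assume x: "x \<in> {-1..1}"
      show "((\<lambda>t. (w t)\<^sup>2 + (w' t)\<^sup>2) has_real_derivative
          2 * w x * w' x + 2 * w' x * ((q0 x + \<sigma> * q1 x) * w x)) (at x within {-1..1})"
        by (rule derivative_eq_intros ode_solD[OF s] x refl)+ (simp add: algebra_simps)
      show "2 * w x * w' x + 2 * w' x * ((q0 x + \<sigma> * q1 x) * w x) \<le> (1 + L) * ((w x)\<^sup>2 + (w' x)\<^sup>2) + 0"
        using en[OF QL[OF x that(2)]] by simp
    qed (use Lnn that in auto)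
    then show ?thesis using ode_solD(3,4)[OF s] by (simp add: C0_def)
  qed
  define C where "C = sqrt (2 * (L1\<^sup>2 * C0) * exp (2 * (2 + L)))"
  show ?thesis
  proof (intro exI ballI allI impI)
    fix \<tau> \<sigma> v v' w w' and t :: real
    assume \<tau>: "\<tau> \<in> {0..T}" and \<sigma>: "\<sigma> \<in> {0..T}" and t: "t \<in> {-1..1}"
      and v: "ode_sol (\<lambda>t. q0 t + \<tau> * q1 t) v v'" and w: "ode_sol (\<lambda>t. q0 t + \<sigma> * q1 t) w w'"
    define d d' where "d t = v t - w t" and "d' t = v' t - w' t" for t
    define r where "r t = (\<tau> - \<sigma>) * q1 t * w t" for t
    define R where "R = (\<tau> - \<sigma>)\<^sup>2 * (L1\<^sup>2 * C0)"
    have rR: "(r x)\<^sup>2 \<le> R" if x: "x \<in> {-1..1}" for x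
    proof -
      have "(w x)\<^sup>2 \<le> C0" using wb[OF w \<sigma> x] zero_le_power2[of "w' x"] by linarith
      moreover have "(q1 x)\<^sup>2 \<le> L1\<^sup>2" using L1(1)[OF x] by (metis abs_ge_zero power2_abs power_mono)
      ultimately show ?thesis unfolding r_def R_def power_mult_distrib mult.assoc
        by (intro mult_left_mono mult_mono) auto
    qed
    have "(d t)\<^sup>2 + (d' t)\<^sup>2 \<le> ((d (-1))\<^sup>2 + (d' (-1))\<^sup>2 + 2 * R) * exp (2 * (2 + L))"
    proof (rule gronwall[where wext="\<lambda>t. (d t)\<^sup>2 + (d' t)\<^sup>2"
          and E'="\<lambda>t. 2 * d t * d' t + 2 * d' t * ((q0 t + \<tau> * q1 t) * d t + r t)"])
      fix x :: real assume x: "x \<in> {-1..1}"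
      show "((\<lambda>t. (d t)\<^sup>2 + (d' t)\<^sup>2) has_real_derivative
          2 * d x * d' x + 2 * d' x * ((q0 x + \<tau> * q1 x) * d x + r x)) (at x within {-1..1})"
        unfolding d_def d'_def r_def
        by (rule derivative_eq_intros ode_solD[OF v] ode_solD[OF w] x refl)+ (simp add: algebra_simps)
      have "2 * d' x * r x \<le> (d' x)\<^sup>2 + (r x)\<^sup>2" by (rule sum_squares_bound)
      moreover have "2 * d x * d' x + 2 * d' x * ((q0 x + \<tau> * q1 x) * d x + r x)
          = (2 * d x * d' x + 2 * d' x * ((q0 x + \<tau> * q1 x) * d x)) + 2 * d' x * r x"
        by (simp only: distrib_left add.assoc)
      moreover have "(2 + L) * ((d x)\<^sup>2 + (d' x)\<^sup>2) = (1 + L) * ((d x)\<^sup>2 + (d' x)\<^sup>2) + ((d x)\<^sup>2 + (d' x)\<^sup>2)"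
        by (simp add: algebra_simps)
      ultimately show "2 * d x * d' x + 2 * d' x * ((q0 x + \<tau> * q1 x) * d x + r x)
          \<le> (2 + L) * ((d x)\<^sup>2 + (d' x)\<^sup>2) + R"
        using en[OF QL[OF x \<tau>], of "d x" "d' x"] rR[OF x] zero_le_power2[of "d x"] by linarith
    qed (use Lnn t in \<open>auto simp: R_def C0_def\<close>)
    moreover have "d (-1) = 0" "d' (-1) = 0"
      using ode_solD(3,4)[OF v] ode_solD(3,4)[OF w] by (simp_all add: d_def d'_def)
    ultimately have "(d t)\<^sup>2 + (d' t)\<^sup>2 \<le> (2 * R) * exp (2 * (2 + L))" by simp
    then have "(d' t)\<^sup>2 \<le> (2 * R) * exp (2 * (2 + L))"
      using zero_le_power2[of "d t"] by linarith
    also have "\<dots> = (C * \<bar>\<tau> - \<sigma>\<bar>)\<^sup>2"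
      by (simp add: C_def R_def power_mult_distrib C0_def algebra_simps)
    finally have "\<bar>d' t\<bar> \<le> \<bar>C * \<bar>\<tau> - \<sigma>\<bar>\<bar>" by (simp add: abs_le_square_iff)
    then show "\<bar>v' t - w' t\<bar> \<le> C * \<bar>\<tau> - \<sigma>\<bar>" by (simp add: d'_def C_def C0_def)
  qed
qed

text \<open>Intermediate value theorem for the minimum over \<open>t\<close> of \<open>v t / (t + 1)\<close>: at a parameter where
  this minimum vanishes it is attained at the right end point only, an interior zero being double.\<close>

lemma principal_solution_exists:
  assumes q: "continuous_on {-1..1} q0" "continuous_on {-1..1} q1" and T: "T \<ge> 0"
    and start: "\<And>v v' t. ode_sol q0 v v' \<Longrightarrow> t \<in> {-1<..1} \<Longrightarrow> v t > 0"
    and stop: "\<And>v v'. ode_sol (\<lambda>t. q0 t + T * q1 t) v v' \<Longrightarrow> \<exists>t\<in>{-1<..1}. v t \<le> 0"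
  shows "\<exists>\<tau>\<in>{0..T}. \<exists>v v'. ode_sol (\<lambda>t. q0 t + \<tau> * q1 t) v v' \<and> (\<forall>t\<in>{-1<..<1}. v t > 0) \<and> v 1 = 0"
proof -
  define Q where "Q \<tau> t = q0 t + \<tau> * q1 t" for \<tau> t
  have Qc: "continuous_on {-1..1} (Q \<tau>)" for \<tau> unfolding Q_def by (intro continuous_intros q)
  then have "\<forall>\<tau>. \<exists>v v'. ode_sol (Q \<tau>) v v'" using ode_sol_exists by blast
  then obtain V V' where V: "\<And>\<tau>. ode_sol (Q \<tau>) (V \<tau>) (V' \<tau>)" by metis
  have V2: "ode_sol (\<lambda>t. q0 t + \<tau> * q1 t) (V \<tau>) (V' \<tau>)" for \<tau>
    using V[of \<tau>] by (simp add: Q_def[abs_def])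
  from ode_sol_param_lipschitz[OF q, of T] obtain C where C0:
    "\<forall>\<tau>\<in>{0..T}. \<forall>\<sigma>\<in>{0..T}. \<forall>v v' w w'.
      ode_sol (\<lambda>t. q0 t + \<tau> * q1 t) v v' \<longrightarrow> ode_sol (\<lambda>t. q0 t + \<sigma> * q1 t) w w' \<longrightarrow>
      (\<forall>t\<in>{-1..1}. \<bar>v' t - w' t\<bar> \<le> C * \<bar>\<tau> - \<sigma>\<bar>)" ..
  note C = C0[rule_format, OF _ _ V2 V2]
  have Cnn: "C * \<bar>\<tau> - \<sigma>\<bar> \<ge> 0" if "\<tau> \<in> {0..T}" "\<sigma> \<in> {0..T}" for \<tau> \<sigma>
    using C[OF that, of 0] by simp
  have wC: "quot (V \<tau>) t \<le> quot (V \<sigma>) t + C * \<bar>\<tau> - \<sigma>\<bar>"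
    if "\<tau> \<in> {0..T}" "\<sigma> \<in> {0..T}" "t \<in> {-1..1}" for \<tau> \<sigma> t
  proof (cases "t = -1")
    case False
    have "(V \<tau> t - V \<sigma> t) - C * \<bar>\<tau> - \<sigma>\<bar> * (t + 1) \<le> (V \<tau> (-1) - V \<sigma> (-1)) - C * \<bar>\<tau> - \<sigma>\<bar> * (-1 + 1)"
    proof -
      have "C * \<bar>\<tau> - \<sigma>\<bar> * (-1 + 1) - (V \<tau> (-1) - V \<sigma> (-1)) \<le> C * \<bar>\<tau> - \<sigma>\<bar> * (t + 1) - (V \<tau> t - V \<sigma> t)"
      proof (rule deriv_nonneg_mono[of "-1" 1 "\<lambda>a. C * \<bar>\<tau> - \<sigma>\<bar> * (a + 1) - (V \<tau> a - V \<sigma> a)"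
            "\<lambda>t. C * \<bar>\<tau> - \<sigma>\<bar> - (V' \<tau> t - V' \<sigma> t)"])
        fix x :: real assume x: "x \<in> {-1..1}"
        show "((\<lambda>a. C * \<bar>\<tau> - \<sigma>\<bar> * (a + 1) - (V \<tau> a - V \<sigma> a)) has_real_derivative
            C * \<bar>\<tau> - \<sigma>\<bar> - (V' \<tau> x - V' \<sigma> x)) (at x within {-1..1})"
          by (rule derivative_eq_intros ode_solD[OF V] x refl)+ simp
      next
        fix x :: real assume x: "x \<in> {-1<..<1}"
        then show "0 \<le> C * \<bar>\<tau> - \<sigma>\<bar> - (V' \<tau> x - V' \<sigma> x)" using C[OF that(1,2), of x] by auto
      qed (use that in auto)
      then show ?thesis by simp
    qed
    then have "V \<tau> t \<le> V \<sigma> t + C * \<bar>\<tau> - \<sigma>\<bar> * (t + 1)" using ode_solD(3)[OF V] by simp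
    then have "V \<tau> t / (t + 1) \<le> (V \<sigma> t + C * \<bar>\<tau> - \<sigma>\<bar> * (t + 1)) / (t + 1)"
      using that by (intro divide_right_mono) auto
    then show ?thesis using False that by (simp add: quot_def add_divide_distrib)
  qed (use Cnn that in \<open>simp add: quot_def\<close>)
  have "\<exists>s\<in>{-1..1}. \<forall>t\<in>{-1..1}. quot (V \<tau>) s \<le> quot (V \<tau>) t" for \<tau>
    by (rule continuous_attains_inf[OF _ _ quot_continuous[OF V]]) auto
  then obtain s where s: "\<And>\<tau>. s \<tau> \<in> {-1..1}" "\<And>\<tau> t. t \<in> {-1..1} \<Longrightarrow> quot (V \<tau>) (s \<tau>) \<le> quot (V \<tau>) t"
    by metis
  define m where "m \<tau> = quot (V \<tau>) (s \<tau>)" for \<tau>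
  \<comment> \<open>A minimum of functions that are Lipschitz in the parameter, uniformly in t, is
    again Lipschitz.\<close>
  have mC: "m \<tau> \<le> m \<sigma> + C * \<bar>\<tau> - \<sigma>\<bar>" if "\<tau> \<in> {0..T}" "\<sigma> \<in> {0..T}" for \<tau> \<sigma>
    using s(2)[OF s(1)[of \<sigma>], of \<tau>] wC[OF that s(1)[of \<sigma>]] by (simp add: m_def)
  have "continuous_on {0..T} m"
  proof (rule continuous_onI)
    fix \<tau> e :: real assume \<tau>: "\<tau> \<in> {0..T}" and e: "e > 0"
    have "dist (m \<sigma>) (m \<tau>) \<le> e" if "\<sigma> \<in> {0..T}" "dist \<sigma> \<tau> < e / (\<bar>C\<bar> + 1)" for \<sigma>
    proof -
      have "\<bar>\<sigma> - \<tau>\<bar> * (\<bar>C\<bar> + 1) \<le> e" using that(2) by (simp add: dist_real_def field_simps)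
      moreover have "C * \<bar>\<sigma> - \<tau>\<bar> \<le> \<bar>\<sigma> - \<tau>\<bar> * (\<bar>C\<bar> + 1)"
        by (subst mult.commute) (intro mult_left_mono; simp)
      moreover have "\<bar>\<tau> - \<sigma>\<bar> = \<bar>\<sigma> - \<tau>\<bar>" by simp
      ultimately show ?thesis using mC[OF that(1) \<tau>] mC[OF \<tau> that(1)] unfolding dist_real_def abs_le_iff by simp
    qed
    then show "\<exists>d>0. \<forall>x'\<in>{0..T}. dist x' \<tau> < d \<longrightarrow> dist (m x') (m \<tau>) \<le> e"
      using e by (intro exI[of _ "e / (\<bar>C\<bar> + 1)"]) auto
  qed
  moreover have "m 0 \<ge> 0"
  proof -
    have "V 0 t > 0" if "t \<in> {-1<..1}" for t using start[of "V 0" "V' 0" t] V2[of 0] that by simp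
    then have "quot (V 0) (s 0) > 0"
      using s(1)[of 0] quot_pos_iff[of "s 0" "V 0"] by (cases "s 0 = -1") (auto simp: quot_def)
    then show ?thesis by (simp add: m_def)
  qed
  moreover have "m T \<le> 0"
  proof -
    obtain t where t: "t \<in> {-1<..1}" "V T t \<le> 0" using stop[OF V2] by auto
    then have "quot (V T) t \<le> 0" using quot_pos_iff[OF t(1), of "V T"] by linarith
    then show ?thesis using s(2)[of t T] t(1) by (simp add: m_def)
  qed
  ultimately obtain \<tau> where \<tau>: "0 \<le> \<tau>" "\<tau> \<le> T" "m \<tau> = 0" using IVT2'[of m T 0 0] T by auto
  have nn: "quot (V \<tau>) t \<ge> 0" if "t \<in> {-1..1}" for t using s(2)[OF that, of \<tau>] \<tau>(3) by (simp add: m_def)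
  then have Vnn: "V \<tau> t \<ge> 0" if "t \<in> {-1<..1}" for t
    using that nn[of t] by (auto simp: quot_def zero_le_divide_iff)
  have s1: "s \<tau> \<noteq> -1" using \<tau>(3) by (auto simp: m_def quot_def)
  then have Vs: "V \<tau> (s \<tau>) = 0" using \<tau>(3) s(1)[of \<tau>] by (auto simp: m_def quot_def)
  have pos: "V \<tau> t > 0" if t: "t \<in> {-1<..<1}" for t
  proof (rule ccontr)
    assume "\<not> V \<tau> t > 0"
    with Vnn[of t] t have z: "V \<tau> t = 0" by auto
    have "(V \<tau> has_real_derivative V' \<tau> t) (at t)"
      using ode_solD(1)[OF V, of t] t at_within_Icc_at[of "-1" t 1] by auto
    then have "V' \<tau> t = 0"
    proof (rule DERIV_local_min[where d="min (t + 1) (1 - t)"])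
      show "\<forall>y. \<bar>t - y\<bar> < min (t + 1) (1 - t) \<longrightarrow> V \<tau> t \<le> V \<tau> y"
        using z by (auto intro!: Vnn)
    qed (use t in auto)
    moreover obtain L where "\<And>t. t \<in> {-1..1} \<Longrightarrow> \<bar>Q \<tau> t\<bar> \<le> L" by (rule bounded_on_Icc[OF Qc]) blast
    ultimately show False using ode_sol_nontrivial[OF V, of \<tau> L t] z t by auto
  qed
  have "s \<tau> = 1" using pos[of "s \<tau>"] Vs s(1)[of \<tau>] s1 by fastforce
  then have "V \<tau> 1 = 0" using Vs by simp
  with pos V2[of \<tau>] show ?thesis
    by (intro bexI[of _ \<tau>] exI[of _ "V \<tau>"] exI[of _ "V' \<tau>"]) (use \<tau> in auto)
qed

section \<open>Picone's identity and a Poincare inequality on cells\<close>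

text \<open>Cauchy-Schwarz against the constant 1, obtained by integrating the squared deviation of
  g from its mean.\<close>

lemma square_integral_le:
  fixes g :: "real \<Rightarrow> real"
  assumes g: "continuous_on {a..b} g" and ab: "a < b"
  shows "(integral {a..b} g)\<^sup>2 \<le> (b - a) * integral {a..b} (\<lambda>x. (g x)\<^sup>2)"
proof -
  define c where "c = integral {a..b} g / (b - a)"
  have i: "g integrable_on {a..b}" "(\<lambda>x. (g x)\<^sup>2) integrable_on {a..b}"
    by (intro integrable_continuous_real continuous_intros g)+
  have "0 \<le> integral {a..b} (\<lambda>x. (g x - c)\<^sup>2)"
    by (rule integral_nonneg) (auto intro!: integrable_continuous_real continuous_intros g)
  also have "((\<lambda>x. (g x)\<^sup>2 - 2 * c * g x + c\<^sup>2) has_integral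
      (integral {a..b} (\<lambda>x. (g x)\<^sup>2) - 2 * c * integral {a..b} g + (b - a) * c\<^sup>2)) {a..b}"
    using has_integral_const_real[of "c\<^sup>2" a b] ab
    by (intro has_integral_add has_integral_diff has_integral_mult_right integrable_integral i) auto
  then have "integral {a..b} (\<lambda>x. (g x - c)\<^sup>2) =
      integral {a..b} (\<lambda>x. (g x)\<^sup>2) - 2 * c * integral {a..b} g + (b - a) * c\<^sup>2"
    by (intro integral_unique) (simp add: power2_diff algebra_simps)
  also have "(b - a) * c\<^sup>2 = c * integral {a..b} g"
    using ab by (simp add: c_def power2_eq_square)
  also have "integral {a..b} (\<lambda>x. (g x)\<^sup>2) - 2 * c * integral {a..b} g + c * integral {a..b} g
      = integral {a..b} (\<lambda>x. (g x)\<^sup>2) - c * integral {a..b} g" by simp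
  also have "c * integral {a..b} g = (integral {a..b} g)\<^sup>2 / (b - a)"
    by (simp add: c_def power2_eq_square)
  finally show ?thesis using ab by (simp add: field_simps)
qed

text \<open>Averaging f x - f y over y compares f x with the mean of f, and each difference is at
  most the integral of |f'|. Sharp constants do not matter, as the cells will be taken
  small.\<close>

lemma poincare_interval:
  fixes f :: "real \<Rightarrow> complex"
  assumes d: "\<And>t. t \<in> {a..b} \<Longrightarrow> (f has_vector_derivative f' t) (at t within {a..b})"
    and f': "continuous_on {a..b} f'" and ab: "a < b"
  shows "integral {a..b} (\<lambda>t. (cmod (f t))\<^sup>2) \<le>
    2 / (b - a) * (cmod (integral {a..b} f))\<^sup>2 + 2 * (b - a)\<^sup>2 * integral {a..b} (\<lambda>t. (cmod (f' t))\<^sup>2)"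
proof -
  have fc: "continuous_on {a..b} f"
    using d has_vector_derivative_continuous continuous_on_eq_continuous_within by blast
  define D where "D = integral {a..b} (\<lambda>t. cmod (f' t))"
  define I where "I = integral {a..b} f"
  have ni: "(\<lambda>t. cmod (f' t)) integrable_on {a..b}"
    by (intro integrable_continuous_real continuous_intros f')
  have le: "cmod (f y - f x) \<le> D" if "a \<le> x" "x \<le> y" "y \<le> b" for x y
  proof -
    have sub: "{x..y} \<subseteq> {a..b}" using that by auto
    have "(f' has_integral (f y - f x)) {x..y}"
      by (rule fundamental_theorem_of_calculus[OF that(2)])
        (use sub in \<open>auto intro: has_vector_derivative_within_subset[OF d]\<close>)
    then have "f y - f x = integral {x..y} f'" by (simp add: integral_unique)
    also have "cmod \<dots> \<le> integral {x..y} (\<lambda>t. cmod (f' t))"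
      by (rule integral_norm_bound_integral)
        (auto intro!: integrable_continuous_real continuous_intros continuous_on_subset[OF f' sub])
    also have "\<dots> \<le> D" unfolding D_def
      by (rule integral_subset_le[OF sub _ ni])
        (auto intro!: integrable_continuous_real continuous_intros continuous_on_subset[OF f' sub])
    finally show ?thesis .
  qed
  have le': "cmod (f x - f y) \<le> D" if "x \<in> {a..b}" "y \<in> {a..b}" for x y
    using le[of x y] le[of y x] that by (cases "x \<le> y") (auto simp: norm_minus_commute)
  have pt: "(cmod (f x))\<^sup>2 \<le> 2 / (b - a)\<^sup>2 * (cmod I)\<^sup>2 + 2 * D\<^sup>2" if x: "x \<in> {a..b}" for x
  proof -
    have "((\<lambda>y. f x - f y) has_integral ((b - a) *\<^sub>R f x - I)) {a..b}"
      unfolding I_def using ab has_integral_const_real[of "f x" a b]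
      by (intro has_integral_diff integrable_integral integrable_continuous_real fc) simp
    then have "(b - a) *\<^sub>R f x - I = integral {a..b} (\<lambda>y. f x - f y)" by (simp add: integral_unique)
    also have "cmod \<dots> \<le> D * (b - a)"
      by (rule integral_bound) (use ab x le' in \<open>auto intro!: continuous_intros fc\<close>)
    finally have 1: "cmod ((b - a) *\<^sub>R f x - I) \<le> D * (b - a)" .
    have "(b - a) * cmod (f x) = cmod (((b - a) *\<^sub>R f x - I) + I)" using ab by simp
    also have "\<dots> \<le> D * (b - a) + cmod I" by (rule order_trans[OF norm_triangle_ineq]) (use 1 in simp)
    finally have "cmod (f x) \<le> D + cmod I / (b - a)" using ab by (simp add: field_simps)
    then have "(cmod (f x))\<^sup>2 \<le> (D + cmod I / (b - a))\<^sup>2" by (intro power_mono) auto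
    also have "\<dots> \<le> 2 * D\<^sup>2 + 2 * (cmod I / (b - a))\<^sup>2"
      using sum_squares_bound[of D "cmod I / (b - a)"] by (simp add: power2_sum)
    finally show ?thesis by (simp add: power_divide)
  qed
  have "integral {a..b} (\<lambda>t. (cmod (f t))\<^sup>2) \<le> integral {a..b} (\<lambda>t. 2 / (b - a)\<^sup>2 * (cmod I)\<^sup>2 + 2 * D\<^sup>2)"
    by (rule integral_le) (use pt in \<open>auto intro!: integrable_continuous_real continuous_intros fc\<close>)
  also have "\<dots> = (2 / (b - a)\<^sup>2 * (cmod I)\<^sup>2 + 2 * D\<^sup>2) * (b - a)"
    using ab by simp
  also have "\<dots> = 2 / (b - a) * (cmod I)\<^sup>2 + 2 * (b - a) * D\<^sup>2"
  proof -
    have "(2 / x\<^sup>2 * y + 2 * z) * x = 2 / x * y + 2 * x * z" if "x > 0" for x y z :: real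
      using that by (simp add: power2_eq_square field_simps)
    then show ?thesis using ab by simp
  qed
  also have "\<dots> \<le> 2 / (b - a) * (cmod I)\<^sup>2 + 2 * (b - a) * ((b - a) * integral {a..b} (\<lambda>t. (cmod (f' t))\<^sup>2))"
    using square_integral_le[of a b "\<lambda>t. cmod (f' t)"] ab f'
    by (intro add_left_mono mult_left_mono) (auto simp: D_def intro!: continuous_intros)
  finally show ?thesis by (simp only: I_def power2_eq_square[of "b - a"] mult.assoc)
qed

lemma integral_partition:
  fixes g :: "real \<Rightarrow> 'b::banach"
  assumes l: "l > 0" and g: "continuous_on {a..a + real n * l} g"
  shows "integral {a..a + real n * l} g = (\<Sum>i<n. integral {a + real i * l..a + real (Suc i) * l} g)"
  using g
proof (induction n)
  case (Suc n)
  have "integral {a..a + real n * l} g + integral {a + real n * l..a + real (Suc n) * l} g =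
      integral {a..a + real (Suc n) * l} g"
    by (rule Henstock_Kurzweil_Integration.integral_combine)
      (use l Suc.prems in \<open>auto intro: integrable_continuous_real simp: field_simps\<close>)
  moreover have "continuous_on {a..a + real n * l} g"
    by (rule continuous_on_subset[OF Suc.prems]) (use l in \<open>auto simp: field_simps\<close>)
  ultimately show ?case using Suc.IH by simp
qed simp

lemma poincare_partition:
  fixes f :: "real \<Rightarrow> complex"
  assumes d: "\<And>t. t \<in> {a..a + real n * l} \<Longrightarrow> (f has_vector_derivative f' t) (at t within {a..a + real n * l})"
    and f': "continuous_on {a..a + real n * l} f'" and l: "l > 0"
  shows "integral {a..a + real n * l} (\<lambda>t. (cmod (f t))\<^sup>2) \<le>
    (\<Sum>i<n. 2 / l * (cmod (integral {a + real i * l..a + real (Suc i) * l} f))\<^sup>2)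
      + 2 * l\<^sup>2 * integral {a..a + real n * l} (\<lambda>t. (cmod (f' t))\<^sup>2)"
proof -
  have fc: "continuous_on {a..a + real n * l} f"
    using d has_vector_derivative_continuous continuous_on_eq_continuous_within by blast
  have sub: "{a + real i * l..a + real (Suc i) * l} \<subseteq> {a..a + real n * l}" if "i < n" for i
  proof -
    have "real (Suc i) * l \<le> real n * l" using that l by (intro mult_right_mono) auto
    moreover have "0 \<le> real i * l" using l by simp
    ultimately show ?thesis by auto
  qed
  have "integral {a..a + real n * l} (\<lambda>t. (cmod (f t))\<^sup>2) =
      (\<Sum>i<n. integral {a + real i * l..a + real (Suc i) * l} (\<lambda>t. (cmod (f t))\<^sup>2))"
    by (intro integral_partition l continuous_intros fc)
  also have "\<dots> \<le> (\<Sum>i<n. 2 / l * (cmod (integral {a + real i * l..a + real (Suc i) * l} f))\<^sup>2 +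
      2 * l\<^sup>2 * integral {a + real i * l..a + real (Suc i) * l} (\<lambda>t. (cmod (f' t))\<^sup>2))"
  proof (rule sum_mono)
    fix i assume "i \<in> {..<n}"
    then have s: "{a + real i * l..a + real (Suc i) * l} \<subseteq> {a..a + real n * l}" using sub by simp
    have len: "a + real (Suc i) * l - (a + real i * l) = l" by (simp add: algebra_simps)
    have "a + real i * l < a + real (Suc i) * l" using l by (simp add: algebra_simps)
    from poincare_interval[OF _ continuous_on_subset[OF f' s] this, of f]
    show "integral {a + real i * l..a + real (Suc i) * l} (\<lambda>t. (cmod (f t))\<^sup>2) \<le>
      2 / l * (cmod (integral {a + real i * l..a + real (Suc i) * l} f))\<^sup>2 +
      2 * l\<^sup>2 * integral {a + real i * l..a + real (Suc i) * l} (\<lambda>t. (cmod (f' t))\<^sup>2)"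
      unfolding len using has_vector_derivative_within_subset[OF d s] s by blast
  qed
  also have "\<dots> = (\<Sum>i<n. 2 / l * (cmod (integral {a + real i * l..a + real (Suc i) * l} f))\<^sup>2)
      + 2 * l\<^sup>2 * integral {a..a + real n * l} (\<lambda>t. (cmod (f' t))\<^sup>2)"
    by (subst integral_partition[OF l]) (auto intro!: continuous_intros f' simp: sum.distrib sum_distrib_left)
  finally show ?thesis .
qed

lemma continuous_on_inner_integral:
  fixes g :: "real \<times> real \<Rightarrow> 'b::banach"
  assumes "continuous_on UNIV g"
  shows "continuous_on S (\<lambda>s. integral {c..d} (\<lambda>t. g (s, t)))"
proof -
  have "continuous_on (S \<times> cbox c d) (\<lambda>(s, t). g (s, t))"
    using continuous_on_subset[OF assms subset_UNIV] by simp
  from integral_continuous_on_param[OF this] show ?thesis by simp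
qed

lemma continuous_on_slice:
  fixes g :: "real \<times> real \<Rightarrow> 'b::topological_space"
  assumes "continuous_on UNIV g"
  shows "continuous_on S (\<lambda>t. g (s, t))" "continuous_on S (\<lambda>s. g (s, t))"
  by (rule continuous_on_compose2[OF assms]; auto intro!: continuous_intros)+

text \<open>Apply the interval inequality in t for each s, then in s to the integrals M j over the
  t-cells. The derivative of M j is controlled by Cauchy-Schwarz, whose factor k cancels the 1 / k
  of the first step.\<close>

lemma poincare_cells:
  fixes \<phi> ps pt :: "real \<times> real \<Rightarrow> complex"
  assumes ps: "continuous_on UNIV ps" and pt: "continuous_on UNIV pt"
    and d: "\<And>x. (\<phi> has_derivative (\<lambda>h. fst h *\<^sub>R ps x + snd h *\<^sub>R pt x)) (at x)"
    and l: "l > 0" and k: "k > 0"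
  shows "integral {a..a + real n * l} (\<lambda>s. integral {b..b + real m * k} (\<lambda>t. (cmod (\<phi> (s, t)))\<^sup>2)) \<le>
    (\<Sum>j<m. \<Sum>i<n. 4 / (k * l) * (cmod (integral {a + real i * l..a + real (Suc i) * l}
        (\<lambda>s. integral {b + real j * k..b + real (Suc j) * k} (\<lambda>t. \<phi> (s, t)))))\<^sup>2)
    + 4 * l\<^sup>2 * integral {a..a + real n * l} (\<lambda>s. integral {b..b + real m * k} (\<lambda>t. (cmod (ps (s, t)))\<^sup>2))
    + 2 * k\<^sup>2 * integral {a..a + real n * l} (\<lambda>s. integral {b..b + real m * k} (\<lambda>t. (cmod (pt (s, t)))\<^sup>2))"
proof -
  have \<phi>c: "continuous_on UNIV \<phi>"
    by (rule has_derivative_continuous_on) (rule has_derivative_at_withinI[OF d])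
  have dt: "((\<lambda>t. \<phi> (s, t)) has_vector_derivative pt (s, t)) (at t within S)" for s t S
  proof -
    have "((\<lambda>t. (s, t)) has_derivative (\<lambda>h. (0, h))) (at t within S)"
      by (auto intro!: derivative_eq_intros)
    from has_derivative_compose[OF this d] show ?thesis by (simp add: has_vector_derivative_def)
  qed
  have ds: "((\<lambda>s. \<phi> (s, t)) has_vector_derivative ps (s, t)) (at s within S)" for s t S
  proof -
    have "((\<lambda>s. (s, t)) has_derivative (\<lambda>h. (h, 0))) (at s within S)"
      by (auto intro!: derivative_eq_intros)
    from has_derivative_compose[OF this d] show ?thesis by (simp add: has_vector_derivative_def)
  qed
  define A where "A = {a..a + real n * l}"
  define B where "B = {b..b + real m * k}"
  define J where "J j = {b + real j * k..b + real (Suc j) * k}" for j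
  define I where "I i = {a + real i * l..a + real (Suc i) * l}" for i
  define M where "M j s = integral (J j) (\<lambda>t. \<phi> (s, t))" for j s
  define M' where "M' j s = integral (J j) (\<lambda>t. ps (s, t))" for j s
  have Mc: "continuous_on S (M j)" "continuous_on S (M' j)" for j S
    unfolding M_def[abs_def] M'_def[abs_def] J_def by (rule continuous_on_inner_integral; fact)+
  have ii: "(\<lambda>s. integral B (\<lambda>t. g (s, t))) integrable_on A" if "continuous_on UNIV g"
    for g :: "real \<times> real \<Rightarrow> real"
    unfolding A_def B_def by (intro integrable_continuous_real continuous_on_inner_integral that)
  have c2: "continuous_on UNIV (\<lambda>x. (cmod (g x))\<^sup>2)" if "continuous_on UNIV g" for g :: "real \<times> real \<Rightarrow> complex"
    by (intro continuous_intros that)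
  have dM: "(M j has_vector_derivative M' j s) (at s within A)" if "s \<in> A" for j s
    unfolding M_def[abs_def] M'_def[abs_def] J_def cbox_interval[symmetric]
  proof (rule leibniz_rule_vector_derivative)
    show "convex A" by (simp add: A_def)
    show "s \<in> A" by fact
    show "continuous_on (A \<times> cbox (b + real j * k) (b + real (Suc j) * k)) (\<lambda>(x, t). ps (x, t))"
      using continuous_on_subset[OF ps subset_UNIV] by simp
  qed (intro ds integrable_continuous continuous_on_slice \<phi>c)+
  have "integral A (\<lambda>s. integral B (\<lambda>t. (cmod (\<phi> (s, t)))\<^sup>2)) \<le>
      integral A (\<lambda>s. (\<Sum>j<m. 2 / k * (cmod (M j s))\<^sup>2) + 2 * k\<^sup>2 * integral B (\<lambda>t. (cmod (pt (s, t)))\<^sup>2))"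
  proof (rule integral_le)
    show "(\<lambda>s. (\<Sum>j<m. 2 / k * (cmod (M j s))\<^sup>2) + 2 * k\<^sup>2 * integral B (\<lambda>t. (cmod (pt (s, t)))\<^sup>2)) integrable_on A"
      unfolding A_def B_def
      by (intro integrable_continuous_real continuous_intros Mc continuous_on_inner_integral c2 pt)
    show "(\<lambda>s. integral B (\<lambda>t. (cmod (\<phi> (s, t)))\<^sup>2)) integrable_on A" by (intro ii c2 \<phi>c)
  next
    fix s
    show "integral B (\<lambda>t. (cmod (\<phi> (s, t)))\<^sup>2) \<le> (\<Sum>j<m. 2 / k * (cmod (M j s))\<^sup>2) + 2 * k\<^sup>2 * integral B (\<lambda>t. (cmod (pt (s, t)))\<^sup>2)"
      unfolding B_def M_def J_def by (rule poincare_partition[OF dt _ k]) (intro continuous_on_slice pt)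
  qed
  also have "\<dots> = (\<Sum>j<m. 2 / k * integral A (\<lambda>s. (cmod (M j s))\<^sup>2))
      + 2 * k\<^sup>2 * integral A (\<lambda>s. integral B (\<lambda>t. (cmod (pt (s, t)))\<^sup>2))"
  proof (rule integral_unique, intro has_integral_add has_integral_sum has_integral_mult_right integrable_integral)
    show "(\<lambda>s. (cmod (M j s))\<^sup>2) integrable_on A" for j
      unfolding A_def by (intro integrable_continuous_real continuous_intros Mc)
    show "(\<lambda>s. integral B (\<lambda>t. (cmod (pt (s, t)))\<^sup>2)) integrable_on A" by (intro ii c2 pt)
  qed simp
  finally have 1: "integral A (\<lambda>s. integral B (\<lambda>t. (cmod (\<phi> (s, t)))\<^sup>2)) \<le>
      (\<Sum>j<m. 2 / k * integral A (\<lambda>s. (cmod (M j s))\<^sup>2))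
      + 2 * k\<^sup>2 * integral A (\<lambda>s. integral B (\<lambda>t. (cmod (pt (s, t)))\<^sup>2))" .
  have "(\<Sum>j<m. 2 / k * integral A (\<lambda>s. (cmod (M j s))\<^sup>2)) \<le>
      (\<Sum>j<m. 2 / k * ((\<Sum>i<n. 2 / l * (cmod (integral (I i) (M j)))\<^sup>2) + 2 * l\<^sup>2 * integral A (\<lambda>s. (cmod (M' j s))\<^sup>2)))"
  proof (rule sum_mono, rule mult_left_mono)
    fix j
    show "integral A (\<lambda>s. (cmod (M j s))\<^sup>2) \<le> (\<Sum>i<n. 2 / l * (cmod (integral (I i) (M j)))\<^sup>2) + 2 * l\<^sup>2 * integral A (\<lambda>s. (cmod (M' j s))\<^sup>2)"
      unfolding A_def I_def by (rule poincare_partition[OF _ Mc(2) l]) (use dM in \<open>simp add: A_def\<close>)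
  qed (use k in simp)
  also have "\<dots> = (\<Sum>j<m. \<Sum>i<n. 4 / (k * l) * (cmod (integral (I i) (M j)))\<^sup>2)
      + 4 * l\<^sup>2 / k * (\<Sum>j<m. integral A (\<lambda>s. (cmod (M' j s))\<^sup>2))"
    by (simp add: sum.distrib sum_distrib_left distrib_left mult.assoc algebra_simps)
  finally have 2: "(\<Sum>j<m. 2 / k * integral A (\<lambda>s. (cmod (M j s))\<^sup>2)) \<le>
      (\<Sum>j<m. \<Sum>i<n. 4 / (k * l) * (cmod (integral (I i) (M j)))\<^sup>2)
      + 4 * l\<^sup>2 / k * (\<Sum>j<m. integral A (\<lambda>s. (cmod (M' j s))\<^sup>2))" .
  have "(\<Sum>j<m. integral A (\<lambda>s. (cmod (M' j s))\<^sup>2)) \<le> k * integral A (\<lambda>s. integral B (\<lambda>t. (cmod (ps (s, t)))\<^sup>2))"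
  proof -
    have "(\<Sum>j<m. integral A (\<lambda>s. (cmod (M' j s))\<^sup>2)) = integral A (\<lambda>s. \<Sum>j<m. (cmod (M' j s))\<^sup>2)"
      unfolding A_def by (rule integral_sum[symmetric]) (auto intro!: integrable_continuous_real continuous_intros Mc)
    also have "\<dots> \<le> integral A (\<lambda>s. k * integral B (\<lambda>t. (cmod (ps (s, t)))\<^sup>2))"
    proof (rule integral_le)
      show "(\<lambda>s. \<Sum>j<m. (cmod (M' j s))\<^sup>2) integrable_on A"
        unfolding A_def by (intro integrable_continuous_real continuous_intros Mc)
      show "(\<lambda>s. k * integral B (\<lambda>t. (cmod (ps (s, t)))\<^sup>2)) integrable_on A"
        unfolding A_def B_def by (intro integrable_continuous_real continuous_intros continuous_on_inner_integral c2 ps)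
      fix s
      have "(\<Sum>j<m. (cmod (M' j s))\<^sup>2) \<le> (\<Sum>j<m. k * integral (J j) (\<lambda>t. (cmod (ps (s, t)))\<^sup>2))"
      proof (rule sum_mono)
        fix j
        have "cmod (M' j s) \<le> integral (J j) (\<lambda>t. cmod (ps (s, t)))"
          unfolding M'_def J_def
          by (rule integral_norm_bound_integral)
            (auto intro!: integrable_continuous_real continuous_intros continuous_on_slice ps)
        then have "(cmod (M' j s))\<^sup>2 \<le> (integral (J j) (\<lambda>t. cmod (ps (s, t))))\<^sup>2" by (intro power_mono) auto
        also have "\<dots> \<le> (b + real (Suc j) * k - (b + real j * k)) * integral (J j) (\<lambda>t. (cmod (ps (s, t)))\<^sup>2)"
          unfolding J_def by (rule square_integral_le)
            (use k in \<open>auto intro!: continuous_intros continuous_on_slice ps simp: algebra_simps\<close>)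
        finally show "(cmod (M' j s))\<^sup>2 \<le> k * integral (J j) (\<lambda>t. (cmod (ps (s, t)))\<^sup>2)"
          by (simp add: algebra_simps)
      qed
      also have "\<dots> = k * integral B (\<lambda>t. (cmod (ps (s, t)))\<^sup>2)"
        unfolding B_def J_def
        by (subst integral_partition[OF k]) (auto intro!: continuous_intros continuous_on_slice ps simp: sum_distrib_left)
      finally show "(\<Sum>j<m. (cmod (M' j s))\<^sup>2) \<le> k * integral B (\<lambda>t. (cmod (ps (s, t)))\<^sup>2)" .
    qed
    finally show ?thesis by simp
  qed
  then have "4 * l\<^sup>2 / k * (\<Sum>j<m. integral A (\<lambda>s. (cmod (M' j s))\<^sup>2)) \<le>
      4 * l\<^sup>2 / k * (k * integral A (\<lambda>s. integral B (\<lambda>t. (cmod (ps (s, t)))\<^sup>2)))"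
    using k by (intro mult_left_mono) auto
  also have "\<dots> = 4 * l\<^sup>2 * integral A (\<lambda>s. integral B (\<lambda>t. (cmod (ps (s, t)))\<^sup>2))" using k by simp
  finally have "integral A (\<lambda>s. integral B (\<lambda>t. (cmod (\<phi> (s, t)))\<^sup>2)) \<le>
      (\<Sum>j<m. \<Sum>i<n. 4 / (k * l) * (cmod (integral (I i) (M j)))\<^sup>2)
      + 4 * l\<^sup>2 * integral A (\<lambda>s. integral B (\<lambda>t. (cmod (ps (s, t)))\<^sup>2))
      + 2 * k\<^sup>2 * integral A (\<lambda>s. integral B (\<lambda>t. (cmod (pt (s, t)))\<^sup>2))"
    using 1 2 by linarith
  then show ?thesis by (simp only: A_def B_def I_def J_def M_def[abs_def])
qed

section \<open>Supports and fibres of test functions\<close>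

lemma C1c_R_support:
  assumes "C1c_R {-1<..<1} \<phi> \<phi>'"
  obtains \<rho> where "0 < \<rho>" "\<rho> < 1" "\<And>t. \<rho> \<le> \<bar>t\<bar> \<Longrightarrow> \<phi> t = 0 \<and> \<phi>' t = 0"
proof -
  define S where "S = closure {x. \<phi> x \<noteq> 0}"
  have S: "compact S" "S \<subseteq> {-1<..<1}" using assms by (auto simp: C1c_R_def S_def)
  have "\<exists>m. 0 \<le> m \<and> m < 1 \<and> (\<forall>t\<in>S. \<bar>t\<bar> \<le> m)"
  proof (cases "S = {}")
    case False
    have "continuous_on S (abs :: real \<Rightarrow> real)" by (intro continuous_intros)
    from continuous_attains_sup[OF S(1) False this] obtain x where "x \<in> S" "\<forall>t\<in>S. \<bar>t\<bar> \<le> \<bar>x\<bar>" by auto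
    moreover from this(1) S(2) have "x \<in> {-1<..<1}" by blast
    ultimately show ?thesis by (intro exI[of _ "\<bar>x\<bar>"]) auto
  qed (intro exI[of _ 0], simp)
  then obtain m where m: "0 \<le> m" "m < 1" "\<And>t. t \<in> S \<Longrightarrow> \<bar>t\<bar> \<le> m" by auto
  show ?thesis
  \<comment> \<open>The midpoint between m and 1: points beyond it lie in the open complement of the
    support, where the derivative vanishes as well.\<close>
  proof (rule that[of "(m + 1) / 2"])
    fix t :: real assume "(m + 1) / 2 \<le> \<bar>t\<bar>"
    then have "\<bar>t\<bar> > m" using m by (simp add: field_simps)
    then have tS: "t \<in> - S" using m(3) by force
    have op: "open (- S)" unfolding S_def by (rule open_Compl) (rule closed_closure)
    have z: "\<phi> x = 0" if "x \<in> - S" for x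
      using that closure_subset[of "{x. \<phi> x \<noteq> 0}"] by (auto simp: S_def)
    have "(\<phi> has_vector_derivative \<phi>' t) (at t)" using assms by (simp add: C1c_R_def)
    then have "((\<lambda>x. 0) has_vector_derivative \<phi>' t) (at t)"
      by (rule has_vector_derivative_transform_within_open[OF _ op tS]) (use z in simp)
    moreover have "((\<lambda>x. 0::complex) has_vector_derivative 0) (at t)" by simp
    ultimately have "\<phi>' t = 0" by (rule vector_derivative_unique_at)
    then show "\<phi> t = 0 \<and> \<phi>' t = 0" using z[OF tS] by simp
  qed (use m in auto)
qed

lemma C1c_R2_support:
  assumes "C1c_R2 Lam \<phi> ps pt"
  obtains R where "0 < R" "\<And>s t. R \<le> \<bar>s\<bar> \<or> 1 \<le> \<bar>t\<bar> \<Longrightarrow> \<phi> (s, t) = 0 \<and> ps (s, t) = 0 \<and> pt (s, t) = 0"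
proof -
  define S where "S = closure {x. \<phi> x \<noteq> 0}"
  have S: "compact S" "S \<subseteq> Lam" using assms by (auto simp: C1c_R2_def S_def)
  obtain m where m: "m > 0" "\<And>x. x \<in> S \<Longrightarrow> norm x \<le> m"
    using compact_imp_bounded[OF S(1)] by (auto simp: bounded_pos)
  show ?thesis
  proof (rule that[of "m + 1"])
    fix s t :: real assume st: "m + 1 \<le> \<bar>s\<bar> \<or> 1 \<le> \<bar>t\<bar>"
    have "\<bar>s\<bar> \<le> norm (s, t)" using norm_fst_le[of s t] by simp
    have tS: "(s, t) \<in> - S"
    proof
      assume st': "(s, t) \<in> S"
      then have "(s, t) \<in> Lam" using S(2) by blast
      then show False using st m(2)[OF st'] \<open>\<bar>s\<bar> \<le> norm (s, t)\<close> by (auto simp: Lam_def)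
    qed
    have op: "open (- S)" unfolding S_def by (rule open_Compl) (rule closed_closure)
    have z: "\<phi> x = 0" if "x \<in> - S" for x
      using that closure_subset[of "{x. \<phi> x \<noteq> 0}"] by (auto simp: S_def)
    have "(\<phi> has_derivative (\<lambda>h. fst h *\<^sub>R ps (s, t) + snd h *\<^sub>R pt (s, t))) (at (s, t))"
      using assms by (simp add: C1c_R2_def)
    then have "((\<lambda>x. 0) has_derivative (\<lambda>h. fst h *\<^sub>R ps (s, t) + snd h *\<^sub>R pt (s, t))) (at (s, t))"
      by (rule has_derivative_transform_within_open[OF _ op tS]) (use z in simp)
    from has_derivative_unique[OF this has_derivative_const]
    have "fst h *\<^sub>R ps (s, t) + snd h *\<^sub>R pt (s, t) = 0" for h :: "real \<times> real" by meson
    from this[of "(1, 0)"] this[of "(0, 1)"] z[OF tS]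
    show "\<phi> (s, t) = 0 \<and> ps (s, t) = 0 \<and> pt (s, t) = 0" by simp
  qed (use m in simp)
qed

text \<open>The support of a fibre lies in the projection of a compact subset of the strip, hence
  stays away from the ends.\<close>

lemma C1c_R2_slice:
  assumes "C1c_R2 Lam \<phi> ps pt"
  shows "C1c_R {-1<..<1} (\<lambda>t. \<phi> (s, t)) (\<lambda>t. pt (s, t))"
  unfolding C1c_R_def
proof (intro conjI allI)
  have pt: "continuous_on UNIV pt" and d: "(\<phi> has_derivative (\<lambda>h. fst h *\<^sub>R ps x + snd h *\<^sub>R pt x)) (at x)" for x
    using assms unfolding C1c_R2_def by blast+
  show "continuous_on UNIV (\<lambda>t. pt (s, t))" by (intro continuous_on_slice pt)
  show "((\<lambda>t. \<phi> (s, t)) has_vector_derivative pt (s, t)) (at t)" for t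
  proof -
    have "((\<lambda>t. (s, t)) has_derivative (\<lambda>h. (0, h))) (at t)"
      by (auto intro!: derivative_eq_intros)
    from has_derivative_compose[OF this d] show ?thesis by (simp add: has_vector_derivative_def)
  qed
  define S where "S = closure {x. \<phi> x \<noteq> 0}"
  have S: "compact S" "S \<subseteq> Lam" using assms by (auto simp: C1c_R2_def S_def)
  have "compact (snd ` (S \<inter> {s} \<times> UNIV))"
    by (intro compact_continuous_image compact_Int_closed S closed_Times continuous_intros closed_UNIV closed_singleton)
  then have cl: "closed (snd ` (S \<inter> {s} \<times> UNIV))" and co: "compact (snd ` (S \<inter> {s} \<times> UNIV))"
    by (auto intro: compact_imp_closed)
  have sub: "{t. \<phi> (s, t) \<noteq> 0} \<subseteq> snd ` (S \<inter> {s} \<times> UNIV)"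
    using closure_subset[of "{x. \<phi> x \<noteq> 0}"] by (force simp: S_def image_iff)
  then have c: "closure {t. \<phi> (s, t) \<noteq> 0} \<subseteq> snd ` (S \<inter> {s} \<times> UNIV)"
    using cl by (rule closure_minimal)
  show "closure {t. \<phi> (s, t) \<noteq> 0} \<subseteq> {-1<..<1}"
    using c S(2) by (force simp: Lam_def)
  show "compact (closure {t. \<phi> (s, t) \<noteq> 0})"
    using compact_Int_closed[OF co closed_closure[of "{t. \<phi> (s, t) \<noteq> 0}"]] c
    by (simp add: inf.absorb2)
qed

text \<open>Picone's identity: the integrand \<open>p * \<bar>\<phi>'\<bar>\<^sup>2 - r * \<bar>\<phi>\<bar>\<^sup>2\<close> is the sum of
  \<open>p * \<bar>\<phi>' - (u' / u) * \<phi>\<bar>\<^sup>2\<close> and the derivative of \<open>(p * u' / u) * \<bar>\<phi>\<bar>\<^sup>2\<close>.\<close>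

lemma picone:
  assumes \<phi>: "C1c_R {-1<..<1} \<phi> \<phi>'"
    and u: "\<And>t. t \<in> {-1<..<1} \<Longrightarrow> u t > 0"
    and du: "\<And>t. t \<in> {-1<..<1} \<Longrightarrow> (u has_real_derivative u' t) (at t)"
    and dpu: "\<And>t. t \<in> {-1<..<1} \<Longrightarrow> ((\<lambda>t. p t * u' t) has_real_derivative - r t * u t) (at t)"
    and p: "continuous_on {-1..1} p" "\<And>t. t \<in> {-1..1} \<Longrightarrow> p t \<ge> 0"
    and r: "continuous_on {-1..1} r"
  shows "integral {-1..1} (\<lambda>t. r t * (cmod (\<phi> t))\<^sup>2) \<le> integral {-1..1} (\<lambda>t. p t * (cmod (\<phi>' t))\<^sup>2)"
proof -
  obtain \<rho> where \<rho>: "0 < \<rho>" "\<rho> < 1" "\<And>t. \<rho> \<le> \<bar>t\<bar> \<Longrightarrow> \<phi> t = 0 \<and> \<phi>' t = 0"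
    using C1c_R_support[OF \<phi>] by blast
  have d\<phi>: "(\<phi> has_vector_derivative \<phi>' t) (at t)" for t using \<phi> by (simp add: C1c_R_def)
  have \<phi>'c: "continuous_on UNIV \<phi>'" using \<phi> by (simp add: C1c_R_def)
  have \<phi>c: "continuous_on UNIV \<phi>"
    using d\<phi> has_vector_derivative_continuous continuous_at_imp_continuous_on by blast
  have sub: "{-\<rho>..\<rho>} \<subseteq> {-1..1}" using \<rho> by auto
  have cp: "continuous_on {-\<rho>..\<rho>} p" "continuous_on {-\<rho>..\<rho>} r"
    "continuous_on {-\<rho>..\<rho>} \<phi>" "continuous_on {-\<rho>..\<rho>} \<phi>'"
    using sub p(1) r \<phi>c \<phi>'c by (meson continuous_on_subset subset_UNIV)+
  have i1: "(\<lambda>t. r t * (cmod (\<phi> t))\<^sup>2) integrable_on {-\<rho>..\<rho>}"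
    and i2: "(\<lambda>t. p t * (cmod (\<phi>' t))\<^sup>2) integrable_on {-\<rho>..\<rho>}"
    by (intro integrable_continuous_real continuous_intros cp)+
  \<comment> \<open>Both integrals are reduced to an interval inside (-1, 1) that carries \<phi>: u
    may vanish at the ends, so u' / u is available only in the interior.\<close>
  have "integral {-1..1} (\<lambda>t. r t * (cmod (\<phi> t))\<^sup>2) = integral {-\<rho>..\<rho>} (\<lambda>t. r t * (cmod (\<phi> t))\<^sup>2)"
    by (intro integral_unique has_integral_on_superset[OF integrable_integral[OF i1] _ sub]) (use \<rho>(3) in force)
  moreover have "integral {-1..1} (\<lambda>t. p t * (cmod (\<phi>' t))\<^sup>2) = integral {-\<rho>..\<rho>} (\<lambda>t. p t * (cmod (\<phi>' t))\<^sup>2)"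
    by (intro integral_unique has_integral_on_superset[OF integrable_integral[OF i2] _ sub]) (use \<rho>(3) in force)
  moreover have "integral {-\<rho>..\<rho>} (\<lambda>t. r t * (cmod (\<phi> t))\<^sup>2) \<le> integral {-\<rho>..\<rho>} (\<lambda>t. p t * (cmod (\<phi>' t))\<^sup>2)"
  proof -
    define G where "G t = (p t * u' t / u t) * (inner (\<phi> t) (\<phi> t))" for t
    define G' where "G' t = ((- r t * u t) * u t - (p t * u' t) * u' t) / (u t * u t) * inner (\<phi> t) (\<phi> t)
        + (p t * u' t / u t) * (inner (\<phi> t) (\<phi>' t) + inner (\<phi>' t) (\<phi> t))" for t
    have dG: "(G has_real_derivative G' t) (at t within {-\<rho>..\<rho>})" if t: "t \<in> {-\<rho>..\<rho>}" for t
    proof -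
      have t': "t \<in> {-1<..<1}" using t \<rho> by auto
      have "((\<lambda>t. inner (\<phi> t) (\<phi> t)) has_real_derivative (inner (\<phi> t) (\<phi>' t) + inner (\<phi>' t) (\<phi> t))) (at t)"
        unfolding has_real_derivative_iff_has_vector_derivative
        using has_derivative_inner[OF d\<phi>[of t, unfolded has_vector_derivative_def] d\<phi>[of t, unfolded has_vector_derivative_def]]
        by (simp add: has_vector_derivative_def distrib_left)
      from DERIV_mult[OF DERIV_divide[OF dpu[OF t'] du[OF t']] this]
      have "(G has_real_derivative G' t) (at t)"
        unfolding G_def[abs_def] by (rule DERIV_cong) (use u[OF t'] in \<open>auto simp: G'_def mult.commute\<close>)
      then show ?thesis by (rule has_field_derivative_at_within)
    qed
    have "(G' has_integral (G \<rho> - G (-\<rho>))) {-\<rho>..\<rho>}"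
      by (rule fundamental_theorem_of_calculus)
        (use \<rho> dG in \<open>auto simp: has_real_derivative_iff_has_vector_derivative\<close>)
    then have G'i: "(G' has_integral 0) {-\<rho>..\<rho>}" using \<rho>(3)[of \<rho>] \<rho>(3)[of "-\<rho>"] by (simp add: G_def)
    have "((\<lambda>t. p t * (cmod (\<phi>' t))\<^sup>2 - r t * (cmod (\<phi> t))\<^sup>2) has_integral
        (integral {-\<rho>..\<rho>} (\<lambda>t. p t * (cmod (\<phi>' t))\<^sup>2) - integral {-\<rho>..\<rho>} (\<lambda>t. r t * (cmod (\<phi> t))\<^sup>2))) {-\<rho>..\<rho>}"
      by (intro has_integral_diff integrable_integral i1 i2)
    note hi = this
    have "0 \<le> integral {-\<rho>..\<rho>} (\<lambda>t. p t * (cmod (\<phi>' t))\<^sup>2) - integral {-\<rho>..\<rho>} (\<lambda>t. r t * (cmod (\<phi> t))\<^sup>2)"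
    proof (rule has_integral_le[OF G'i hi])
      fix t assume t: "t \<in> {-\<rho>..\<rho>}"
      then have ut: "u t > 0" using u[of t] \<rho> by auto
      define c where "c = u' t / u t"
      have "p t * (cmod (\<phi>' t))\<^sup>2 - r t * (cmod (\<phi> t))\<^sup>2 - G' t =
          p t * inner (\<phi>' t - c *\<^sub>R \<phi> t) (\<phi>' t - c *\<^sub>R \<phi> t)"
        using ut unfolding G'_def power2_norm_eq_inner
        by (simp add: c_def inner_simps inner_commute field_simps)
      also have "\<dots> \<ge> 0" using p(2)[of t] t \<rho> by (intro mult_nonneg_nonneg) auto
      finally show "G' t \<le> p t * (cmod (\<phi>' t))\<^sup>2 - r t * (cmod (\<phi> t))\<^sup>2" by simp
    qed
    then show ?thesis by simp
  qed
  ultimately show ?thesis by simp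
qed

section \<open>Extension by zero and Sobolev functions\<close>

text \<open>The Hilbert space consists of functions on the whole space; a function given on S enters
  it through this extension.\<close>

definition zext :: "'a set \<Rightarrow> ('a \<Rightarrow> complex) \<Rightarrow> 'a \<Rightarrow> complex" where
  "zext S f x = (if x \<in> S then f x else 0)"

lemma zext_measurable [measurable]:
  fixes f :: "'a::euclidean_space \<Rightarrow> complex"
  assumes [measurable]: "f \<in> borel_measurable lborel" "S \<in> sets borel"
  shows "zext S f \<in> borel_measurable lborel"
  unfolding zext_def[abs_def] by measurable

lemma cmod_zext_sq: "(cmod (zext S f x))\<^sup>2 = indicator S x *\<^sub>R (cmod (f x))\<^sup>2"
  by (simp add: zext_def)

lemma zext_diff: "zext S f x - zext S g x = zext S (\<lambda>x. f x - g x) x"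
  by (simp add: zext_def)

lemma sq_int_zext:
  fixes f :: "'a::euclidean_space \<Rightarrow> complex"
  assumes "L2w S (\<lambda>_. 1) f" "S \<in> sets borel"
  shows "sq_int (zext S f)"
  unfolding sq_int_def
proof
  show "zext S f \<in> borel_measurable lborel" using assms by (intro zext_measurable) (auto simp: L2w_def)
  show "integrable lborel (\<lambda>x. (cmod (zext S f x))\<^sup>2)"
    using assms unfolding cmod_zext_sq by (simp add: L2w_def set_integrable_def)
qed

lemma norm_cls_zext_sq:
  fixes f :: "'a::euclidean_space \<Rightarrow> complex"
  shows "sq_int (zext S f) \<Longrightarrow> (norm (cls (zext S f)))\<^sup>2 = (LINT x:S|lborel. (cmod (f x))\<^sup>2)"
  by (simp add: norm_cls_sq cmod_zext_sq set_lebesgue_integral_def)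

lemma norm_cls_zext_diff_sq:
  fixes f :: "'a::euclidean_space \<Rightarrow> complex"
  assumes "sq_int (zext S f)" "sq_int (zext S g)"
  shows "(norm (cls (zext S f) - cls (zext S g)))\<^sup>2 = (LINT x:S|lborel. (cmod (f x - g x))\<^sup>2)"
  by (simp add: norm_cls_diff_sq assms zext_diff cmod_zext_sq set_lebesgue_integral_def)

text \<open>Translates the convergence of integrals in the definitions of the Sobolev spaces into
  norm convergence.\<close>

lemma tendsto_cls_zext_iff:
  fixes f :: "nat \<Rightarrow> 'a::euclidean_space \<Rightarrow> complex"
  assumes "\<And>n. sq_int (zext S (f n))" "sq_int (zext S g)"
  shows "(\<lambda>n. cls (zext S (f n))) \<longlonglongrightarrow> cls (zext S g) \<longleftrightarrow>
    (\<lambda>n. LINT x:S|lborel. (cmod (f n x - g x))\<^sup>2) \<longlonglongrightarrow> 0"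
proof -
  have "(\<lambda>n. cls (zext S (f n))) \<longlonglongrightarrow> cls (zext S g) \<longleftrightarrow> (\<lambda>n. norm (cls (zext S (f n)) - cls (zext S g))) \<longlonglongrightarrow> 0"
    by (metis LIM_zero_iff tendsto_norm_zero_iff)
  also have "\<dots> \<longleftrightarrow> (\<lambda>n. (norm (cls (zext S (f n)) - cls (zext S g)))\<^sup>2) \<longlonglongrightarrow> 0"
  proof
    assume "(\<lambda>n. norm (cls (zext S (f n)) - cls (zext S g))) \<longlonglongrightarrow> 0"
    from tendsto_power[OF this, of 2] show "(\<lambda>n. (norm (cls (zext S (f n)) - cls (zext S g)))\<^sup>2) \<longlonglongrightarrow> 0" by simp
  next
    assume "(\<lambda>n. (norm (cls (zext S (f n)) - cls (zext S g)))\<^sup>2) \<longlonglongrightarrow> 0"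
    from tendsto_real_sqrt[OF this] show "(\<lambda>n. norm (cls (zext S (f n)) - cls (zext S g))) \<longlonglongrightarrow> 0" by simp
  qed
  finally show ?thesis by (simp add: norm_cls_zext_diff_sq assms)
qed

lemma norm_cls_mult_le:
  assumes f: "sq_int f" and m: "m \<in> borel_measurable lborel" "\<And>x. cmod (m x) \<le> C"
  shows "norm (cls (\<lambda>x. m x * f x)) \<le> C * norm (cls f)"
proof -
  have sq: "sq_int (\<lambda>x. m x * f x)" by (rule sq_int_mult_bounded[OF f m])
  have C: "C \<ge> 0" using m(2)[of undefined] norm_ge_zero order_trans by blast
  have "(norm (cls (\<lambda>x. m x * f x)))\<^sup>2 \<le> (LINT x|lborel. C\<^sup>2 * (cmod (f x))\<^sup>2)"
    unfolding norm_cls_sq[OF sq]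
  proof (rule integral_mono)
    show "integrable lborel (\<lambda>x. (cmod (m x * f x))\<^sup>2)" by (rule sq_int_integrable[OF sq])
    show "integrable lborel (\<lambda>x. C\<^sup>2 * (cmod (f x))\<^sup>2)" using sq_int_integrable[OF f] by simp
    show "(cmod (m x * f x))\<^sup>2 \<le> C\<^sup>2 * (cmod (f x))\<^sup>2" for x
      unfolding norm_mult power_mult_distrib by (intro mult_right_mono power_mono m) auto
  qed
  also have "\<dots> = (C * norm (cls f))\<^sup>2" by (simp add: norm_cls_sq[OF f] power_mult_distrib)
  finally show ?thesis by (rule power2_le_imp_le) (use C in simp)
qed

lemma sq_int_zext_continuous:
  fixes f :: "real \<Rightarrow> complex"
  assumes f: "continuous_on {-1..1} f"
  shows "sq_int (zext {-1<..<1} f)"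
proof -
  obtain B where "\<forall>y\<in>f ` {-1..1}. cmod y \<le> B"
    using compact_imp_bounded[OF compact_continuous_image[OF f compact_Icc]] by (auto simp: bounded_iff)
  then have B: "cmod (f x) \<le> B" if "x \<in> {-1..1}" for x using that by blast
  show ?thesis
  proof (rule sq_int_bound)
  have "(\<lambda>x. indicator {-1<..<1} x *\<^sub>R f x) \<in> borel_measurable borel"
    by (rule borel_measurable_continuous_on_indicator) (auto intro: continuous_on_subset[OF f])
  also have "(\<lambda>x. indicator {-1<..<1} x *\<^sub>R f x) = zext {-1<..<1} f" by (auto simp: zext_def fun_eq_iff)
  finally show "zext {-1<..<1} f \<in> borel_measurable lborel" by simp
  show "integrable lborel (\<lambda>x. indicator {-1<..<1::real} x *\<^sub>R B\<^sup>2)" by simp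
  show "AE x in lborel. (cmod (zext {-1<..<1} f x))\<^sup>2 \<le> indicator {-1<..<1} x *\<^sub>R B\<^sup>2"
    using B by (auto simp: zext_def intro!: AE_I2 power_mono)
  qed
qed

lemma L2w_zext_iff:
  assumes "sq_int (zext S f)" "f \<in> borel_measurable lborel"
  shows "L2w S (\<lambda>_. 1) f"
  using assms sq_int_integrable[OF assms(1)]
  unfolding cmod_zext_sq by (simp add: L2w_def set_integrable_def)

lemma C1c_R_continuous:
  assumes "C1c_R U \<phi> \<phi>'"
  shows "continuous_on S \<phi>" "continuous_on S \<phi>'"
proof -
  have d: "(\<phi> has_vector_derivative \<phi>' t) (at t)" for t using assms by (simp add: C1c_R_def)
  have "continuous_on UNIV \<phi>"
    by (intro continuous_at_imp_continuous_on ballI has_vector_derivative_continuous[OF d])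
  moreover have "continuous_on UNIV \<phi>'" using assms by (simp add: C1c_R_def)
  ultimately show "continuous_on S \<phi>" "continuous_on S \<phi>'" by (auto intro: continuous_on_subset)
qed

lemma LINT_Ioo_eq_integral:
  fixes g :: "real \<Rightarrow> real"
  assumes g: "continuous_on {-1..1} g" and z: "g (-1) = 0" "g 1 = 0"
  shows "(LINT t:{-1<..<1}|lborel. g t) = integral {-1..1} g"
proof -
  have "(LINT t:{-1<..<1}|lborel. g t) = (LINT t:{-1..1}|lborel. g t)"
    unfolding set_lebesgue_integral_def
  proof (intro Bochner_Integration.integral_cong refl)
    fix x :: real
    show "indicator {-1<..<1} x *\<^sub>R g x = indicator {-1..1} x *\<^sub>R g x"
      by (cases "x = 1"; cases "x = -1") (use z in \<open>auto simp: indicator_def\<close>)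
  qed
  also have "\<dots> = integral {-1..1} g"
    by (rule set_borel_integral_eq_integral(2)) (rule borel_integrable_atLeastAtMost'[OF g])
  finally show ?thesis .
qed

text \<open>Squaring the positive part makes it continuously differentiable. It is the source of
  differentiable functions with prescribed support, here and in \<open>chi\<close>.\<close>

lemma max_sq_deriv: "((\<lambda>y::real. (max 0 y)\<^sup>2) has_real_derivative 2 * max 0 y) (at y)"
proof -
  consider "y > 0" | "y < 0" | "y = 0" by linarith
  then show ?thesis
  proof cases
    case 1
    have "((\<lambda>y. y\<^sup>2) has_real_derivative 2 * max 0 y) (at y)"
      using 1 by (auto intro!: derivative_eq_intros)
    then show ?thesis
      by (rule has_field_derivative_transform_within_open[where S="{0<..}"]) (use 1 in auto)
  next
    case 2
    have "((\<lambda>y. 0) has_real_derivative 2 * max 0 y) (at y)" using 2 by simp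
    then show ?thesis
      by (rule has_field_derivative_transform_within_open[where S="{..<0}"]) (use 2 in auto)
  next
    case 3
    have "((\<lambda>h::real. (max 0 h)\<^sup>2 / h) \<longlongrightarrow> 0) (at 0)"
    proof (rule Lim_null_comparison)
      have "norm ((max 0 h)\<^sup>2 / h) \<le> \<bar>h\<bar>" for h :: real
        by (cases "h > 0") (auto simp: power2_eq_square max_def)
      then show "\<forall>\<^sub>F h::real in at 0. norm ((max 0 h)\<^sup>2 / h) \<le> \<bar>h\<bar>" by simp
      show "((\<lambda>h::real. \<bar>h\<bar>) \<longlongrightarrow> 0) (at 0)" by (intro tendsto_eq_intros) auto
    qed
    then show ?thesis using 3 by (simp add: DERIV_def)
  qed
qed

text \<open>The approximants are \<open>(max 0 (w - \<delta>))\<^sup>2 / w\<close>, whose support is \<open>{w \<ge> \<delta>}\<close>.\<close>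

lemma H10_R_positive:
  fixes w w' :: "real \<Rightarrow> real"
  assumes d: "\<And>t. t \<in> {-1..1} \<Longrightarrow> (w has_real_derivative w' t) (at t within {-1..1})"
    and w': "continuous_on {-1..1} w'"
    and pos: "\<And>t. t \<in> {-1<..<1} \<Longrightarrow> w t > 0" and bd: "w (-1) = 0" "w 1 = 0"
  shows "H10_R {-1<..<1} (zext {-1<..<1} (\<lambda>t. of_real (w t))) (zext {-1<..<1} (\<lambda>t. of_real (w' t)))"
proof -
  let ?U = "{-1<..<1::real}"
  have pos': "w t \<noteq> 0" if "-1 < t" "t < 1" for t using pos[of t] that by auto
  have wc: "continuous_on {-1..1} w" using d by (intro DERIV_continuous_on)
  have d_at: "(w has_real_derivative w' t) (at t)" if "t \<in> ?U" for t
    using d[of t] that at_within_Icc_at[of "-1" t 1] by auto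
  define \<delta> where "\<delta> n = 1 / real (Suc n)" for n
  have \<delta>: "\<delta> n > 0" for n by (simp add: \<delta>_def)
  have \<delta>0: "\<delta> \<longlonglongrightarrow> 0" unfolding \<delta>_def by (rule LIMSEQ_inverse_real_of_nat[unfolded inverse_eq_divide])
  define M where "M n t = max 0 (w t - \<delta> n)" for n t
  define K where "K n = {t \<in> {-1..1}. \<delta> n \<le> w t}" for n
  have Kc: "compact (K n)" for n
  proof -
    have "K n = {-1..1} \<inter> w -` {\<delta> n..}" by (auto simp: K_def)
    moreover have "closed ({-1..1} \<inter> w -` {\<delta> n..})"
      by (intro continuous_closed_preimage wc) auto
    ultimately have "closed (K n)" by simp
    moreover have "bounded (K n)" by (rule bounded_subset[of "{-1..1}"]) (auto simp: K_def)
    ultimately show ?thesis by (simp add: compact_eq_bounded_closed)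
  qed
  \<comment> \<open>The boundary values 0 lie below \<delta> n, which keeps the compact set K n
    inside the open interval.\<close>
  have KU: "K n \<subseteq> ?U" for n
    using \<delta>[of n] bd by (auto simp: K_def) (metis less_le_not_le order_le_less)+
  define \<phi> where "\<phi> n t = complex_of_real (if t \<in> ?U then (M n t)\<^sup>2 / w t else 0)" for n t
  define \<phi>' where "\<phi>' n t = complex_of_real (if t \<in> ?U then w' t * (M n t * (2 * w t - M n t) / (w t)\<^sup>2) else 0)" for n t
  have zK: "\<phi> n t = 0" "\<phi>' n t = 0" if "t \<notin> K n" for n t
    using that by (auto simp: \<phi>_def \<phi>'_def K_def M_def max_def)
  have opK: "open (- K n)" for n using compact_imp_closed[OF Kc] by (simp add: open_Compl)
  \<comment> \<open>An open cover: the derivative is given by a formula on the first set and is zero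
    on the second, so continuity can be checked on each.\<close>
  have un: "UNIV = ?U \<union> - K n" for n using KU[of n] by auto
  have Mc: "continuous_on ?U (M n)" for n
    unfolding M_def by (intro continuous_intros continuous_on_subset[OF wc]) auto
  have \<phi>'c: "continuous_on UNIV (\<phi>' n)" for n
  proof -
    have "continuous_on ?U (\<lambda>t. complex_of_real (w' t * (M n t * (2 * w t - M n t) / (w t)\<^sup>2)))"
      using pos by (intro continuous_intros Mc continuous_on_subset[OF wc] continuous_on_subset[OF w']) (auto simp: pos')
    then have "continuous_on ?U (\<phi>' n)"
      by (rule continuous_on_eq) (simp add: \<phi>'_def)
    moreover have "continuous_on (- K n) (\<phi>' n)"
      by (rule continuous_on_eq[of _ "\<lambda>_. 0"]) (auto simp: zK)
    ultimately show ?thesis unfolding un[of n]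
      by (intro continuous_on_open_Un opK) auto
  qed
  have d\<phi>: "(\<phi> n has_vector_derivative \<phi>' n t) (at t)" for n t
  proof (cases "t \<in> ?U")
    case True
    have wt: "w t > 0" using pos True .
    have "((\<lambda>t. (M n t)\<^sup>2) has_real_derivative 2 * M n t * w' t) (at t)"
      unfolding M_def
      using DERIV_chain2[where f="\<lambda>y. (max 0 y)\<^sup>2" and g="\<lambda>t. w t - \<delta> n",
          OF max_sq_deriv DERIV_diff[OF d_at[OF True] DERIV_const]] by simp
    from DERIV_divide[OF this d_at[OF True]]
    have "((\<lambda>t. (M n t)\<^sup>2 / w t) has_real_derivative w' t * (M n t * (2 * w t - M n t) / (w t)\<^sup>2)) (at t)"
      by (rule DERIV_cong) (use wt in \<open>auto simp: power2_eq_square field_simps\<close>)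
    then have "((\<lambda>t. complex_of_real ((M n t)\<^sup>2 / w t)) has_vector_derivative \<phi>' n t) (at t)"
      unfolding \<phi>'_def using True by (simp only: if_True has_vector_derivative_of_real)
    then show ?thesis
      by (rule has_vector_derivative_transform_within_open[where S="?U"]) (use True in \<open>auto simp: \<phi>_def\<close>)
  next
    case False
    then have t: "t \<in> - K n" using KU[of n] by blast
    have "((\<lambda>t. 0) has_vector_derivative \<phi>' n t) (at t)" using t zK by simp
    then show ?thesis
      by (rule has_vector_derivative_transform_within_open[OF _ opK t]) (simp add: zK)
  qed
  have C1c: "C1c_R ?U (\<phi> n) (\<phi>' n)" for n
    unfolding C1c_R_def
  proof (intro conjI allI \<phi>'c d\<phi>)
    have "closure {x. \<phi> n x \<noteq> 0} \<subseteq> K n"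
      by (rule closure_minimal) (use zK compact_imp_closed[OF Kc] in auto)
    then show "closure {x. \<phi> n x \<noteq> 0} \<subseteq> ?U" "compact (closure {x. \<phi> n x \<noteq> 0})"
      using KU[of n] compact_Int_closed[OF Kc[of n] closed_closure[of "{x. \<phi> n x \<noteq> 0}"]]
      by (auto simp: inf.absorb2)
  qed
  obtain B where B: "\<And>x. x \<in> {-1..1} \<Longrightarrow> \<bar>w' x\<bar> \<le> B" "B \<ge> 0" by (rule bounded_on_Icc[OF w']) blast
  have sq: "sq_int (zext ?U (\<lambda>t. complex_of_real (w t)))" "sq_int (zext ?U (\<lambda>t. complex_of_real (w' t)))"
    by (intro sq_int_zext_continuous continuous_intros wc w')+
  have rsrs: "zext ?U (zext ?U f) = zext ?U f" for f by (auto simp: zext_def)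
  have L2: "L2w ?U (\<lambda>_. 1) (zext ?U f)" if "sq_int (zext ?U f)" for f
    by (rule L2w_zext_iff) (simp_all only: rsrs that sq_int_measurable[OF that])
  have Mw: "0 \<le> M n t" "M n t \<le> w t" "w t - M n t \<le> \<delta> n" if "t \<in> ?U" for n t
    using pos[OF that] \<delta>[of n] by (auto simp: M_def)
  \<comment> \<open>The error is - (w - M) (w + M) / w; here w - M is at most \<delta> and (w + M) /
    w at most 2.\<close>
  have bound1: "(cmod (\<phi> n t - zext ?U (\<lambda>t. complex_of_real (w t)) t))\<^sup>2 \<le> (2 * \<delta> n)\<^sup>2" if t: "t \<in> ?U" for n t
  proof -
    have "\<phi> n t - zext ?U (\<lambda>t. complex_of_real (w t)) t = of_real ((M n t)\<^sup>2 / w t - w t)"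
      using t by (simp add: \<phi>_def zext_def)
    also have "cmod \<dots> = (w t - M n t) * ((w t + M n t) / w t)"
    proof -
      have "(M n t)\<^sup>2 / w t - w t = - ((w t - M n t) * ((w t + M n t) / w t))"
        using pos[OF t] by (simp add: field_simps power2_eq_square)
      moreover have "(w t - M n t) * ((w t + M n t) / w t) \<ge> 0"
        using Mw[OF t, of n] pos[OF t] by (intro mult_nonneg_nonneg divide_nonneg_pos) auto
      ultimately show ?thesis by (simp only: norm_of_real abs_minus_cancel abs_of_nonneg)
    qed
    also have "\<dots> \<le> \<delta> n * 2"
      using Mw[OF t, of n] pos[OF t] by (intro mult_mono) (auto simp: field_simps)
    finally show ?thesis by (intro power_mono) auto
  qed
  have conv1: "(\<lambda>n. LINT t:?U|lborel. (cmod (\<phi> n t - zext ?U (\<lambda>t. complex_of_real (w t)) t))\<^sup>2) \<longlonglongrightarrow> 0"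
  proof (rule Lim_null_comparison)
    have cont: "continuous_on ?U (\<lambda>t. (cmod (\<phi> n t - zext ?U (\<lambda>t. complex_of_real (w t)) t))\<^sup>2)" for n
    proof -
      have "continuous_on ?U (\<lambda>t. (cmod (\<phi> n t - complex_of_real (w t)))\<^sup>2)"
        by (intro continuous_intros C1c_R_continuous[OF C1c] continuous_on_subset[OF wc]) auto
      then show ?thesis by (rule continuous_on_eq) (simp add: zext_def)
    qed
    have "norm (LINT t:?U|lborel. (cmod (\<phi> n t - zext ?U (\<lambda>t. complex_of_real (w t)) t))\<^sup>2)
        \<le> (LINT t:?U|lborel. (2 * \<delta> n)\<^sup>2)" for n
      unfolding set_lebesgue_integral_def
    proof (rule Bochner_Integration.integral_norm_bound_integral)
      show "integrable lborel (\<lambda>x. indicator ?U x *\<^sub>R (2 * \<delta> n)\<^sup>2)" by simp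
      then show "integrable lborel (\<lambda>x. indicator ?U x *\<^sub>R (cmod (\<phi> n x - zext ?U (\<lambda>t. complex_of_real (w t)) x))\<^sup>2)"
      proof (rule Bochner_Integration.integrable_bound)
        show "(\<lambda>x. indicator ?U x *\<^sub>R (cmod (\<phi> n x - zext ?U (\<lambda>t. complex_of_real (w t)) x))\<^sup>2) \<in> borel_measurable lborel"
          using borel_measurable_continuous_on_indicator[OF _ cont] by simp
        show "AE x in lborel. norm (indicator ?U x *\<^sub>R (cmod (\<phi> n x - zext ?U (\<lambda>t. complex_of_real (w t)) x))\<^sup>2)
            \<le> norm (indicator ?U x *\<^sub>R (2 * \<delta> n)\<^sup>2)"
          using bound1 by (intro AE_I2) (auto simp: indicator_def)
      qed
      show "norm (indicator ?U x *\<^sub>R (cmod (\<phi> n x - zext ?U (\<lambda>t. complex_of_real (w t)) x))\<^sup>2)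
          \<le> indicator ?U x *\<^sub>R (2 * \<delta> n)\<^sup>2" for x
        using bound1 by (auto simp: indicator_def)
    qed
    then show "\<forall>\<^sub>F n in sequentially. norm (LINT t:?U|lborel. (cmod (\<phi> n t - zext ?U (\<lambda>t. complex_of_real (w t)) t))\<^sup>2)
        \<le> 8 * (\<delta> n)\<^sup>2"
      by (auto simp: set_lebesgue_integral_def power_mult_distrib)
    have "(\<lambda>n. 8 * (\<delta> n)\<^sup>2) \<longlonglongrightarrow> 8 * 0\<^sup>2" by (intro tendsto_intros \<delta>0)
    then show "(\<lambda>n. 8 * (\<delta> n)\<^sup>2) \<longlonglongrightarrow> 0" by simp
  qed
  \<comment> \<open>This error tends to 0 pointwise but need not do so uniformly near the ends,
    where w is small and w' is not; hence dominated convergence with the bound B^2 on its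
    square.\<close>
  have eq2: "\<phi>' n t - zext ?U (\<lambda>t. complex_of_real (w' t)) t = of_real (- w' t * ((w t - M n t) / w t)\<^sup>2)"
    if t: "t \<in> ?U" for n t
  proof -
    have "w' t * (M n t * (2 * w t - M n t) / (w t)\<^sup>2) - w' t = - w' t * ((w t - M n t) / w t)\<^sup>2"
      using pos[OF t] by (simp add: field_simps power2_eq_square)
    then show ?thesis using t by (simp only: \<phi>'_def zext_def if_True of_real_diff[symmetric])
  qed
  have conv2: "(\<lambda>n. LINT t:?U|lborel. (cmod (\<phi>' n t - zext ?U (\<lambda>t. complex_of_real (w' t)) t))\<^sup>2) \<longlonglongrightarrow> 0"
  proof -
    have "(\<lambda>n. LINT t|lborel. indicator ?U t *\<^sub>R (cmod (\<phi>' n t - zext ?U (\<lambda>t. complex_of_real (w' t)) t))\<^sup>2)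
        \<longlonglongrightarrow> (LINT t|(lborel::real measure). 0)"
    proof (rule integral_dominated_convergence)
      show "integrable lborel (\<lambda>t. indicator ?U t *\<^sub>R B\<^sup>2)" by simp
      show "(\<lambda>t. indicator ?U t *\<^sub>R (cmod (\<phi>' n t - zext ?U (\<lambda>t. complex_of_real (w' t)) t))\<^sup>2) \<in> borel_measurable lborel" for n
      proof -
        have [measurable]: "\<phi>' n \<in> borel_measurable borel" by (rule borel_measurable_continuous_onI[OF \<phi>'c])
        have [measurable]: "zext ?U (\<lambda>t. complex_of_real (w' t)) \<in> borel_measurable borel"
          using sq_int_measurable[OF sq(2)] by simp
        show ?thesis by measurable
      qed
      show "AE t in lborel. (\<lambda>n. indicator ?U t *\<^sub>R (cmod (\<phi>' n t - zext ?U (\<lambda>t. complex_of_real (w' t)) t))\<^sup>2) \<longlonglongrightarrow> 0"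
      proof (rule AE_I2)
        fix t :: real
        show "(\<lambda>n. indicator ?U t *\<^sub>R (cmod (\<phi>' n t - zext ?U (\<lambda>t. complex_of_real (w' t)) t))\<^sup>2) \<longlonglongrightarrow> 0"
        proof (cases "t \<in> ?U")
          case True
          have "(\<lambda>n. M n t) \<longlonglongrightarrow> max 0 (w t - 0)" unfolding M_def by (intro tendsto_intros \<delta>0)
          then have Ml: "(\<lambda>n. M n t) \<longlonglongrightarrow> w t" using pos[OF True] by simp
          have "(\<lambda>n. (cmod (of_real (- w' t * ((w t - M n t) / w t)\<^sup>2)))\<^sup>2) \<longlonglongrightarrow>
              (cmod (of_real (- w' t * ((w t - w t) / w t)\<^sup>2)))\<^sup>2"
            by (intro tendsto_intros Ml) (use pos[OF True] in auto)
          then show ?thesis using True by (simp add: eq2)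
        qed simp
      qed
      show "AE t in lborel. norm (indicator ?U t *\<^sub>R (cmod (\<phi>' n t - zext ?U (\<lambda>t. complex_of_real (w' t)) t))\<^sup>2)
          \<le> indicator ?U t *\<^sub>R B\<^sup>2" for n
      proof (rule AE_I2)
        fix t :: real
        show "norm (indicator ?U t *\<^sub>R (cmod (\<phi>' n t - zext ?U (\<lambda>t. complex_of_real (w' t)) t))\<^sup>2)
          \<le> indicator ?U t *\<^sub>R B\<^sup>2"
        proof (cases "t \<in> ?U")
          case True
          have "((w t - M n t) / w t)\<^sup>2 \<le> 1"
            using Mw[OF True, of n] pos[OF True] by (intro power_le_one) auto
          then have "\<bar>w' t\<bar> * ((w t - M n t) / w t)\<^sup>2 \<le> B * 1"
            using B(1)[of t] B(2) True by (intro mult_mono) auto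
          then have "(cmod (of_real (- w' t * ((w t - M n t) / w t)\<^sup>2)))\<^sup>2 \<le> B\<^sup>2"
            by (intro power_mono) (auto simp: norm_mult abs_mult simp del: of_real_mult)
          then show ?thesis using True by (simp add: eq2)
        qed simp
      qed
    qed simp
    then show ?thesis by (simp add: set_lebesgue_integral_def)
  qed
  show ?thesis
    unfolding H10_R_def using L2[OF sq(1)] L2[OF sq(2)] C1c conv1 conv2 by blast
qed

section \<open>The transverse eigenvalue problem\<close>

lemma h_eps_sq: "(h_eps \<gamma> \<epsilon> t)\<^sup>2 = 1 + \<gamma>\<^sup>2 * \<epsilon>\<^sup>2 * t\<^sup>2"
  by (simp add: h_eps_def)

lemma h_eps_ge_1: "h_eps \<gamma> \<epsilon> t \<ge> 1"
  by (simp add: h_eps_def)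

lemma h_eps_pos: "h_eps \<gamma> \<epsilon> t > 0"
  using h_eps_ge_1[of \<gamma> \<epsilon> t] by linarith

lemma continuous_h_eps: "continuous_on S (h_eps \<gamma> \<epsilon>)"
  unfolding h_eps_def by (intro continuous_intros)

lemma continuous_Y0: "continuous_on S (Y0 \<gamma> \<epsilon>)"
  unfolding Y0_def using h_eps_pos[of \<gamma> \<epsilon>]
  by (intro continuous_intros continuous_h_eps) (auto simp: less_imp_neq[symmetric])

definition g_eps :: "real \<Rightarrow> real \<Rightarrow> real \<Rightarrow> real" where
  "g_eps \<gamma> \<epsilon> t = sqrt (h_eps \<gamma> \<epsilon> t)"

definition g_eps' :: "real \<Rightarrow> real \<Rightarrow> real \<Rightarrow> real" where
  "g_eps' \<gamma> \<epsilon> t = \<gamma>\<^sup>2 * \<epsilon>\<^sup>2 * t / (2 * g_eps \<gamma> \<epsilon> t ^ 3)"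

lemma g_eps_pos: "g_eps \<gamma> \<epsilon> t > 0"
  using h_eps_pos[of \<gamma> \<epsilon> t] by (simp add: g_eps_def)

lemma g_eps_sq: "(g_eps \<gamma> \<epsilon> t)\<^sup>2 = h_eps \<gamma> \<epsilon> t"
  using h_eps_pos[of \<gamma> \<epsilon> t] by (simp add: g_eps_def)

lemma continuous_g_eps: "continuous_on S (g_eps \<gamma> \<epsilon>)"
  unfolding g_eps_def by (intro continuous_intros continuous_h_eps)

lemma continuous_g_eps': "continuous_on S (g_eps' \<gamma> \<epsilon>)"
  unfolding g_eps'_def using g_eps_pos[of \<gamma> \<epsilon>]
  by (intro continuous_intros continuous_g_eps) (auto simp: less_imp_neq[symmetric])

lemma g_eps_deriv: "(g_eps \<gamma> \<epsilon> has_real_derivative g_eps' \<gamma> \<epsilon> t) (at t within S)"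
proof -
  define c where "c = \<gamma>\<^sup>2 * \<epsilon>\<^sup>2"
  define g where "g = g_eps \<gamma> \<epsilon> t"
  have c: "1 + c * t\<^sup>2 > 0" by (simp add: c_def add_pos_nonneg)
  have g: "sqrt (sqrt (1 + c * t\<^sup>2)) = g" "g > 0" "sqrt (1 + c * t\<^sup>2) = g\<^sup>2"
    using g_eps_pos[of \<gamma> \<epsilon> t] g_eps_sq[of \<gamma> \<epsilon> t] by (simp_all add: g_def g_eps_def h_eps_def c_def)
  have "((\<lambda>t. 1 + c * t\<^sup>2) has_real_derivative 2 * c * t) (at t within S)"
    by (rule derivative_eq_intros refl | simp)+
  from DERIV_chain2[OF DERIV_real_sqrt[OF c] this]
  have "((\<lambda>t. sqrt (1 + c * t\<^sup>2)) has_real_derivative inverse (g\<^sup>2) / 2 * (2 * c * t)) (at t within S)"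
    unfolding g(3) .
  moreover have "(sqrt has_real_derivative inverse g / 2) (at (sqrt (1 + c * t\<^sup>2)))"
    using DERIV_real_sqrt[of "sqrt (1 + c * t\<^sup>2)"] c g(1) by simp
  ultimately have "((\<lambda>t. sqrt (sqrt (1 + c * t\<^sup>2))) has_real_derivative
      inverse g / 2 * (inverse (g\<^sup>2) / 2 * (2 * c * t))) (at t within S)"
    by (rule DERIV_chain2[rotated])
  also have "(\<lambda>t. sqrt (sqrt (1 + c * t\<^sup>2))) = g_eps \<gamma> \<epsilon>"
    by (simp add: fun_eq_iff g_eps_def h_eps_def c_def)
  finally show ?thesis
    by (rule DERIV_cong) (use g(2) in \<open>simp add: g_eps'_def g_def[symmetric] c_def power2_eq_square power3_eq_cube field_simps\<close>)
qed

text \<open>The origin of \<open>Y0\<close>: with g = sqrt h one has g'' = \<epsilon>^2 Y0 g, so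
  \<open>Y0\<close> is exactly the potential produced by the substitution v = g u.\<close>

lemma g_eps'_deriv:
  assumes "\<epsilon> \<noteq> 0"
  shows "(g_eps' \<gamma> \<epsilon> has_real_derivative \<epsilon>\<^sup>2 * Y0 \<gamma> \<epsilon> t * g_eps \<gamma> \<epsilon> t) (at t within S)"
proof -
  define c where "c = \<gamma>\<^sup>2 * \<epsilon>\<^sup>2"
  define g where "g = g_eps \<gamma> \<epsilon> t"
  have g: "g > 0" "h_eps \<gamma> \<epsilon> t = g\<^sup>2"
    using g_eps_pos[of \<gamma> \<epsilon> t] g_eps_sq[of \<gamma> \<epsilon> t] by (simp_all add: g_def)
  have g': "g_eps' \<gamma> \<epsilon> t = c * t / (2 * g ^ 3)" by (simp add: g_eps'_def g_def c_def)
  have "((\<lambda>t. c * t / (2 * g_eps \<gamma> \<epsilon> t ^ 3)) has_real_derivative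
      (c * (2 * g ^ 3) - c * t * (2 * (3 * g\<^sup>2 * (c * t / (2 * g ^ 3))))) / ((2 * g ^ 3) * (2 * g ^ 3))) (at t within S)"
    by (rule derivative_eq_intros g_eps_deriv refl | use g in \<open>simp add: g_def g'[unfolded g_def]\<close>)+
  moreover have "g_eps' \<gamma> \<epsilon> = (\<lambda>t. c * t / (2 * g_eps \<gamma> \<epsilon> t ^ 3))"
    by (simp add: fun_eq_iff g_eps'_def c_def)
  moreover have "(c * (2 * g ^ 3) - c * t * (2 * (3 * g\<^sup>2 * (c * t / (2 * g ^ 3))))) / ((2 * g ^ 3) * (2 * g ^ 3))
      = \<epsilon>\<^sup>2 * Y0 \<gamma> \<epsilon> t * g"
  proof -
    have "\<epsilon>\<^sup>2 * Y0 \<gamma> \<epsilon> t * g = (- (3 * (c\<^sup>2 * t\<^sup>2)) / (4 * g ^ 8) + c / (2 * g ^ 4)) * g"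
    proof -
      have "\<epsilon>\<^sup>2 * (- (3 * \<gamma>^4 * \<epsilon>\<^sup>2 * t\<^sup>2) / (4 * A) + \<gamma>\<^sup>2 / (2 * B)) = - (3 * (c\<^sup>2 * t\<^sup>2)) / (4 * A) + c / (2 * B)"
        for A B :: real
        unfolding c_def by (cases "A = 0"; cases "B = 0") (simp_all add: field_simps power2_eq_square power4_eq_xxxx)
      moreover have "(g\<^sup>2)^4 = g^8" "(g\<^sup>2)\<^sup>2 = g^4" by (simp_all add: power_mult[symmetric])
      ultimately show ?thesis unfolding Y0_def g(2) by simp
    qed
    also have "\<dots> = c / (2 * g ^ 3) - 3 * (c\<^sup>2 * t\<^sup>2) / (4 * g ^ 7)"
      using g(1) by (simp add: field_simps eval_nat_numeral)
    also have "\<dots> = (c * (2 * g ^ 3) - c * t * (2 * (3 * g\<^sup>2 * (c * t / (2 * g ^ 3))))) / ((2 * g ^ 3) * (2 * g ^ 3))"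
      using g(1) by (simp add: field_simps eval_nat_numeral)
    finally show ?thesis by simp
  qed
  ultimately show ?thesis by (simp add: g_def)
qed

locale strip =
  fixes \<gamma> \<epsilon> :: real
  assumes \<epsilon>: "\<epsilon> > 0" and Y0_pos: "\<And>t. t \<in> {-1..1} \<Longrightarrow> Y0 \<gamma> \<epsilon> t > 0"
begin

text \<open>Here \<open>v = sqrt h * u\<close> where \<open>(h u')' = \<epsilon>\<^sup>2 (\<kappa> / h - l h) u\<close>; \<open>\<kappa>\<close> is the square of a
  longitudinal frequency.\<close>

definition trans_sol :: "real \<Rightarrow> real \<Rightarrow> (real \<Rightarrow> real) \<Rightarrow> (real \<Rightarrow> real) \<Rightarrow> bool" where
  "trans_sol \<kappa> l v v' \<longleftrightarrow> ode_sol (\<lambda>t. \<epsilon>\<^sup>2 * (Y0 \<gamma> \<epsilon> t + \<kappa> / (h_eps \<gamma> \<epsilon> t)\<^sup>2 - l)) v v' \<and>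
     (\<forall>t\<in>{-1<..<1}. v t > 0) \<and> v 1 = 0"

lemma continuous_Q: "continuous_on S (\<lambda>t. \<epsilon>\<^sup>2 * (Y0 \<gamma> \<epsilon> t + \<kappa> / (h_eps \<gamma> \<epsilon> t)\<^sup>2 - l))"
  using h_eps_pos[of \<gamma> \<epsilon>]
  by (intro continuous_intros continuous_Y0 continuous_h_eps) (auto simp: less_imp_neq[symmetric])

text \<open>A negative parameter leaves a positive potential, for which the solution does not return
  to zero.\<close>

lemma trans_sol_nonneg:
  assumes "trans_sol 0 l v v'"
  shows "l \<ge> 0"
proof (rule ccontr)
  assume "\<not> l \<ge> 0"
  then have "\<epsilon>\<^sup>2 * (Y0 \<gamma> \<epsilon> t + 0 / (h_eps \<gamma> \<epsilon> t)\<^sup>2 - l) \<ge> 0" if "t \<in> {-1..1}" for t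
    using Y0_pos[OF that] by simp
  then have "v 1 > 0"
    using ode_sol_pos[of "\<lambda>t. \<epsilon>\<^sup>2 * (Y0 \<gamma> \<epsilon> t + 0 / (h_eps \<gamma> \<epsilon> t)\<^sup>2 - l)" v v' 1] assms
    by (simp add: trans_sol_def)
  then show False using assms by (simp add: trans_sol_def)
qed

text \<open>The parameter runs from 0, where the potential is positive, to a value T at which the
  potential is at most - pi^2 / 4. At that end the comparison function is the half sine wave on an
  interval of length 2.\<close>

lemma exists_ground_state: "\<exists>\<mu> v v'. trans_sol 0 \<mu> v v'"
proof -
  obtain B where B: "\<And>t. t \<in> {-1..1} \<Longrightarrow> \<bar>Y0 \<gamma> \<epsilon> t\<bar> \<le> B" "B \<ge> 0"
    by (rule bounded_on_Icc[OF continuous_Y0]) blast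
  define T where "T = B + pi\<^sup>2 / (4 * \<epsilon>\<^sup>2)"
  have "\<exists>\<tau>\<in>{0..T}. \<exists>v v'. ode_sol (\<lambda>t. \<epsilon>\<^sup>2 * Y0 \<gamma> \<epsilon> t + \<tau> * (- (\<epsilon>\<^sup>2))) v v' \<and> (\<forall>t\<in>{-1<..<1}. v t > 0) \<and> v 1 = 0"
  proof (rule principal_solution_exists)
    show "continuous_on {-1..1} (\<lambda>t. \<epsilon>\<^sup>2 * Y0 \<gamma> \<epsilon> t)" "continuous_on {-1..1} (\<lambda>t::real. - (\<epsilon>\<^sup>2))"
      by (intro continuous_intros continuous_Y0)+
    show "0 \<le> T" using B(2) by (simp add: T_def)
  next
    fix v v' and t :: real
    assume "ode_sol (\<lambda>t. \<epsilon>\<^sup>2 * Y0 \<gamma> \<epsilon> t) v v'" "t \<in> {-1<..1}"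
    then show "v t > 0"
      using ode_sol_pos[of "\<lambda>t. \<epsilon>\<^sup>2 * Y0 \<gamma> \<epsilon> t" v v' t] Y0_pos by (simp add: less_imp_le)
  next
    fix v v'
    assume v: "ode_sol (\<lambda>t. \<epsilon>\<^sup>2 * Y0 \<gamma> \<epsilon> t + T * (- (\<epsilon>\<^sup>2))) v v'"
    show "\<exists>t\<in>{-1<..1}. v t \<le> 0"
    proof (rule sturm_comparison[OF v])
      \<comment> \<open>The factor 2 / pi normalises the derivative at the left end to 1.\<close>
      show "ode_sol (\<lambda>_. - (pi\<^sup>2 / 4)) (\<lambda>t. 2 / pi * sin (pi / 2 * (t + 1))) (\<lambda>t. cos (pi / 2 * (t + 1)))"
        unfolding ode_sol_def
        by (auto intro!: derivative_eq_intros simp: power2_eq_square)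
      show "\<bar>- (pi\<^sup>2 / 4)\<bar> \<le> pi\<^sup>2 / 4" by simp
      show "2 / pi * sin (pi / 2 * (t + 1)) > 0" if "t \<in> {-1<..<1}" for t :: real
      proof -
        have "pi / 2 * (t + 1) < pi / 2 * 2" using that by (intro mult_strict_left_mono) auto
        then have "sin (pi / 2 * (t + 1)) > 0" using that by (intro sin_gt_zero) auto
        then show ?thesis by simp
      qed
      show "\<epsilon>\<^sup>2 * Y0 \<gamma> \<epsilon> t + T * - \<epsilon>\<^sup>2 \<le> - (pi\<^sup>2 / 4)" if "t \<in> {-1..1}" for t
      proof -
        have "\<epsilon>\<^sup>2 * Y0 \<gamma> \<epsilon> t \<le> \<epsilon>\<^sup>2 * B" using B(1)[OF that] by (intro mult_left_mono) auto
        moreover have "T * \<epsilon>\<^sup>2 = \<epsilon>\<^sup>2 * B + pi\<^sup>2 / 4" using \<epsilon> by (simp add: T_def field_simps)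
        ultimately show ?thesis by simp
      qed
    qed simp
  qed
  then obtain \<tau> v v' where "ode_sol (\<lambda>t. \<epsilon>\<^sup>2 * Y0 \<gamma> \<epsilon> t + \<tau> * (- (\<epsilon>\<^sup>2))) v v'" "\<forall>t\<in>{-1<..<1}. v t > 0" "v 1 = 0"
    by blast
  moreover have "(\<lambda>t. \<epsilon>\<^sup>2 * Y0 \<gamma> \<epsilon> t + \<tau> * (- (\<epsilon>\<^sup>2))) = (\<lambda>t. \<epsilon>\<^sup>2 * (Y0 \<gamma> \<epsilon> t + 0 / (h_eps \<gamma> \<epsilon> t)\<^sup>2 - \<tau>))"
    by (simp add: fun_eq_iff algebra_simps)
  ultimately have "trans_sol 0 \<tau> v v'" by (simp only: trans_sol_def)
  then show ?thesis by (intro exI)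
qed

text \<open>\<kappa> is lowered from K to 0, so the search parameter is K - \<kappa>. At \<kappa> =
  K the potential is nonnegative. At \<kappa> = 0 it does not exceed that of the ground state,
  because \<mu> \<le> l, and comparison with the ground state forces a zero.\<close>

lemma exists_trans_sol:
  assumes g: "trans_sol 0 \<mu> s s'" and l: "\<mu> \<le> l"
  shows "\<exists>\<kappa>\<ge>0. \<exists>v v'. trans_sol \<kappa> l v v'"
proof -
  have l0: "l \<ge> 0" using trans_sol_nonneg[OF g] l by simp
  \<comment> \<open>On [-1, 1] the square of h is at most 1 + \<gamma>^2 \<epsilon>^2, so K / h^2
    outweighs l there.\<close>
  define K where "K = l * (1 + \<gamma>\<^sup>2 * \<epsilon>\<^sup>2)"
  have K0: "K \<ge> 0" using l0 by (simp add: K_def)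
  have Kh: "K / (h_eps \<gamma> \<epsilon> t)\<^sup>2 \<ge> l" if "t \<in> {-1..1}" for t
  proof -
    have "t\<^sup>2 \<le> 1" using that by (simp add: abs_square_le_1 abs_le_iff)
    then have "(h_eps \<gamma> \<epsilon> t)\<^sup>2 \<le> 1 + \<gamma>\<^sup>2 * \<epsilon>\<^sup>2"
      unfolding h_eps_sq using mult_left_mono[of "t\<^sup>2" 1 "\<gamma>\<^sup>2 * \<epsilon>\<^sup>2"] by simp
    then have "l * (h_eps \<gamma> \<epsilon> t)\<^sup>2 \<le> K" unfolding K_def by (intro mult_left_mono l0)
    then show ?thesis using h_eps_pos[of \<gamma> \<epsilon> t] by (simp add: field_simps)
  qed
  let ?q0 = "\<lambda>t. \<epsilon>\<^sup>2 * (Y0 \<gamma> \<epsilon> t + K / (h_eps \<gamma> \<epsilon> t)\<^sup>2 - l)"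
  let ?q1 = "\<lambda>t. - (\<epsilon>\<^sup>2 / (h_eps \<gamma> \<epsilon> t)\<^sup>2)"
  have eq: "?q0 t + \<tau> * ?q1 t = \<epsilon>\<^sup>2 * (Y0 \<gamma> \<epsilon> t + (K - \<tau>) / (h_eps \<gamma> \<epsilon> t)\<^sup>2 - l)" for t \<tau>
    by (simp add: algebra_simps diff_divide_distrib)
  obtain L where L: "\<And>t. t \<in> {-1..1} \<Longrightarrow> \<bar>\<epsilon>\<^sup>2 * (Y0 \<gamma> \<epsilon> t + 0 / (h_eps \<gamma> \<epsilon> t)\<^sup>2 - \<mu>)\<bar> \<le> L"
    by (rule bounded_on_Icc[OF continuous_Q]) blast
  have "\<exists>\<tau>\<in>{0..K}. \<exists>v v'. ode_sol (\<lambda>t. ?q0 t + \<tau> * ?q1 t) v v' \<and> (\<forall>t\<in>{-1<..<1}. v t > 0) \<and> v 1 = 0"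
  proof (rule principal_solution_exists[OF continuous_Q _ K0])
    show "continuous_on {-1..1} ?q1"
      using h_eps_pos[of \<gamma> \<epsilon>]
      by (intro continuous_intros continuous_h_eps) (auto simp: less_imp_neq[symmetric])
  next
    fix v v' and t :: real
    assume v: "ode_sol ?q0 v v'" and t: "t \<in> {-1<..1}"
    have "?q0 t \<ge> 0" if "t \<in> {-1..1}" for t
      using Y0_pos[OF that] Kh[OF that] by (intro mult_nonneg_nonneg) auto
    from ode_sol_pos[OF v this t] show "v t > 0" .
  next
    fix v v'
    assume v: "ode_sol (\<lambda>t. ?q0 t + K * ?q1 t) v v'"
    show "\<exists>t\<in>{-1<..1}. v t \<le> 0"
    proof (rule sturm_comparison[OF v _ L])
      show "ode_sol (\<lambda>t. \<epsilon>\<^sup>2 * (Y0 \<gamma> \<epsilon> t + 0 / (h_eps \<gamma> \<epsilon> t)\<^sup>2 - \<mu>)) s s'"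
        using g by (simp only: trans_sol_def)
      show "\<And>t. t \<in> {-1<..<1} \<Longrightarrow> 0 < s t" "s 1 = 0" using g by (simp_all add: trans_sol_def)
      show "?q0 t + K * ?q1 t \<le> \<epsilon>\<^sup>2 * (Y0 \<gamma> \<epsilon> t + 0 / (h_eps \<gamma> \<epsilon> t)\<^sup>2 - \<mu>)" for t
        unfolding eq using l by (intro mult_left_mono) auto
    qed
  qed
  then obtain \<tau> v v' where "\<tau> \<in> {0..K}" "ode_sol (\<lambda>t. ?q0 t + \<tau> * ?q1 t) v v'" "\<forall>t\<in>{-1<..<1}. v t > 0" "v 1 = 0"
    by blast
  then have "trans_sol (K - \<tau>) l v v'" "K - \<tau> \<ge> 0" unfolding eq by (simp_all add: trans_sol_def)
  then show ?thesis by blast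
qed

section \<open>The transverse solutions in weighted form, and the value of
  \<open>lambda1\<close>\<close>

definition uu :: "(real \<Rightarrow> real) \<Rightarrow> real \<Rightarrow> real" where
  "uu v t = v t / g_eps \<gamma> \<epsilon> t"

definition uu' :: "(real \<Rightarrow> real) \<Rightarrow> (real \<Rightarrow> real) \<Rightarrow> real \<Rightarrow> real" where
  "uu' v v' t = (g_eps \<gamma> \<epsilon> t * v' t - g_eps' \<gamma> \<epsilon> t * v t) / h_eps \<gamma> \<epsilon> t"

text \<open>Since h u' = g v' - g' v with g = sqrt h, its derivative is g v'' - g'' v, where the two
  \<open>Y0\<close> terms cancel by the equation for g.\<close>

lemma uu_deriv:
  assumes s: "trans_sol \<kappa> l v v'" and t: "t \<in> {-1..1}"
  shows "(uu v has_real_derivative uu' v v' t) (at t within {-1..1})"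
    "((\<lambda>t. h_eps \<gamma> \<epsilon> t * uu' v v' t) has_real_derivative
      \<epsilon>\<^sup>2 * (\<kappa> / h_eps \<gamma> \<epsilon> t - l * h_eps \<gamma> \<epsilon> t) * uu v t) (at t within {-1..1})"
proof -
  have o: "ode_sol (\<lambda>t. \<epsilon>\<^sup>2 * (Y0 \<gamma> \<epsilon> t + \<kappa> / (h_eps \<gamma> \<epsilon> t)\<^sup>2 - l)) v v'" using s by (simp add: trans_sol_def)
  have gp: "g_eps \<gamma> \<epsilon> t > 0" and hp: "h_eps \<gamma> \<epsilon> t > 0" by (rule g_eps_pos h_eps_pos)+
  have hg: "h_eps \<gamma> \<epsilon> t = g_eps \<gamma> \<epsilon> t * g_eps \<gamma> \<epsilon> t" using g_eps_sq[of \<gamma> \<epsilon> t] by (simp add: power2_eq_square)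
  show "(uu v has_real_derivative uu' v v' t) (at t within {-1..1})"
    unfolding uu_def[abs_def]
    by (rule DERIV_cong[OF DERIV_divide[OF ode_solD(1)[OF o t] g_eps_deriv]])
      (use gp in \<open>auto simp: uu'_def hg field_simps\<close>)
  have "((\<lambda>t. g_eps \<gamma> \<epsilon> t * v' t - g_eps' \<gamma> \<epsilon> t * v t) has_real_derivative
      (g_eps' \<gamma> \<epsilon> t * v' t + \<epsilon>\<^sup>2 * (Y0 \<gamma> \<epsilon> t + \<kappa> / (h_eps \<gamma> \<epsilon> t)\<^sup>2 - l) * v t * g_eps \<gamma> \<epsilon> t) -
      (\<epsilon>\<^sup>2 * Y0 \<gamma> \<epsilon> t * g_eps \<gamma> \<epsilon> t * v t + v' t * g_eps' \<gamma> \<epsilon> t)) (at t within {-1..1})"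
    by (intro DERIV_diff DERIV_mult g_eps_deriv g_eps'_deriv ode_solD[OF o] t) (use \<epsilon> in auto)
  moreover have "(\<lambda>t. h_eps \<gamma> \<epsilon> t * uu' v v' t) = (\<lambda>t. g_eps \<gamma> \<epsilon> t * v' t - g_eps' \<gamma> \<epsilon> t * v t)"
    using h_eps_pos[of \<gamma> \<epsilon>] by (simp add: fun_eq_iff uu'_def less_imp_neq[symmetric])
  moreover have "(g_eps' \<gamma> \<epsilon> t * v' t + \<epsilon>\<^sup>2 * (Y0 \<gamma> \<epsilon> t + \<kappa> / (h_eps \<gamma> \<epsilon> t)\<^sup>2 - l) * v t * g_eps \<gamma> \<epsilon> t) -
      (\<epsilon>\<^sup>2 * Y0 \<gamma> \<epsilon> t * g_eps \<gamma> \<epsilon> t * v t + v' t * g_eps' \<gamma> \<epsilon> t)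
      = \<epsilon>\<^sup>2 * (\<kappa> / h_eps \<gamma> \<epsilon> t - l * h_eps \<gamma> \<epsilon> t) * uu v t"
    using gp unfolding uu_def hg by (simp add: field_simps power2_eq_square)
  ultimately show "((\<lambda>t. h_eps \<gamma> \<epsilon> t * uu' v v' t) has_real_derivative
      \<epsilon>\<^sup>2 * (\<kappa> / h_eps \<gamma> \<epsilon> t - l * h_eps \<gamma> \<epsilon> t) * uu v t) (at t within {-1..1})" by simp
qed

lemma uu_continuous:
  assumes s: "trans_sol \<kappa> l v v'"
  shows "continuous_on {-1..1} (uu v)" "continuous_on {-1..1} (uu' v v')"
proof -
  have o: "ode_sol (\<lambda>t. \<epsilon>\<^sup>2 * (Y0 \<gamma> \<epsilon> t + \<kappa> / (h_eps \<gamma> \<epsilon> t)\<^sup>2 - l)) v v'" using s by (simp add: trans_sol_def)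
  show "continuous_on {-1..1} (uu v)" by (rule DERIV_continuous_on) (rule uu_deriv(1)[OF s])
  show "continuous_on {-1..1} (uu' v v')"
    unfolding uu'_def[abs_def] using h_eps_pos[of \<gamma> \<epsilon>]
    by (intro continuous_intros continuous_g_eps continuous_g_eps' continuous_h_eps ode_solD[OF o])
      (auto simp: less_imp_neq[symmetric])
qed

lemma uu_pos: "trans_sol \<kappa> l v v' \<Longrightarrow> t \<in> {-1<..<1} \<Longrightarrow> uu v t > 0"
  using g_eps_pos[of \<gamma> \<epsilon> t] by (simp add: uu_def trans_sol_def)

lemma uu_boundary: "trans_sol \<kappa> l v v' \<Longrightarrow> uu v (-1) = 0 \<and> uu v 1 = 0"
  by (simp add: uu_def trans_sol_def ode_sol_def)

lemma H10_R_uu: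
  assumes "trans_sol \<kappa> l v v'"
  shows "H10_R {-1<..<1} (zext {-1<..<1} (\<lambda>t. of_real (uu v t))) (zext {-1<..<1} (\<lambda>t. of_real (uu' v v' t)))"
  using uu_deriv(1)[OF assms] uu_continuous(2)[OF assms] uu_pos[OF assms] uu_boundary[OF assms]
  by (intro H10_R_positive) auto

text \<open>Picone for u with the weight h. This version serves the fibres on which the metric is
  that of the constantly twisted strip.\<close>

lemma weighted_ground_state_inequality:
  assumes s: "trans_sol 0 \<mu> v v'" and \<phi>: "C1c_R {-1<..<1} \<phi> \<phi>'"
  shows "\<mu> * integral {-1..1} (\<lambda>t. h_eps \<gamma> \<epsilon> t * (cmod (\<phi> t))\<^sup>2) \<le>
    integral {-1..1} (\<lambda>t. h_eps \<gamma> \<epsilon> t * (cmod (\<phi>' t))\<^sup>2) / \<epsilon>\<^sup>2"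
proof -
  have "integral {-1..1} (\<lambda>t. (\<epsilon>\<^sup>2 * (\<mu> * h_eps \<gamma> \<epsilon> t)) * (cmod (\<phi> t))\<^sup>2) \<le>
      integral {-1..1} (\<lambda>t. h_eps \<gamma> \<epsilon> t * (cmod (\<phi>' t))\<^sup>2)"
  proof (rule picone[OF \<phi> uu_pos[OF s]])
    fix t :: real assume t: "t \<in> {-1<..<1}"
    then have at: "at t within {-1..1} = at t" using at_within_Icc_at[of "-1" t 1] by auto
    show "(uu v has_real_derivative uu' v v' t) (at t)" using uu_deriv(1)[OF s, of t] t at by auto
    show "((\<lambda>t. h_eps \<gamma> \<epsilon> t * uu' v v' t) has_real_derivative - (\<epsilon>\<^sup>2 * (\<mu> * h_eps \<gamma> \<epsilon> t)) * uu v t) (at t)"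
      using uu_deriv(2)[OF s, of t] t at by (auto simp: algebra_simps)
  qed (auto intro!: continuous_intros continuous_h_eps less_imp_le[OF h_eps_pos])
  also have "integral {-1..1} (\<lambda>t. (\<epsilon>\<^sup>2 * (\<mu> * h_eps \<gamma> \<epsilon> t)) * (cmod (\<phi> t))\<^sup>2) =
      \<epsilon>\<^sup>2 * \<mu> * integral {-1..1} (\<lambda>t. h_eps \<gamma> \<epsilon> t * (cmod (\<phi> t))\<^sup>2)"
    by (subst integral_mult_right[symmetric]) (simp add: mult_ac)
  finally show ?thesis using \<epsilon> by (simp add: pos_le_divide_eq mult_ac)
qed

text \<open>Picone for v without weight. This version matches the operator in
  \<open>D0_eigenvalue\<close>.\<close>

lemma ground_state_inequality:
  assumes s: "trans_sol 0 \<mu> v v'" and \<phi>: "C1c_R {-1<..<1} \<phi> \<phi>'"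
  shows "integral {-1..1} (\<lambda>t. \<epsilon>\<^sup>2 * (\<mu> - Y0 \<gamma> \<epsilon> t) * (cmod (\<phi> t))\<^sup>2) \<le>
    integral {-1..1} (\<lambda>t. (cmod (\<phi>' t))\<^sup>2)"
proof -
  have o: "ode_sol (\<lambda>t. \<epsilon>\<^sup>2 * (Y0 \<gamma> \<epsilon> t + 0 / (h_eps \<gamma> \<epsilon> t)\<^sup>2 - \<mu>)) v v'" using s by (simp add: trans_sol_def)
  have "integral {-1..1} (\<lambda>t. \<epsilon>\<^sup>2 * (\<mu> - Y0 \<gamma> \<epsilon> t) * (cmod (\<phi> t))\<^sup>2) \<le>
      integral {-1..1} (\<lambda>t. 1 * (cmod (\<phi>' t))\<^sup>2)"
  proof (rule picone[OF \<phi>])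
    fix t :: real assume t: "t \<in> {-1<..<1}"
    then have at: "at t within {-1..1} = at t" using at_within_Icc_at[of "-1" t 1] by auto
    show "v t > 0" using s t by (simp add: trans_sol_def)
    show "(v has_real_derivative v' t) (at t)" using ode_solD(1)[OF o, of t] t at by auto
    show "((\<lambda>t. 1 * v' t) has_real_derivative - (\<epsilon>\<^sup>2 * (\<mu> - Y0 \<gamma> \<epsilon> t)) * v t) (at t)"
      using ode_solD(2)[OF o, of t] t at by (auto simp: algebra_simps)
  qed (auto intro!: continuous_intros continuous_Y0)
  then show ?thesis by simp
qed

lemma ground_state_D0_eigenvalue:
  assumes s: "trans_sol 0 \<mu> v v'"
  shows "D0_eigenvalue \<gamma> \<epsilon> (complex_of_real \<mu>)"
proof -
  let ?U = "{-1<..<1::real}"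
  define Q where "Q t = \<epsilon>\<^sup>2 * (Y0 \<gamma> \<epsilon> t + 0 / (h_eps \<gamma> \<epsilon> t)\<^sup>2 - \<mu>)" for t
  have o: "ode_sol Q v v'" using s by (simp add: trans_sol_def Q_def[abs_def])
  define u u' u'' where "u = zext ?U (\<lambda>t. complex_of_real (v t))" and "u' = zext ?U (\<lambda>t. complex_of_real (v' t))"
    and "u'' = zext ?U (\<lambda>t. complex_of_real (Q t * v t))"
  have "H10_R ?U u u'"
    unfolding u_def u'_def
    using ode_solD[OF o] s by (intro H10_R_positive) (auto simp: trans_sol_def)
  moreover have "L2w ?U (\<lambda>_. 1) u''"
  proof -
    have "sq_int (zext ?U (\<lambda>t. complex_of_real (Q t * v t)))"
      unfolding Q_def by (intro sq_int_zext_continuous continuous_intros continuous_Q ode_solD(5)[OF o])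
    then have sq: "sq_int u''" by (simp only: u''_def)
    moreover have "zext ?U u'' = u''" by (auto simp: u''_def zext_def)
    ultimately show ?thesis using sq_int_measurable[OF sq] by (intro L2w_zext_iff) simp_all
  qed
  moreover have "weak_deriv_R ?U u' u''"
    unfolding weak_deriv_R_def
  proof (intro allI impI)
    fix \<phi> \<phi>' assume \<phi>: "C1c_R ?U \<phi> \<phi>'"
    obtain \<rho> where \<rho>: "0 < \<rho>" "\<rho> < 1" "\<And>t. \<rho> \<le> \<bar>t\<bar> \<Longrightarrow> \<phi> t = 0 \<and> \<phi>' t = 0"
      using C1c_R_support[OF \<phi>] by blast
    define F where "F t = of_real (v' t) * \<phi> t" for t
    define F' where "F' t = of_real (v' t) * \<phi>' t + of_real (Q t * v t) * \<phi> t" for t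
    have dF: "(F has_vector_derivative F' t) (at t within {-1..1})" if "t \<in> {-1..1}" for t
      unfolding F_def F'_def
      using \<phi> by (intro has_vector_derivative_mult has_vector_derivative_of_real ode_solD[OF o] that)
        (auto simp: C1c_R_def intro: has_vector_derivative_at_within)
    have c: "continuous_on {-1..1} (\<lambda>t. of_real (v' t) * \<phi>' t)" "continuous_on {-1..1} (\<lambda>t. of_real (Q t * v t) * \<phi> t)"
      unfolding Q_def by (intro continuous_intros C1c_R_continuous[OF \<phi>] ode_solD[OF o] continuous_Q)+
    have i: "set_integrable lborel {-1..1} (\<lambda>t. of_real (v' t) * \<phi>' t)"
      "set_integrable lborel {-1..1} (\<lambda>t. of_real (Q t * v t) * \<phi> t)"
      by (intro borel_integrable_atLeastAtMost' c)+
    have e1: "(LINT t:?U|lborel. u' t * \<phi>' t) = (LINT t:{-1..1}|lborel. of_real (v' t) * \<phi>' t)"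
      unfolding set_lebesgue_integral_def
      by (intro Bochner_Integration.integral_cong refl)
        (use \<rho>(2,3) in \<open>force simp: indicator_def u'_def zext_def\<close>)
    have e2: "(LINT t:?U|lborel. u'' t * \<phi> t) = (LINT t:{-1..1}|lborel. of_real (Q t * v t) * \<phi> t)"
      unfolding set_lebesgue_integral_def
      by (intro Bochner_Integration.integral_cong refl)
        (use \<rho>(2,3) in \<open>force simp: indicator_def u''_def zext_def\<close>)
    have "(LINT t:?U|lborel. u' t * \<phi>' t) + (LINT t:?U|lborel. u'' t * \<phi> t) = (LINT t:{-1..1}|lborel. F' t)"
      unfolding e1 e2 F'_def by (rule set_integral_add(2)[OF i, symmetric])
    also have "\<dots> = F 1 - F (-1)"
      unfolding set_lebesgue_integral_def
      by (rule integral_FTC_Icc) (use dF c in \<open>auto simp: F'_def intro!: continuous_intros\<close>)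
    also have "\<dots> = 0" using \<rho>(2,3) by (simp add: F_def)
    finally show "(LINT t:?U|lborel. u' t * \<phi>' t) = - (LINT t:?U|lborel. u'' t * \<phi> t)"
      by (simp add: add_eq_0_iff2)
  qed
  moreover have "\<not> aeq ?U u (\<lambda>_. 0)"
  proof
    assume "aeq ?U u (\<lambda>_. 0)"
    then have "AE t in lborel. t \<notin> ?U"
      unfolding aeq_def by eventually_elim (use s in \<open>force simp: u_def zext_def trans_sol_def\<close>)
    then have "?U \<in> null_sets lborel" by (subst AE_iff_null_sets) auto
    then show False by (simp add: null_sets_def)
  qed
  moreover have "aeq ?U (\<lambda>t. - u'' t / complex_of_real (\<epsilon>\<^sup>2) + complex_of_real (Y0 \<gamma> \<epsilon> t) * u t)
      (\<lambda>t. complex_of_real \<mu> * u t)"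
    unfolding aeq_def using \<epsilon>
    by (intro AE_I2) (auto simp: u_def u''_def zext_def Q_def field_simps)
  ultimately show ?thesis unfolding D0_eigenvalue_def by blast
qed

text \<open>Approximate the eigenfunction u by test functions. The weak second derivative gives that
  the squared norm of u' is - (u'', u), and the ground state inequality passes to the limit.
  Inserting the equation for u'' leaves \<epsilon>^2 (\<mu> - l) |u|^2 \<le> 0.\<close>

lemma D0_eigenvalue_ge:
  assumes s: "trans_sol 0 \<mu> v v'" and l: "D0_eigenvalue \<gamma> \<epsilon> (complex_of_real l)"
  shows "\<mu> \<le> l"
proof -
  let ?U = "{-1<..<1::real}"
  obtain u u' u'' where u: "H10_R ?U u u'" and u'': "L2w ?U (\<lambda>_. 1) u''" "weak_deriv_R ?U u' u''"
    and nz: "\<not> aeq ?U u (\<lambda>_. 0)"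
    and eq: "aeq ?U (\<lambda>t. - u'' t / complex_of_real (\<epsilon>\<^sup>2) + complex_of_real (Y0 \<gamma> \<epsilon> t) * u t) (\<lambda>t. complex_of_real l * u t)"
    using l unfolding D0_eigenvalue_def by blast
  obtain \<phi> \<phi>' where \<phi>: "\<And>n. C1c_R ?U (\<phi> n) (\<phi>' n)"
    and lim: "(\<lambda>n. LINT x:?U|lborel. (cmod (\<phi> n x - u x))\<^sup>2) \<longlonglongrightarrow> 0"
      "(\<lambda>n. LINT x:?U|lborel. (cmod (\<phi>' n x - u' x))\<^sup>2) \<longlonglongrightarrow> 0"
    using u unfolding H10_R_def by blast
  have sq: "sq_int (zext ?U u)" "sq_int (zext ?U u')" "sq_int (zext ?U u'')"
    using u u''(1) by (auto simp: H10_R_def intro!: sq_int_zext)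
  have sq\<phi>: "sq_int (zext ?U (\<phi> n))" "sq_int (zext ?U (\<phi>' n))" for n
    by (intro sq_int_zext_continuous C1c_R_continuous[OF \<phi>])+
  have L1: "(\<lambda>n. cls (zext ?U (\<phi> n))) \<longlonglongrightarrow> cls (zext ?U u)" using tendsto_cls_zext_iff[of ?U \<phi> u] sq\<phi> sq lim by blast
  have L2: "(\<lambda>n. cls (zext ?U (\<phi>' n))) \<longlonglongrightarrow> cls (zext ?U u')" using tendsto_cls_zext_iff[of ?U \<phi>' u'] sq\<phi> sq lim by blast
  have zext_inner: "inner (cls (zext ?U f)) (cls (zext ?U g)) = Re (LINT t:?U|lborel. f t * cnj (g t))"
    if "sq_int (zext ?U f)" "sq_int (zext ?U g)" for f g
  proof -
    have "inner (cls (zext ?U f)) (cls (zext ?U g)) = Re (LINT t|lborel. zext ?U f t * cnj (zext ?U g t))"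
      unfolding inner_cls[OF that] by (rule integral_Re[OF sq_int_integrable_mult[OF that]])
    also have "(\<lambda>t. zext ?U f t * cnj (zext ?U g t)) = (\<lambda>t. indicator ?U t *\<^sub>R (f t * cnj (g t)))"
      by (auto simp: zext_def fun_eq_iff)
    finally show ?thesis by (simp add: set_lebesgue_integral_def)
  qed
  \<comment> \<open>The weak derivative is defined by a bilinear pairing while the inner product is
    sesquilinear; conjugate test functions mediate between the two.\<close>
  have cnjC: "C1c_R ?U (\<lambda>t. cnj (\<phi> n t)) (\<lambda>t. cnj (\<phi>' n t))" for n
    using \<phi>[of n] unfolding C1c_R_def
    by (auto intro!: continuous_intros bounded_linear.has_vector_derivative[OF bounded_linear_cnj])
  have w: "inner (cls (zext ?U u')) (cls (zext ?U (\<phi>' n))) = - inner (cls (zext ?U u'')) (cls (zext ?U (\<phi> n)))" for n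
    unfolding zext_inner[OF sq(2) sq\<phi>(2)] zext_inner[OF sq(3) sq\<phi>(1)]
    using u''(2) cnjC[of n] by (simp add: weak_deriv_R_def)
  have "(\<lambda>n. inner (cls (zext ?U u')) (cls (zext ?U (\<phi>' n)))) \<longlonglongrightarrow> inner (cls (zext ?U u')) (cls (zext ?U u'))"
    "(\<lambda>n. - inner (cls (zext ?U u'')) (cls (zext ?U (\<phi> n)))) \<longlonglongrightarrow> - inner (cls (zext ?U u'')) (cls (zext ?U u))"
    by (intro tendsto_intros L1 L2)+
  then have en: "inner (cls (zext ?U u')) (cls (zext ?U u')) = - inner (cls (zext ?U u'')) (cls (zext ?U u))"
    unfolding w by (rule LIMSEQ_unique)
  obtain B where B: "\<And>t. t \<in> {-1..1} \<Longrightarrow> \<bar>\<epsilon>\<^sup>2 * (\<mu> - Y0 \<gamma> \<epsilon> t)\<bar> \<le> B" "B \<ge> 0"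
    by (rule bounded_on_Icc[of "\<lambda>t. \<epsilon>\<^sup>2 * (\<mu> - Y0 \<gamma> \<epsilon> t)"]) (intro continuous_intros continuous_Y0, blast)
  \<comment> \<open>Multiplication by the potential term is a bounded operator, so the corresponding
    quadratic term is continuous along the approximating sequence.\<close>
  define m where "m = zext ?U (\<lambda>t. complex_of_real (\<epsilon>\<^sup>2 * (\<mu> - Y0 \<gamma> \<epsilon> t)))"
  have m: "m \<in> borel_measurable lborel"
    unfolding m_def
    by (intro sq_int_measurable sq_int_zext_continuous continuous_intros continuous_Y0)
  have mB: "cmod (m t) \<le> B" for t
    using B(1)[of t] B(2) by (auto simp: m_def zext_def simp del: of_real_mult of_real_diff)
  have sqm: "sq_int (\<lambda>t. m t * f t)" if "sq_int f" for f by (rule sq_int_mult_bounded[OF that m mB])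
  have L3: "(\<lambda>n. cls (\<lambda>t. m t * zext ?U (\<phi> n) t)) \<longlonglongrightarrow> cls (\<lambda>t. m t * zext ?U u t)"
  proof (rule LIM_zero_cancel, rule Lim_null_comparison)
    have "norm (cls (\<lambda>t. m t * zext ?U (\<phi> n) t) - cls (\<lambda>t. m t * zext ?U u t))
        = norm (cls (\<lambda>t. m t * (zext ?U (\<phi> n) t - zext ?U u t)))" for n
      by (simp add: cls_diff sqm sq sq\<phi> algebra_simps)
    also have "\<dots> n \<le> B * norm (cls (\<lambda>t. zext ?U (\<phi> n) t - zext ?U u t))" for n
      by (intro norm_cls_mult_le sq_int_diff sq sq\<phi> m mB)
    finally show "\<forall>\<^sub>F n in sequentially. norm (cls (\<lambda>t. m t * zext ?U (\<phi> n) t) - cls (\<lambda>t. m t * zext ?U u t))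
        \<le> B * norm (cls (zext ?U (\<phi> n)) - cls (zext ?U u))"
      by (simp add: cls_diff sq sq\<phi>)
    have "(\<lambda>n. B * norm (cls (zext ?U (\<phi> n)) - cls (zext ?U u))) \<longlonglongrightarrow> B * norm (cls (zext ?U u) - cls (zext ?U u))"
      by (intro tendsto_intros L1)
    then show "(\<lambda>n. B * norm (cls (zext ?U (\<phi> n)) - cls (zext ?U u))) \<longlonglongrightarrow> 0" by simp
  qed
  have in1: "inner (cls (\<lambda>t. m t * zext ?U f t)) (cls (zext ?U f)) =
      (LINT t:?U|lborel. \<epsilon>\<^sup>2 * (\<mu> - Y0 \<gamma> \<epsilon> t) * (cmod (f t))\<^sup>2)" if "sq_int (zext ?U f)" for f
  proof -
    have "Re (m t * zext ?U f t * cnj (zext ?U f t)) = indicator ?U t *\<^sub>R (\<epsilon>\<^sup>2 * (\<mu> - Y0 \<gamma> \<epsilon> t) * (cmod (f t))\<^sup>2)" for t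
      by (auto simp: m_def zext_def mult.assoc complex_mult_cnj cmod_power2 simp del: of_real_mult of_real_diff)
    then show ?thesis by (simp add: inner_cls sqm that set_lebesgue_integral_def)
  qed
  have pn: "inner (cls (\<lambda>t. m t * zext ?U (\<phi> n) t)) (cls (zext ?U (\<phi> n))) \<le> (norm (cls (zext ?U (\<phi>' n))))\<^sup>2" for n
  proof -
    obtain \<rho> where \<rho>: "0 < \<rho>" "\<rho> < 1" "\<And>t. \<rho> \<le> \<bar>t\<bar> \<Longrightarrow> \<phi> n t = 0 \<and> \<phi>' n t = 0"
      using C1c_R_support[OF \<phi>] by blast
    have z: "\<phi> n 1 = 0" "\<phi> n (-1) = 0" "\<phi>' n 1 = 0" "\<phi>' n (-1) = 0" using \<rho>(2) \<rho>(3)[of 1] \<rho>(3)[of "-1"] by auto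
    have "(LINT t:?U|lborel. \<epsilon>\<^sup>2 * (\<mu> - Y0 \<gamma> \<epsilon> t) * (cmod (\<phi> n t))\<^sup>2) =
        integral {-1..1} (\<lambda>t. \<epsilon>\<^sup>2 * (\<mu> - Y0 \<gamma> \<epsilon> t) * (cmod (\<phi> n t))\<^sup>2)"
      by (rule LINT_Ioo_eq_integral) (auto intro!: continuous_intros continuous_Y0 C1c_R_continuous[OF \<phi>] simp: z)
    moreover have "(LINT t:?U|lborel. (cmod (\<phi>' n t))\<^sup>2) = integral {-1..1} (\<lambda>t. (cmod (\<phi>' n t))\<^sup>2)"
      by (rule LINT_Ioo_eq_integral) (auto intro!: continuous_intros C1c_R_continuous[OF \<phi>] simp: z)
    ultimately show ?thesis
      using ground_state_inequality[OF s \<phi>[of n]] by (simp add: in1 sq\<phi> norm_cls_zext_sq)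
  qed
  have "(\<lambda>n. inner (cls (\<lambda>t. m t * zext ?U (\<phi> n) t)) (cls (zext ?U (\<phi> n)))) \<longlonglongrightarrow> inner (cls (\<lambda>t. m t * zext ?U u t)) (cls (zext ?U u))"
    "(\<lambda>n. (norm (cls (zext ?U (\<phi>' n))))\<^sup>2) \<longlonglongrightarrow> (norm (cls (zext ?U u')))\<^sup>2"
    by (intro tendsto_intros L1 L2 L3)+
  then have "inner (cls (\<lambda>t. m t * zext ?U u t)) (cls (zext ?U u)) \<le> (norm (cls (zext ?U u')))\<^sup>2"
    by (rule LIMSEQ_le) (use pn in auto)
  also have "\<dots> = - inner (cls (zext ?U u'')) (cls (zext ?U u))" using en by (simp add: power2_norm_eq_inner)
  finally have le: "inner (cls (\<lambda>t. m t * zext ?U u t)) (cls (zext ?U u)) \<le> - inner (cls (zext ?U u'')) (cls (zext ?U u))" .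
  have u''_eq: "cls (zext ?U u'') = (-1) *\<^sub>R cls (\<lambda>t. m t * zext ?U u t) + (\<epsilon>\<^sup>2 * (\<mu> - l)) *\<^sub>R cls (zext ?U u)"
  proof -
    have "AE t in lborel. zext ?U u'' t = (-1) *\<^sub>R (m t * zext ?U u t) + (\<epsilon>\<^sup>2 * (\<mu> - l)) *\<^sub>R zext ?U u t"
      using eq unfolding aeq_def
    proof eventually_elim
      case (elim t)
      show ?case
      proof (cases "t \<in> ?U")
        case True
        then have "- u'' t / complex_of_real (\<epsilon>\<^sup>2) + complex_of_real (Y0 \<gamma> \<epsilon> t) * u t = complex_of_real l * u t"
          using elim by blast
        then have "u'' t = complex_of_real (\<epsilon>\<^sup>2) * (complex_of_real (Y0 \<gamma> \<epsilon> t) * u t - complex_of_real l * u t)"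
          using \<epsilon> by (simp add: field_simps)
        then show ?thesis using True
          by (simp add: zext_def m_def scaleR_conv_of_real algebra_simps)
      qed (auto simp: zext_def)
    qed
    then have "cls (zext ?U u'') = cls (\<lambda>t. (-1) *\<^sub>R (m t * zext ?U u t) + (\<epsilon>\<^sup>2 * (\<mu> - l)) *\<^sub>R zext ?U u t)"
      by (subst cls_eq_iff) (intro sq sq_int_add sq_int_scaleR sqm)+
    also have "\<dots> = (-1) *\<^sub>R cls (\<lambda>t. m t * zext ?U u t) + (\<epsilon>\<^sup>2 * (\<mu> - l)) *\<^sub>R cls (zext ?U u)"
      by (simp only: cls_scaleR cls_add sqm sq sq_int_scaleR)
    finally show ?thesis .
  qed
  have "\<epsilon>\<^sup>2 * (\<mu> - l) * (norm (cls (zext ?U u)))\<^sup>2 \<le> 0"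
    using le unfolding u''_eq by (simp add: inner_simps power2_norm_eq_inner)
  moreover have "norm (cls (zext ?U u)) \<noteq> 0"
  proof
    assume "norm (cls (zext ?U u)) = 0"
    then have "cls (zext ?U u) = cls (\<lambda>_. 0)" by (simp add: cls_zero)
    then have "AE t in lborel. zext ?U u t = 0" using cls_eq_iff[OF sq(1) sq_int_zero] by simp
    then have "aeq ?U u (\<lambda>_. 0)" unfolding aeq_def by eventually_elim (auto simp: zext_def)
    with nz show False ..
  qed
  ultimately have "\<epsilon>\<^sup>2 * (\<mu> - l) \<le> 0" by (simp add: mult_le_0_iff zero_less_power2)
  then show ?thesis using \<epsilon> by (simp add: mult_le_0_iff)
qed

theorem lambda1_eq:
  assumes "trans_sol 0 \<mu> v v'"
  shows "lambda1 \<gamma> \<epsilon> = \<mu>"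
  unfolding lambda1_def
  by (rule Least_equality) (rule ground_state_D0_eigenvalue[OF assms], rule D0_eigenvalue_ge[OF assms])

end

section \<open>The form domain of the tube\<close>

lemma tendsto_cls_mult:
  assumes g: "\<And>n. sq_int (g n)" "sq_int f" and m: "m \<in> borel_measurable lborel" "\<And>x. cmod (m x) \<le> C"
    and lim: "(\<lambda>n. cls (g n)) \<longlonglongrightarrow> cls f"
  shows "(\<lambda>n. cls (\<lambda>x. m x * g n x)) \<longlonglongrightarrow> cls (\<lambda>x. m x * f x)"
proof (rule LIM_zero_cancel, rule Lim_null_comparison)
  have sqm: "sq_int (\<lambda>t. m t * f t)" if "sq_int f" for f by (rule sq_int_mult_bounded[OF that m])
  have "norm (cls (\<lambda>t. m t * g n t) - cls (\<lambda>t. m t * f t)) \<le> C * norm (cls (g n) - cls f)" for n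
  proof -
    have "norm (cls (\<lambda>t. m t * g n t) - cls (\<lambda>t. m t * f t)) = norm (cls (\<lambda>t. m t * (g n t - f t)))"
      by (simp add: cls_diff sqm g right_diff_distrib)
    also have "\<dots> \<le> C * norm (cls (\<lambda>t. g n t - f t))"
      by (intro norm_cls_mult_le sq_int_diff g m)
    finally show ?thesis by (simp add: cls_diff g)
  qed
  then show "\<forall>\<^sub>F n in sequentially. norm (cls (\<lambda>t. m t * g n t) - cls (\<lambda>t. m t * f t)) \<le> C * norm (cls (g n) - cls f)"
    by simp
  have "(\<lambda>n. C * norm (cls (g n) - cls f)) \<longlonglongrightarrow> C * norm (cls f - cls f)"
    by (intro tendsto_intros lim)
  then show "(\<lambda>n. C * norm (cls (g n) - cls f)) \<longlonglongrightarrow> 0" by simp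
qed

text \<open>\<open>L2\<close> is a real Hilbert space, with the real part of the usual inner product; its complex structure
  is carried by the isometry \<open>imult\<close>.\<close>

lift_definition imult :: "'a::euclidean_space L2 \<Rightarrow> 'a L2" is "\<lambda>f x. \<i> * f x"
proof -
  fix f f' :: "'a \<Rightarrow> complex"
  assume a: "sq_int f \<and> sq_int f' \<and> (AE x in lborel. f x = f' x)"
  then have "AE x in lborel. f x = f' x" by auto
  then have "AE x in lborel. \<i> * f x = \<i> * f' x" by eventually_elim simp
  with a show "sq_int (\<lambda>x. \<i> * f x) \<and> sq_int (\<lambda>x. \<i> * f' x) \<and> (AE x in lborel. \<i> * f x = \<i> * f' x)"
    by (simp add: sq_int_cmult)
qed

lemma imult_cls: "sq_int f \<Longrightarrow> imult (cls f) = cls (\<lambda>x. \<i> * f x)"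
  by (rule imult.abs_eq) auto

lemma imult_inner: "inner (imult x) (imult y) = inner x y"
proof -
  obtain f g where "sq_int f" "x = cls f" "sq_int g" "y = cls g" by (metis L2_cases)
  then show ?thesis by (simp add: imult_cls inner_cls sq_int_cmult algebra_simps)
qed

lemma imult_self: "inner (imult x) x = 0"
proof -
  obtain f where "sq_int f" "x = cls f" by (metis L2_cases)
  then show ?thesis by (simp add: imult_cls inner_cls sq_int_cmult algebra_simps)
qed

lemma imult_imult: "imult (imult x) = - x"
proof -
  obtain f where f: "sq_int f" "x = cls f" by (metis L2_cases)
  have "- cls f = (-1) *\<^sub>R cls f" by simp
  also have "\<dots> = cls (\<lambda>x. (-1) *\<^sub>R f x)" by (rule cls_scaleR) (rule f)
  finally show ?thesis using f by (simp add: imult_cls sq_int_cmult mult.assoc[symmetric])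
qed

lemma bounded_linear_imult: "bounded_linear imult"
proof (rule bounded_linear_intro[where K=1])
  fix x y :: "'a L2" and r :: real
  obtain f g where f: "sq_int f" "x = cls f" "sq_int g" "y = cls g" by (metis L2_cases)
  then show "imult (x + y) = imult x + imult y" "imult (r *\<^sub>R x) = r *\<^sub>R imult x"
    by (simp_all add: imult_cls cls_add cls_scaleR sq_int_cmult sq_int_add sq_int_scaleR algebra_simps)
  show "norm (imult x) \<le> norm x * 1" by (simp add: norm_eq_sqrt_inner imult_inner)
qed

text \<open>The complex inner product, taken on representatives. The Hilbert space keeps only its
  real part (\<open>Re_cin\<close>); the imaginary part is recovered through
  \<open>cin_imult\<close>.\<close>

definition cin :: "('a::euclidean_space \<Rightarrow> complex) \<Rightarrow> ('a \<Rightarrow> complex) \<Rightarrow> complex" where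
  "cin f g = (LINT x|lborel. f x * cnj (g x))"

lemma Re_cin: "sq_int f \<Longrightarrow> sq_int g \<Longrightarrow> Re (cin f g) = inner (cls f) (cls g)"
  unfolding cin_def by (simp only: inner_cls integral_Re[OF sq_int_integrable_mult])

lemma cin_imult: "cin f (\<lambda>x. \<i> * g x) = - \<i> * cin f g"
proof -
  have "cin f (\<lambda>x. \<i> * g x) = (LINT x|lborel. (- \<i>) * (f x * cnj (g x)))"
    unfolding cin_def by (simp add: mult_ac)
  then show ?thesis unfolding cin_def by simp
qed

lemma Lam_borel: "Lam \<in> sets borel"
proof -
  have "open Lam" unfolding Lam_def by (intro open_Times open_UNIV open_greaterThanLessThan)
  then show ?thesis by simp
qed

text \<open>On the strip such a weight and its reciprocal are bounded, so multiplying by it changes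
  neither square integrability nor convergence.\<close>

definition adm :: "(real \<times> real \<Rightarrow> real) \<Rightarrow> bool" where
  "adm m \<longleftrightarrow> continuous_on UNIV m \<and> (\<exists>c>0. \<exists>C. \<forall>x\<in>Lam. c \<le> m x \<and> m x \<le> C)"

definition wext :: "(real \<times> real \<Rightarrow> real) \<Rightarrow> (real \<times> real \<Rightarrow> complex) \<Rightarrow> real \<times> real \<Rightarrow> complex" where
  "wext m f = zext Lam (\<lambda>x. of_real (m x) * f x)"

lemma wext_eq_mult: "wext m f = (\<lambda>x. zext Lam (\<lambda>x. of_real (m x)) x * zext Lam f x)"
  by (auto simp: wext_def zext_def)

lemma adm_mult:
  assumes "adm m"
  obtains C where "zext Lam (\<lambda>x. of_real (m x)) \<in> borel_measurable lborel"
    "\<And>x. cmod (zext Lam (\<lambda>x. of_real (m x)) x) \<le> C"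
    "zext Lam (\<lambda>x. of_real (1 / m x)) \<in> borel_measurable lborel"
    "\<And>x. cmod (zext Lam (\<lambda>x. of_real (1 / m x)) x) \<le> C" "\<And>x. x \<in> Lam \<Longrightarrow> m x > 0"
    "m \<in> borel_measurable borel"
proof -
  obtain c C where c: "c > 0" "\<And>x. x \<in> Lam \<Longrightarrow> c \<le> m x \<and> m x \<le> C" using assms by (auto simp: adm_def)
  have [measurable]: "m \<in> borel_measurable borel"
    using assms by (intro borel_measurable_continuous_onI) (simp add: adm_def)
  have [measurable]: "Lam \<in> sets borel" by (rule Lam_borel)
  have b: "cmod (zext Lam (\<lambda>x. of_real (m x)) x) \<le> max C (1 / c)" for x
    using c(2)[of x] c(1) by (auto simp: zext_def le_max_iff_disj)
  have b2: "cmod (zext Lam (\<lambda>x. of_real (1 / m x)) x) \<le> max C (1 / c)" for x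
  proof (cases "x \<in> Lam")
    case True
    then have "1 / m x \<le> 1 / c" "m x > 0" using c(2)[of x] c(1) by (auto intro!: divide_left_mono)
    then have "cmod (of_real (1 / m x)) \<le> 1 / c" unfolding norm_of_real by simp
    then show ?thesis using True by (simp add: zext_def le_max_iff_disj)
  qed (use c(1) in \<open>simp add: zext_def le_max_iff_disj\<close>)
  have 1: "zext Lam (\<lambda>x. of_real (m x)) \<in> borel_measurable lborel" by measurable
  have 2: "zext Lam (\<lambda>x. of_real (1 / m x)) \<in> borel_measurable lborel" by measurable
  have 3: "m x > 0" if "x \<in> Lam" for x using c(2)[OF that] c(1) by linarith
  have 4: "m \<in> borel_measurable borel" by measurable
  show ?thesis by (rule that[OF 1 b 2 b2 3 4])
qed

lemma sq_int_wext:
  assumes m: "adm m" and f: "sq_int (zext Lam f)"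
  shows "sq_int (wext m f)"
  unfolding wext_eq_mult by (rule adm_mult[OF m]) (rule sq_int_mult_bounded[OF f])

lemma zext_eq_wext:
  assumes "adm m"
  shows "zext Lam f = (\<lambda>x. zext Lam (\<lambda>x. of_real (1 / m x)) x * wext m f x)"
proof (rule adm_mult[OF assms])
  assume pos: "\<And>x. x \<in> Lam \<Longrightarrow> m x > 0"
  show ?thesis
    by (rule ext) (use pos in \<open>force simp: wext_def zext_def\<close>)
qed

lemma sq_int_wext_iff:
  assumes m: "adm m"
  shows "sq_int (wext m f) \<longleftrightarrow> sq_int (zext Lam f)"
proof
  assume f: "sq_int (wext m f)"
  show "sq_int (zext Lam f)"
    by (subst zext_eq_wext[OF m]) (rule adm_mult[OF m], rule sq_int_mult_bounded[OF f])
qed (rule sq_int_wext[OF m])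

lemma tendsto_wext_iff:
  assumes m: "adm m" and f: "\<And>n. sq_int (zext Lam (f n))" "sq_int (zext Lam g)"
  shows "(\<lambda>n. cls (wext m (f n))) \<longlonglongrightarrow> cls (wext m g) \<longleftrightarrow> (\<lambda>n. LINT x:Lam|lborel. (cmod (f n x - g x))\<^sup>2) \<longlonglongrightarrow> 0"
  unfolding tendsto_cls_zext_iff[of Lam f g, OF f, symmetric]
proof
  assume l: "(\<lambda>n. cls (wext m (f n))) \<longlonglongrightarrow> cls (wext m g)"
  show "(\<lambda>n. cls (zext Lam (f n))) \<longlonglongrightarrow> cls (zext Lam g)"
    unfolding zext_eq_wext[OF m, of "f n" for n] zext_eq_wext[OF m, of g]
    by (rule adm_mult[OF m]) (rule tendsto_cls_mult[OF sq_int_wext[OF m f(1)] sq_int_wext[OF m f(2)] _ _ l])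
next
  assume l: "(\<lambda>n. cls (zext Lam (f n))) \<longlonglongrightarrow> cls (zext Lam g)"
  show "(\<lambda>n. cls (wext m (f n))) \<longlonglongrightarrow> cls (wext m g)"
    unfolding wext_eq_mult by (rule adm_mult[OF m]) (rule tendsto_cls_mult[OF f _ _ l])
qed

text \<open>Needed to turn abstract limits and eigenvectors back into functions: every class
  supported in the strip comes from a weighted function.\<close>

lemma wext_surj:
  assumes m: "adm m" and f: "sq_int f"
  shows "\<exists>g. g \<in> borel_measurable lborel \<and> sq_int (zext Lam g) \<and> wext m g = zext Lam f"
proof (rule adm_mult[OF m])
  fix C
  assume a: "zext Lam (\<lambda>x. complex_of_real (1 / m x)) \<in> borel_measurable lborel"
    "\<And>x. cmod (zext Lam (\<lambda>x. of_real (1 / m x)) x) \<le> C" and pos: "\<And>x. x \<in> Lam \<Longrightarrow> m x > 0"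
  define g where "g x = zext Lam (\<lambda>x. of_real (1 / m x)) x * f x" for x
  have sg: "sq_int g" unfolding g_def[abs_def] by (rule sq_int_mult_bounded[OF f a])
  have "zext Lam g = g" by (auto simp: g_def zext_def fun_eq_iff)
  moreover have "wext m g = zext Lam f"
    by (rule ext) (use pos in \<open>force simp: wext_def zext_def g_def\<close>)
  ultimately show ?thesis using sg sq_int_measurable[OF sg] by (intro exI[of _ g]) simp
qed

section \<open>Test functions on the strip\<close>

lemma C1c_R2_continuous:
  assumes "C1c_R2 U \<phi> ps pt"
  shows "continuous_on S \<phi>" "continuous_on S ps" "continuous_on S pt"
proof -
  have d: "(\<phi> has_derivative (\<lambda>h. fst h *\<^sub>R ps x + snd h *\<^sub>R pt x)) (at x)" for x
    using assms unfolding C1c_R2_def by blast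
  have c: "continuous_on UNIV ps" "continuous_on UNIV pt"
    using assms unfolding C1c_R2_def by blast+
  have "continuous_on UNIV \<phi>"
    by (rule has_derivative_continuous_on) (rule has_derivative_at_withinI[OF d])
  with c show "continuous_on S \<phi>" "continuous_on S ps" "continuous_on S pt"
    by (auto intro: continuous_on_subset)
qed

lemma sq_int_zext_Lam_continuous:
  fixes f :: "real \<times> real \<Rightarrow> complex"
  assumes f: "continuous_on UNIV f" and z: "\<And>s t. R \<le> \<bar>s\<bar> \<Longrightarrow> f (s, t) = 0"
  shows "sq_int (zext Lam f)"
proof -
  let ?K = "cbox (-R, -1) (R, 1::real)"
  have fc: "continuous_on ?K f" using f by (rule continuous_on_subset) simp
  obtain B where "\<forall>y\<in>f ` ?K. cmod y \<le> B"
    using compact_imp_bounded[OF compact_continuous_image[OF fc compact_cbox]] by (auto simp: bounded_iff)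
  then have B: "cmod (f x) \<le> B" if "x \<in> ?K" for x using that by blast
  show ?thesis
  proof (rule sq_int_bound)
    show "zext Lam f \<in> borel_measurable lborel"
      using borel_measurable_continuous_onI[OF f] Lam_borel by (intro zext_measurable) auto
    show "integrable lborel (\<lambda>x. indicator ?K x *\<^sub>R B\<^sup>2)"
      by (rule borel_integrable_compact) auto
    show "AE x in lborel. (cmod (zext Lam f x))\<^sup>2 \<le> indicator ?K x *\<^sub>R B\<^sup>2"
    proof (rule AE_I2)
      fix x :: "real \<times> real"
      obtain s t where x: "x = (s, t)" by (cases x)
      show "(cmod (zext Lam f x))\<^sup>2 \<le> indicator ?K x *\<^sub>R B\<^sup>2"
      proof (cases "x \<in> Lam \<and> \<bar>s\<bar> < R")
        case True
        then have "x \<in> ?K" by (auto simp: x Lam_def cbox_Pair_eq)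
        then show ?thesis using B[of x] by (auto simp: zext_def intro!: power_mono)
      next
        case False
        then have "zext Lam f x = 0" using z[of s t] by (auto simp: zext_def x)
        then show ?thesis by simp
      qed
    qed
  qed
qed

lemma C1c_R2_sq_int:
  assumes "C1c_R2 Lam \<phi> ps pt"
  shows "sq_int (zext Lam \<phi>)" "sq_int (zext Lam ps)" "sq_int (zext Lam pt)"
proof -
  obtain R where R: "\<And>s t. R \<le> \<bar>s\<bar> \<or> 1 \<le> \<bar>t\<bar> \<Longrightarrow> \<phi> (s, t) = 0 \<and> ps (s, t) = 0 \<and> pt (s, t) = 0"
    using C1c_R2_support[OF assms] by metis
  show "sq_int (zext Lam \<phi>)" "sq_int (zext Lam ps)" "sq_int (zext Lam pt)"
    using R by (intro sq_int_zext_Lam_continuous[where R=R] C1c_R2_continuous[OF assms]; blast)+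
qed

lemma C1c_R2_add:
  assumes "C1c_R2 U \<phi> ps pt" "C1c_R2 U \<phi>' ps' pt'"
  shows "C1c_R2 U (\<lambda>x. \<phi> x + \<phi>' x) (\<lambda>x. ps x + ps' x) (\<lambda>x. pt x + pt' x)"
  unfolding C1c_R2_def
proof (intro conjI allI)
  show "continuous_on UNIV (\<lambda>x. ps x + ps' x)" "continuous_on UNIV (\<lambda>x. pt x + pt' x)"
    using assms by (intro continuous_intros; simp add: C1c_R2_def)+
  show "((\<lambda>x. \<phi> x + \<phi>' x) has_derivative (\<lambda>h. fst h *\<^sub>R (ps x + ps' x) + snd h *\<^sub>R (pt x + pt' x))) (at x)" for x
  proof -
    have d: "(\<phi> has_derivative (\<lambda>h. fst h *\<^sub>R ps x + snd h *\<^sub>R pt x)) (at x)"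
      "(\<phi>' has_derivative (\<lambda>h. fst h *\<^sub>R ps' x + snd h *\<^sub>R pt' x)) (at x)"
      using assms unfolding C1c_R2_def by blast+
    have "(\<lambda>h. fst h *\<^sub>R (ps x + ps' x) + snd h *\<^sub>R (pt x + pt' x)) =
        (\<lambda>h. (fst h *\<^sub>R ps x + snd h *\<^sub>R pt x) + (fst h *\<^sub>R ps' x + snd h *\<^sub>R pt' x))"
      by (simp add: fun_eq_iff scaleR_add_right)
    then show ?thesis using has_derivative_add[OF d] by simp
  qed
  have sub: "closure {x. \<phi> x + \<phi>' x \<noteq> 0} \<subseteq> closure {x. \<phi> x \<noteq> 0} \<union> closure {x. \<phi>' x \<noteq> 0}"
    unfolding closure_Un[symmetric] by (rule closure_mono) auto
  have c: "compact (closure {x. \<phi> x \<noteq> 0} \<union> closure {x. \<phi>' x \<noteq> 0})"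
    using assms by (intro compact_Un) (simp_all add: C1c_R2_def)
  show "closure {x. \<phi> x + \<phi>' x \<noteq> 0} \<subseteq> U" using sub assms unfolding C1c_R2_def by blast
  show "compact (closure {x. \<phi> x + \<phi>' x \<noteq> 0})"
    using compact_Int_closed[OF c closed_closure[of "{x. \<phi> x + \<phi>' x \<noteq> 0}"]] sub
    by (simp only: inf.absorb2)
qed

lemma C1c_R2_cmult:
  assumes "C1c_R2 U \<phi> ps pt"
  shows "C1c_R2 U (\<lambda>x. c * \<phi> x) (\<lambda>x. c * ps x) (\<lambda>x. c * pt x)"
  unfolding C1c_R2_def
proof (intro conjI allI)
  show "continuous_on UNIV (\<lambda>x. c * ps x)" "continuous_on UNIV (\<lambda>x. c * pt x)"
    using assms by (intro continuous_intros; simp add: C1c_R2_def)+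
  show "((\<lambda>x. c * \<phi> x) has_derivative (\<lambda>h. fst h *\<^sub>R (c * ps x) + snd h *\<^sub>R (c * pt x))) (at x)" for x
  proof -
    have d: "(\<phi> has_derivative (\<lambda>h. fst h *\<^sub>R ps x + snd h *\<^sub>R pt x)) (at x)"
      using assms unfolding C1c_R2_def by blast
    have "(\<lambda>h. fst h *\<^sub>R (c * ps x) + snd h *\<^sub>R (c * pt x)) = (\<lambda>h. c * (fst h *\<^sub>R ps x + snd h *\<^sub>R pt x))"
      by (simp add: fun_eq_iff distrib_left)
    then show ?thesis using has_derivative_mult_right[OF d, of c] by simp
  qed
  have sub: "closure {x. c * \<phi> x \<noteq> 0} \<subseteq> closure {x. \<phi> x \<noteq> 0}"
    by (rule closure_mono) auto
  have c: "compact (closure {x. \<phi> x \<noteq> 0})" using assms by (simp only: C1c_R2_def)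
  show "closure {x. c * \<phi> x \<noteq> 0} \<subseteq> U" using sub assms unfolding C1c_R2_def by blast
  show "compact (closure {x. c * \<phi> x \<noteq> 0})"
    using compact_Int_closed[OF c closed_closure[of "{x. c * \<phi> x \<noteq> 0}"]] sub
    by (simp only: inf.absorb2)
qed

lemma C1c_R2_H10:
  assumes "C1c_R2 Lam \<phi> ps pt"
  shows "H10_R2 Lam \<phi> ps pt"
  unfolding H10_R2_def
proof (intro conjI exI allI)
  have "\<phi> \<in> borel_measurable lborel" "ps \<in> borel_measurable lborel" "pt \<in> borel_measurable lborel"
    using borel_measurable_continuous_onI[OF C1c_R2_continuous(1)[OF assms]]
      borel_measurable_continuous_onI[OF C1c_R2_continuous(2)[OF assms]]
      borel_measurable_continuous_onI[OF C1c_R2_continuous(3)[OF assms]] by auto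
  then show "L2w Lam (\<lambda>_. 1) \<phi>" "L2w Lam (\<lambda>_. 1) ps" "L2w Lam (\<lambda>_. 1) pt"
    using C1c_R2_sq_int[OF assms] L2w_zext_iff by blast+
  show "C1c_R2 Lam ((\<lambda>_. \<phi>) n) ((\<lambda>_. ps) n) ((\<lambda>_. pt) n)" for n :: nat by (rule assms)
qed (simp_all add: set_lebesgue_integral_def)

lemma subspace_closure':
  fixes S :: "'a::real_normed_vector set"
  assumes "subspace S"
  shows "subspace (closure S)"
proof (rule subspaceI)
  show "0 \<in> closure S" using assms closure_subset subspace_0 by blast
  fix x y assume "x \<in> closure S" "y \<in> closure S"
  then obtain f g where "\<And>n. f n \<in> S" "f \<longlonglongrightarrow> x" "\<And>n. g n \<in> S" "g \<longlonglongrightarrow> y"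
    unfolding closure_sequential by blast
  then show "x + y \<in> closure S"
    unfolding closure_sequential
    by (intro exI[of _ "\<lambda>n. f n + g n"] conjI allI tendsto_add subspace_add[OF assms])
next
  fix x and c :: real assume "x \<in> closure S"
  then obtain f where "\<And>n. f n \<in> S" "f \<longlonglongrightarrow> x" unfolding closure_sequential by blast
  then show "c *\<^sub>R x \<in> closure S"
    unfolding closure_sequential
    by (intro exI[of _ "\<lambda>n. c *\<^sub>R f n"] conjI allI tendsto_scaleR tendsto_const subspace_scale[OF assms])
qed

text \<open>\<open>a\<close> plays the role of |\<Theta>'|; beyond \<open>s0\<close> the strip
  carries the metric of the constantly twisted one.\<close>

locale tube = strip +
  fixes a :: "real \<Rightarrow> real" and s0 :: real
  assumes a_cont: "continuous_on UNIV a" and a_out: "\<And>s. s0 \<le> \<bar>s\<bar> \<Longrightarrow> a s = \<gamma>" and s0: "s0 > 0"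
begin

definition F :: "real \<times> real \<Rightarrow> real" where "F = f_eps a \<epsilon>"

lemma F_ge_1: "F x \<ge> 1"
  by (simp add: F_def f_eps_def)

lemma F_pos: "F x > 0"
  using F_ge_1[of x] by linarith

lemma F_continuous: "continuous_on S F"
proof -
  have "continuous_on UNIV F"
    unfolding F_def f_eps_def
    by (intro continuous_intros continuous_on_compose2[OF a_cont]) auto
  then show ?thesis by (rule continuous_on_subset) simp
qed

lemma F_out: "s0 \<le> \<bar>s\<bar> \<Longrightarrow> F (s, t) = h_eps \<gamma> \<epsilon> t"
  by (simp add: F_def f_eps_def h_eps_def a_out)

text \<open>\<open>a\<close> is bounded on the compact middle part by continuity and is constant
  outside, so the bound is uniform in s.\<close>

lemma F_bounded: obtains Fm where "Fm \<ge> 1" "\<And>s t. \<bar>t\<bar> \<le> 1 \<Longrightarrow> F (s, t) \<le> Fm"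
proof -
  have "continuous_on {-s0..s0} a" using a_cont by (rule continuous_on_subset) simp
  then obtain A where "\<forall>y\<in>a ` {-s0..s0}. norm y \<le> A"
    using compact_imp_bounded[OF compact_continuous_image[OF _ compact_Icc, of "-s0" s0 a]]
    by (auto simp: bounded_iff)
  then have A: "\<bar>a s\<bar> \<le> A" if "s \<in> {-s0..s0}" for s using that by force
  define B where "B = max A \<bar>\<gamma>\<bar>"
  have aB: "(a s)\<^sup>2 \<le> B\<^sup>2" for s
  proof -
    have "\<bar>a s\<bar> \<le> B" using A[of s] a_out[of s] by (cases "s0 \<le> \<bar>s\<bar>") (auto simp: B_def le_max_iff_disj not_le abs_less_iff)
    then show ?thesis by (metis abs_ge_zero power2_abs power_mono)
  qed
  show ?thesis
  proof (rule that[of "sqrt (1 + B\<^sup>2 * \<epsilon>\<^sup>2)"])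
    fix s t :: real assume "\<bar>t\<bar> \<le> 1"
    then have "t\<^sup>2 \<le> 1" by (simp add: abs_square_le_1)
    then have "(a s)\<^sup>2 * \<epsilon>\<^sup>2 * t\<^sup>2 \<le> B\<^sup>2 * \<epsilon>\<^sup>2 * 1" by (intro mult_mono aB) auto
    then show "F (s, t) \<le> sqrt (1 + B\<^sup>2 * \<epsilon>\<^sup>2)" by (simp add: F_def f_eps_def)
  qed simp
qed

text \<open>\<open>w\<close> is the density of the Hilbert space; \<open>m1\<close>,
  \<open>m2\<close>, \<open>m3\<close> are the square roots of the weights that |\<psi>|^2, |d_s
  \<psi>|^2 and |d_t \<psi>|^2 carry in the norm and in the form.\<close>

definition w :: "real \<times> real \<Rightarrow> real" where "w x = \<epsilon> * F x"
definition m1 :: "real \<times> real \<Rightarrow> real" where "m1 x = sqrt (w x)"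
definition m2 :: "real \<times> real \<Rightarrow> real" where "m2 x = sqrt (w x) / F x"
definition m3 :: "real \<times> real \<Rightarrow> real" where "m3 x = sqrt (w x) / \<epsilon>"

lemma w_pos: "w x > 0" using F_pos[of x] \<epsilon> by (simp add: w_def)

lemma m_sq: "(m1 x)\<^sup>2 = w x" "(m2 x)\<^sup>2 = w x / (F x)\<^sup>2" "(m3 x)\<^sup>2 = w x / \<epsilon>\<^sup>2"
  using w_pos[of x] by (simp_all add: m1_def m2_def m3_def power_divide)

lemma adm_m: "adm m1" "adm m2" "adm m3"
proof -
  obtain Fm where Fm: "Fm \<ge> 1" "\<And>s t. \<bar>t\<bar> \<le> 1 \<Longrightarrow> F (s, t) \<le> Fm" by (rule F_bounded) blast
  have FL: "F x \<le> Fm" if "x \<in> Lam" for x using that Fm(2)[of "snd x" "fst x"] by (auto simp: Lam_def)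
  have wL: "\<epsilon> \<le> w x" "w x \<le> \<epsilon> * Fm" if "x \<in> Lam" for x
    using FL[OF that] F_ge_1[of x] \<epsilon> by (auto simp: w_def)
  have sL: "sqrt \<epsilon> \<le> sqrt (w x)" "sqrt (w x) \<le> sqrt (\<epsilon> * Fm)" if "x \<in> Lam" for x
    using wL[OF that] by auto
  have c: "continuous_on UNIV (\<lambda>x. sqrt (w x))" unfolding w_def by (intro continuous_intros F_continuous)
  show "adm m1" unfolding adm_def m1_def
    using c sL \<epsilon> by (intro conjI exI[of _ "sqrt \<epsilon>"] exI[of _ "sqrt (\<epsilon> * Fm)"]) auto
  have "continuous_on UNIV (\<lambda>x. sqrt (w x) / F x)"
    using F_pos by (intro continuous_intros c F_continuous) (auto simp: less_imp_neq[symmetric])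
  moreover have "sqrt \<epsilon> / Fm \<le> sqrt (w x) / F x \<and> sqrt (w x) / F x \<le> sqrt (\<epsilon> * Fm)" if "x \<in> Lam" for x
  proof
    show "sqrt \<epsilon> / Fm \<le> sqrt (w x) / F x"
      using sL[OF that] FL[OF that] F_pos[of x] w_pos[of x] \<epsilon> by (intro frac_le) auto
    have "sqrt (w x) / F x \<le> sqrt (w x) / 1" using F_ge_1[of x] w_pos[of x] by (intro divide_left_mono) auto
    then show "sqrt (w x) / F x \<le> sqrt (\<epsilon> * Fm)" using sL(2)[OF that] by linarith
  qed
  ultimately show "adm m2" unfolding adm_def m2_def
    using Fm(1) \<epsilon> by (intro conjI exI[of _ "sqrt \<epsilon> / Fm"] exI[of _ "sqrt (\<epsilon> * Fm)"] ballI) auto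
  have "continuous_on UNIV (\<lambda>x. sqrt (w x) / \<epsilon>)" using \<epsilon> by (intro continuous_intros c) auto
  moreover have "sqrt \<epsilon> / \<epsilon> \<le> sqrt (w x) / \<epsilon> \<and> sqrt (w x) / \<epsilon> \<le> sqrt (\<epsilon> * Fm) / \<epsilon>" if "x \<in> Lam" for x
    using sL[OF that] \<epsilon> by (auto intro: divide_right_mono)
  ultimately show "adm m3" unfolding adm_def m3_def
    using \<epsilon> by (intro conjI exI[of _ "sqrt \<epsilon> / \<epsilon>"] exI[of _ "sqrt (\<epsilon> * Fm) / \<epsilon>"] ballI) auto
qed

lemma L2w_w_iff: "L2w Lam w f \<longleftrightarrow> f \<in> borel_measurable lborel \<and> sq_int (zext Lam f)"
proof -
  have "(cmod (wext m1 f x))\<^sup>2 = indicator Lam x *\<^sub>R (w x * (cmod (f x))\<^sup>2)" for x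
    using m_sq(1)[of x] by (auto simp: wext_def zext_def norm_mult power_mult_distrib)
  then have "integrable lborel (\<lambda>x. (cmod (wext m1 f x))\<^sup>2) \<longleftrightarrow> set_integrable lborel Lam (\<lambda>x. w x * (cmod (f x))\<^sup>2)"
    by (simp add: set_integrable_def)
  moreover have "wext m1 f \<in> borel_measurable lborel" if "f \<in> borel_measurable lborel"
  proof (rule adm_mult[OF adm_m(1)])
    assume [measurable]: "m1 \<in> borel_measurable borel"
    have [measurable]: "f \<in> borel_measurable borel" using that by simp
    show ?thesis unfolding wext_def by (intro zext_measurable Lam_borel) measurable
  qed
  ultimately have "f \<in> borel_measurable lborel \<Longrightarrow>
      set_integrable lborel Lam (\<lambda>x. w x * (cmod (f x))\<^sup>2) \<longleftrightarrow> sq_int (wext m1 f)"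
    by (auto simp: sq_int_def)
  then show ?thesis unfolding L2w_def sq_int_wext_iff[OF adm_m(1)] by blast
qed

lemma nrmw_eq:
  assumes "sq_int (zext Lam f)"
  shows "nrmw Lam w f = norm (cls (wext m1 f))"
proof -
  have "(cmod (wext m1 f x))\<^sup>2 = indicator Lam x *\<^sub>R (w x * (cmod (f x))\<^sup>2)" for x
    using m_sq(1)[of x] by (auto simp: wext_def zext_def norm_mult power_mult_distrib)
  then have "(norm (cls (wext m1 f)))\<^sup>2 = (LINT x:Lam|lborel. w x * (cmod (f x))\<^sup>2)"
    by (simp add: norm_cls_sq sq_int_wext[OF adm_m(1) assms] set_lebesgue_integral_def)
  then show ?thesis unfolding nrmw_def by (metis norm_ge_zero real_sqrt_unique)
qed

text \<open>The weights turn \<open>H\<^sup>1\<^sub>0(\<Lambda>)\<close> into a subspace of an unweighted Hilbert space in which the form and the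
  scalar product are the inner products of the second and of the first components.\<close>

definition emb :: "(real \<times> real \<Rightarrow> complex) \<Rightarrow> (real \<times> real \<Rightarrow> complex) \<Rightarrow> (real \<times> real \<Rightarrow> complex) \<Rightarrow>
    (real \<times> real) L2 \<times> ((real \<times> real) L2 \<times> (real \<times> real) L2)" where
  "emb \<psi> \<psi>s \<psi>t = (cls (wext m1 \<psi>), (cls (wext m2 \<psi>s), cls (wext m3 \<psi>t)))"

definition S0 :: "((real \<times> real) L2 \<times> ((real \<times> real) L2 \<times> (real \<times> real) L2)) set" where
  "S0 = {u. \<exists>\<phi> ps pt. C1c_R2 Lam \<phi> ps pt \<and> u = emb \<phi> ps pt}"

text \<open>Convergence of all three components amounts to convergence in the first order Sobolev
  norm, so this closure is the image of the form domain; \<open>H10_R2_X\<close> and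
  \<open>X_cases\<close> give the two inclusions.\<close>

definition X :: "((real \<times> real) L2 \<times> ((real \<times> real) L2 \<times> (real \<times> real) L2)) set" where
  "X = closure S0"

lemma wext_add: "wext m (\<lambda>x. f x + g x) = (\<lambda>x. wext m f x + wext m g x)"
  by (auto simp: wext_def zext_def distrib_left)

lemma wext_cmult: "wext m (\<lambda>x. c * f x) = (\<lambda>x. c * wext m f x)"
  by (auto simp: wext_def zext_def)

lemma subspace_S0: "subspace S0"
proof (rule subspaceI)
  have "C1c_R2 Lam (\<lambda>x. 0) (\<lambda>x. 0) (\<lambda>x. 0)" by (simp add: C1c_R2_def)
  moreover have "emb (\<lambda>x. 0) (\<lambda>x. 0) (\<lambda>x. 0) = 0"
    by (simp add: emb_def wext_def zext_def[abs_def] cls_zero zero_prod_def cong: if_cong)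
  ultimately show "0 \<in> S0" unfolding S0_def by force
next
  fix x y assume "x \<in> S0" "y \<in> S0"
  then obtain \<phi> ps pt \<phi>' ps' pt' where c: "C1c_R2 Lam \<phi> ps pt" "C1c_R2 Lam \<phi>' ps' pt'"
    and x: "x = emb \<phi> ps pt" "y = emb \<phi>' ps' pt'" unfolding S0_def by blast
  have "x + y = emb (\<lambda>x. \<phi> x + \<phi>' x) (\<lambda>x. ps x + ps' x) (\<lambda>x. pt x + pt' x)"
    using C1c_R2_sq_int[OF c(1)] C1c_R2_sq_int[OF c(2)]
    by (simp add: x emb_def wext_add cls_add sq_int_wext adm_m)
  then show "x + y \<in> S0" unfolding S0_def using C1c_R2_add[OF c] by blast
next
  fix x and r :: real assume "x \<in> S0"
  then obtain \<phi> ps pt where c: "C1c_R2 Lam \<phi> ps pt" and x: "x = emb \<phi> ps pt" unfolding S0_def by blast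
  have "r *\<^sub>R x = emb (\<lambda>x. of_real r * \<phi> x) (\<lambda>x. of_real r * ps x) (\<lambda>x. of_real r * pt x)"
    using C1c_R2_sq_int[OF c]
    by (simp add: x emb_def wext_cmult cls_scaleR sq_int_wext adm_m scaleR_conv_of_real)
  then show "r *\<^sub>R x \<in> S0" unfolding S0_def using C1c_R2_cmult[OF c] by blast
qed

lemma subspace_X: "subspace X"
  unfolding X_def by (rule subspace_closure'[OF subspace_S0])

lemma closed_X: "closed X"
  unfolding X_def by (rule closed_closure)

lemma H10_R2_X:
  assumes "H10_R2 Lam \<psi> \<psi>s \<psi>t"
  shows "emb \<psi> \<psi>s \<psi>t \<in> X" "sq_int (zext Lam \<psi>)" "sq_int (zext Lam \<psi>s)" "sq_int (zext Lam \<psi>t)"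
    "\<psi> \<in> borel_measurable lborel" "\<psi>s \<in> borel_measurable lborel" "\<psi>t \<in> borel_measurable lborel"
proof -
  show sq: "sq_int (zext Lam \<psi>)" "sq_int (zext Lam \<psi>s)" "sq_int (zext Lam \<psi>t)"
    using assms by (auto simp: H10_R2_def intro!: sq_int_zext Lam_borel)
  show "\<psi> \<in> borel_measurable lborel" "\<psi>s \<in> borel_measurable lborel" "\<psi>t \<in> borel_measurable lborel"
    using assms by (auto simp: H10_R2_def L2w_def)
  obtain \<phi> ps pt where c: "\<And>n. C1c_R2 Lam (\<phi> n) (ps n) (pt n)"
    and l: "(\<lambda>n. LINT x:Lam|lborel. (cmod (\<phi> n x - \<psi> x))\<^sup>2) \<longlonglongrightarrow> 0"
      "(\<lambda>n. LINT x:Lam|lborel. (cmod (ps n x - \<psi>s x))\<^sup>2) \<longlonglongrightarrow> 0"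
      "(\<lambda>n. LINT x:Lam|lborel. (cmod (pt n x - \<psi>t x))\<^sup>2) \<longlonglongrightarrow> 0"
    using assms unfolding H10_R2_def by blast
  note sc = C1c_R2_sq_int[OF c]
  have "(\<lambda>n. emb (\<phi> n) (ps n) (pt n)) \<longlonglongrightarrow> emb \<psi> \<psi>s \<psi>t"
    unfolding emb_def
    using tendsto_wext_iff[of m1 \<phi> \<psi>, OF adm_m(1) sc(1) sq(1)] tendsto_wext_iff[of m2 ps \<psi>s, OF adm_m(2) sc(2) sq(2)]
      tendsto_wext_iff[of m3 pt \<psi>t, OF adm_m(3) sc(3) sq(3)] l
    by (intro tendsto_Pair) blast+
  moreover have "emb (\<phi> n) (ps n) (pt n) \<in> S0" for n unfolding S0_def using c by blast
  ultimately show "emb \<psi> \<psi>s \<psi>t \<in> X" unfolding X_def closure_sequential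
    by (intro exI[of _ "\<lambda>n. emb (\<phi> n) (ps n) (pt n)"]) blast
qed

lemma X_H10_R2:
  assumes X: "emb \<psi> \<psi>s \<psi>t \<in> X" and sq: "sq_int (zext Lam \<psi>)" "sq_int (zext Lam \<psi>s)" "sq_int (zext Lam \<psi>t)"
    and meas: "\<psi> \<in> borel_measurable lborel" "\<psi>s \<in> borel_measurable lborel" "\<psi>t \<in> borel_measurable lborel"
  shows "H10_R2 Lam \<psi> \<psi>s \<psi>t"
proof -
  obtain x where x: "\<And>n. x n \<in> S0" "x \<longlonglongrightarrow> emb \<psi> \<psi>s \<psi>t" using X unfolding X_def closure_sequential by blast
  have "\<forall>n. \<exists>\<phi> ps pt. C1c_R2 Lam \<phi> ps pt \<and> x n = emb \<phi> ps pt" using x(1) unfolding S0_def by blast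
  then obtain \<phi> ps pt where c: "\<And>n. C1c_R2 Lam (\<phi> n) (ps n) (pt n)" and xe: "\<And>n. x n = emb (\<phi> n) (ps n) (pt n)"
    by metis
  note sc = C1c_R2_sq_int[OF c]
  have l: "(\<lambda>n. emb (\<phi> n) (ps n) (pt n)) \<longlonglongrightarrow> emb \<psi> \<psi>s \<psi>t" using x(2) unfolding xe[abs_def] by (simp add: xe)
  have "(\<lambda>n. cls (wext m1 (\<phi> n))) \<longlonglongrightarrow> cls (wext m1 \<psi>)" using tendsto_fst[OF l] by (simp add: emb_def)
  moreover have "(\<lambda>n. cls (wext m2 (ps n))) \<longlonglongrightarrow> cls (wext m2 \<psi>s)" using tendsto_fst[OF tendsto_snd[OF l]] by (simp add: emb_def)
  moreover have "(\<lambda>n. cls (wext m3 (pt n))) \<longlonglongrightarrow> cls (wext m3 \<psi>t)" using tendsto_snd[OF tendsto_snd[OF l]] by (simp add: emb_def)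
  ultimately show ?thesis
    unfolding H10_R2_def
    using tendsto_wext_iff[of m1 \<phi> \<psi>, OF adm_m(1) sc(1) sq(1)] tendsto_wext_iff[of m2 ps \<psi>s, OF adm_m(2) sc(2) sq(2)]
      tendsto_wext_iff[of m3 pt \<psi>t, OF adm_m(3) sc(3) sq(3)] c
      L2w_zext_iff[OF sq(1) meas(1)] L2w_zext_iff[OF sq(2) meas(2)] L2w_zext_iff[OF sq(3) meas(3)]
    by blast
qed

text \<open>A limit of embedded triples could a priori be nonzero off the strip. Multiplying by the
  indicator of the strip fixes every member of the sequence, hence also the limit, and surjectivity
  of the weighting then produces the functions.\<close>

lemma X_cases:
  assumes u: "u \<in> X"
  obtains \<psi> \<psi>s \<psi>t where "u = emb \<psi> \<psi>s \<psi>t" "H10_R2 Lam \<psi> \<psi>s \<psi>t"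
proof -
  have res: "\<exists>g. g \<in> borel_measurable lborel \<and> sq_int (zext Lam g) \<and> v = cls (wext m g)"
    if m: "adm m" and l: "(\<lambda>n. cls (wext m (f n))) \<longlonglongrightarrow> v" and f: "\<And>n. sq_int (zext Lam (f n))" for m v and f :: "nat \<Rightarrow> _"
  proof -
    obtain f1 where f1: "sq_int f1" "v = cls f1" by (rule L2_cases)
    have ind: "zext Lam (\<lambda>_. 1) \<in> borel_measurable lborel" by (intro zext_measurable Lam_borel) simp
    have "(\<lambda>n. cls (\<lambda>x. zext Lam (\<lambda>_. 1) x * wext m (f n) x)) \<longlonglongrightarrow> cls (\<lambda>x. zext Lam (\<lambda>_. 1) x * f1 x)"
    proof (rule tendsto_cls_mult[where C=1, OF sq_int_wext[OF m f] f1(1) ind])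
      show "cmod (zext Lam (\<lambda>_. 1) x) \<le> 1" for x by (simp add: zext_def)
      show "(\<lambda>n. cls (wext m (f n))) \<longlonglongrightarrow> cls f1" using l f1(2) by simp
    qed
    moreover have "(\<lambda>x. zext Lam (\<lambda>_. 1) x * g x) = zext Lam g" for g by (auto simp: zext_def)
    moreover have "zext Lam (wext m g) = wext m g" for g by (auto simp: zext_def wext_def)
    ultimately have "(\<lambda>n. cls (wext m (f n))) \<longlonglongrightarrow> cls (zext Lam f1)" by simp
    then have "v = cls (zext Lam f1)" using l LIMSEQ_unique by blast
    then show ?thesis using wext_surj[OF m f1(1)] by metis
  qed
  obtain x where x: "\<And>n. x n \<in> S0" "x \<longlonglongrightarrow> u" using u unfolding X_def closure_sequential by blast
  have "\<forall>n. \<exists>\<phi> ps pt. C1c_R2 Lam \<phi> ps pt \<and> x n = emb \<phi> ps pt" using x(1) unfolding S0_def by blast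
  then obtain \<phi> ps pt where c: "\<And>n. C1c_R2 Lam (\<phi> n) (ps n) (pt n)" and xe: "\<And>n. x n = emb (\<phi> n) (ps n) (pt n)"
    by metis
  note sc = C1c_R2_sq_int[OF c]
  have l1: "(\<lambda>n. cls (wext m1 (\<phi> n))) \<longlonglongrightarrow> fst u" using tendsto_fst[OF x(2)] by (simp add: xe emb_def)
  have l2: "(\<lambda>n. cls (wext m2 (ps n))) \<longlonglongrightarrow> fst (snd u)" using tendsto_fst[OF tendsto_snd[OF x(2)]] by (simp add: xe emb_def)
  have l3: "(\<lambda>n. cls (wext m3 (pt n))) \<longlonglongrightarrow> snd (snd u)" using tendsto_snd[OF tendsto_snd[OF x(2)]] by (simp add: xe emb_def)
  obtain \<psi> where g1: "\<psi> \<in> borel_measurable lborel" "sq_int (zext Lam \<psi>)" "fst u = cls (wext m1 \<psi>)"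
    using res[OF adm_m(1) l1 sc(1)] by blast
  obtain \<psi>s where g2: "\<psi>s \<in> borel_measurable lborel" "sq_int (zext Lam \<psi>s)" "fst (snd u) = cls (wext m2 \<psi>s)"
    using res[OF adm_m(2) l2 sc(2)] by blast
  obtain \<psi>t where g3: "\<psi>t \<in> borel_measurable lborel" "sq_int (zext Lam \<psi>t)" "snd (snd u) = cls (wext m3 \<psi>t)"
    using res[OF adm_m(3) l3 sc(3)] by blast
  have ue: "u = emb \<psi> \<psi>s \<psi>t" using g1 g2 g3 by (simp add: emb_def prod_eq_iff)
  have "H10_R2 Lam \<psi> \<psi>s \<psi>t"
    by (rule X_H10_R2[OF _ g1(2) g2(2) g3(2) g1(1) g2(1) g3(1)]) (use u ue in simp)
  with ue show ?thesis by (rule that)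
qed

lemma H10_R2_imult: "H10_R2 Lam \<psi> \<psi>s \<psi>t \<Longrightarrow>
  emb (\<lambda>x. \<i> * \<psi> x) (\<lambda>x. \<i> * \<psi>s x) (\<lambda>x. \<i> * \<psi>t x) =
    (imult (fst (emb \<psi> \<psi>s \<psi>t)), (imult (fst (snd (emb \<psi> \<psi>s \<psi>t))), imult (snd (snd (emb \<psi> \<psi>s \<psi>t)))))"
  using H10_R2_X[of \<psi> \<psi>s \<psi>t] by (simp add: emb_def wext_cmult imult_cls sq_int_wext adm_m)

definition J2 :: "(real \<times> real) L2 \<times> (real \<times> real) L2 \<Rightarrow> (real \<times> real) L2 \<times> (real \<times> real) L2" where
  "J2 v = (imult (fst v), imult (snd v))"

lemma J2: "bounded_linear J2" "inner (J2 x) (J2 y) = inner x y" "inner (J2 x) x = 0" "J2 (J2 x) = - x"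
proof -
  show "bounded_linear J2" unfolding J2_def
    by (intro bounded_linear_Pair bounded_linear_compose[OF bounded_linear_imult] bounded_linear_fst bounded_linear_snd)
qed (simp_all add: J2_def inner_prod_def imult_inner imult_self imult_imult prod_eq_iff)

lemma X_imult:
  assumes "u \<in> X"
  shows "(imult (fst u), J2 (snd u)) \<in> X"
proof -
  have bl: "bounded_linear (\<lambda>u. (imult (fst u), J2 (snd u)))"
    by (intro bounded_linear_Pair bounded_linear_compose[OF bounded_linear_imult]
        bounded_linear_compose[OF J2(1)] bounded_linear_fst bounded_linear_snd)
  obtain x where x: "\<And>n. x n \<in> S0" "x \<longlonglongrightarrow> u" using assms unfolding X_def closure_sequential by blast
  have "(\<lambda>n. (imult (fst (x n)), J2 (snd (x n)))) \<longlonglongrightarrow> (imult (fst u), J2 (snd u))"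
    using bounded_linear.tendsto[OF bl x(2)] .
  moreover have "(imult (fst (x n)), J2 (snd (x n))) \<in> S0" for n
  proof -
    obtain \<phi> ps pt where c: "C1c_R2 Lam \<phi> ps pt" "x n = emb \<phi> ps pt" using x(1)[of n] unfolding S0_def by blast
    have "(imult (fst (x n)), J2 (snd (x n))) = emb (\<lambda>x. \<i> * \<phi> x) (\<lambda>x. \<i> * ps x) (\<lambda>x. \<i> * pt x)"
      using H10_R2_imult[OF C1c_R2_H10[OF c(1)]] by (simp add: c(2) J2_def)
    then show ?thesis unfolding S0_def using C1c_R2_cmult[OF c(1)] by blast
  qed
  ultimately show ?thesis unfolding X_def closure_sequential
    by (intro exI[of _ "\<lambda>n. (imult (fst (x n)), J2 (snd (x n)))"] conjI allI)
qed

text \<open>Both sides are continuous in v, so an equation tested on smooth functions extends to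
  their closure.\<close>

lemma X_closed_inner:
  assumes "\<And>\<phi> ps pt. C1c_R2 Lam \<phi> ps pt \<Longrightarrow>
    inner p (snd (emb \<phi> ps pt)) = inner q (fst (emb \<phi> ps pt))"
    and "v \<in> X"
  shows "inner p (snd v) = inner q (fst v)"
proof -
  obtain x where x: "\<And>n. x n \<in> S0" "x \<longlonglongrightarrow> v" using assms(2) unfolding X_def closure_sequential by blast
  have "(\<lambda>n. inner p (snd (x n))) \<longlonglongrightarrow> inner p (snd v)" "(\<lambda>n. inner q (fst (x n))) \<longlonglongrightarrow> inner q (fst v)"
    by (intro tendsto_intros x)+
  moreover have "inner p (snd (x n)) = inner q (fst (x n))" for n
  proof -
    obtain \<phi> ps pt where "C1c_R2 Lam \<phi> ps pt" "x n = emb \<phi> ps pt" using x(1)[of n] unfolding S0_def by blast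
    with assms(1) show ?thesis by simp
  qed
  ultimately show ?thesis using LIMSEQ_unique by simp
qed

lemma form_eq:
  assumes "H10_R2 Lam \<psi> \<psi>s \<psi>t" "H10_R2 Lam \<phi> \<phi>s \<phi>t"
  shows "(LINT x:Lam|lborel. complex_of_real (\<epsilon> * F x) *
        (\<psi>s x * cnj (\<phi>s x) / complex_of_real ((F x)\<^sup>2) + \<psi>t x * cnj (\<phi>t x) / complex_of_real (\<epsilon>\<^sup>2)))
     = cin (wext m2 \<psi>s) (wext m2 \<phi>s) + cin (wext m3 \<psi>t) (wext m3 \<phi>t)"
proof -
  note u = H10_R2_X[OF assms(1)] and v = H10_R2_X[OF assms(2)]
  have i: "integrable lborel (\<lambda>x. wext m2 \<psi>s x * cnj (wext m2 \<phi>s x))" "integrable lborel (\<lambda>x. wext m3 \<psi>t x * cnj (wext m3 \<phi>t x))"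
    by (rule sq_int_integrable_mult[OF sq_int_wext[OF adm_m(2) u(3)] sq_int_wext[OF adm_m(2) v(3)]],
      rule sq_int_integrable_mult[OF sq_int_wext[OF adm_m(3) u(4)] sq_int_wext[OF adm_m(3) v(4)]])
  have "indicator Lam x *\<^sub>R (complex_of_real (\<epsilon> * F x) *
        (\<psi>s x * cnj (\<phi>s x) / complex_of_real ((F x)\<^sup>2) + \<psi>t x * cnj (\<phi>t x) / complex_of_real (\<epsilon>\<^sup>2)))
     = wext m2 \<psi>s x * cnj (wext m2 \<phi>s x) + wext m3 \<psi>t x * cnj (wext m3 \<phi>t x)" for x
  proof (cases "x \<in> Lam")
    case True
    have 2: "complex_of_real (m2 x) * complex_of_real (m2 x) = complex_of_real (\<epsilon> * F x) / complex_of_real ((F x)\<^sup>2)"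
      using m_sq(2)[of x] unfolding w_def by (metis of_real_divide of_real_mult power2_eq_square)
    have 3: "complex_of_real (m3 x) * complex_of_real (m3 x) = complex_of_real (\<epsilon> * F x) / complex_of_real (\<epsilon>\<^sup>2)"
      using m_sq(3)[of x] unfolding w_def by (metis of_real_divide of_real_mult power2_eq_square)
    have "wext m2 \<psi>s x * cnj (wext m2 \<phi>s x) = (complex_of_real (m2 x) * complex_of_real (m2 x)) * (\<psi>s x * cnj (\<phi>s x))"
      "wext m3 \<psi>t x * cnj (wext m3 \<phi>t x) = (complex_of_real (m3 x) * complex_of_real (m3 x)) * (\<psi>t x * cnj (\<phi>t x))"
      using True by (simp_all add: wext_def zext_def mult_ac)
    then show ?thesis using True unfolding 2 3 by (simp add: distrib_left)
  qed (simp add: wext_def zext_def)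
  then show ?thesis unfolding set_lebesgue_integral_def cin_def by (simp add: Bochner_Integration.integral_add[OF i])
qed

lemma ipw_eq: "ipw Lam w g \<phi> = cin (wext m1 g) (wext m1 \<phi>)"
proof -
  have "indicator Lam x *\<^sub>R (complex_of_real (w x) * g x * cnj (\<phi> x)) = wext m1 g x * cnj (wext m1 \<phi> x)" for x
  proof (cases "x \<in> Lam")
    case True
    have 1: "complex_of_real (m1 x) * complex_of_real (m1 x) = complex_of_real (w x)"
      using m_sq(1)[of x] by (metis of_real_mult power2_eq_square)
    show ?thesis using True by (simp add: wext_def zext_def 1[symmetric] mult_ac)
  qed (simp add: wext_def zext_def)
  then show ?thesis unfolding ipw_def set_lebesgue_integral_def cin_def by simp
qed

text \<open>Real parts suffice because \<open>\<phi>\<close> may be replaced by \<open>\<i> * \<phi>\<close>.\<close>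

theorem graph_iff:
  "(\<psi>, g) \<in> dirichlet_graph \<epsilon> F \<longleftrightarrow> L2w Lam w g \<and> (\<exists>\<psi>s \<psi>t. H10_R2 Lam \<psi> \<psi>s \<psi>t \<and>
     (\<forall>\<phi> ps pt. C1c_R2 Lam \<phi> ps pt \<longrightarrow>
        inner (snd (emb \<psi> \<psi>s \<psi>t)) (snd (emb \<phi> ps pt)) = inner (cls (wext m1 g)) (fst (emb \<phi> ps pt))))"
  (is "_ \<longleftrightarrow> ?R")
proof
  have w: "w = (\<lambda>x. \<epsilon> * F x)" by (simp add: w_def fun_eq_iff)
  have Re_form: "Re (cin (wext m2 \<psi>s) (wext m2 \<phi>s) + cin (wext m3 \<psi>t) (wext m3 \<phi>t)) =
      inner (snd (emb \<psi> \<psi>s \<psi>t)) (snd (emb \<phi> \<phi>s \<phi>t))"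
    if "H10_R2 Lam \<psi> \<psi>s \<psi>t" "H10_R2 Lam \<phi> \<phi>s \<phi>t" for \<psi> \<psi>s \<psi>t \<phi> \<phi>s \<phi>t
    using H10_R2_X[OF that(1)] H10_R2_X[OF that(2)]
    by (simp add: emb_def inner_prod_def Re_cin sq_int_wext adm_m)
  have Re_ip: "Re (cin (wext m1 g) (wext m1 \<phi>)) = inner (cls (wext m1 g)) (fst (emb \<phi> \<phi>s \<phi>t))"
    if "L2w Lam w g" "H10_R2 Lam \<phi> \<phi>s \<phi>t" for \<phi> \<phi>s \<phi>t
    using H10_R2_X[OF that(2)] that(1) by (simp add: emb_def Re_cin sq_int_wext adm_m L2w_w_iff)
  {
    assume "(\<psi>, g) \<in> dirichlet_graph \<epsilon> F"
    then obtain \<psi>s \<psi>t where g: "L2w Lam w g" and \<psi>: "H10_R2 Lam \<psi> \<psi>s \<psi>t"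
      and eq: "\<And>\<phi> \<phi>s \<phi>t. H10_R2 Lam \<phi> \<phi>s \<phi>t \<Longrightarrow>
        (LINT x:Lam|lborel. complex_of_real (\<epsilon> * F x) *
        (\<psi>s x * cnj (\<phi>s x) / complex_of_real ((F x)\<^sup>2) + \<psi>t x * cnj (\<phi>t x) / complex_of_real (\<epsilon>\<^sup>2)))
        = ipw Lam w g \<phi>"
      unfolding dirichlet_graph_def w by blast
    have "inner (snd (emb \<psi> \<psi>s \<psi>t)) (snd (emb \<phi> ps pt)) = inner (cls (wext m1 g)) (fst (emb \<phi> ps pt))"
      if c: "C1c_R2 Lam \<phi> ps pt" for \<phi> ps pt
    proof -
      note \<phi> = C1c_R2_H10[OF c]
      have "Re (cin (wext m2 \<psi>s) (wext m2 ps) + cin (wext m3 \<psi>t) (wext m3 pt)) = Re (cin (wext m1 g) (wext m1 \<phi>))"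
        using eq[OF \<phi>] unfolding form_eq[OF \<psi> \<phi>] ipw_eq by simp
      then show ?thesis unfolding Re_form[OF \<psi> \<phi>] Re_ip[OF g \<phi>] .
    qed
    with g \<psi> show ?R by blast
  }
  assume ?R
  then obtain \<psi>s \<psi>t where g: "L2w Lam w g" and \<psi>: "H10_R2 Lam \<psi> \<psi>s \<psi>t"
    and C: "\<And>\<phi> ps pt. C1c_R2 Lam \<phi> ps pt \<Longrightarrow>
      inner (snd (emb \<psi> \<psi>s \<psi>t)) (snd (emb \<phi> ps pt)) = inner (cls (wext m1 g)) (fst (emb \<phi> ps pt))" by blast
  have eq: "inner (snd (emb \<psi> \<psi>s \<psi>t)) (snd v) = inner (cls (wext m1 g)) (fst v)" if "v \<in> X" for v
    using X_closed_inner[OF C that] .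
  have "cin (wext m2 \<psi>s) (wext m2 \<phi>s) + cin (wext m3 \<psi>t) (wext m3 \<phi>t) = cin (wext m1 g) (wext m1 \<phi>)"
    if \<phi>: "H10_R2 Lam \<phi> \<phi>s \<phi>t" for \<phi> \<phi>s \<phi>t
  proof (rule complex_eqI)
    show "Re (cin (wext m2 \<psi>s) (wext m2 \<phi>s) + cin (wext m3 \<psi>t) (wext m3 \<phi>t)) = Re (cin (wext m1 g) (wext m1 \<phi>))"
      unfolding Re_form[OF \<psi> \<phi>] Re_ip[OF g \<phi>] by (rule eq[OF H10_R2_X(1)[OF \<phi>]])
    have \<phi>': "H10_R2 Lam (\<lambda>x. \<i> * \<phi> x) (\<lambda>x. \<i> * \<phi>s x) (\<lambda>x. \<i> * \<phi>t x)"
    proof (rule X_H10_R2)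
      show "emb (\<lambda>x. \<i> * \<phi> x) (\<lambda>x. \<i> * \<phi>s x) (\<lambda>x. \<i> * \<phi>t x) \<in> X"
        using X_imult[OF H10_R2_X(1)[OF \<phi>]] H10_R2_imult[OF \<phi>] by (simp add: J2_def)
      have r: "zext Lam (\<lambda>x. \<i> * f x) = (\<lambda>x. \<i> * zext Lam f x)" for f by (auto simp: zext_def)
      show "sq_int (zext Lam (\<lambda>x. \<i> * \<phi> x))" "sq_int (zext Lam (\<lambda>x. \<i> * \<phi>s x))" "sq_int (zext Lam (\<lambda>x. \<i> * \<phi>t x))"
        unfolding r using H10_R2_X[OF \<phi>] by (auto intro: sq_int_cmult)
    qed (use H10_R2_X[OF \<phi>] in auto)
    have "Re (cin (wext m2 \<psi>s) (wext m2 (\<lambda>x. \<i> * \<phi>s x)) + cin (wext m3 \<psi>t) (wext m3 (\<lambda>x. \<i> * \<phi>t x)))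
        = Re (cin (wext m1 g) (wext m1 (\<lambda>x. \<i> * \<phi> x)))"
      unfolding Re_form[OF \<psi> \<phi>'] Re_ip[OF g \<phi>'] by (rule eq[OF H10_R2_X(1)[OF \<phi>']])
    then show "Im (cin (wext m2 \<psi>s) (wext m2 \<phi>s) + cin (wext m3 \<psi>t) (wext m3 \<phi>t)) = Im (cin (wext m1 g) (wext m1 \<phi>))"
      by (simp add: wext_cmult cin_imult)
  qed
  then show "(\<psi>, g) \<in> dirichlet_graph \<epsilon> F"
    unfolding dirichlet_graph_def using g \<psi> form_eq[OF \<psi>] ipw_eq unfolding w by auto
qed

end

section \<open>A lower bound for the form\<close>

lemma LINT_cbox_iterated:
  fixes g :: "real \<times> real \<Rightarrow> 'b::euclidean_space"
  assumes gc: "continuous_on (cbox (a, c) (b, d)) g"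
  shows "set_integrable lborel (cbox (a, c) (b, d)) g"
    "(LINT x:cbox (a, c) (b, d)|lborel. g x) = integral {a..b} (\<lambda>s. integral {c..d} (\<lambda>t. g (s, t)))"
proof -
  show i: "set_integrable lborel (cbox (a, c) (b, d)) g"
    unfolding set_integrable_def by (rule borel_integrable_compact[OF compact_cbox gc])
  show "(LINT x:cbox (a, c) (b, d)|lborel. g x) = integral {a..b} (\<lambda>s. integral {c..d} (\<lambda>t. g (s, t)))"
    unfolding set_borel_integral_eq_integral(2)[OF i] integral_prod_continuous[OF gc] by simp
qed

lemma LINT_Lam_iterated:
  fixes g :: "real \<times> real \<Rightarrow> 'b::euclidean_space"
  assumes g: "continuous_on (cbox (-R, -1) (R, 1)) g" and z: "\<And>s t. R \<le> \<bar>s\<bar> \<or> 1 \<le> \<bar>t\<bar> \<Longrightarrow> g (s, t) = 0"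
  shows "set_integrable lborel Lam g"
    "(LINT x:Lam|lborel. g x) = integral {-R..R} (\<lambda>s. integral {-1..1} (\<lambda>t. g (s, t)))"
proof -
  have eq: "(\<lambda>x. indicator Lam x *\<^sub>R g x) = (\<lambda>x. indicator (cbox (-R, -1) (R, 1)) x *\<^sub>R g x)"
  proof
    fix x :: "real \<times> real"
    obtain s t where x: "x = (s, t)" by (cases x)
    show "indicator Lam x *\<^sub>R g x = indicator (cbox (-R, -1) (R, 1)) x *\<^sub>R g x"
    proof (cases "R \<le> \<bar>s\<bar> \<or> 1 \<le> \<bar>t\<bar>")
      case True
      then show ?thesis using z by (simp add: x)
    next
      case False
      then have "x \<in> Lam" "x \<in> cbox (-R, -1) (R, 1)" by (auto simp: x Lam_def cbox_Pair_eq)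
      then show ?thesis by simp
    qed
  qed
  show "set_integrable lborel Lam g"
    using LINT_cbox_iterated(1)[OF g] unfolding set_integrable_def eq .
  show "(LINT x:Lam|lborel. g x) = integral {-R..R} (\<lambda>s. integral {-1..1} (\<lambda>t. g (s, t)))"
    using LINT_cbox_iterated(2)[OF g] unfolding set_lebesgue_integral_def eq .
qed

context tube
begin

definition cell :: "nat \<Rightarrow> nat \<Rightarrow> nat \<Rightarrow> (real \<times> real) set" where
  "cell n i j = cbox (- s0 + real i * (2 * s0 / real n), -1 + real j * (2 / real n))
     (- s0 + real (Suc i) * (2 * s0 / real n), -1 + real (Suc j) * (2 / real n))"

text \<open>The densities of the squared norm and, in \<open>gA\<close>, of the quadratic
  form.\<close>

definition gN :: "(real \<times> real \<Rightarrow> complex) \<Rightarrow> real \<times> real \<Rightarrow> real" where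
  "gN \<phi> x = w x * (cmod (\<phi> x))\<^sup>2"

definition gA :: "(real \<times> real \<Rightarrow> complex) \<Rightarrow> (real \<times> real \<Rightarrow> complex) \<Rightarrow> real \<times> real \<Rightarrow> real" where
  "gA ps pt x = \<epsilon> / F x * (cmod (ps x))\<^sup>2 + F x / \<epsilon> * (cmod (pt x))\<^sup>2"

lemma continuous_gN: "continuous_on UNIV \<phi> \<Longrightarrow> continuous_on UNIV (gN \<phi>)"
  unfolding gN_def w_def by (intro continuous_intros F_continuous)

lemma continuous_gA: "continuous_on UNIV ps \<Longrightarrow> continuous_on UNIV pt \<Longrightarrow> continuous_on UNIV (gA ps pt)"
  unfolding gA_def using F_pos \<epsilon>
  by (intro continuous_intros F_continuous) (auto simp: less_imp_neq[symmetric])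

text \<open>On such a fibre F = h, so the transverse estimate applies; the s-derivative contributes
  a nonnegative term, which is dropped.\<close>

lemma slice_inequality:
  assumes s: "trans_sol 0 \<mu> v v'" and c: "C1c_R2 Lam \<phi> ps pt" and out: "s0 \<le> \<bar>s\<bar>"
  shows "\<mu> * integral {-1..1} (\<lambda>t. gN \<phi> (s, t)) \<le> integral {-1..1} (\<lambda>t. gA ps pt (s, t))"
proof -
  note cc = C1c_R2_continuous[OF c]
  have "integral {-1..1} (\<lambda>t. gN \<phi> (s, t)) = \<epsilon> * integral {-1..1} (\<lambda>t. h_eps \<gamma> \<epsilon> t * (cmod (\<phi> (s, t)))\<^sup>2)"
    by (subst integral_mult_right[symmetric]) (simp add: gN_def w_def F_out[OF out] mult.assoc)
  then have "\<mu> * integral {-1..1} (\<lambda>t. gN \<phi> (s, t)) =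
      \<epsilon> * (\<mu> * integral {-1..1} (\<lambda>t. h_eps \<gamma> \<epsilon> t * (cmod (\<phi> (s, t)))\<^sup>2))" by simp
  also have "\<dots> \<le> \<epsilon> * (integral {-1..1} (\<lambda>t. h_eps \<gamma> \<epsilon> t * (cmod (pt (s, t)))\<^sup>2) / \<epsilon>\<^sup>2)"
    using weighted_ground_state_inequality[OF s C1c_R2_slice[OF c, of s]] \<epsilon> by (intro mult_left_mono) auto
  also have "\<dots> = integral {-1..1} (\<lambda>t. F (s, t) / \<epsilon> * (cmod (pt (s, t)))\<^sup>2)"
  proof -
    have "integral {-1..1} (\<lambda>t. F (s, t) / \<epsilon> * (cmod (pt (s, t)))\<^sup>2) =
        1 / \<epsilon> * integral {-1..1} (\<lambda>t. h_eps \<gamma> \<epsilon> t * (cmod (pt (s, t)))\<^sup>2)"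
      by (subst integral_mult_right[symmetric]) (simp add: F_out[OF out] mult.assoc)
    then show ?thesis using \<epsilon> by (simp add: power2_eq_square)
  qed
  also have "\<dots> \<le> integral {-1..1} (\<lambda>t. gA ps pt (s, t))"
  proof (rule integral_le)
    have "continuous_on UNIV (\<lambda>x. F x / \<epsilon> * (cmod (pt x))\<^sup>2)"
      using \<epsilon> by (intro continuous_intros F_continuous cc) auto
    then show "(\<lambda>t. F (s, t) / \<epsilon> * (cmod (pt (s, t)))\<^sup>2) integrable_on {-1..1}"
      by (intro integrable_continuous_real continuous_on_slice(1))
    show "(\<lambda>t. gA ps pt (s, t)) integrable_on {-1..1}"
      by (intro integrable_continuous_real continuous_on_slice(1) continuous_gA cc)
    show "F (s, t) / \<epsilon> * (cmod (pt (s, t)))\<^sup>2 \<le> gA ps pt (s, t)" for t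
      using F_pos[of "(s, t)"] \<epsilon> by (simp add: gA_def)
  qed
  finally show ?thesis .
qed

text \<open>The Poincare constants are of order 1 / n^2, so on a fine grid the gradient terms that
  bound \<mu> times the norm fit into the form, and only the cell integrals remain. Replacing the
  weight by its maximum uses \<mu> \<ge> 0.\<close>

lemma middle_inequality:
  assumes "\<mu> \<ge> 0"
  shows "\<exists>n M. n > 0 \<and> M \<ge> 0 \<and> (\<forall>\<phi> ps pt. C1c_R2 Lam \<phi> ps pt \<longrightarrow>
    \<mu> * integral {-s0..s0} (\<lambda>s. integral {-1..1} (\<lambda>t. gN \<phi> (s, t))) \<le>
      integral {-s0..s0} (\<lambda>s. integral {-1..1} (\<lambda>t. gA ps pt (s, t)))
      + M * (\<Sum>j<n. \<Sum>i<n. (cmod (LINT x:cell n i j|lborel. \<phi> x))\<^sup>2))"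
proof -
  obtain Fm where Fm: "Fm \<ge> 1" "\<And>s t. \<bar>t\<bar> \<le> 1 \<Longrightarrow> F (s, t) \<le> Fm" by (rule F_bounded) blast
  \<comment> \<open>A lower bound for both coefficients \<epsilon> / F and F / \<epsilon> of the
    form.\<close>
  define c where "c = min (\<epsilon> / Fm) (1 / \<epsilon>)"
  have c: "c > 0" using \<epsilon> Fm(1) by (simp add: c_def)
  \<comment> \<open>16 (s0^2 + 1) dominates n^2 times each of 4 l^2 and 2 k^2, where l = 2 s0 / n
    and k = 2 / n are the sides of the cells.\<close>
  define K where "K = \<mu> * \<epsilon> * Fm * (16 * (s0\<^sup>2 + 1)) / c"
  obtain n0 :: nat where n0: "K < real n0" using reals_Archimedean2 by blast
  define n where "n = Suc n0"
  have n: "n > 0" "real n \<ge> 1" by (auto simp: n_def)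
  have "K \<le> real n * real n"
  proof -
    have "K \<le> real n" using n0 by (simp add: n_def)
    also have "\<dots> \<le> real n * real n" using mult_left_mono[of 1 "real n" "real n"] n(2) by simp
    finally show ?thesis .
  qed
  then have Kc: "\<mu> * \<epsilon> * Fm * (16 * (s0\<^sup>2 + 1)) / (real n)\<^sup>2 \<le> c"
    using c n by (simp add: K_def field_simps power2_eq_square)
  define l where "l = 2 * s0 / real n"
  define k where "k = 2 / real n"
  have l: "l > 0" and k: "k > 0" using s0 n by (auto simp: l_def k_def)
  have nl: "- s0 + real n * l = s0" "-1 + real n * k = 1" using n by (auto simp: l_def k_def)
  have lk: "4 * l\<^sup>2 \<le> 16 * (s0\<^sup>2 + 1) / (real n)\<^sup>2" "2 * k\<^sup>2 \<le> 16 * (s0\<^sup>2 + 1) / (real n)\<^sup>2"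
    using n by (auto simp: l_def k_def power_divide power_mult_distrib intro!: divide_right_mono)
  define P where "P = \<mu> * \<epsilon> * Fm"
  have P: "P \<ge> 0" using assms \<epsilon> Fm(1) by (simp add: P_def)
  have Pc: "P * (4 * l\<^sup>2) \<le> c" "P * (2 * k\<^sup>2) \<le> c"
  proof -
    have "P * (4 * l\<^sup>2) \<le> P * (16 * (s0\<^sup>2 + 1) / (real n)\<^sup>2)" by (rule mult_left_mono[OF lk(1) P])
    also have "\<dots> \<le> c" using Kc by (simp add: P_def)
    finally show "P * (4 * l\<^sup>2) \<le> c" .
    have "P * (2 * k\<^sup>2) \<le> P * (16 * (s0\<^sup>2 + 1) / (real n)\<^sup>2)" by (rule mult_left_mono[OF lk(2) P])
    also have "\<dots> \<le> c" using Kc by (simp add: P_def)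
    finally show "P * (2 * k\<^sup>2) \<le> c" .
  qed
  define M where "M = P * (4 / (k * l))"
  have M: "M \<ge> 0" using P k l by (simp add: M_def)
  show ?thesis
  proof (intro exI conjI allI impI)
    fix \<phi> ps pt assume C: "C1c_R2 Lam \<phi> ps pt"
    note cc = C1c_R2_continuous[OF C]
    have d: "(\<phi> has_derivative (\<lambda>h. fst h *\<^sub>R ps x + snd h *\<^sub>R pt x)) (at x)" for x
      using C unfolding C1c_R2_def by blast
    define I where "I g = integral {-s0..s0} (\<lambda>s. integral {-1..1} (\<lambda>t. g (s, t)))" for g :: "real \<times> real \<Rightarrow> real"
    define S where "S = (\<Sum>j<n. \<Sum>i<n. (cmod (LINT x:cell n i j|lborel. \<phi> x))\<^sup>2)"
    have c2: "continuous_on UNIV (\<lambda>x. (cmod (\<phi> x))\<^sup>2)" "continuous_on UNIV (\<lambda>x. (cmod (ps x))\<^sup>2)"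
      "continuous_on UNIV (\<lambda>x. (cmod (pt x))\<^sup>2)" by (intro continuous_intros cc)+
    have Imono: "I f \<le> I g" if "continuous_on UNIV f" "continuous_on UNIV g" "\<And>s t. \<bar>t\<bar> \<le> 1 \<Longrightarrow> f (s, t) \<le> g (s, t)" for f g
      unfolding I_def
      by (intro integral_le integrable_continuous_real continuous_on_inner_integral continuous_on_slice(1) that) auto
    have Icmult: "I (\<lambda>x. r * f x) = r * I f" for r f
      unfolding I_def by simp
    have Iadd: "I (\<lambda>x. f x + g x) = I f + I g" if "continuous_on UNIV f" "continuous_on UNIV g" for f g
      unfolding I_def
      by (subst integral_add[symmetric])
        (auto intro!: integrable_continuous_real continuous_on_inner_integral that integral_cong
          Henstock_Kurzweil_Integration.integral_add continuous_on_slice(1))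
    have cell_eq: "(LINT x:cell n i j|lborel. \<phi> x) = integral {- s0 + real i * l..- s0 + real (Suc i) * l}
        (\<lambda>s. integral {-1 + real j * k..-1 + real (Suc j) * k} (\<lambda>t. \<phi> (s, t)))" for i j
      unfolding cell_def l_def k_def by (rule LINT_cbox_iterated(2)) (rule cc(1))
    have "I (\<lambda>x. (cmod (\<phi> x))\<^sup>2) \<le> (\<Sum>j<n. \<Sum>i<n. 4 / (k * l) * (cmod (LINT x:cell n i j|lborel. \<phi> x))\<^sup>2)
        + 4 * l\<^sup>2 * I (\<lambda>x. (cmod (ps x))\<^sup>2) + 2 * k\<^sup>2 * I (\<lambda>x. (cmod (pt x))\<^sup>2)"
      using poincare_cells[OF cc(2) cc(3) d l k, of "-s0" n "-1" n] unfolding nl cell_eq I_def .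
    also have "(\<Sum>j<n. \<Sum>i<n. 4 / (k * l) * (cmod (LINT x:cell n i j|lborel. \<phi> x))\<^sup>2) = 4 / (k * l) * S"
      unfolding S_def by (simp only: sum_distrib_left)
    finally have p: "I (\<lambda>x. (cmod (\<phi> x))\<^sup>2) \<le> 4 / (k * l) * S
        + 4 * l\<^sup>2 * I (\<lambda>x. (cmod (ps x))\<^sup>2) + 2 * k\<^sup>2 * I (\<lambda>x. (cmod (pt x))\<^sup>2)" .
    have "\<mu> * I (gN \<phi>) \<le> \<mu> * (\<epsilon> * Fm * I (\<lambda>x. (cmod (\<phi> x))\<^sup>2))"
    proof (rule mult_left_mono[OF _ assms])
      have "I (gN \<phi>) \<le> I (\<lambda>x. \<epsilon> * Fm * (cmod (\<phi> x))\<^sup>2)"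
        using Fm(2) \<epsilon>
        by (intro Imono continuous_gN cc continuous_intros c2) (auto simp: gN_def w_def intro!: mult_right_mono)
      then show "I (gN \<phi>) \<le> \<epsilon> * Fm * I (\<lambda>x. (cmod (\<phi> x))\<^sup>2)" by (simp only: Icmult)
    qed
    also have "\<dots> = P * I (\<lambda>x. (cmod (\<phi> x))\<^sup>2)" by (simp add: P_def)
    also have "\<dots> \<le> P * (4 / (k * l) * S + 4 * l\<^sup>2 * I (\<lambda>x. (cmod (ps x))\<^sup>2) + 2 * k\<^sup>2 * I (\<lambda>x. (cmod (pt x))\<^sup>2))"
      by (rule mult_left_mono[OF p P])
    also have "\<dots> = M * S + P * (4 * l\<^sup>2) * I (\<lambda>x. (cmod (ps x))\<^sup>2) + P * (2 * k\<^sup>2) * I (\<lambda>x. (cmod (pt x))\<^sup>2)"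
      unfolding M_def by (simp only: distrib_left mult.assoc)
    also have "\<dots> \<le> M * S + c * I (\<lambda>x. (cmod (ps x))\<^sup>2) + c * I (\<lambda>x. (cmod (pt x))\<^sup>2)"
    proof -
      have "0 \<le> I (\<lambda>x. (cmod (ps x))\<^sup>2)" "0 \<le> I (\<lambda>x. (cmod (pt x))\<^sup>2)"
        using Imono[of "\<lambda>_. 0" "\<lambda>x. (cmod (ps x))\<^sup>2"] Imono[of "\<lambda>_. 0" "\<lambda>x. (cmod (pt x))\<^sup>2"] c2
        by (simp_all add: I_def[of "\<lambda>_. 0"])
      from mult_right_mono[OF Pc(1) this(1)] mult_right_mono[OF Pc(2) this(2)]
      show ?thesis by linarith
    qed
    also have "\<dots> = M * S + I (\<lambda>x. c * (cmod (ps x))\<^sup>2 + c * (cmod (pt x))\<^sup>2)"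
      by (subst Iadd) (auto intro!: continuous_intros c2 cc simp: Icmult)
    also have "\<dots> \<le> M * S + I (gA ps pt)"
    proof (intro add_left_mono Imono)
      show "continuous_on UNIV (\<lambda>x. c * (cmod (ps x))\<^sup>2 + c * (cmod (pt x))\<^sup>2)" by (intro continuous_intros cc)
      show "continuous_on UNIV (gA ps pt)" by (intro continuous_gA cc)
      fix s t :: real assume t: "\<bar>t\<bar> \<le> 1"
      have "\<epsilon> / Fm \<le> \<epsilon> / F (s, t)" using Fm(2)[OF t, of s] F_pos[of "(s, t)"] Fm(1) \<epsilon> by (intro divide_left_mono) auto
      then have 1: "c \<le> \<epsilon> / F (s, t)" by (simp add: c_def)
      have "1 / \<epsilon> \<le> F (s, t) / \<epsilon>" using F_ge_1[of "(s, t)"] \<epsilon> by (intro divide_right_mono) auto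
      then have 2: "c \<le> F (s, t) / \<epsilon>" by (simp add: c_def)
      show "c * (cmod (ps (s, t)))\<^sup>2 + c * (cmod (pt (s, t)))\<^sup>2 \<le> gA ps pt (s, t)"
        unfolding gA_def by (intro add_mono mult_right_mono 1 2) auto
    qed
    finally show "\<mu> * integral {-s0..s0} (\<lambda>s. integral {-1..1} (\<lambda>t. gN \<phi> (s, t))) \<le>
      integral {-s0..s0} (\<lambda>s. integral {-1..1} (\<lambda>t. gA ps pt (s, t)))
      + M * (\<Sum>j<n. \<Sum>i<n. (cmod (LINT x:cell n i j|lborel. \<phi> x))\<^sup>2)"
      by (simp add: I_def S_def)
  qed (use n M in auto)
qed

text \<open>Fibres beyond s0 satisfy the inequality without remainder, so the finitely many cell
  integrals of the middle piece are the only correction.\<close>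

lemma cell_inequality:
  assumes s: "trans_sol 0 \<mu> v v'"
  shows "\<exists>n M. n > 0 \<and> M \<ge> 0 \<and> (\<forall>\<phi> ps pt. C1c_R2 Lam \<phi> ps pt \<longrightarrow>
    \<mu> * (LINT x:Lam|lborel. gN \<phi> x) \<le> (LINT x:Lam|lborel. gA ps pt x)
      + M * (\<Sum>j<n. \<Sum>i<n. (cmod (LINT x:cell n i j|lborel. \<phi> x))\<^sup>2))"
proof -
  obtain n M where nM: "n > 0" "M \<ge> 0" and mid: "\<And>\<phi> ps pt. C1c_R2 Lam \<phi> ps pt \<Longrightarrow>
    \<mu> * integral {-s0..s0} (\<lambda>s. integral {-1..1} (\<lambda>t. gN \<phi> (s, t))) \<le>
      integral {-s0..s0} (\<lambda>s. integral {-1..1} (\<lambda>t. gA ps pt (s, t)))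
      + M * (\<Sum>j<n. \<Sum>i<n. (cmod (LINT x:cell n i j|lborel. \<phi> x))\<^sup>2)"
    using middle_inequality[OF trans_sol_nonneg[OF s]] by blast
  show ?thesis
  proof (intro exI conjI allI impI)
    fix \<phi> ps pt assume C: "C1c_R2 Lam \<phi> ps pt"
    note cc = C1c_R2_continuous[OF C]
    obtain R where R: "\<And>s t. R \<le> \<bar>s\<bar> \<or> 1 \<le> \<bar>t\<bar> \<Longrightarrow> \<phi> (s, t) = 0 \<and> ps (s, t) = 0 \<and> pt (s, t) = 0"
      using C1c_R2_support[OF C] by metis
    \<comment> \<open>Large enough to contain both the support and the middle piece, so that the
      integrals can be split at -s0 and s0.\<close>
    define r where "r = max R s0"
    have r: "s0 \<le> r" "R \<le> r" by (auto simp: r_def)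
    define f where "f s = integral {-1..1} (\<lambda>t. gN \<phi> (s, t))" for s
    define g where "g s = integral {-1..1} (\<lambda>t. gA ps pt (s, t))" for s
    have fi: "f integrable_on {p..q}" and gi: "g integrable_on {p..q}" for p q
      unfolding f_def[abs_def] g_def[abs_def]
      by (intro integrable_continuous_real continuous_on_inner_integral continuous_gN continuous_gA cc)+
    have "(LINT x:Lam|lborel. gN \<phi> x) = integral {-r..r} f"
      unfolding f_def[abs_def]
    proof (rule LINT_Lam_iterated(2)[OF continuous_on_subset[OF continuous_gN[OF cc(1)] subset_UNIV]])
      show "gN \<phi> (s, t) = 0" if "r \<le> \<bar>s\<bar> \<or> 1 \<le> \<bar>t\<bar>" for s t
        using R[of s t] that r by (auto simp: gN_def)
    qed
    moreover have "(LINT x:Lam|lborel. gA ps pt x) = integral {-r..r} g"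
      unfolding g_def[abs_def]
    proof (rule LINT_Lam_iterated(2)[OF continuous_on_subset[OF continuous_gA[OF cc(2,3)] subset_UNIV]])
      show "gA ps pt (s, t) = 0" if "r \<le> \<bar>s\<bar> \<or> 1 \<le> \<bar>t\<bar>" for s t
        using R[of s t] that r by (auto simp: gA_def)
    qed
    moreover have split: "integral {-r..r} u = integral {-r..-s0} u + integral {-s0..s0} u + integral {s0..r} u"
      if "\<And>p q. u integrable_on {p..q}" for u :: "real \<Rightarrow> real"
      using Henstock_Kurzweil_Integration.integral_combine[of "-r" "-s0" r u]
        Henstock_Kurzweil_Integration.integral_combine[of "-s0" s0 r u] that r s0 by simp
    moreover have out: "\<mu> * integral {p..q} f \<le> integral {p..q} g" if "\<And>s. s \<in> {p..q} \<Longrightarrow> s0 \<le> \<bar>s\<bar>" for p q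
    proof -
      have "integral {p..q} (\<lambda>s. \<mu> * f s) \<le> integral {p..q} g"
      proof (rule integral_le[OF _ gi])
        show "(\<lambda>s. \<mu> * f s) integrable_on {p..q}" by (intro integrable_on_mult_right fi)
        show "\<mu> * f s \<le> g s" if "s \<in> {p..q}" for s
          unfolding f_def g_def using slice_inequality[OF assms C] \<open>\<And>s. s \<in> {p..q} \<Longrightarrow> s0 \<le> \<bar>s\<bar>\<close>[OF that] by blast
      qed
      then show ?thesis by simp
    qed
    have "\<mu> * integral {-r..-s0} f \<le> integral {-r..-s0} g" "\<mu> * integral {s0..r} f \<le> integral {s0..r} g"
      using s0 by (intro out; auto)+
    moreover have "\<mu> * integral {-s0..s0} f \<le> integral {-s0..s0} g + M * (\<Sum>j<n. \<Sum>i<n. (cmod (LINT x:cell n i j|lborel. \<phi> x))\<^sup>2)"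
      using mid[OF C] by (simp only: f_def[abs_def] g_def[abs_def])
    ultimately show "\<mu> * (LINT x:Lam|lborel. gN \<phi> x) \<le> (LINT x:Lam|lborel. gA ps pt x)
      + M * (\<Sum>j<n. \<Sum>i<n. (cmod (LINT x:cell n i j|lborel. \<phi> x))\<^sup>2)"
      by (simp only: split[OF fi] split[OF gi] distrib_left)
  qed (use nM in auto)
qed

text \<open>Dividing by \<open>m1\<close> compensates the weight of the embedding: paired with an
  embedded \<phi>, this gives the real part of c times the conjugate of the integral of \<phi> over
  C.\<close>

definition efun :: "complex \<Rightarrow> (real \<times> real) set \<Rightarrow> real \<times> real \<Rightarrow> complex" where
  "efun c C x = zext Lam (\<lambda>x. of_real (1 / m1 x)) x * (indicator C x * c)"

lemma efun_inner:
  assumes C: "C = cbox p q" and c: "C1c_R2 Lam \<phi> ps pt"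
  shows "sq_int (efun z C)" "inner (cls (efun z C)) (cls (wext m1 \<phi>)) = Re (z * cnj (LINT x:C|lborel. \<phi> x))"
proof -
  have si: "sq_int (\<lambda>x. indicator C x * z)"
  proof (rule sq_int_bound)
    show "(\<lambda>x. indicator C x * z) \<in> borel_measurable lborel" by (simp add: C)
    show "integrable lborel (\<lambda>x. indicator C x *\<^sub>R (cmod z)\<^sup>2)"
      unfolding C by (rule borel_integrable_compact) auto
    show "AE x in lborel. (cmod (indicator C x * z))\<^sup>2 \<le> indicator C x *\<^sub>R (cmod z)\<^sup>2"
      by (auto simp: indicator_def)
  qed
  show sq: "sq_int (efun z C)"
    unfolding efun_def[abs_def] by (rule adm_mult[OF adm_m(1)]) (rule sq_int_mult_bounded[OF si])
  have z: "\<phi> x = 0" if "x \<notin> Lam" for x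
    using c that closure_subset[of "{x. \<phi> x \<noteq> 0}"] unfolding C1c_R2_def by blast
  have "efun z C x * cnj (wext m1 \<phi> x) = z * cnj (indicator C x *\<^sub>R \<phi> x)" for x
  proof (cases "x \<in> Lam")
    case True
    have "m1 x \<noteq> 0" using w_pos[of x] by (simp add: m1_def)
    then show ?thesis using True by (simp add: efun_def wext_def zext_def indicator_def)
  qed (simp add: efun_def wext_def zext_def z)
  then have "inner (cls (efun z C)) (cls (wext m1 \<phi>)) = Re (LINT x|lborel. z * cnj (indicator C x *\<^sub>R \<phi> x))"
    using Re_cin[OF sq sq_int_wext[OF adm_m(1) C1c_R2_sq_int(1)[OF c]]] by (simp add: cin_def)
  also have "(LINT x|lborel. z * cnj (indicator C x *\<^sub>R \<phi> x)) = z * cnj (LINT x|lborel. indicator C x *\<^sub>R \<phi> x)"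
    by (simp only: integral_mult_right_zero Bochner_Integration.integral_cnj)
  finally show "inner (cls (efun z C)) (cls (wext m1 \<phi>)) = Re (z * cnj (LINT x:C|lborel. \<phi> x))"
    by (simp add: set_lebesgue_integral_def)
qed

text \<open>The squared modulus of a cell integral is a sum of two squares of real linear
  functionals, its real and imaginary parts. Their representing vectors, scaled by sqrt M, are the e
  i. The inequality then holds on a dense set, and it is a closed condition.\<close>

theorem form_lower_bound:
  assumes s: "trans_sol 0 \<mu> v v'"
  shows "\<exists>e (N::nat). \<forall>u\<in>X. \<mu> * inner (fst u) (fst u) \<le> inner (snd u) (snd u) + (\<Sum>i<N. (inner (e i) (fst u))\<^sup>2)"
proof -
  obtain n M where nM: "n > 0" "M \<ge> 0" and ineq: "\<And>\<phi> ps pt. C1c_R2 Lam \<phi> ps pt \<Longrightarrow>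
    \<mu> * (LINT x:Lam|lborel. gN \<phi> x) \<le> (LINT x:Lam|lborel. gA ps pt x)
      + M * (\<Sum>j<n. \<Sum>i<n. (cmod (LINT x:cell n i j|lborel. \<phi> x))\<^sup>2)"
    using cell_inequality[OF s] by blast
  \<comment> \<open>Two vectors per cell: the truth value selects the real or the imaginary part of
    its integral.\<close>
  define I where "I = {..<n} \<times> {..<n} \<times> (UNIV :: bool set)"
  define f where "f = (\<lambda>(j, i, b). sqrt M *\<^sub>R cls (efun (if b then \<i> else 1) (cell n i j)))"
  have "finite I" by (simp add: I_def)
  then obtain h where h: "bij_betw h {..<card I} I" using ex_bij_betw_nat_finite by (metis atLeast0LessThan)
  define e where "e i = f (h i)" for i
  have sum_e: "(\<Sum>i<card I. (inner (e i) x)\<^sup>2) = (\<Sum>k\<in>I. (inner (f k) x)\<^sup>2)" for x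
    unfolding e_def by (rule sum.reindex_bij_betw[OF h])
  have dense: "\<mu> * inner (fst u) (fst u) \<le> inner (snd u) (snd u) + (\<Sum>i<card I. (inner (e i) (fst u))\<^sup>2)"
    if u: "u \<in> S0" for u
  proof -
    obtain \<phi> ps pt where C: "C1c_R2 Lam \<phi> ps pt" and ue: "u = emb \<phi> ps pt" using u unfolding S0_def by blast
    note sq = C1c_R2_sq_int[OF C]
    have "inner (fst u) (fst u) = (LINT x:Lam|lborel. gN \<phi> x)"
    proof -
      have "(cmod (wext m1 \<phi> x))\<^sup>2 = indicator Lam x *\<^sub>R gN \<phi> x" for x
        using m_sq(1)[of x] by (auto simp: wext_def zext_def norm_mult power_mult_distrib gN_def)
      then show ?thesis
        by (simp add: ue emb_def power2_norm_eq_inner[symmetric] norm_cls_sq sq_int_wext adm_m sq set_lebesgue_integral_def)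
    qed
    moreover have "inner (snd u) (snd u) = (LINT x:Lam|lborel. gA ps pt x)"
    proof -
      have "(cmod (wext m2 ps x))\<^sup>2 + (cmod (wext m3 pt x))\<^sup>2 = indicator Lam x *\<^sub>R gA ps pt x" for x
      proof -
        have "(m2 x)\<^sup>2 = \<epsilon> / F x" "(m3 x)\<^sup>2 = F x / \<epsilon>"
          using m_sq(2,3)[of x] F_pos[of x] \<epsilon> by (simp_all add: w_def power2_eq_square)
        then show ?thesis by (simp add: wext_def zext_def norm_mult power_mult_distrib gA_def)
      qed
      moreover have "(LINT x|lborel. (cmod (wext m2 ps x))\<^sup>2 + (cmod (wext m3 pt x))\<^sup>2) =
          (LINT x|lborel. (cmod (wext m2 ps x))\<^sup>2) + (LINT x|lborel. (cmod (wext m3 pt x))\<^sup>2)"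
        by (intro Bochner_Integration.integral_add sq_int_integrable sq_int_wext adm_m sq)
      ultimately show ?thesis
        by (simp add: ue emb_def inner_prod_def power2_norm_eq_inner[symmetric] norm_cls_sq sq_int_wext adm_m sq
            set_lebesgue_integral_def)
    qed
    moreover have "(\<Sum>k\<in>I. (inner (f k) (fst u))\<^sup>2) = M * (\<Sum>j<n. \<Sum>i<n. (cmod (LINT x:cell n i j|lborel. \<phi> x))\<^sup>2)"
    proof -
      have b: "(\<Sum>b\<in>UNIV. (inner (f (j, i, b)) (fst u))\<^sup>2) = M * (cmod (LINT x:cell n i j|lborel. \<phi> x))\<^sup>2" for i j
        unfolding f_def UNIV_bool using nM(2)
        by (simp add: ue emb_def efun_inner(2)[OF cell_def C] power_mult_distrib cmod_power2 algebra_simps)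
      have "(\<Sum>k\<in>I. (inner (f k) (fst u))\<^sup>2) = (\<Sum>j<n. \<Sum>i<n. \<Sum>b\<in>UNIV. (inner (f (j, i, b)) (fst u))\<^sup>2)"
        unfolding I_def by (simp add: sum.cartesian_product split_def)
      then show ?thesis unfolding b by (simp only: sum_distrib_left)
    qed
    ultimately show ?thesis using ineq[OF C] unfolding sum_e by simp
  qed
  have "closed {u. \<mu> * inner (fst u) (fst u) \<le> inner (snd u) (snd u) + (\<Sum>i<card I. (inner (e i) (fst u))\<^sup>2)}"
    by (intro closed_Collect_le continuous_intros)
  then have "X \<subseteq> {u. \<mu> * inner (fst u) (fst u) \<le> inner (snd u) (snd u) + (\<Sum>i<card I. (inner (e i) (fst u))\<^sup>2)}"
    unfolding X_def using dense by (intro closure_minimal) auto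
  then have "\<forall>u\<in>X. \<mu> * inner (fst u) (fst u) \<le> inner (snd u) (snd u) + (\<Sum>i<card I. (inner (e i) (fst u))\<^sup>2)"
    by auto
  then show ?thesis by (intro exI[of _ e] exI[of _ "card I"])
qed

end

section \<open>Weyl sequences\<close>

lemma tensor_integral:
  fixes f g :: "real \<Rightarrow> real"
  assumes f: "integrable lborel f" and g: "integrable lborel g"
  shows "integrable lborel (\<lambda>x. f (fst x) * g (snd x))"
    "(LINT x|lborel. f (fst x) * g (snd x)) = (LINT s|lborel. f s) * (LINT t|lborel. g t)"
proof -
  have [measurable]: "f \<in> borel_measurable lborel" "g \<in> borel_measurable lborel"
    using f g by (auto intro: borel_measurable_integrable)
  have i: "integrable (lborel \<Otimes>\<^sub>M lborel) (\<lambda>x. f (fst x) * g (snd x))"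
  proof (rule lborel_pair.Fubini_integrable)
    show "(\<lambda>x. f (fst x) * g (snd x)) \<in> borel_measurable (lborel \<Otimes>\<^sub>M lborel)" by measurable
    have "(\<lambda>x. LINT y|lborel. norm (f (fst (x, y)) * g (snd (x, y)))) = (\<lambda>x. \<bar>f x\<bar> * (LINT y|lborel. \<bar>g y\<bar>))"
      by (simp add: abs_mult)
    then show "integrable lborel (\<lambda>x. LINT y|lborel. norm (f (fst (x, y)) * g (snd (x, y))))"
      using f by (simp add: integrable_abs)
    show "AE x in lborel. integrable lborel (\<lambda>y. f (fst (x, y)) * g (snd (x, y)))"
      using g by simp
  qed
  show "integrable lborel (\<lambda>x. f (fst x) * g (snd x))" using i unfolding lborel_prod .
  have "(LINT x|(lborel \<Otimes>\<^sub>M lborel). f (fst x) * g (snd x)) = (LINT x|lborel. LINT y|lborel. f (fst (x, y)) * g (snd (x, y)))"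
    by (rule lborel_pair.integral_fst'[OF i, symmetric])
  also have "\<dots> = (LINT s|lborel. f s) * (LINT t|lborel. g t)" by simp
  finally show "(LINT x|lborel. f (fst x) * g (snd x)) = (LINT s|lborel. f s) * (LINT t|lborel. g t)"
    unfolding lborel_prod .
qed

lemma sq_int_compact_support:
  fixes Z :: "real \<Rightarrow> complex"
  assumes Z: "continuous_on UNIV Z" "\<And>s. R \<le> \<bar>s\<bar> \<Longrightarrow> Z s = 0"
  shows "integrable lborel (\<lambda>s. (cmod (Z s))\<^sup>2)"
proof -
  have "(\<lambda>s. (cmod (Z s))\<^sup>2) = (\<lambda>s. indicator {-R..R} s *\<^sub>R (cmod (Z s))\<^sup>2)"
  proof
    fix s
    show "(cmod (Z s))\<^sup>2 = indicator {-R..R} s *\<^sub>R (cmod (Z s))\<^sup>2"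
      by (cases "R \<le> \<bar>s\<bar>") (use Z(2)[of s] in \<open>auto simp: indicator_def not_le abs_less_iff\<close>)
  qed
  moreover have "integrable lborel (\<lambda>s. indicator {-R..R} s *\<^sub>R (cmod (Z s))\<^sup>2)"
    by (intro borel_integrable_compact compact_Icc continuous_intros continuous_on_subset[OF Z(1)]) auto
  ultimately show ?thesis by simp
qed

lemma tensor_sq:
  fixes Z B :: "real \<Rightarrow> complex"
  assumes Z: "continuous_on UNIV Z" "\<And>s. R \<le> \<bar>s\<bar> \<Longrightarrow> Z s = 0"
    and B: "sq_int (zext {-1<..<1} B)"
  shows "sq_int (zext Lam (\<lambda>x. Z (fst x) * B (snd x)))"
    "(LINT x:Lam|lborel. (cmod (Z (fst x) * B (snd x)))\<^sup>2) =
      (LINT s|lborel. (cmod (Z s))\<^sup>2) * (LINT t:{-1<..<1}|lborel. (cmod (B t))\<^sup>2)"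
proof -
  let ?U = "{-1<..<1::real}"
  have eq: "zext Lam (\<lambda>x. Z (fst x) * B (snd x)) = (\<lambda>x. Z (fst x) * zext ?U B (snd x))"
    by (auto simp: zext_def Lam_def fun_eq_iff)
  have [measurable]: "Z \<in> borel_measurable borel" by (rule borel_measurable_continuous_onI[OF Z(1)])
  have [measurable]: "zext ?U B \<in> borel_measurable borel" using sq_int_measurable[OF B] by simp
  note ti = tensor_integral[OF sq_int_compact_support[OF Z] sq_int_integrable[OF B]]
  have sq: "(cmod (Z (fst x) * zext ?U B (snd x)))\<^sup>2 = (cmod (Z (fst x)))\<^sup>2 * (cmod (zext ?U B (snd x)))\<^sup>2" for x :: "real \<times> real"
    by (simp add: norm_mult power_mult_distrib)
  have meas: "(\<lambda>x::real \<times> real. Z (fst x) * zext ?U B (snd x)) \<in> borel_measurable lborel"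
  proof -
    have "(\<lambda>x::real \<times> real. Z (fst x) * zext ?U B (snd x)) \<in> borel_measurable (borel \<Otimes>\<^sub>M borel)" by measurable
    then show ?thesis by (simp add: borel_prod)
  qed
  show s: "sq_int (zext Lam (\<lambda>x. Z (fst x) * B (snd x)))"
    unfolding eq sq_int_def sq using ti(1) meas by simp
  have "(LINT x:Lam|lborel. (cmod (Z (fst x) * B (snd x)))\<^sup>2) = (LINT x|lborel. (cmod (zext Lam (\<lambda>x. Z (fst x) * B (snd x)) x))\<^sup>2)"
    by (simp add: set_lebesgue_integral_def cmod_zext_sq)
  also have "\<dots> = (LINT s|lborel. (cmod (Z s))\<^sup>2) * (LINT t|lborel. (cmod (zext ?U B t))\<^sup>2)"
    unfolding eq sq by (rule ti(2))
  finally show "(LINT x:Lam|lborel. (cmod (Z (fst x) * B (snd x)))\<^sup>2) =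
      (LINT s|lborel. (cmod (Z s))\<^sup>2) * (LINT t:?U|lborel. (cmod (B t))\<^sup>2)"
    by (simp add: cmod_zext_sq set_lebesgue_integral_def)
qed

lemma borel_measurable_tensor:
  fixes Z B :: "real \<Rightarrow> complex"
  assumes "Z \<in> borel_measurable borel" "B \<in> borel_measurable borel"
  shows "(\<lambda>x::real \<times> real. Z (fst x) * B (snd x)) \<in> borel_measurable lborel"
proof -
  note [measurable] = assms
  have "(\<lambda>x::real \<times> real. Z (fst x) * B (snd x)) \<in> borel_measurable (borel \<Otimes>\<^sub>M borel)" by measurable
  then show ?thesis by (simp add: borel_prod)
qed

lemma C1c_R2_tensor:
  assumes Z: "\<And>s. (Z has_vector_derivative Z' s) (at s)" "continuous_on UNIV Z'" "\<And>s. R \<le> \<bar>s\<bar> \<Longrightarrow> Z s = 0"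
    and B: "C1c_R {-1<..<1} B B'"
  shows "C1c_R2 Lam (\<lambda>x. Z (fst x) * B (snd x)) (\<lambda>x. Z' (fst x) * B (snd x)) (\<lambda>x. Z (fst x) * B' (snd x))"
  unfolding C1c_R2_def
proof (intro conjI allI)
  have Zc: "continuous_on UNIV Z"
    by (intro continuous_at_imp_continuous_on ballI has_vector_derivative_continuous[OF Z(1)])
  note Bc = C1c_R_continuous[OF B]
  show "continuous_on UNIV (\<lambda>x::real \<times> real. Z' (fst x) * B (snd x))"
    by (intro continuous_intros continuous_on_compose2[OF Z(2)] continuous_on_compose2[OF Bc(1)]) auto
  show "continuous_on UNIV (\<lambda>x::real \<times> real. Z (fst x) * B' (snd x))"
    by (intro continuous_intros continuous_on_compose2[OF Zc] continuous_on_compose2[OF Bc(2)]) auto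
  show "((\<lambda>x. Z (fst x) * B (snd x)) has_derivative
      (\<lambda>h. fst h *\<^sub>R (Z' (fst x) * B (snd x)) + snd h *\<^sub>R (Z (fst x) * B' (snd x)))) (at x)" for x
  proof -
    have "(Z has_derivative (\<lambda>h. h *\<^sub>R Z' (fst x))) (at (fst x))" using Z(1) by (simp add: has_vector_derivative_def)
    from has_derivative_compose[OF bounded_linear_imp_has_derivative[OF bounded_linear_fst] this]
    have 1: "((\<lambda>x. Z (fst x)) has_derivative (\<lambda>h. fst h *\<^sub>R Z' (fst x))) (at x)" .
    have "(B has_derivative (\<lambda>h. h *\<^sub>R B' (snd x))) (at (snd x))"
      using B by (simp add: C1c_R_def has_vector_derivative_def)
    from has_derivative_compose[OF bounded_linear_imp_has_derivative[OF bounded_linear_snd] this]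
    have 2: "((\<lambda>x. B (snd x)) has_derivative (\<lambda>h. snd h *\<^sub>R B' (snd x))) (at x)" .
    show ?thesis by (rule has_derivative_eq_rhs[OF has_derivative_mult[OF 1 2]]) (simp add: fun_eq_iff)
  qed
  obtain \<rho> where \<rho>: "0 < \<rho>" "\<rho> < 1" "\<And>t. \<rho> \<le> \<bar>t\<bar> \<Longrightarrow> B t = 0 \<and> B' t = 0"
    using C1c_R_support[OF B] by blast
  have sub: "closure {x. Z (fst x) * B (snd x) \<noteq> 0} \<subseteq> cbox (-R, -\<rho>) (R, \<rho>)"
  proof (rule closure_minimal)
    show "{x. Z (fst x) * B (snd x) \<noteq> 0} \<subseteq> cbox (-R, -\<rho>) (R, \<rho>)"
    proof
      fix x :: "real \<times> real" assume "x \<in> {x. Z (fst x) * B (snd x) \<noteq> 0}"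
      then have "\<not> R \<le> \<bar>fst x\<bar>" "\<not> \<rho> \<le> \<bar>snd x\<bar>" using Z(3) \<rho>(3) by auto
      then show "x \<in> cbox (-R, -\<rho>) (R, \<rho>)" by (cases x) (auto simp: cbox_Pair_eq)
    qed
  qed (rule closed_cbox)
  also have "cbox (-R, -\<rho>) (R, \<rho>) \<subseteq> Lam" using \<rho>(2) by (auto simp: cbox_Pair_eq Lam_def)
  finally show "closure {x. Z (fst x) * B (snd x) \<noteq> 0} \<subseteq> Lam" .
  show "compact (closure {x. Z (fst x) * B (snd x) \<noteq> 0})"
    using compact_Int_closed[OF compact_cbox[of "(-R, -\<rho>)" "(R, \<rho>)"] closed_closure[of "{x. Z (fst x) * B (snd x) \<noteq> 0}"]] sub
    by (simp only: inf.absorb2)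
qed

text \<open>Only the transverse factor has to be approximated, as Z is continuously differentiable
  with compact support.\<close>

lemma H10_R2_tensor:
  assumes Z: "\<And>s. (Z has_vector_derivative Z' s) (at s)" "continuous_on UNIV Z'"
      "\<And>s. R \<le> \<bar>s\<bar> \<Longrightarrow> Z s = 0" "\<And>s. R \<le> \<bar>s\<bar> \<Longrightarrow> Z' s = 0"
    and A: "H10_R {-1<..<1} A A'"
  shows "H10_R2 Lam (\<lambda>x. Z (fst x) * A (snd x)) (\<lambda>x. Z' (fst x) * A (snd x)) (\<lambda>x. Z (fst x) * A' (snd x))"
proof -
  let ?U = "{-1<..<1::real}"
  have Zc: "continuous_on UNIV Z"
    by (intro continuous_at_imp_continuous_on ballI has_vector_derivative_continuous[OF Z(1)])
  have sq: "sq_int (zext ?U A)" "sq_int (zext ?U A')" and m: "A \<in> borel_measurable borel" "A' \<in> borel_measurable borel"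
    using A by (auto simp: H10_R_def L2w_def intro!: sq_int_zext)
  obtain \<phi> \<phi>' where \<phi>: "\<And>n. C1c_R ?U (\<phi> n) (\<phi>' n)"
    and l: "(\<lambda>n. LINT x:?U|lborel. (cmod (\<phi> n x - A x))\<^sup>2) \<longlonglongrightarrow> 0"
      "(\<lambda>n. LINT x:?U|lborel. (cmod (\<phi>' n x - A' x))\<^sup>2) \<longlonglongrightarrow> 0"
    using A unfolding H10_R_def by blast
  have sq\<phi>: "sq_int (zext ?U (\<phi> n))" "sq_int (zext ?U (\<phi>' n))" for n
    by (intro sq_int_zext_continuous C1c_R_continuous[OF \<phi>])+
  have mZ: "Z \<in> borel_measurable borel" "Z' \<in> borel_measurable borel"
    using Zc Z(2) by (auto intro: borel_measurable_continuous_onI)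
  have L2: "L2w Lam (\<lambda>_. 1) (\<lambda>x. Y (fst x) * B (snd x))"
    if "continuous_on UNIV Y" "\<And>s. R \<le> \<bar>s\<bar> \<Longrightarrow> Y s = 0" "sq_int (zext ?U B)" "B \<in> borel_measurable borel" for Y B
    using tensor_sq(1)[OF that(1-3)] borel_measurable_tensor[OF borel_measurable_continuous_onI[OF that(1)] that(4)]
    by (rule L2w_zext_iff)
  have conv: "(\<lambda>n. LINT x:Lam|lborel. (cmod (Y (fst x) * f n (snd x) - Y (fst x) * B (snd x)))\<^sup>2) \<longlonglongrightarrow> 0"
    if Y: "continuous_on UNIV Y" "\<And>s. R \<le> \<bar>s\<bar> \<Longrightarrow> Y s = 0" and B: "sq_int (zext ?U B)"
      and f: "\<And>n. sq_int (zext ?U (f n))" and lf: "(\<lambda>n. LINT x:?U|lborel. (cmod (f n x - B x))\<^sup>2) \<longlonglongrightarrow> 0" for Y B f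
  proof -
    have "sq_int (zext ?U (\<lambda>t. f n t - B t))" for n
      using sq_int_diff[OF f[of n] B] by (simp add: zext_diff)
    note ts = tensor_sq(2)[where R=R, OF Y this]
    have "(LINT x:Lam|lborel. (cmod (Y (fst x) * f n (snd x) - Y (fst x) * B (snd x)))\<^sup>2) =
        (LINT s|lborel. (cmod (Y s))\<^sup>2) * (LINT t:?U|lborel. (cmod (f n t - B t))\<^sup>2)" for n
      using ts[of n] by (simp add: right_diff_distrib)
    moreover have "(\<lambda>n. (LINT s|lborel. (cmod (Y s))\<^sup>2) * (LINT t:?U|lborel. (cmod (f n t - B t))\<^sup>2)) \<longlonglongrightarrow>
        (LINT s|lborel. (cmod (Y s))\<^sup>2) * 0"
      by (intro tendsto_intros lf)
    ultimately show ?thesis by simp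
  qed
  have C: "C1c_R2 Lam (\<lambda>x. Z (fst x) * \<phi> n (snd x)) (\<lambda>x. Z' (fst x) * \<phi> n (snd x)) (\<lambda>x. Z (fst x) * \<phi>' n (snd x))" for n
    by (rule C1c_R2_tensor[OF Z(1-3) \<phi>])
  show ?thesis
    unfolding H10_R2_def
  proof (intro conjI exI allI)
    show "L2w Lam (\<lambda>_. 1) (\<lambda>x. Z (fst x) * A (snd x))" by (rule L2[OF Zc Z(3) sq(1) m(1)])
    show "L2w Lam (\<lambda>_. 1) (\<lambda>x. Z' (fst x) * A (snd x))" by (rule L2[OF Z(2) Z(4) sq(1) m(1)])
    show "L2w Lam (\<lambda>_. 1) (\<lambda>x. Z (fst x) * A' (snd x))" by (rule L2[OF Zc Z(3) sq(2) m(2)])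
    show "C1c_R2 Lam ((\<lambda>n x. Z (fst x) * \<phi> n (snd x)) n) ((\<lambda>n x. Z' (fst x) * \<phi> n (snd x)) n)
        ((\<lambda>n x. Z (fst x) * \<phi>' n (snd x)) n)" for n by (rule C)
  next
    show "(\<lambda>n. LINT x:Lam|lborel. (cmod (Z (fst x) * \<phi> n (snd x) - Z (fst x) * A (snd x)))\<^sup>2) \<longlonglongrightarrow> 0"
      by (rule conv[OF Zc Z(3) sq(1) sq\<phi>(1) l(1)])
    show "(\<lambda>n. LINT x:Lam|lborel. (cmod (Z' (fst x) * \<phi> n (snd x) - Z' (fst x) * A (snd x)))\<^sup>2) \<longlonglongrightarrow> 0"
      by (rule conv[OF Z(2) Z(4) sq(1) sq\<phi>(1) l(1)])
    show "(\<lambda>n. LINT x:Lam|lborel. (cmod (Z (fst x) * \<phi>' n (snd x) - Z (fst x) * A' (snd x)))\<^sup>2) \<longlonglongrightarrow> 0"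
      by (rule conv[OF Zc Z(3) sq(2) sq\<phi>(2) l(2)])
  qed
qed

text \<open>The third power makes \<open>chi\<close> twice continuously differentiable.\<close>

definition chi :: "real \<Rightarrow> real" where "chi x = (max 0 (1 - x\<^sup>2)) ^ 3"
definition chi' :: "real \<Rightarrow> real" where "chi' x = - 6 * x * (max 0 (1 - x\<^sup>2))\<^sup>2"
definition chi'' :: "real \<Rightarrow> real" where
  "chi'' x = - 6 * (max 0 (1 - x\<^sup>2))\<^sup>2 + 24 * x\<^sup>2 * max 0 (1 - x\<^sup>2)"

lemma chi_deriv: "(chi has_real_derivative chi' x) (at x)" "(chi' has_real_derivative chi'' x) (at x)"
proof -
  let ?m = "\<lambda>x::real. max 0 (1 - x\<^sup>2)"
  have "((\<lambda>x::real. 1 - x\<^sup>2) has_real_derivative - 2 * x) (at x)"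
    by (rule derivative_eq_intros refl | simp)+
  from DERIV_chain2[where f="\<lambda>y. (max 0 y)\<^sup>2" and g="\<lambda>x. 1 - x\<^sup>2", OF max_sq_deriv this]
  have m2: "((\<lambda>x. (?m x)\<^sup>2) has_real_derivative 2 * ?m x * (- 2 * x)) (at x)" .
  have mm: "(1 - x\<^sup>2) * ?m x = (?m x)\<^sup>2" for x :: real by (simp add: max_def power2_eq_square)
  have "((\<lambda>x. (1 - x\<^sup>2) * (?m x)\<^sup>2) has_real_derivative (- 2 * x) * (?m x)\<^sup>2 + (2 * ?m x * (- 2 * x)) * (1 - x\<^sup>2)) (at x)"
    by (rule DERIV_mult[OF \<open>((\<lambda>x::real. 1 - x\<^sup>2) has_real_derivative - 2 * x) (at x)\<close> m2])
  moreover have "(\<lambda>x. (1 - x\<^sup>2) * (?m x)\<^sup>2) = chi"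
    by (auto simp: chi_def fun_eq_iff max_def power2_eq_square power3_eq_cube)
  moreover have "(- 2 * x) * (?m x)\<^sup>2 + (2 * ?m x * (- 2 * x)) * (1 - x\<^sup>2) = chi' x"
  proof -
    have "(- 2 * x) * (?m x)\<^sup>2 + (2 * ?m x * (- 2 * x)) * (1 - x\<^sup>2) =
        (- 2 * x) * (?m x)\<^sup>2 + (- 4 * x) * ((1 - x\<^sup>2) * ?m x)"
      by (simp add: mult_ac)
    then show ?thesis unfolding mm by (simp add: chi'_def)
  qed
  ultimately show "(chi has_real_derivative chi' x) (at x)" by simp
  have "((\<lambda>x. (- 6 * x) * (?m x)\<^sup>2) has_real_derivative (- 6) * (?m x)\<^sup>2 + (2 * ?m x * (- 2 * x)) * (- 6 * x)) (at x)"
    by (rule DERIV_mult[OF _ m2]) (rule derivative_eq_intros refl | simp)+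
  moreover have "(- 6) * (?m x)\<^sup>2 + (2 * ?m x * (- 2 * x)) * (- 6 * x) = chi'' x"
    by (simp add: chi''_def power2_eq_square algebra_simps)
  ultimately show "(chi' has_real_derivative chi'' x) (at x)" unfolding chi'_def[abs_def] by simp
qed

lemma chi_zero: "1 \<le> \<bar>x\<bar> \<Longrightarrow> chi x = 0 \<and> chi' x = 0 \<and> chi'' x = 0"
proof -
  assume "1 \<le> \<bar>x\<bar>"
  then have "1 \<le> x\<^sup>2" using abs_square_less_1[of x] by (simp add: not_less[symmetric])
  then show ?thesis by (simp add: chi_def chi'_def chi''_def)
qed

lemma chi_bounds: "\<bar>chi' x\<bar> \<le> 6" "\<bar>chi'' x\<bar> \<le> 30"
proof -
  let ?m = "max 0 (1 - x\<^sup>2)"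
  have m: "0 \<le> ?m" "?m \<le> 1" by auto
  have "\<bar>chi' x\<bar> \<le> 6 \<and> \<bar>chi'' x\<bar> \<le> 30"
  proof (cases "1 \<le> \<bar>x\<bar>")
    case False
    then have x: "\<bar>x\<bar> \<le> 1" "x\<^sup>2 \<le> 1" by (auto simp: abs_square_le_1)
    have m2: "0 \<le> ?m\<^sup>2" "?m\<^sup>2 \<le> 1" using m by (auto intro: power_le_one)
    have "\<bar>x\<bar> * ?m\<^sup>2 \<le> 1 * 1" by (intro mult_mono x m2) auto
    moreover have "x\<^sup>2 * ?m \<le> 1 * 1" by (intro mult_mono x m) auto
    moreover have "0 \<le> x\<^sup>2 * ?m" using m by simp
    moreover have "chi'' x = - 6 * ?m\<^sup>2 + 24 * (x\<^sup>2 * ?m)" by (simp add: chi''_def mult.assoc)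
    moreover have "\<bar>chi' x\<bar> = 6 * (\<bar>x\<bar> * ?m\<^sup>2)" using m2 by (simp add: chi'_def abs_mult)
    ultimately show ?thesis using m2 by (intro conjI; linarith)
  qed (use chi_zero in simp)
  then show "\<bar>chi' x\<bar> \<le> 6" "\<bar>chi'' x\<bar> \<le> 30" by auto
qed

lemma chi_lower: "\<bar>x\<bar> \<le> 1/2 \<Longrightarrow> 1/7 \<le> (chi x)\<^sup>2"
proof -
  assume "\<bar>x\<bar> \<le> 1/2"
  then have "\<bar>x\<bar>\<^sup>2 \<le> (1/2)\<^sup>2" by (intro power_mono) auto
  then have "x\<^sup>2 \<le> 1/4" by (simp add: power_divide)
  then have m: "3/4 \<le> max 0 (1 - x\<^sup>2)" by (simp add: le_max_iff_disj)
  have "(3/4)^3 \<le> chi x" unfolding chi_def by (rule power_mono[OF m]) simp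
  then have "((3/4)^3)\<^sup>2 \<le> (chi x)\<^sup>2" by (intro power_mono) auto
  \<comment> \<open>(3/4)^6 = 729 / 4096, which exceeds 1/7.\<close>
  moreover have "1/7 \<le> ((3/4::real)^3)\<^sup>2" by (simp add: power2_eq_square power3_eq_cube)
  ultimately show ?thesis by linarith
qed

text \<open>A plane wave of frequency p times a cut-off supported in |s - c| \<le> n;
  \<open>wav'\<close> and \<open>wav''\<close> are its first two derivatives in s.\<close>

definition wav :: "real \<Rightarrow> real \<Rightarrow> real \<Rightarrow> real \<Rightarrow> complex" where
  "wav p c n s = of_real (chi ((s - c) / n)) * exp (s *\<^sub>R (\<i> * of_real p))"
definition wav' :: "real \<Rightarrow> real \<Rightarrow> real \<Rightarrow> real \<Rightarrow> complex" where
  "wav' p c n s = (of_real (chi' ((s - c) / n) / n) + of_real (chi ((s - c) / n)) * (\<i> * of_real p)) * exp (s *\<^sub>R (\<i> * of_real p))"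
definition wav'' :: "real \<Rightarrow> real \<Rightarrow> real \<Rightarrow> real \<Rightarrow> complex" where
  "wav'' p c n s = (of_real (chi'' ((s - c) / n) / n\<^sup>2) + 2 * of_real (chi' ((s - c) / n) / n) * (\<i> * of_real p)
     - of_real (p\<^sup>2) * of_real (chi ((s - c) / n))) * exp (s *\<^sub>R (\<i> * of_real p))"

lemma wav_deriv:
  assumes n: "n > 0"
  shows "(wav p c n has_vector_derivative wav' p c n s) (at s)"
    "(wav' p c n has_vector_derivative wav'' p c n s) (at s)"
proof -
  let ?A = "\<i> * complex_of_real p"
  have e: "((\<lambda>s. exp (s *\<^sub>R ?A)) has_vector_derivative exp (s *\<^sub>R ?A) * ?A) (at s)"
    by (rule exp_scaleR_has_vector_derivative_right)
  have l: "((\<lambda>s. (s - c) / n) has_real_derivative 1 / n) (at s)"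
    using n by (auto intro!: derivative_eq_intros)
  have d1: "((\<lambda>s. complex_of_real (chi ((s - c) / n))) has_vector_derivative of_real (chi' ((s - c) / n) / n)) (at s)"
    using DERIV_chain2[where f=chi and g="\<lambda>s. (s - c) / n", OF chi_deriv(1) l]
    by (intro has_vector_derivative_of_real) simp
  have d2: "((\<lambda>s. complex_of_real (chi' ((s - c) / n) / n)) has_vector_derivative of_real (chi'' ((s - c) / n) / n\<^sup>2)) (at s)"
    using DERIV_cdivide[OF DERIV_chain2[where f=chi' and g="\<lambda>s. (s - c) / n", OF chi_deriv(2) l], of n]
    by (intro has_vector_derivative_of_real) (simp add: power2_eq_square)
  have "(wav p c n has_vector_derivative of_real (chi ((s - c) / n)) * (exp (s *\<^sub>R ?A) * ?A)
      + of_real (chi' ((s - c) / n) / n) * exp (s *\<^sub>R ?A)) (at s)"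
    unfolding wav_def[abs_def] by (rule has_vector_derivative_mult[OF d1 e])
  then show "(wav p c n has_vector_derivative wav' p c n s) (at s)"
    by (simp add: wav'_def algebra_simps)
  have d3: "((\<lambda>s. of_real (chi' ((s - c) / n) / n) + of_real (chi ((s - c) / n)) * ?A) has_vector_derivative
      of_real (chi'' ((s - c) / n) / n\<^sup>2) + of_real (chi' ((s - c) / n) / n) * ?A) (at s)"
    by (intro has_vector_derivative_add d2 has_vector_derivative_mult_left d1)
  have "?A * ?A = (\<i> * \<i>) * (of_real p * of_real p)" by (simp only: mult.assoc mult.left_commute)
  then have AA: "?A * ?A = - of_real (p\<^sup>2)" by (simp add: power2_eq_square)
  have "(wav' p c n has_vector_derivative
      (of_real (chi' ((s - c) / n) / n) + of_real (chi ((s - c) / n)) * ?A) * (exp (s *\<^sub>R ?A) * ?A) +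
      (of_real (chi'' ((s - c) / n) / n\<^sup>2) + of_real (chi' ((s - c) / n) / n) * ?A) * exp (s *\<^sub>R ?A)) (at s)"
    unfolding wav'_def[abs_def] by (rule has_vector_derivative_mult[OF d3 e])
  moreover have "(x + y * ?A) * (wext * ?A) + (z + x * ?A) * wext = (z + 2 * x * ?A - of_real (p\<^sup>2) * y) * wext" for x y z wext
  proof -
    have "(x + y * ?A) * (wext * ?A) + (z + x * ?A) * wext = (z + 2 * x * ?A + (?A * ?A) * y) * wext"
      by (simp add: algebra_simps)
    then show ?thesis unfolding AA by simp
  qed
  ultimately show "(wav' p c n has_vector_derivative wav'' p c n s) (at s)"
    by (simp only: wav''_def)
qed

lemma norm_wave: "cmod (exp (s *\<^sub>R (\<i> * of_real p))) = 1"
  by (simp add: norm_exp_eq_Re)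

lemma wav_zero:
  assumes "n > 0" "n \<le> \<bar>s - c\<bar>"
  shows "wav p c n s = 0" "wav' p c n s = 0" "wav'' p c n s = 0"
proof -
  have "1 \<le> \<bar>(s - c) / n\<bar>" using assms by (simp add: field_simps)
  from chi_zero[OF this] show "wav p c n s = 0" "wav' p c n s = 0" "wav'' p c n s = 0"
    by (simp_all add: wav_def wav'_def wav''_def)
qed

lemma wav_continuous:
  assumes "n > 0"
  shows "continuous_on S (wav p c n)" "continuous_on S (wav' p c n)" "continuous_on S (wav'' p c n)"
proof -
  show "continuous_on S (wav p c n)" "continuous_on S (wav' p c n)"
    by (intro continuous_at_imp_continuous_on ballI has_vector_derivative_continuous[OF wav_deriv(1)[OF assms]]
        has_vector_derivative_continuous[OF wav_deriv(2)[OF assms]])+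
  show "continuous_on S (wav'' p c n)"
    unfolding wav''_def chi_def chi'_def chi''_def using assms by (intro continuous_intros) auto
qed

text \<open>In wav'' + p^2 wav only terms with a derivative of the cut-off survive. They are of size
  1 / n on an interval of length 2 n, so the squared norm is of order 1 / n, whereas that of the
  wave itself grows like n.\<close>

lemma wav_residual:
  assumes n: "n \<ge> 1"
  shows "(LINT s|lborel. (cmod (wav'' p c n s + of_real (p\<^sup>2) * wav p c n s))\<^sup>2) \<le> (30 + 12 * \<bar>p\<bar>)\<^sup>2 * 2 / n"
proof -
  define r where "r s = wav'' p c n s + of_real (p\<^sup>2) * wav p c n s" for s
  have r: "cmod (r s) \<le> (30 + 12 * \<bar>p\<bar>) / n" for s
  proof -
    let ?y = "(s - c) / n"
    have "r s = (of_real (chi'' ?y / n\<^sup>2) + 2 * of_real (chi' ?y / n) * (\<i> * of_real p)) * exp (s *\<^sub>R (\<i> * of_real p))"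
      by (simp add: r_def wav''_def wav_def algebra_simps)
    then have "cmod (r s) = cmod (of_real (chi'' ?y / n\<^sup>2) + 2 * of_real (chi' ?y / n) * (\<i> * of_real p))"
      by (simp only: norm_mult norm_wave mult_1_right)
    also have "\<dots> \<le> cmod (of_real (chi'' ?y / n\<^sup>2)) + cmod (2 * of_real (chi' ?y / n) * (\<i> * of_real p))"
      by (rule norm_triangle_ineq)
    also have "\<dots> = \<bar>chi'' ?y\<bar> / n\<^sup>2 + 2 * (\<bar>chi' ?y\<bar> / n) * \<bar>p\<bar>"
      using n by (simp add: norm_mult norm_divide del: of_real_divide)
    also have "\<dots> \<le> 30 / n + 2 * (6 / n) * \<bar>p\<bar>"
    proof (intro add_mono mult_right_mono mult_left_mono)
      have "n \<le> n\<^sup>2" using n by (simp add: power2_eq_square)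
      then show "\<bar>chi'' ?y\<bar> / n\<^sup>2 \<le> 30 / n" using chi_bounds(2)[of ?y] n by (intro frac_le) auto
      show "\<bar>chi' ?y\<bar> / n \<le> 6 / n" using chi_bounds(1)[of ?y] n by (intro divide_right_mono) auto
    qed auto
    finally show ?thesis by (simp add: add_divide_distrib)
  qed
  have r0: "r s = 0" if "n \<le> \<bar>s - c\<bar>" for s using wav_zero[OF _ that] n by (simp add: r_def)
  have rc: "continuous_on S r" for S unfolding r_def[abs_def] using n by (intro continuous_intros wav_continuous) auto
  have eq: "(cmod (r s))\<^sup>2 = indicator {c - n..c + n} s *\<^sub>R (cmod (r s))\<^sup>2" for s
    by (cases "n \<le> \<bar>s - c\<bar>") (use r0[of s] in \<open>auto simp: indicator_def not_le abs_less_iff\<close>)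
  have "(LINT s|lborel. (cmod (r s))\<^sup>2) \<le> (LINT s|lborel. indicator {c - n..c + n} s *\<^sub>R ((30 + 12 * \<bar>p\<bar>) / n)\<^sup>2)"
  proof (rule integral_mono)
    show "integrable lborel (\<lambda>s. (cmod (r s))\<^sup>2)"
    proof -
      have "integrable lborel (\<lambda>s. indicator {c - n..c + n} s *\<^sub>R (cmod (r s))\<^sup>2)"
        by (intro borel_integrable_compact compact_Icc continuous_intros rc)
      then show ?thesis by (simp only: eq[symmetric])
    qed
    show "integrable lborel (\<lambda>s. indicator {c - n..c + n} s *\<^sub>R ((30 + 12 * \<bar>p\<bar>) / n)\<^sup>2)"
      by (intro borel_integrable_compact compact_Icc continuous_intros)
    show "(cmod (r s))\<^sup>2 \<le> indicator {c - n..c + n} s *\<^sub>R ((30 + 12 * \<bar>p\<bar>) / n)\<^sup>2" for s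
      using power_mono[OF r norm_ge_zero, of s 2] eq[of s] by (auto simp: indicator_def)
  qed
  also have "\<dots> = 2 * n * ((30 + 12 * \<bar>p\<bar>) / n)\<^sup>2" using n by simp
  also have "\<dots> = (30 + 12 * \<bar>p\<bar>)\<^sup>2 * 2 / n" using n by (simp add: power_divide power2_eq_square)
  finally show ?thesis by (simp add: r_def)
qed

lemma wav_norm:
  assumes n: "n > 0"
  shows "n / 7 \<le> (LINT s|lborel. (cmod (wav p c n s))\<^sup>2)"
proof -
  have "n / 7 = (LINT s|lborel. indicator {c - n / 2..c + n / 2} s *\<^sub>R (1/7::real))" using n by simp
  also have "\<dots> \<le> (LINT s|lborel. (cmod (wav p c n s))\<^sup>2)"
  proof (rule integral_mono)
    show "integrable lborel (\<lambda>s. (cmod (wav p c n s))\<^sup>2)"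
    proof (rule sq_int_compact_support[where R="\<bar>c\<bar> + n"])
      show "continuous_on UNIV (wav p c n)" by (rule wav_continuous[OF n])
      show "wav p c n s = 0" if "\<bar>c\<bar> + n \<le> \<bar>s\<bar>" for s using that by (intro wav_zero n) linarith
    qed
    show "integrable lborel (\<lambda>s. indicator {c - n / 2..c + n / 2} s *\<^sub>R (1/7::real))"
      by (intro borel_integrable_compact compact_Icc continuous_intros)
    fix s
    show "indicator {c - n / 2..c + n / 2} s *\<^sub>R (1/7) \<le> (cmod (wav p c n s))\<^sup>2"
    proof (cases "s \<in> {c - n / 2..c + n / 2}")
      case True
      then have "\<bar>s - c\<bar> \<le> n / 2" unfolding abs_le_iff atLeastAtMost_iff by linarith
      then have "\<bar>(s - c) / n\<bar> \<le> 1/2" using n by (simp add: abs_divide field_simps)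
      from chi_lower[OF this] show ?thesis
        using True unfolding wav_def norm_mult norm_wave by simp
    qed simp
  qed
  finally show ?thesis .
qed

context tube
begin

text \<open>The difference of the two sides is the integral of the divergence
  \<open>(\<epsilon> / h) * U * \<partial>\<^sub>s (Z' * cnj \<phi>) + (Z / \<epsilon>) * \<partial>\<^sub>t (h * U' * cnj \<phi>)\<close>.\<close>

lemma wave_form_identity:
  assumes s: "trans_sol \<kappa> l v v'"
    and Z: "\<And>s. (Z has_vector_derivative Z' s) (at s)" "\<And>s. (Z' has_vector_derivative Z'' s) (at s)"
      "continuous_on UNIV Z''"
    and C: "C1c_R2 Lam \<phi> ps pt"
  shows "(LINT x:Lam|lborel. of_real (\<epsilon> / h_eps \<gamma> \<epsilon> (snd x) * uu v (snd x)) * Z' (fst x) * cnj (ps x)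
        + of_real (h_eps \<gamma> \<epsilon> (snd x) * uu' v v' (snd x) / \<epsilon>) * Z (fst x) * cnj (pt x)) =
    (LINT x:Lam|lborel. - (of_real (\<epsilon> / h_eps \<gamma> \<epsilon> (snd x) * uu v (snd x)) * Z'' (fst x)
        + of_real (\<epsilon> * (\<kappa> / h_eps \<gamma> \<epsilon> (snd x) - l * h_eps \<gamma> \<epsilon> (snd x)) * uu v (snd x)) * Z (fst x)) * cnj (\<phi> x))"
    (is "(LINT x:Lam|lborel. ?k1 x) = (LINT x:Lam|lborel. ?k2 x)")
proof -
  note cc = C1c_R2_continuous[OF C]
  obtain R where R: "\<And>s t. R \<le> \<bar>s\<bar> \<or> 1 \<le> \<bar>t\<bar> \<Longrightarrow> \<phi> (s, t) = 0 \<and> ps (s, t) = 0 \<and> pt (s, t) = 0" and R0: "R > 0"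
    using C1c_R2_support[OF C] by metis
  let ?K = "cbox (-R, -1) (R, 1::real)"
  let ?h = "h_eps \<gamma> \<epsilon>"
  have Zc: "continuous_on S Z" "continuous_on S Z'" for S
    by (intro continuous_at_imp_continuous_on ballI has_vector_derivative_continuous[OF Z(1)]
        has_vector_derivative_continuous[OF Z(2)])+
  have cZ: "continuous_on ?K (\<lambda>x. Z (fst x))" "continuous_on ?K (\<lambda>x. Z' (fst x))" "continuous_on ?K (\<lambda>x. Z'' (fst x))"
    by (rule continuous_on_compose2[OF Zc(1)[of UNIV]] continuous_on_compose2[OF Zc(2)[of UNIV]]
        continuous_on_compose2[OF Z(3)]; auto intro!: continuous_intros)+
  have cU: "continuous_on ?K (\<lambda>x. uu v (snd x))" "continuous_on ?K (\<lambda>x. uu' v v' (snd x))"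
    by (rule continuous_on_compose2[OF uu_continuous(1)[OF s]] continuous_on_compose2[OF uu_continuous(2)[OF s]];
        auto intro!: continuous_intros simp: cbox_Pair_eq)+
  have ch: "continuous_on ?K (\<lambda>x. ?h (snd x))"
    by (rule continuous_on_compose2[OF continuous_h_eps[of UNIV]]) (auto intro!: continuous_intros)
  have hne: "?h t \<noteq> 0" for t using h_eps_pos[of \<gamma> \<epsilon> t] by simp
  note ci = continuous_intros cZ cU ch cc
  have c1: "continuous_on ?K ?k1" using \<epsilon> by (intro ci) (auto simp: hne)
  have c2: "continuous_on ?K ?k2" by (intro ci) (auto simp: hne)
  have z1: "?k1 (s, t) = 0" if "R \<le> \<bar>s\<bar> \<or> 1 \<le> \<bar>t\<bar>" for s t using R[OF that] by simp
  have z2: "?k2 (s, t) = 0" if "R \<le> \<bar>s\<bar> \<or> 1 \<le> \<bar>t\<bar>" for s t using R[OF that] by simp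
  \<comment> \<open>\<open>T1\<close> and \<open>T2\<close> are the two parts of the divergence. The
    second integrates to zero along t, the first along s, which is why the order of integration is
    exchanged in between.\<close>
  define T1 where "T1 x = of_real (\<epsilon> / ?h (snd x) * uu v (snd x)) * (Z'' (fst x) * cnj (\<phi> x) + Z' (fst x) * cnj (ps x))" for x
  define T2 where "T2 x = (Z (fst x) / of_real \<epsilon>) * (of_real (\<epsilon>\<^sup>2 * (\<kappa> / ?h (snd x) - l * ?h (snd x)) * uu v (snd x)) * cnj (\<phi> x)
      + of_real (?h (snd x) * uu' v v' (snd x)) * cnj (pt x))" for x
  have cT: "continuous_on ?K T1" "continuous_on ?K T2"
    unfolding T1_def T2_def using \<epsilon> by (intro ci; auto simp: hne)+
  have k12: "?k1 x - ?k2 x = T1 x + T2 x" for x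
  proof -
    have "complex_of_real (?h (snd x)) \<noteq> 0" using hne[of "snd x"] by simp
    then show ?thesis using \<epsilon> unfolding T1_def T2_def by (simp add: field_simps power2_eq_square)
  qed
  have "(LINT x:Lam|lborel. ?k1 x) - (LINT x:Lam|lborel. ?k2 x) = (LINT x:Lam|lborel. ?k1 x - ?k2 x)"
    by (rule set_integral_diff(2)[symmetric]) (rule LINT_Lam_iterated(1)[OF c1 z1] LINT_Lam_iterated(1)[OF c2 z2]; assumption)+
  also have "\<dots> = integral {-R..R} (\<lambda>s. integral {-1..1} (\<lambda>t. ?k1 (s, t) - ?k2 (s, t)))"
    by (rule LINT_Lam_iterated(2)) (use c1 c2 z1 z2 in \<open>auto intro!: continuous_on_diff\<close>)
  also have "\<dots> = integral {-R..R} (\<lambda>s. integral {-1..1} (\<lambda>t. T1 (s, t) + T2 (s, t)))"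
    by (simp only: k12)
  also have "\<dots> = integral {-R..R} (\<lambda>s. integral {-1..1} (\<lambda>t. T1 (s, t)))"
  proof (rule integral_cong)
    fix s assume s': "s \<in> {-R..R}"
    have sl: "continuous_on {-1..1} (\<lambda>t. g (s, t))" if "continuous_on ?K g" for g :: "real \<times> real \<Rightarrow> complex"
      by (rule continuous_on_compose2[OF that]) (use s' in \<open>auto intro!: continuous_intros simp: cbox_Pair_eq\<close>)
    have "((\<lambda>t. of_real (\<epsilon>\<^sup>2 * (\<kappa> / ?h t - l * ?h t) * uu v t) * cnj (\<phi> (s, t)) + of_real (?h t * uu' v v' t) * cnj (pt (s, t)))
        has_integral (of_real (?h 1 * uu' v v' 1) * cnj (\<phi> (s, 1)) - of_real (?h (-1) * uu' v v' (-1)) * cnj (\<phi> (s, -1)))) {-1..1}"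
    proof (rule fundamental_theorem_of_calculus)
      fix t :: real assume t: "t \<in> {-1..1}"
      have d: "((\<lambda>t. cnj (\<phi> (s, t))) has_vector_derivative cnj (pt (s, t))) (at t within {-1..1})"
        using C1c_R2_slice[OF C, of s] unfolding C1c_R_def
        by (intro bounded_linear.has_vector_derivative[OF bounded_linear_cnj]) (auto intro: has_vector_derivative_at_within)
      show "((\<lambda>t. of_real (?h t * uu' v v' t) * cnj (\<phi> (s, t))) has_vector_derivative
          of_real (\<epsilon>\<^sup>2 * (\<kappa> / ?h t - l * ?h t) * uu v t) * cnj (\<phi> (s, t)) + of_real (?h t * uu' v v' t) * cnj (pt (s, t))) (at t within {-1..1})"
        using has_vector_derivative_mult[OF has_vector_derivative_of_real[OF uu_deriv(2)[OF s t]] d]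
        by (simp only: add.commute)
    qed simp
    then have "((\<lambda>t. of_real (\<epsilon>\<^sup>2 * (\<kappa> / ?h t - l * ?h t) * uu v t) * cnj (\<phi> (s, t)) + of_real (?h t * uu' v v' t) * cnj (pt (s, t)))
        has_integral 0) {-1..1}" using R[of s 1] R[of s "-1"] by simp
    from has_integral_mult_right[OF this, of "Z s / of_real \<epsilon>"]
    have "((\<lambda>t. T2 (s, t)) has_integral 0) {-1..1}" by (simp add: T2_def)
    from has_integral_add[OF integrable_integral[OF integrable_continuous_real[OF sl[OF cT(1)]]] this]
    show "integral {-1..1} (\<lambda>t. T1 (s, t) + T2 (s, t)) = integral {-1..1} (\<lambda>t. T1 (s, t))"
      by (simp add: integral_unique)
  qed
  also have "\<dots> = integral {-1..1} (\<lambda>t. integral {-R..R} (\<lambda>s. T1 (s, t)))"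
    using integral_swap_continuous[of "-R" "-1" R 1 "\<lambda>s t. T1 (s, t)"] cT(1) by simp
  also have "\<dots> = integral {-1..1} (\<lambda>t::real. 0)"
  proof (rule integral_cong)
    fix t :: real
    have "((\<lambda>s. Z' s * cnj (ps (s, t)) + Z'' s * cnj (\<phi> (s, t))) has_integral
        (Z' R * cnj (\<phi> (R, t)) - Z' (-R) * cnj (\<phi> (-R, t)))) {-R..R}"
    proof (rule fundamental_theorem_of_calculus)
      fix s :: real
      have d: "(\<phi> has_derivative (\<lambda>h. fst h *\<^sub>R ps (s, t) + snd h *\<^sub>R pt (s, t))) (at (s, t))"
        using C unfolding C1c_R2_def by blast
      have "((\<lambda>s. (s, t)) has_derivative (\<lambda>h. (h, 0))) (at s within {-R..R})"
        by (auto intro!: derivative_eq_intros)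
      from has_derivative_compose[OF this d]
      have "((\<lambda>s. \<phi> (s, t)) has_vector_derivative ps (s, t)) (at s within {-R..R})" by (simp add: has_vector_derivative_def)
      then have "((\<lambda>s. cnj (\<phi> (s, t))) has_vector_derivative cnj (ps (s, t))) (at s within {-R..R})"
        by (rule bounded_linear.has_vector_derivative[OF bounded_linear_cnj])
      from has_vector_derivative_mult[OF has_vector_derivative_at_within[OF Z(2)] this]
      show "((\<lambda>s. Z' s * cnj (\<phi> (s, t))) has_vector_derivative Z' s * cnj (ps (s, t)) + Z'' s * cnj (\<phi> (s, t))) (at s within {-R..R})" .
    qed (use R0 in simp)
    then have "((\<lambda>s. Z'' s * cnj (\<phi> (s, t)) + Z' s * cnj (ps (s, t))) has_integral 0) {-R..R}"
      using R[of R t] R[of "-R" t] R0 by (simp add: add.commute)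
    from has_integral_mult_right[OF this, of "of_real (\<epsilon> / ?h t * uu v t)"]
    have "((\<lambda>s. T1 (s, t)) has_integral 0) {-R..R}" by (simp add: T1_def)
    then show "integral {-R..R} (\<lambda>s. T1 (s, t)) = 0" by (rule integral_unique)
  qed
  also have "\<dots> = 0" by simp
  finally show ?thesis by simp
qed

text \<open>On \<psi> = Z(s) u(t) the transverse equation turns the operator into l \<psi> - (Z'' +
  \<kappa> Z) u / h^2, provided that Z lives where F = h. The residual is thus that of the cut-off
  wave, of frequency sqrt \<kappa>.\<close>

lemma weyl_pair:
  assumes s: "trans_sol \<kappa> l v v'" and \<kappa>: "\<kappa> \<ge> 0" and n: "n \<ge> 1"
  defines "A2 \<equiv> (LINT t:{-1<..<1}|lborel. (cmod (zext {-1<..<1} (\<lambda>t. of_real (uu v t)) t))\<^sup>2)"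
  shows "\<exists>\<psi> g. (\<psi>, g) \<in> dirichlet_graph \<epsilon> F \<and> \<epsilon> * (n / 7 * A2) \<le> (nrmw Lam w \<psi>)\<^sup>2 \<and>
    (nrmw Lam w (\<lambda>x. g x - of_real l * \<psi> x))\<^sup>2 \<le> \<epsilon> * ((30 + 12 * \<bar>sqrt \<kappa>\<bar>)\<^sup>2 * 2 / n * A2)"
proof -
  let ?U = "{-1<..<1::real}"
  let ?h = "h_eps \<gamma> \<epsilon>"
  define p where "p = sqrt \<kappa>"
  have p2: "p\<^sup>2 = \<kappa>" using \<kappa> by (simp add: p_def)
  \<comment> \<open>Centre s0 + n and half width n place the support in [s0, s0 + 2 n], where the
    metric is unperturbed.\<close>
  define c where "c = s0 + n"
  define R where "R = s0 + 2 * n"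
  define Z Z' Z'' where "Z = wav p c n" and "Z' = wav' p c n" and "Z'' = wav'' p c n"
  have n0: "n > 0" using n by simp
  have dZ: "(Z has_vector_derivative Z' s) (at s)" "(Z' has_vector_derivative Z'' s) (at s)" for s
    unfolding Z_def Z'_def Z''_def by (rule wav_deriv[OF n0])+
  have cZ: "continuous_on S Z" "continuous_on S Z'" "continuous_on S Z''" for S
    unfolding Z_def Z'_def Z''_def by (rule wav_continuous[OF n0])+
  have zZ: "Z s = 0" "Z' s = 0" "Z'' s = 0" if "R \<le> \<bar>s\<bar> \<or> \<bar>s\<bar> < s0" for s
  proof -
    have "n \<le> \<bar>s - c\<bar>" using that n s0 by (auto simp: R_def c_def abs_if split: if_splits)
    then show "Z s = 0" "Z' s = 0" "Z'' s = 0" unfolding Z_def Z'_def Z''_def by (simp_all add: wav_zero n0)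
  qed
  define B B' B1 where "B = zext ?U (\<lambda>t. of_real (uu v t))" and "B' = zext ?U (\<lambda>t. of_real (uu' v v' t))"
    and "B1 = zext ?U (\<lambda>t. of_real (uu v t / (?h t)\<^sup>2))"
  have rsrs: "zext ?U (zext ?U f) = zext ?U f" for f by (auto simp: zext_def)
  have sB: "sq_int (zext ?U B)" "sq_int (zext ?U B1)"
    unfolding B_def B1_def rsrs using h_eps_pos[of \<gamma> \<epsilon>]
    by (intro sq_int_zext_continuous continuous_intros uu_continuous[OF s] continuous_h_eps;
        auto simp: less_imp_neq[symmetric])+
  have mB: "B \<in> borel_measurable borel" "B1 \<in> borel_measurable borel"
    using sq_int_measurable[OF sB(1)] sq_int_measurable[OF sB(2)] by (simp_all add: B_def B1_def rsrs)
  define r where "r s = Z'' s + of_real (p\<^sup>2) * Z s" for s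
  have rc: "continuous_on S r" for S unfolding r_def[abs_def] by (intro continuous_intros cZ)
  have r0: "r s = 0" if "R \<le> \<bar>s\<bar> \<or> \<bar>s\<bar> < s0" for s using zZ[OF that] by (simp add: r_def)
  define \<psi> where "\<psi> x = Z (fst x) * B (snd x)" for x
  define \<psi>s where "\<psi>s x = Z' (fst x) * B (snd x)" for x
  define \<psi>t where "\<psi>t x = Z (fst x) * B' (snd x)" for x
  define \<rho> where "\<rho> x = r (fst x) * B1 (snd x)" for x
  define g where "g x = of_real l * \<psi> x - \<rho> x" for x
  have H: "H10_R2 Lam \<psi> \<psi>s \<psi>t"
    unfolding \<psi>_def[abs_def] \<psi>s_def[abs_def] \<psi>t_def[abs_def] B_def B'_def
    by (rule H10_R2_tensor[OF dZ(1) cZ(2) _ _ H10_R_uu[OF s]]) (use zZ in blast)+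
  have sq\<psi>: "sq_int (zext Lam \<psi>)" by (rule H10_R2_X(2)[OF H])
  have m\<psi>: "\<psi> \<in> borel_measurable lborel" by (rule H10_R2_X(5)[OF H])
  have sq\<rho>: "sq_int (zext Lam \<rho>)"
    unfolding \<rho>_def[abs_def] by (rule tensor_sq(1)[OF rc _ sB(2)]) (use r0 in blast)
  have m\<rho>: "\<rho> \<in> borel_measurable lborel"
    unfolding \<rho>_def[abs_def] by (rule borel_measurable_tensor[OF borel_measurable_continuous_onI[OF rc] mB(2)])
  have rsg: "zext Lam g = (\<lambda>x. of_real l * zext Lam \<psi> x - zext Lam \<rho> x)" by (auto simp: zext_def g_def fun_eq_iff)
  have L2g: "L2w Lam w g"
    unfolding L2w_w_iff
  proof
    show "sq_int (zext Lam g)" unfolding rsg by (intro sq_int_diff sq_int_cmult sq\<psi> sq\<rho>)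
    note [measurable] = m\<psi>[simplified] m\<rho>[simplified]
    show "g \<in> borel_measurable lborel" unfolding g_def[abs_def] by measurable
  qed
  have graph: "(\<psi>, g) \<in> dirichlet_graph \<epsilon> F"
    unfolding graph_iff
  proof (intro conjI exI allI impI)
    show "L2w Lam w g" by (rule L2g)
    show "H10_R2 Lam \<psi> \<psi>s \<psi>t" by (rule H)
    fix \<phi> ps pt assume C: "C1c_R2 Lam \<phi> ps pt"
    note H\<phi> = C1c_R2_H10[OF C]
    have eps: "complex_of_real \<epsilon> \<noteq> 0" using \<epsilon> by simp
    \<comment> \<open>Either the wave vanishes with its derivatives or the metric is the unperturbed
      one; the pointwise identities below are checked in both cases.\<close>
    have Lam_cases: "Z s = 0 \<and> Z' s = 0 \<and> Z'' s = 0 \<or> F (s, t) = ?h t" for s t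
      using zZ[of s] F_out[of s t] by (cases "\<bar>s\<bar> < s0") auto
    have e1: "complex_of_real (\<epsilon> * F x) * (\<psi>s x * cnj (ps x) / complex_of_real ((F x)\<^sup>2) + \<psi>t x * cnj (pt x) / complex_of_real (\<epsilon>\<^sup>2))
        = of_real (\<epsilon> / ?h (snd x) * uu v (snd x)) * Z' (fst x) * cnj (ps x)
          + of_real (?h (snd x) * uu' v v' (snd x) / \<epsilon>) * Z (fst x) * cnj (pt x)"
      if x: "x \<in> Lam" for x
    proof -
      obtain s t where st: "x = (s, t)" "t \<in> ?U" using x by (auto simp: Lam_def)
      have hn: "complex_of_real (?h t) \<noteq> 0" using h_eps_pos[of \<gamma> \<epsilon> t] by simp
      from Lam_cases[of s t] show ?thesis
      proof
        assume "F (s, t) = ?h t"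
        then show ?thesis using eps hn st(2)
          by (simp add: st(1) \<psi>s_def \<psi>t_def B_def B'_def zext_def field_simps power2_eq_square)
      qed (simp add: st(1) \<psi>s_def \<psi>t_def)
    qed
    have LamS: "Lam \<in> sets lborel" using Lam_borel by simp
    have pp: "complex_of_real \<kappa> = of_real p * of_real p" by (metis of_real_mult p2 power2_eq_square)
    have e2: "complex_of_real (w x) * g x * cnj (\<phi> x) =
        - (of_real (\<epsilon> / ?h (snd x) * uu v (snd x)) * Z'' (fst x)
        + of_real (\<epsilon> * (\<kappa> / ?h (snd x) - l * ?h (snd x)) * uu v (snd x)) * Z (fst x)) * cnj (\<phi> x)"
      if x: "x \<in> Lam" for x
    proof -
      obtain s t where st: "x = (s, t)" "t \<in> ?U" using x by (auto simp: Lam_def)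
      have hn: "complex_of_real (?h t) \<noteq> 0" using h_eps_pos[of \<gamma> \<epsilon> t] by simp
      from Lam_cases[of s t] show ?thesis
      proof
        assume "F (s, t) = ?h t"
        then show ?thesis using eps hn st(2)
          by (simp add: st(1) g_def \<psi>_def \<rho>_def r_def w_def B_def B1_def zext_def pp field_simps power2_eq_square)
      qed (simp add: st(1) g_def \<psi>_def \<rho>_def r_def)
    qed
    have "cin (wext m2 \<psi>s) (wext m2 ps) + cin (wext m3 \<psi>t) (wext m3 pt) = ipw Lam w g \<phi>"
      unfolding form_eq[OF H H\<phi>, symmetric] ipw_def
      by (rule trans[OF set_lebesgue_integral_cong[OF LamS allI[OF impI[OF e1]]]
            trans[OF wave_form_identity[OF s dZ cZ(3) C] set_lebesgue_integral_cong[OF LamS allI[OF impI[OF e2]], symmetric]]])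
        assumption+
    then have "Re (cin (wext m2 \<psi>s) (wext m2 ps) + cin (wext m3 \<psi>t) (wext m3 pt)) = Re (cin (wext m1 g) (wext m1 \<phi>))"
      by (simp only: ipw_eq)
    then show "inner (snd (emb \<psi> \<psi>s \<psi>t)) (snd (emb \<phi> ps pt)) = inner (cls (wext m1 g)) (fst (emb \<phi> ps pt))"
      using H10_R2_X[OF H] H10_R2_X[OF H\<phi>] L2g
      by (simp add: emb_def inner_prod_def Re_cin sq_int_wext adm_m L2w_w_iff)
  qed
  have wi: "set_integrable lborel Lam (\<lambda>x. w x * (cmod (f x))\<^sup>2)"
    if "sq_int (zext Lam f)" "f \<in> borel_measurable lborel" for f
    using that L2w_w_iff[of f] by (simp add: L2w_def)
  have i1: "set_integrable lborel Lam (\<lambda>x. (cmod (f x))\<^sup>2)" if "sq_int (zext Lam f)" for f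
    using sq_int_integrable[OF that] unfolding cmod_zext_sq set_integrable_def .
  have wnn: "nrmw Lam w f ^ 2 = (LINT x:Lam|lborel. w x * (cmod (f x))\<^sup>2)" for f
  proof -
    have "0 \<le> (LINT x:Lam|lborel. w x * (cmod (f x))\<^sup>2)"
      unfolding set_lebesgue_integral_def
      by (rule Bochner_Integration.integral_nonneg) (simp add: less_imp_le[OF w_pos])
    then show ?thesis by (simp add: nrmw_def)
  qed
  have A2: "A2 = (LINT t:?U|lborel. (cmod (B t))\<^sup>2)" by (simp add: A2_def B_def)
  have A2nn: "A2 \<ge> 0" unfolding A2 set_lebesgue_integral_def
    by (rule Bochner_Integration.integral_nonneg) simp
  have ts1: "(LINT x:Lam|lborel. (cmod (\<psi> x))\<^sup>2) = (LINT s|lborel. (cmod (Z s))\<^sup>2) * A2"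
    unfolding \<psi>_def A2 by (rule tensor_sq(2)[OF cZ(1) _ sB(1)]) (use zZ in blast)
  have "\<epsilon> * (n / 7 * A2) \<le> \<epsilon> * (LINT x:Lam|lborel. (cmod (\<psi> x))\<^sup>2)"
    unfolding ts1 using \<epsilon> A2nn wav_norm[OF n0, of p c] by (intro mult_left_mono mult_right_mono) (auto simp: Z_def)
  also have "\<dots> = (LINT x:Lam|lborel. \<epsilon> * (cmod (\<psi> x))\<^sup>2)" by simp
  also have "\<dots> \<le> (nrmw Lam w \<psi>)\<^sup>2"
    unfolding wnn
  proof (rule set_integral_mono)
    show "set_integrable lborel Lam (\<lambda>x. \<epsilon> * (cmod (\<psi> x))\<^sup>2)" using i1[OF sq\<psi>] by simp
    show "set_integrable lborel Lam (\<lambda>x. w x * (cmod (\<psi> x))\<^sup>2)" by (rule wi[OF sq\<psi> m\<psi>])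
    show "\<epsilon> * (cmod (\<psi> x))\<^sup>2 \<le> w x * (cmod (\<psi> x))\<^sup>2" for x
      using F_ge_1[of x] \<epsilon> by (intro mult_right_mono) (auto simp: w_def)
  qed
  finally have lower: "\<epsilon> * (n / 7 * A2) \<le> (nrmw Lam w \<psi>)\<^sup>2" .
  \<comment> \<open>The residual without the factor 1 / h^2. As h \<ge> 1, on the support w
    |\<rho>|^2 = \<epsilon> |\<rho>'|^2 / h^3 is at most \<epsilon> |\<rho>'|^2, whose integral
    factorises.\<close>
  define \<rho>' where "\<rho>' x = r (fst x) * B (snd x)" for x
  have sq\<rho>': "sq_int (zext Lam \<rho>')"
    unfolding \<rho>'_def[abs_def] by (rule tensor_sq(1)[OF rc _ sB(1)]) (use r0 in blast)
  have ts2: "(LINT x:Lam|lborel. (cmod (\<rho>' x))\<^sup>2) = (LINT s|lborel. (cmod (r s))\<^sup>2) * A2"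
    unfolding \<rho>'_def A2 by (rule tensor_sq(2)[OF rc _ sB(1)]) (use r0 in blast)
  have "(nrmw Lam w \<rho>)\<^sup>2 \<le> (LINT x:Lam|lborel. \<epsilon> * (cmod (\<rho>' x))\<^sup>2)"
    unfolding wnn
  proof (rule set_integral_mono)
    show "set_integrable lborel Lam (\<lambda>x. \<epsilon> * (cmod (\<rho>' x))\<^sup>2)" using i1[OF sq\<rho>'] by simp
    show "set_integrable lborel Lam (\<lambda>x. w x * (cmod (\<rho> x))\<^sup>2)" by (rule wi[OF sq\<rho> m\<rho>])
    fix x :: "real \<times> real" assume "x \<in> Lam"
    then obtain s t where st: "x = (s, t)" "t \<in> ?U" by (auto simp: Lam_def)
    show "w x * (cmod (\<rho> x))\<^sup>2 \<le> \<epsilon> * (cmod (\<rho>' x))\<^sup>2"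
    proof (cases "\<bar>s\<bar> < s0")
      case True
      then show ?thesis using r0[of s] by (simp add: st \<rho>_def \<rho>'_def)
    next
      case False
      then have Fh: "F x = ?h t" using F_out[of s t] by (simp add: st)
      have h1: "?h t \<ge> 1" by (rule h_eps_ge_1)
      have "cmod (\<rho> x) = cmod (\<rho>' x) / (?h t)\<^sup>2"
        using st(2) by (simp add: st(1) \<rho>_def \<rho>'_def B1_def B_def zext_def norm_mult norm_divide norm_power del: of_real_divide)
      then have "w x * (cmod (\<rho> x))\<^sup>2 = \<epsilon> * ((cmod (\<rho>' x))\<^sup>2 * (1 / (?h t)^3))"
        using h1 by (simp add: w_def Fh power_divide field_simps eval_nat_numeral)
      also have "\<dots> \<le> \<epsilon> * ((cmod (\<rho>' x))\<^sup>2 * 1)"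
        using h1 \<epsilon> one_le_power[OF h1, of 3] by (intro mult_left_mono) auto
      finally show ?thesis by simp
    qed
  qed
  also have "\<dots> = \<epsilon> * ((LINT s|lborel. (cmod (r s))\<^sup>2) * A2)" by (simp add: ts2)
  also have "\<dots> \<le> \<epsilon> * ((30 + 12 * \<bar>p\<bar>)\<^sup>2 * 2 / n * A2)"
    using wav_residual[OF n, of p c] \<epsilon> A2nn
    by (intro mult_left_mono mult_right_mono) (auto simp: r_def Z_def Z''_def)
  finally have upper: "(nrmw Lam w \<rho>)\<^sup>2 \<le> \<epsilon> * ((30 + 12 * \<bar>p\<bar>)\<^sup>2 * 2 / n * A2)" .
  have "nrmw Lam w (\<lambda>x. g x - of_real l * \<psi> x) = nrmw Lam w \<rho>"
    by (simp add: nrmw_def g_def)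
  then show ?thesis using graph lower upper by (intro exI[of _ \<psi>] exI[of _ g]) (simp add: p_def)
qed

text \<open>A resolvent bound C applied to the pairs just constructed would give n / 7 \<le> 2 C^2
  K^2 / n for every real n \<ge> 1, with K independent of n.\<close>

theorem not_in_resolvent:
  assumes s: "trans_sol 0 \<mu> u u'" and l: "\<mu> \<le> l"
  shows "\<not> in_resolvent Lam w (dirichlet_graph \<epsilon> F) (of_real l)"
proof
  assume "in_resolvent Lam w (dirichlet_graph \<epsilon> F) (of_real l)"
  then obtain C where C: "\<And>\<psi> f. (\<psi>, f) \<in> dirichlet_graph \<epsilon> F \<Longrightarrow>
      nrmw Lam w \<psi> \<le> C * nrmw Lam w (\<lambda>x. f x - of_real l * \<psi> x)"
    unfolding in_resolvent_def by blast
  obtain \<kappa> v v' where \<kappa>: "\<kappa> \<ge> 0" and v: "trans_sol \<kappa> l v v'" using exists_trans_sol[OF s l] by blast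
  let ?U = "{-1<..<1::real}"
  define A2 where "A2 = (LINT t:?U|lborel. (cmod (zext ?U (\<lambda>t. complex_of_real (uu v t)) t))\<^sup>2)"
  have A2: "A2 > 0"
  proof -
    have sq: "sq_int (zext ?U (\<lambda>t. complex_of_real (uu v t)))"
      by (intro sq_int_zext_continuous continuous_intros uu_continuous(1)[OF v])
    have rsrs: "zext ?U (zext ?U f) = zext ?U f" for f by (auto simp: zext_def)
    have e: "A2 = (norm (cls (zext ?U (\<lambda>t. complex_of_real (uu v t)))))\<^sup>2"
      unfolding A2_def using norm_cls_zext_sq[of ?U "zext ?U (\<lambda>t. complex_of_real (uu v t))"] sq by (simp add: rsrs)
    have "cls (zext ?U (\<lambda>t. complex_of_real (uu v t))) \<noteq> cls (\<lambda>_. 0)"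
    proof
      assume "cls (zext ?U (\<lambda>t. complex_of_real (uu v t))) = cls (\<lambda>_. 0)"
      then have "AE t in lborel. zext ?U (\<lambda>t. complex_of_real (uu v t)) t = 0" using cls_eq_iff[OF sq sq_int_zero] by simp
      then have "AE t in lborel. t \<notin> ?U"
        by eventually_elim (use uu_pos[OF v] in \<open>force simp: zext_def\<close>)
      then have "?U \<in> null_sets lborel" by (subst AE_iff_null_sets) auto
      then show False by (simp add: null_sets_def)
    qed
    then show ?thesis unfolding e by (simp add: cls_zero)
  qed
  define K where "K = 30 + 12 * \<bar>sqrt \<kappa>\<bar>"
  \<comment> \<open>Chosen so that n^2 \<le> 14 C^2 K^2 fails, in view of n \<le> n^2.\<close>
  define n where "n = 14 * C\<^sup>2 * K\<^sup>2 + 1"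
  have n: "n \<ge> 1" by (simp add: n_def)
  obtain \<psi> g where g: "(\<psi>, g) \<in> dirichlet_graph \<epsilon> F" "\<epsilon> * (n / 7 * A2) \<le> (nrmw Lam w \<psi>)\<^sup>2"
    "(nrmw Lam w (\<lambda>x. g x - of_real l * \<psi> x))\<^sup>2 \<le> \<epsilon> * (K\<^sup>2 * 2 / n * A2)"
    using weyl_pair[OF v \<kappa> n] unfolding A2_def K_def by blast
  have "0 \<le> nrmw Lam w \<psi>"
    unfolding nrmw_def set_lebesgue_integral_def real_sqrt_ge_0_iff
    by (rule Bochner_Integration.integral_nonneg) (simp add: less_imp_le[OF w_pos])
  then have "(nrmw Lam w \<psi>)\<^sup>2 \<le> C\<^sup>2 * (nrmw Lam w (\<lambda>x. g x - of_real l * \<psi> x))\<^sup>2"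
    using power_mono[OF C[OF g(1)], of 2] by (simp add: power_mult_distrib)
  also have "\<dots> \<le> C\<^sup>2 * (\<epsilon> * (K\<^sup>2 * 2 / n * A2))" by (intro mult_left_mono g) simp
  finally have "\<epsilon> * (n / 7 * A2) \<le> C\<^sup>2 * (\<epsilon> * (K\<^sup>2 * 2 / n * A2))" by (rule order_trans[OF g(2)])
  then have "\<epsilon> * A2 * (n / 7) \<le> \<epsilon> * A2 * (C\<^sup>2 * K\<^sup>2 * 2 / n)" by (simp only: mult_ac times_divide_eq_left times_divide_eq_right)
  then have "n / 7 \<le> C\<^sup>2 * K\<^sup>2 * 2 / n" by (rule mult_left_le_imp_le) (use A2 \<epsilon> in simp)
  then have "n * n \<le> 14 * C\<^sup>2 * K\<^sup>2" using n by (simp add: field_simps)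
  moreover have "n \<le> n * n" using mult_left_mono[OF n, of n] n by simp
  ultimately show False by (simp add: n_def)
qed

end

section \<open>The essential spectrum\<close>

context tube
begin

text \<open>The weak form of (A - z) u = G over the reals: z acts as Re z plus Im z times
  \<open>imult\<close>.\<close>

definition res_sol :: "complex \<Rightarrow> (real \<times> real) L2 \<Rightarrow> (real \<times> real) L2 \<times> ((real \<times> real) L2 \<times> (real \<times> real) L2) \<Rightarrow> bool" where
  "res_sol z G u \<longleftrightarrow> u \<in> X \<and> (\<forall>\<phi>\<in>X. inner (snd u) (snd \<phi>) - Re z * inner (fst u) (fst \<phi>)
      - Im z * inner (imult (fst u)) (fst \<phi>) = inner G (fst \<phi>))"

lemma cls_wext_shift:
  assumes f: "sq_int (zext Lam f)" and p: "sq_int (zext Lam \<psi>)"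
  shows "cls (wext m1 (\<lambda>x. f x - z * \<psi> x)) =
    cls (wext m1 f) - Re z *\<^sub>R cls (wext m1 \<psi>) - Im z *\<^sub>R imult (cls (wext m1 \<psi>))"
proof -
  have sq: "sq_int (wext m1 f)" "sq_int (wext m1 \<psi>)" using f p by (simp_all add: sq_int_wext adm_m)
  have "wext m1 (\<lambda>x. f x - z * \<psi> x) = (\<lambda>x. wext m1 f x - Re z *\<^sub>R wext m1 \<psi> x - Im z *\<^sub>R (\<i> * wext m1 \<psi> x))"
    by (rule ext, rule complex_eqI) (simp_all add: wext_def zext_def algebra_simps)
  then show ?thesis
    using sq by (simp add: imult_cls cls_scaleR cls_diff sq_int_diff sq_int_scaleR sq_int_cmult)
qed

lemma graph_sq_int:
  assumes "(\<psi>, f) \<in> dirichlet_graph \<epsilon> F"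
  shows "sq_int (zext Lam \<psi>)" "sq_int (zext Lam f)"
  using assms H10_R2_X(2) unfolding graph_iff L2w_w_iff by blast+

lemma sq_int_shift:
  assumes "sq_int (zext Lam f)" "sq_int (zext Lam \<psi>)"
  shows "sq_int (zext Lam (\<lambda>x. f x - z * \<psi> x))"
proof -
  have "zext Lam (\<lambda>x. f x - z * \<psi> x) = (\<lambda>x. zext Lam f x - z * zext Lam \<psi> x)" by (auto simp: zext_def)
  then show ?thesis using assms by (simp add: sq_int_diff sq_int_cmult)
qed

lemma graph_res_sol:
  assumes g: "(\<psi>, f) \<in> dirichlet_graph \<epsilon> F"
  shows "\<exists>u. fst u = cls (wext m1 \<psi>) \<and> res_sol z (cls (wext m1 (\<lambda>x. f x - z * \<psi> x))) u"
proof -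
  obtain \<psi>s \<psi>t where H: "H10_R2 Lam \<psi> \<psi>s \<psi>t" and C: "\<And>\<phi> ps pt. C1c_R2 Lam \<phi> ps pt \<Longrightarrow>
      inner (snd (emb \<psi> \<psi>s \<psi>t)) (snd (emb \<phi> ps pt)) = inner (cls (wext m1 f)) (fst (emb \<phi> ps pt))"
    using g unfolding graph_iff by blast
  have f: "fst (emb \<psi> \<psi>s \<psi>t) = cls (wext m1 \<psi>)" by (simp add: emb_def)
  have "res_sol z (cls (wext m1 (\<lambda>x. f x - z * \<psi> x))) (emb \<psi> \<psi>s \<psi>t)"
    unfolding res_sol_def cls_wext_shift[OF graph_sq_int(2,1)[OF g]] f
    using H10_R2_X(1)[OF H] X_closed_inner[OF C] by (simp add: inner_diff_left)
  with f show ?thesis by blast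
qed

lemma res_sol_graph:
  assumes s: "res_sol z (cls (wext m1 g)) u" and g: "L2w Lam w g"
  shows "\<exists>\<psi>. fst u = cls (wext m1 \<psi>) \<and> (\<psi>, \<lambda>x. g x + z * \<psi> x) \<in> dirichlet_graph \<epsilon> F"
proof -
  obtain \<psi> \<psi>s \<psi>t where u: "u = emb \<psi> \<psi>s \<psi>t" and H: "H10_R2 Lam \<psi> \<psi>s \<psi>t"
    using s X_cases unfolding res_sol_def by metis
  note p = H10_R2_X[OF H]
  have gg: "g \<in> borel_measurable lborel" "sq_int (zext Lam g)" using g unfolding L2w_w_iff by auto
  let ?f = "\<lambda>x. g x + z * \<psi> x"
  have sf: "sq_int (zext Lam ?f)" using sq_int_shift[OF gg(2) p(2), of "- z"] by simp
  note [measurable] = gg(1)[simplified] p(5)[simplified]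
  have L: "L2w Lam w ?f" unfolding L2w_w_iff
  proof
    show "?f \<in> borel_measurable lborel" by measurable
  qed (rule sf)
  have e: "cls (wext m1 g) = cls (wext m1 ?f) - Re z *\<^sub>R fst u - Im z *\<^sub>R imult (fst u)"
    using cls_wext_shift[OF sf p(2), of z] by (simp add: u emb_def)
  have "inner (snd u) (snd \<phi>) = inner (cls (wext m1 ?f)) (fst \<phi>)" if "\<phi> \<in> X" for \<phi>
  proof -
    have "inner (snd u) (snd \<phi>) - Re z * inner (fst u) (fst \<phi>) - Im z * inner (imult (fst u)) (fst \<phi>)
        = inner (cls (wext m1 g)) (fst \<phi>)" using s that unfolding res_sol_def by blast
    then show ?thesis unfolding e by (simp add: inner_diff_left)
  qed
  then have "(\<psi>, ?f) \<in> dirichlet_graph \<epsilon> F"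
    unfolding graph_iff using L H H10_R2_X(1)[OF C1c_R2_H10] u by blast
  then show ?thesis by (intro exI[of _ \<psi>]) (simp add: u emb_def)
qed

text \<open>Transfers solvability and the a priori bound from the abstract space to functions; the
  norms agree by \<open>nrmw_eq\<close>.\<close>

lemma in_resolventI:
  assumes ex: "\<And>G. \<exists>u. res_sol z G u" and C: "\<And>G u. res_sol z G u \<Longrightarrow> norm (fst u) \<le> C * norm G"
  shows "in_resolvent Lam w (dirichlet_graph \<epsilon> F) z"
  unfolding in_resolvent_def
proof (intro conjI allI impI)
  fix g assume g: "L2w Lam w g"
  obtain u where "res_sol z (cls (wext m1 g)) u" using ex by blast
  from res_sol_graph[OF this g] obtain \<psi> where "(\<psi>, \<lambda>x. g x + z * \<psi> x) \<in> dirichlet_graph \<epsilon> F" by blast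
  then show "\<exists>\<psi> f. (\<psi>, f) \<in> dirichlet_graph \<epsilon> F \<and> aeq Lam (\<lambda>x. f x - z * \<psi> x) g"
    by (intro exI[of _ \<psi>] exI[of _ "\<lambda>x. g x + z * \<psi> x"]) (simp add: aeq_def)
next
  have "nrmw Lam w \<psi> \<le> C * nrmw Lam w (\<lambda>x. f x - z * \<psi> x)"
    if g: "(\<psi>, f) \<in> dirichlet_graph \<epsilon> F" for \<psi> f
  proof -
    obtain u where u: "fst u = cls (wext m1 \<psi>)" "res_sol z (cls (wext m1 (\<lambda>x. f x - z * \<psi> x))) u"
      using graph_res_sol[OF g] by blast
    show ?thesis
      using C[OF u(2)] unfolding u(1) nrmw_eq[OF graph_sq_int(1)[OF g]]
        nrmw_eq[OF sq_int_shift[OF graph_sq_int(2,1)[OF g]]] .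
  qed
  then show "\<exists>C. \<forall>\<psi> f. (\<psi>, f) \<in> dirichlet_graph \<epsilon> F \<longrightarrow>
      nrmw Lam w \<psi> \<le> C * nrmw Lam w (\<lambda>x. f x - z * \<psi> x)" by blast
qed

lemma nonreal_in_resolvent:
  assumes "Im z \<noteq> 0"
  shows "in_resolvent Lam w (dirichlet_graph \<epsilon> F) z"
  using nonreal_resolvent[OF subspace_X closed_X bounded_linear_imult imult_inner imult_self imult_imult
      J2 X_imult assms, of "Re z", folded res_sol_def] in_resolventI[of z] by blast

lemma eigfun_res_sol:
  assumes "is_eigfun Lam (dirichlet_graph \<epsilon> F) z \<psi>"
  shows "sq_int (zext Lam \<psi>)" "\<exists>u. fst u = cls (wext m1 \<psi>) \<and> res_sol z 0 u"
proof -
  obtain f where g: "(\<psi>, f) \<in> dirichlet_graph \<epsilon> F" and e: "aeq Lam f (\<lambda>x. z * \<psi> x)"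
    using assms unfolding is_eigfun_def by blast
  show "sq_int (zext Lam \<psi>)" by (rule graph_sq_int[OF g])
  have "AE x in lborel. wext m1 (\<lambda>x. f x - z * \<psi> x) x = 0"
    using e unfolding aeq_def by eventually_elim (simp add: wext_def zext_def)
  then have "cls (wext m1 (\<lambda>x. f x - z * \<psi> x)) = cls (\<lambda>x. 0)"
    using cls_eq_iff[OF sq_int_wext[OF adm_m(1) sq_int_shift[OF graph_sq_int(2,1)[OF g]]] sq_int_zero] by blast
  then show "\<exists>u. fst u = cls (wext m1 \<psi>) \<and> res_sol z 0 u"
    using graph_res_sol[OF g, of z] by (simp add: cls_zero)
qed

lemma res_sol_eigenvalue:
  assumes u: "res_sol z 0 u" "fst u \<noteq> 0"
  shows "is_eigenvalue Lam (dirichlet_graph \<epsilon> F) z"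
proof -
  have 0: "wext m1 (\<lambda>x. 0) = (\<lambda>x. 0)" by (auto simp: wext_def zext_def)
  have "zext Lam (\<lambda>x. 0) = (\<lambda>x. 0)" by (auto simp: zext_def)
  then have L: "L2w Lam w (\<lambda>x. 0)" unfolding L2w_w_iff by (simp add: sq_int_zero)
  have "res_sol z (cls (wext m1 (\<lambda>x. 0))) u" using u(1) by (simp add: 0 cls_zero)
  from res_sol_graph[OF this L] obtain \<psi> where \<psi>: "fst u = cls (wext m1 \<psi>)" "(\<psi>, \<lambda>x. z * \<psi> x) \<in> dirichlet_graph \<epsilon> F"
    by auto
  have "\<not> aeq Lam \<psi> (\<lambda>_. 0)"
  proof
    assume "aeq Lam \<psi> (\<lambda>_. 0)"
    then have "AE x in lborel. wext m1 \<psi> x = 0"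
      unfolding aeq_def by eventually_elim (simp add: wext_def zext_def)
    then have "cls (wext m1 \<psi>) = cls (\<lambda>x. 0)"
      using cls_eq_iff[OF sq_int_wext[OF adm_m(1) graph_sq_int(1)[OF \<psi>(2)]] sq_int_zero] by blast
    with u(2) show False by (simp add: \<psi>(1) cls_zero)
  qed
  moreover have "is_eigfun Lam (dirichlet_graph \<epsilon> F) z \<psi>"
    unfolding is_eigfun_def using \<psi>(2) by (auto simp: aeq_def)
  ultimately show ?thesis unfolding is_eigenvalue_def by blast
qed

text \<open>The abstract spanning vectors become functions once the weight \<open>m1\<close> is
  divided out, which is possible since it does not vanish.\<close>

lemma finite_multiplicityI:
  fixes r :: "nat \<Rightarrow> (real \<times> real) L2"
  assumes r: "\<And>u. res_sol z 0 u \<Longrightarrow> \<exists>c :: nat \<Rightarrow> real. fst u = (\<Sum>i<N. c i *\<^sub>R r i)"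
  shows "finite_multiplicity Lam (dirichlet_graph \<epsilon> F) z"
proof -
  have "\<exists>\<rho>. sq_int \<rho> \<and> r i = cls \<rho>" for i using L2_cases[of "r i"] by metis
  then obtain \<rho> where \<rho>: "\<And>i. sq_int (\<rho> i)" "\<And>i. r i = cls (\<rho> i)" by metis
  have "\<exists>g. wext m1 g = zext Lam (\<rho> i)" for i using wext_surj[OF adm_m(1) \<rho>(1)] by blast
  then obtain g where g: "\<And>i. wext m1 (g i) = zext Lam (\<rho> i)" by metis
  show ?thesis unfolding finite_multiplicity_def
  proof (intro exI[of _ "map g [0..<N]"] allI impI)
    fix \<psi> assume \<psi>: "is_eigfun Lam (dirichlet_graph \<epsilon> F) z \<psi>"
    obtain u where u: "fst u = cls (wext m1 \<psi>)" "res_sol z 0 u" using eigfun_res_sol(2)[OF \<psi>] by blast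
    obtain c :: "nat \<Rightarrow> real" where c: "cls (wext m1 \<psi>) = (\<Sum>i<N. c i *\<^sub>R r i)" using r[OF u(2)] u(1) by auto
    have s: "sq_int (\<lambda>x. \<Sum>i<N. c i *\<^sub>R \<rho> i x)" "(\<Sum>i<N. cls (\<lambda>x. c i *\<^sub>R \<rho> i x)) = cls (\<lambda>x. \<Sum>i<N. c i *\<^sub>R \<rho> i x)"
      using cls_sum[of "{..<N}" "\<lambda>i x. c i *\<^sub>R \<rho> i x"] \<rho>(1) by (auto simp: sq_int_scaleR)
    have "cls (wext m1 \<psi>) = cls (\<lambda>x. \<Sum>i<N. c i *\<^sub>R \<rho> i x)"
      unfolding c s(2)[symmetric] \<rho>(2) by (simp add: cls_scaleR \<rho>(1))
    then have "AE x in lborel. wext m1 \<psi> x = (\<Sum>i<N. c i *\<^sub>R \<rho> i x)"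
      using cls_eq_iff[OF sq_int_wext[OF adm_m(1) eigfun_res_sol(1)[OF \<psi>]] s(1)] by blast
    then have "aeq Lam \<psi> (\<lambda>x. \<Sum>i<N. of_real (c i) * g i x)"
      unfolding aeq_def
    proof eventually_elim
      case (elim x)
      show ?case
      proof
        assume x: "x \<in> Lam"
        have m: "complex_of_real (m1 x) \<noteq> 0" using w_pos[of x] by (simp add: m1_def)
        have "\<rho> i x = of_real (m1 x) * g i x" for i
          using fun_cong[OF g, of i x] x by (simp add: wext_def zext_def)
        moreover have "of_real (m1 x) * \<psi> x = wext m1 \<psi> x" using x by (simp add: wext_def zext_def)
        ultimately have "of_real (m1 x) * \<psi> x = (\<Sum>i<N. of_real (m1 x) * (of_real (c i) * g i x))"
          unfolding elim by (simp add: scaleR_conv_of_real mult.left_commute)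
        then have "of_real (m1 x) * \<psi> x = of_real (m1 x) * (\<Sum>i<N. of_real (c i) * g i x)"
          by (simp only: sum_distrib_left)
        then show "\<psi> x = (\<Sum>i<N. of_real (c i) * g i x)" using m by simp
      qed
    qed
    moreover have "(\<Sum>i<length (map g [0..<N]). of_real (c i) * (map g [0..<N] ! i) x) = (\<Sum>i<N. of_real (c i) * g i x)" for x
      by (rule sum.cong) auto
    ultimately show "\<exists>c. aeq Lam \<psi> (\<lambda>x. \<Sum>i<length (map g [0..<N]). c i * (map g [0..<N] ! i) x)"
      by (intro exI[where x = "\<lambda>i. of_real (c i)"]) (simp only:)
  qed
qed

text \<open>Every point from \<mu> on is spectral, so none of them is isolated and none is discrete.
  A spectral point below \<mu> belongs to the finite set Z of eigenvalues, hence has positive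
  distance from \<mu> and from the rest of Z.\<close>

theorem ess_spectrum_tube:
  "ess_spectrum Lam w (dirichlet_graph \<epsilon> F) = complex_of_real ` {lambda1 \<gamma> \<epsilon> ..}"
proof -
  obtain \<mu> v v' where v: "trans_sol 0 \<mu> v v'" using exists_ground_state by blast
  obtain e N where "\<forall>u\<in>X. \<mu> * inner (fst u) (fst u) \<le> inner (snd u) (snd u) + (\<Sum>i<N::nat. (inner (e i) (fst u))\<^sup>2)"
    using form_lower_bound[OF v] by blast
  then interpret P: form_perturbation X e N \<mu>
    by unfold_locales (use subspace_X closed_X in auto)
  \<comment> \<open>At a real point the \<open>imult\<close> term drops out, which leaves the
    equation of the abstract locale.\<close>
  have sol: "res_sol (of_real x) = P.sol x" for x by (simp add: fun_eq_iff res_sol_def P.sol_def)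
  let ?A = "dirichlet_graph \<epsilon> F"
  let ?\<sigma> = "op_spectrum Lam w ?A"
  define Z where "Z = {x. x < \<mu> \<and> (\<exists>u. P.sol x 0 u \<and> fst u \<noteq> 0)}"
  \<comment> \<open>\<open>card_eigenvalues_le\<close> speaks of finite sets, so it is applied to
    all finite subsets of Z; their uniform bound yields finiteness.\<close>
  have "finite Z \<and> card Z \<le> N"
  proof (rule finite_if_finite_subsets_card_bdd)
    fix G assume "G \<subseteq> Z" "finite G"
    then show "card G \<le> N" by (intro P.card_eigenvalues_le) (auto simp: Z_def)
  qed
  then have finZ: "finite Z" by blast
  have high: "of_real x \<in> ?\<sigma>" if "\<mu> \<le> x" for x
    using not_in_resolvent[OF v that] by (simp add: op_spectrum_def)
  have spec: "\<exists>x. z = of_real x \<and> (\<mu> \<le> x \<or> x \<in> Z)" if z: "z \<in> ?\<sigma>" for z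
  proof -
    have nr: "\<not> in_resolvent Lam w ?A z" using z by (simp add: op_spectrum_def)
    then have "Im z = 0" using nonreal_in_resolvent by blast
    then have zr: "z = of_real (Re z)" by (simp add: complex_eq_iff)
    \<comment> \<open>Below \<mu> injectivity is enough for the resolvent set, by the Fredholm
      alternative.\<close>
    have "Re z \<in> Z" if l: "Re z < \<mu>"
    proof (rule ccontr)
      assume "Re z \<notin> Z"
      then have "\<And>u. P.sol (Re z) 0 u \<Longrightarrow> fst u = 0" using l unfolding Z_def by blast
      from P.fredholm_alternative[OF l this, folded sol, folded zr]
      have "in_resolvent Lam w ?A z" using in_resolventI[of z] by blast
      with nr show False ..
    qed
    then show ?thesis using zr by (metis not_le)
  qed
  have low: "of_real x \<in> discrete_spectrum Lam w ?A" if x: "x \<in> Z" and xs: "of_real x \<in> ?\<sigma>" for x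
  proof -
    obtain u where u: "P.sol x 0 u" "fst u \<noteq> 0" and l: "x < \<mu>" using x by (auto simp: Z_def)
    obtain d where d: "d > 0" "\<And>y. y \<in> Z \<Longrightarrow> y \<noteq> x \<Longrightarrow> d \<le> dist x y"
      using finite_set_avoid[OF finZ, of x] by blast
    have "z = of_real x" if z: "z \<in> ?\<sigma>" "dist z (of_real x) < min d (\<mu> - x)" for z
    proof -
      obtain y where y: "z = of_real y" "\<mu> \<le> y \<or> y \<in> Z" using spec[OF z(1)] by blast
      have "dist x y < min d (\<mu> - x)" using z(2) by (simp add: y(1) dist_of_real dist_commute)
      then have "y = x" using y(2) d(2)[of y] by (auto simp: dist_real_def)
      then show ?thesis by (simp add: y(1))
    qed
    moreover have "min d (\<mu> - x) > 0" using d(1) l by simp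
    moreover have "is_eigenvalue Lam ?A (of_real x)"
      by (rule res_sol_eigenvalue[OF _ u(2)]) (simp add: sol u(1))
    moreover have "finite_multiplicity Lam ?A (of_real x)"
    proof -
      obtain r where r: "\<And>u. P.sol x 0 u \<Longrightarrow> u = (\<Sum>i<N. inner (e i) (fst u) *\<^sub>R r i)"
        using P.eigenspace_finite[OF l] by blast
      show ?thesis
      proof (rule finite_multiplicityI)
        fix u assume "res_sol (of_real x) 0 u"
        then have "P.sol x 0 u" by (simp add: sol)
        from arg_cong[OF r[OF this], of fst]
        have "fst u = (\<Sum>i<N. inner (e i) (fst u) *\<^sub>R fst (r i))" by (simp add: fst_sum)
        then show "\<exists>c :: nat \<Rightarrow> real. fst u = (\<Sum>i<N. c i *\<^sub>R fst (r i))"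
          by (rule exI[where P = "\<lambda>c. fst u = (\<Sum>i<N. c i *\<^sub>R fst (r i))" and x = "\<lambda>i. inner (e i) (fst u)"])
      qed
    qed
    ultimately show ?thesis unfolding discrete_spectrum_def using xs by blast
  qed
  have nd: "of_real x \<notin> discrete_spectrum Lam w ?A" if x: "\<mu> \<le> x" for x
  proof
    assume "of_real x \<in> discrete_spectrum Lam w ?A"
    then obtain d where d: "d > 0" "\<And>z. z \<in> ?\<sigma> \<Longrightarrow> dist z (of_real x) < d \<Longrightarrow> z = of_real x"
      unfolding discrete_spectrum_def by blast
    \<comment> \<open>x + d / 2 also lies above \<mu>, so it is a second spectral point within
      distance d.\<close>
    have "dist (complex_of_real (x + d / 2)) (of_real x) < d"
      using d(1) by (simp only: dist_of_real) (simp add: dist_real_def)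
    then have "complex_of_real (x + d / 2) = of_real x" using d(1) x by (intro d(2) high) auto
    then show False using d(1) by (simp only: of_real_eq_iff)
  qed
  have "ess_spectrum Lam w ?A = complex_of_real ` {\<mu> ..}"
    unfolding ess_spectrum_def
  proof
    show "?\<sigma> - discrete_spectrum Lam w ?A \<subseteq> complex_of_real ` {\<mu> ..}"
    proof
      fix z assume z: "z \<in> ?\<sigma> - discrete_spectrum Lam w ?A"
      then obtain x where x: "z = of_real x" "\<mu> \<le> x \<or> x \<in> Z" using spec by blast
      with z low show "z \<in> complex_of_real ` {\<mu> ..}" by blast
    qed
    show "complex_of_real ` {\<mu> ..} \<subseteq> ?\<sigma> - discrete_spectrum Lam w ?A" using high nd by blast
  qed
  then show ?thesis unfolding lambda1_eq[OF v] .
qed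

end

theorem theorem1:
  fixes \<Gamma> T :: "real \<Rightarrow> 'a::euclidean_space"
    and N :: "nat \<Rightarrow> real \<Rightarrow> 'a"
    and k \<Theta> \<Theta>' :: "nat \<Rightarrow> real \<Rightarrow> real"
    and \<beta> \<beta>' :: "real \<Rightarrow> real"
    and \<gamma> s0 \<epsilon>0 :: real
  assumes dim: "DIM('a) \<ge> 2"
    and Gamma_deriv: "\<forall>s. (\<Gamma> has_vector_derivative T s) (at s)"
    and T_unit: "\<forall>s. norm (T s) = 1"
    and T_lip: "\<forall>K. compact K \<longrightarrow> (\<exists>L. L-lipschitz_on K T)"
    and frame_orth: "\<forall>s. \<forall>j\<in>{1..DIM('a) - 1}. norm (N j s) = 1 \<and> inner (T s) (N j s) = 0 \<and>
                        (\<forall>i\<in>{1..DIM('a) - 1}. i \<noteq> j \<longrightarrow> inner (N i s) (N j s) = 0)"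
    and T_deriv: "AE s in lborel. (T has_vector_derivative (\<Sum>j\<in>{1..DIM('a) - 1}. k j s *\<^sub>R N j s)) (at s)"
    and N_deriv: "AE s in lborel. \<forall>j\<in>{1..DIM('a) - 1}. (N j has_vector_derivative (- (k j s *\<^sub>R T s))) (at s)"
    and k_locbdd: "\<forall>j\<in>{1..DIM('a) - 1}. \<forall>K. compact K \<longrightarrow> bounded (k j ` K)"
    and Theta_unit: "\<forall>s. (\<Sum>j\<in>{1..DIM('a) - 1}. (\<Theta> j s)\<^sup>2) = 1"
    and Theta_deriv: "\<forall>j\<in>{1..DIM('a) - 1}. \<forall>s. (\<Theta> j has_real_derivative \<Theta>' j s) (at s)"
    and Theta'_lip: "\<forall>j\<in>{1..DIM('a) - 1}. \<forall>K. compact K \<longrightarrow> (\<exists>L. L-lipschitz_on K (\<Theta>' j))"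
    and k_Theta: "\<forall>s. (\<Sum>j\<in>{1..DIM('a) - 1}. k j s * \<Theta> j s) = 0"
    and Theta'_norm: "\<forall>s. sqrt (\<Sum>j\<in>{1..DIM('a) - 1}. (\<Theta>' j s)\<^sup>2) = \<gamma> - \<beta> s"
    and gamma_pos: "\<gamma> > 0"
    and beta_cont: "continuous_on UNIV \<beta>"
    and beta_deriv: "AE s in lborel. (\<beta> has_real_derivative \<beta>' s) (at s)"
    and beta'_Linf: "\<beta>' \<in> borel_measurable lborel" "\<exists>M. AE s in lborel. \<bar>\<beta>' s\<bar> \<le> M"
    and s0_pos: "s0 > 0"
    and beta_supp: "closure {s. \<beta> s \<noteq> 0} \<subseteq> {-s0..s0}"
    and L_inj: "\<forall>\<epsilon>\<in>{0<..<\<epsilon>0}. inj_on (\<lambda>(s, t). \<Gamma> s + (\<epsilon> * t) *\<^sub>R (\<Sum>j\<in>{1..DIM('a) - 1}. \<Theta> j s *\<^sub>R N j s)) Lam"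
    and eps0_pos: "\<epsilon>0 > 0"
    and Y_pos: "\<forall>\<epsilon>\<in>{0<..<\<epsilon>0}. \<forall>t\<in>{-1..1}. Y0 \<gamma> \<epsilon> t > 0"
  shows "\<forall>\<epsilon>\<in>{0<..<\<epsilon>0}.
    ess_spectrum Lam (\<lambda>x. \<epsilon> * f_eps (\<lambda>s. sqrt (\<Sum>j\<in>{1..DIM('a) - 1}. (\<Theta>' j s)\<^sup>2)) \<epsilon> x)
       (dirichlet_graph \<epsilon> (f_eps (\<lambda>s. sqrt (\<Sum>j\<in>{1..DIM('a) - 1}. (\<Theta>' j s)\<^sup>2)) \<epsilon>))
    = complex_of_real ` {lambda1 \<gamma> \<epsilon> ..}"
proof
  fix \<epsilon> assume e: "\<epsilon> \<in> {0<..<\<epsilon>0}"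
  let ?a = "\<lambda>s. sqrt (\<Sum>j\<in>{1..DIM('a) - 1}. (\<Theta>' j s)\<^sup>2)"
  have a: "?a = (\<lambda>s. \<gamma> - \<beta> s)" using Theta'_norm by auto
  \<comment> \<open>With s0 + 1 in place of s0, every s in the outer region lies strictly outside
    the interval carrying \<beta>, so its end points need no separate argument.\<close>
  interpret Q: tube \<gamma> \<epsilon> ?a "s0 + 1"
  proof
    show "\<epsilon> > 0" using e by simp
    show "\<And>t. t \<in> {-1..1} \<Longrightarrow> Y0 \<gamma> \<epsilon> t > 0" using Y_pos e by blast
    show "continuous_on UNIV ?a" unfolding a by (intro continuous_intros beta_cont)
    show "s0 + 1 > 0" using s0_pos by simp
    fix s assume "s0 + 1 \<le> \<bar>s\<bar>"
    then have "s \<notin> {-s0..s0}" by auto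
    then have "\<beta> s = 0" using subset_trans[OF closure_subset beta_supp] by blast
    then show "?a s = \<gamma>" using fun_cong[OF a, of s] by simp
  qed
  have "Q.w = (\<lambda>x. \<epsilon> * f_eps ?a \<epsilon> x)" by (rule ext) (simp only: Q.w_def Q.F_def)
  then show "ess_spectrum Lam (\<lambda>x. \<epsilon> * f_eps ?a \<epsilon> x) (dirichlet_graph \<epsilon> (f_eps ?a \<epsilon>))
      = complex_of_real ` {lambda1 \<gamma> \<epsilon> ..}"
    using Q.ess_spectrum_tube by (simp only: Q.F_def)
qed

end
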